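(* Let $b,\omega:\mathbb{R}\to\mathbb{R}$ be uniformly continuous with $0<b_0\le b(t)\le b_1$ and $0\le\omega_0\le\omega(t)\le\omega_1<\pi^2$. Then the skew product semiflow $\Pi^+$ is dynamically gradient with respect to the disjoint family of isolated weakly invariant sets $\{M_1,M_2\}$, where $M_1=\{(\xi_{M,\sigma}(0),\sigma):\sigma\in\Sigma\}$ and $M_2=\{(0,\sigma):\sigma\in\Sigma\}$; that is, for every bounded complete trajectory $\Phi$ of $\mathcal{K}^+$, either $\Phi(t)\in M_i$ for all $t$ for some $i\in\{1,2\}$, or $\operatorname{dist}_{\mathcal{X}^+}(\Phi(t),M_1)\to0$ as $t\to+\infty$ and $\operatorname{dist}_{\mathcal{X}^+}(\Phi(t),M_2)\to0$ as $t\to-\infty$.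
   Context: $H=L^2(0,1)$, $V=H_0^1(0,1)$, $A=-d^2/dx^2$, $D(A)=H^2(0,1)\cap V$, $H_0(s)=\{-1\}$ ($s<0$), $[-1,1]$ ($s=0$), $\{1\}$ ($s>0$), $H^+=\{v\in H: v\ge0\text{ a.e.}\}$. $\Sigma$ is the closure in $C(\mathbb{R},\mathbb{R}^2)$ (uniform convergence on compacts, metric $\rho$) of $\{(b(\cdot+t),\omega(\cdot+t)):t\in\mathbb{R}\}$; $\theta_s\sigma=\sigma(\cdot+s)$. For $\sigma=(\bar b,\bar\omega)\in\Sigma$ a solution of problem $(P_\sigma)$ with initial time $\tau$ and datum $x$ is $u\in C([\tau,\infty),H)$ with $u(\tau)=x$, absolutely continuous on each $[T_1,T_2]$, $\tau<T_1<T_2$, $u(t)\in D(A)$ a.e., with some $r\in L^2_{loc}(\tau,\infty;H)$, $r(t)(x')\in\bar b(t)H_0(u(t)(x'))+\bar\omega(t)u(t)(x')$ a.e., $du/dt+Au=r$ a.e.; non-negative if $u(t)\ge0$ for all $t$. A complete trajectory of $(P_\sigma)$ is $\gamma:\mathbb{R}\to H$ whose restriction to each $[\tau,\infty)$ is a solution with initial time $\tau$. With $D=\{v\in V:v(x)>0\ \forall x\in(0,1)\}$, it is known that for each $\sigma$ there is a unique bounded complete trajectory $\xi_{M,\sigma}$ of $(P_\sigma)$ with $\xi_{M,\sigma}(t)\in D$ for all $t$. $\mathcal{X}^+=H^+\times\Sigma$ with metric $\|x_1-x_2\|+\rho(\sigma_1,\sigma_2)$. $\mathcal{K}^+$ is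 the set of maps $y(t)=(u(t),\theta_t\sigma)$, $t\ge0$, with $\sigma\in\Sigma$ and $u$ a non-negative solution of $(P_\sigma)$ with initial time $0$; $\Pi^+(t,(x,\sigma))=\{y(t):y\in\mathcal{K}^+,\ y(0)=(x,\sigma)\}$. A complete trajectory of $\mathcal{K}^+$ is $\Phi:\mathbb{R}\to\mathcal{X}^+$ with $\Phi(\cdot+s)|_{[0,\infty)}\in\mathcal{K}^+$ for all $s$; bounded if its range is bounded. A set $M$ is weakly invariant if for every $y_0\in M$ there is a complete trajectory $\Phi$ of $\mathcal{K}^+$ with range in $M$ and $\Phi(0)=y_0$; a compact weakly invariant $M$ is isolated if for some $\varepsilon>0$ it is the maximal weakly invariant set in its $\varepsilon$-neighborhood; a family $\{M_1,M_2\}$ is disjoint if for some $\delta>0$ their $\delta$-neighborhoods are disjoint. *)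

theory Defs
  imports "HOL-Analysis.Analysis"
begin

section \<open>The Hilbert space H = L2(0,1), represented by functions real => real\<close>

type_synonym fn = "real \<Rightarrow> real"
type_synonym sig = "(real \<Rightarrow> real) \<times> (real \<Rightarrow> real)"

definition I01 :: "real set" where "I01 = {0<..<1}"

definition ae01 :: "(real \<Rightarrow> bool) \<Rightarrow> bool" where
  "ae01 P \<longleftrightarrow> (AE s in lborel. s \<in> I01 \<longrightarrow> P s)"

definition memH :: "fn \<Rightarrow> bool" where
  "memH x \<longleftrightarrow> (\<lambda>s. indicator I01 s * x s) \<in> borel_measurable lborel
     \<and> integrable lborel (\<lambda>s. indicator I01 s * (x s)^2)"

definition nH :: "fn \<Rightarrow> real" where
  "nH x = sqrt (integral\<^sup>L lborel (\<lambda>s. indicator I01 s * (x s)^2))"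

text \<open>V = H_0^1(0,1): a representative that is an indefinite integral of an L2 function,
  vanishing at both end points.\<close>
definition memV :: "fn \<Rightarrow> bool" where
  "memV v \<longleftrightarrow> memH v \<and> (\<exists>g g1. memH g1 \<and> ae01 (\<lambda>s. v s = g s) \<and>
     (\<forall>s\<in>{0..1}. g s = integral\<^sup>L lborel (\<lambda>r. indicator {0..s} r * g1 r)) \<and> g 1 = 0)"

text \<open>D = {v in V. v(x) > 0 for all x in (0,1)} (for the continuous representative)\<close>
definition memD :: "fn \<Rightarrow> bool" where
  "memD v \<longleftrightarrow> memH v \<and> (\<exists>g g1. memH g1 \<and> ae01 (\<lambda>s. v s = g s) \<and>
     (\<forall>s\<in>{0..1}. g s = integral\<^sup>L lborel (\<lambda>r. indicator {0..s} r * g1 r)) \<and> g 1 = 0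
     \<and> (\<forall>s\<in>I01. g s > 0))"

text \<open>isA v w: v in D(A) = H^2(0,1) \<inter> H_0^1(0,1) and A v = - v'' = w (in H)\<close>
definition isA :: "fn \<Rightarrow> fn \<Rightarrow> bool" where
  "isA v w \<longleftrightarrow> memH v \<and> memH w \<and> (\<exists>g g1 g2. memH g2 \<and> ae01 (\<lambda>s. v s = g s) \<and>
     (\<forall>s\<in>{0..1}. g1 s = g1 0 + integral\<^sup>L lborel (\<lambda>r. indicator {0..s} r * g2 r)) \<and>
     (\<forall>s\<in>{0..1}. g s = integral\<^sup>L lborel (\<lambda>r. indicator {0..s} r * g1 r)) \<and> g 1 = 0 \<and>
     ae01 (\<lambda>s. w s = - g2 s))"

definition H0 :: "real \<Rightarrow> real set" where
  "H0 y = (if y < 0 then {-1} else if y = 0 then {-1..1} else {1})"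

definition shift :: "real \<Rightarrow> sig \<Rightarrow> sig" where
  "shift s \<sigma> = ((\<lambda>r. fst \<sigma> (r + s)), (\<lambda>r. snd \<sigma> (r + s)))"

definition supd :: "nat \<Rightarrow> sig \<Rightarrow> sig \<Rightarrow> real" where
  "supd n \<sigma>1 \<sigma>2 = (SUP s\<in>{- real n .. real n}.
      \<bar>fst \<sigma>1 s - fst \<sigma>2 s\<bar> + \<bar>snd \<sigma>1 s - snd \<sigma>2 s\<bar>)"

text \<open>standard metric of uniform convergence on compacts on C(R,R^2)\<close>
definition rho :: "sig \<Rightarrow> sig \<Rightarrow> real" where
  "rho \<sigma>1 \<sigma>2 = (\<Sum>n. (1/2)^n * min 1 (supd n \<sigma>1 \<sigma>2))"

definition Sig :: "fn \<Rightarrow> fn \<Rightarrow> sig set" where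
  "Sig b w = {\<sigma>. continuous_on UNIV (fst \<sigma>) \<and> continuous_on UNIV (snd \<sigma>) \<and>
      (\<forall>e>0. \<exists>t. rho \<sigma> (shift t (b, w)) < e)}"

definition contH :: "real \<Rightarrow> (real \<Rightarrow> fn) \<Rightarrow> bool" where
  "contH \<tau> u \<longleftrightarrow> (\<forall>t\<ge>\<tau>. memH (u t)) \<and>
     (\<forall>t\<ge>\<tau>. \<forall>e>0. \<exists>d>0. \<forall>s\<ge>\<tau>. \<bar>s - t\<bar> < d \<longrightarrow> nH (\<lambda>x. u s x - u t x) < e)"

definition abscontH :: "real \<Rightarrow> real \<Rightarrow> (real \<Rightarrow> fn) \<Rightarrow> bool" where
  "abscontH T1 T2 u \<longleftrightarrow> (\<forall>e>0. \<exists>d>0. \<forall>(n::nat) (a::nat\<Rightarrow>real) (c::nat\<Rightarrow>real).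
     (\<forall>i<n. T1 \<le> a i \<and> a i \<le> c i \<and> c i \<le> T2) \<and>
     (\<forall>i<n. \<forall>j<n. i \<noteq> j \<longrightarrow> c i \<le> a j \<or> c j \<le> a i) \<and>
     (\<Sum>i<n. c i - a i) < d \<longrightarrow> (\<Sum>i<n. nH (\<lambda>x. u (c i) x - u (a i) x)) < e)"

definition hasDerivH :: "(real \<Rightarrow> fn) \<Rightarrow> fn \<Rightarrow> real \<Rightarrow> bool" where
  "hasDerivH u u' t \<longleftrightarrow> memH u' \<and>
     ((\<lambda>h. nH (\<lambda>x. (u (t + h) x - u t x) / h - u' x)) \<longlongrightarrow> 0) (at 0)"

text \<open>r in L2_loc(tau,infinity;H), represented by a jointly measurable function\<close>
definition L2locH :: "real \<Rightarrow> (real \<Rightarrow> fn) \<Rightarrow> bool" where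
  "L2locH \<tau> r \<longleftrightarrow> (\<lambda>p. indicator ({\<tau><..} \<times> I01) p * r (fst p) (snd p))
        \<in> borel_measurable (lborel \<Otimes>\<^sub>M lborel) \<and>
     (\<forall>T1 T2. \<tau> < T1 \<and> T1 < T2 \<longrightarrow>
        integrable (lborel \<Otimes>\<^sub>M lborel)
          (\<lambda>p. indicator ({T1..T2} \<times> I01) p * (r (fst p) (snd p))^2))"

definition sol :: "sig \<Rightarrow> real \<Rightarrow> fn \<Rightarrow> (real \<Rightarrow> fn) \<Rightarrow> bool" where
  "sol \<sigma> \<tau> x u \<longleftrightarrow> contH \<tau> u \<and> u \<tau> = x \<and>
     (\<forall>T1 T2. \<tau> < T1 \<and> T1 < T2 \<longrightarrow> abscontH T1 T2 u) \<and>
     (AE t in lborel. t > \<tau> \<longrightarrow> (\<exists>w. isA (u t) w)) \<and>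
     (\<exists>r. L2locH \<tau> r \<and>
        (AE t in lborel. t > \<tau> \<longrightarrow>
           ae01 (\<lambda>s. r t s \<in> (\<lambda>z. fst \<sigma> t * z + snd \<sigma> t * u t s) ` H0 (u t s))) \<and>
        (AE t in lborel. t > \<tau> \<longrightarrow>
           (\<exists>u' w. hasDerivH u u' t \<and> isA (u t) w \<and> ae01 (\<lambda>s. u' s + w s = r t s))))"

definition nonneg_sol :: "sig \<Rightarrow> real \<Rightarrow> fn \<Rightarrow> (real \<Rightarrow> fn) \<Rightarrow> bool" where
  "nonneg_sol \<sigma> \<tau> x u \<longleftrightarrow> sol \<sigma> \<tau> x u \<and> (\<forall>t\<ge>\<tau>. ae01 (\<lambda>s. u t s \<ge> 0))"

definition bdd_complete_traj_D :: "sig \<Rightarrow> (real \<Rightarrow> fn) \<Rightarrow> bool" where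
  "bdd_complete_traj_D \<sigma> \<gamma> \<longleftrightarrow> (\<forall>\<tau>. sol \<sigma> \<tau> (\<gamma> \<tau>) \<gamma>) \<and>
     (\<exists>B. \<forall>t. nH (\<gamma> t) \<le> B) \<and> (\<forall>t. memD (\<gamma> t))"

type_synonym pt = "fn \<times> sig"

definition Xp :: "fn \<Rightarrow> fn \<Rightarrow> pt set" where
  "Xp b w = {y. memH (fst y) \<and> ae01 (\<lambda>s. fst y s \<ge> 0) \<and> snd y \<in> Sig b w}"

definition dX :: "pt \<Rightarrow> pt \<Rightarrow> real" where
  "dX y z = nH (\<lambda>s. fst y s - fst z s) + rho (snd y) (snd z)"

definition distset :: "pt \<Rightarrow> pt set \<Rightarrow> real" where
  "distset y M = (INF z\<in>M. dX y z)"

definition complete_traj :: "fn \<Rightarrow> fn \<Rightarrow> (real \<Rightarrow> pt) \<Rightarrow> bool" where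
  "complete_traj b w \<Phi> \<longleftrightarrow> (\<forall>s. \<exists>\<sigma> u. \<sigma> \<in> Sig b w \<and> nonneg_sol \<sigma> 0 (u 0) u \<and>
      (\<forall>t\<ge>0. \<Phi> (t + s) = (u t, shift t \<sigma>)))"

definition bounded_traj :: "(real \<Rightarrow> pt) \<Rightarrow> bool" where
  "bounded_traj \<Phi> \<longleftrightarrow> (\<exists>R. \<forall>t t'. dX (\<Phi> t) (\<Phi> t') \<le> R)"

definition weakly_inv :: "fn \<Rightarrow> fn \<Rightarrow> pt set \<Rightarrow> bool" where
  "weakly_inv b w M \<longleftrightarrow> (\<forall>y0\<in>M. \<exists>\<Phi>. complete_traj b w \<Phi> \<and> (\<forall>t. \<Phi> t \<in> M) \<and> \<Phi> 0 = y0)"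

definition compactX :: "pt set \<Rightarrow> bool" where
  "compactX M \<longleftrightarrow> (\<forall>f::nat \<Rightarrow> pt. (\<forall>n. f n \<in> M) \<longrightarrow>
      (\<exists>l\<in>M. \<exists>h. strict_mono h \<and> ((\<lambda>n. dX (f (h n)) l) \<longlonglongrightarrow> 0)))"

definition nbhd :: "fn \<Rightarrow> fn \<Rightarrow> real \<Rightarrow> pt set \<Rightarrow> pt set" where
  "nbhd b w e M = {y\<in>Xp b w. distset y M < e}"

definition isolated :: "fn \<Rightarrow> fn \<Rightarrow> pt set \<Rightarrow> bool" where
  "isolated b w M \<longleftrightarrow> M \<subseteq> Xp b w \<and> compactX M \<and> weakly_inv b w M \<and>
     (\<exists>e>0. M \<subseteq> nbhd b w e M \<and>
        (\<forall>N. N \<subseteq> nbhd b w e M \<and> weakly_inv b w N \<longrightarrow> N \<subseteq> M))"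

definition disjoint_fam :: "fn \<Rightarrow> fn \<Rightarrow> pt set \<Rightarrow> pt set \<Rightarrow> bool" where
  "disjoint_fam b w M1 M2 \<longleftrightarrow> (\<exists>d>0. nbhd b w d M1 \<inter> nbhd b w d M2 = {})"

definition M1 :: "fn \<Rightarrow> fn \<Rightarrow> pt set" where
  "M1 b w = {(x, \<sigma>). \<sigma> \<in> Sig b w \<and> memH x \<and>
      (\<exists>\<xi>. bdd_complete_traj_D \<sigma> \<xi> \<and> ae01 (\<lambda>s. x s = \<xi> 0 s))}"

definition M2 :: "fn \<Rightarrow> fn \<Rightarrow> pt set" where
  "M2 b w = {(x, \<sigma>). \<sigma> \<in> Sig b w \<and> memH x \<and> ae01 (\<lambda>s. x s = 0)}"

end

theory Submission imports Defs "HOL-Complex_Analysis.Great_Picard"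
begin

text \<open>
Fix a symbol \<open>\<sigma> = (\<beta>, \<omega>)\<close>. A nonnegative solution has \<open>u\<^sub>t = 0\<close> and \<open>u\<^sub>x\<^sub>x = 0\<close> almost everywhere on
\<open>{u = 0}\<close>, so its forcing is nonnegative and it is a supersolution of the heat equation. Comparison with
compactly supported subsolutions whose support spreads shows that a nontrivial nonnegative solution is
positive at all later times, where it solves the linear equation \<open>u\<^sub>t - u\<^sub>x\<^sub>x = \<beta>(t) + \<omega>(t) u\<close>.
Since \<open>\<omega> \<le> \<omega>\<^sub>1 < \<pi>\<^sup>2\<close>, two such solutions approach each other at the rate \<open>\<pi>\<^sup>2 - \<omega>\<^sub>1\<close>. The linear equation
has an explicit bounded complete solution \<open>X\<close>, a sine series, and comparison with the stationary
subsolution \<open>b\<^sub>0 x (1 - x) / 2\<close> shows that \<open>X\<close> is positive and bounded away from 0. Hence a bounded complete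
trajectory that is nonzero at arbitrarily negative times equals \<open>X\<close>, and any other one vanishes up to
some time and, unless it vanishes identically, then converges to \<open>X\<close>.

Comparison and decay both come from entropies \<open>\<integral> S\<^sup>2 F(z/S)\<close> with \<open>S = sin(\<pi>x)\<close> and \<open>F\<close> convex: testing
with \<open>S F'(z/S)\<close> and using \<open>S'' = - \<pi>\<^sup>2 S\<close> yields the sharp constant \<open>\<pi>\<^sup>2\<close> without Poincare's inequality.
\<close>

section \<open>The Hilbert space as an L2 space over the unit interval\<close>

text \<open>Solutions that start at 0 are not unique: one may rest at 0 for any length of time and
  then leave, so 0 is handled only through the alternative between zero and nonzero states. A
  nonzero state never returns to 0, and the contraction factor exp(-(pi^2 - w1)(t - s)) available
  from then on depends on the elapsed time alone. Starting it at ever earlier times s against a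
  bounded curve is what forces identities: uniqueness of \<open>X\<close>, membership in M1, the
  barrier below \<open>X\<close>. The barrier does not depend on the symbol. Its norm
  \<open>m0\<close> therefore bounds \<open>nH (X t)\<close> from below over the whole hull, and
  \<open>m0 / 2\<close> serves as radius in both isolation statements and in disjointness.
  Compactness of M1 rests on compactness of the hull and on continuous dependence of
  \<open>X 0\<close> on the symbol; the sine coefficients make this elementary, since each solves a
  scalar dissipative equation that forgets its past. States are functions rather than classes, so M1
  and M2 are saturated under a.e. equality and identifications with \<open>X\<close> hold
  a.e.\<close>

definition mu :: "real measure" where "mu = restrict_space lborel I01"

lemma I01_sets [measurable, simp]: "I01 \<in> sets lborel" "I01 \<in> sets borel"
  by (auto simp: I01_def)

lemma space_mu [simp]: "space mu = I01"
  by (simp add: mu_def space_restrict_space)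

lemma emeasure_mu: "emeasure mu (space mu) = 1"
  by (simp add: mu_def emeasure_restrict_space space_restrict_space) (simp add: I01_def)

interpretation mu: finite_measure mu
  by standard (simp add: emeasure_mu del: space_mu)

lemma ae01_mu: "ae01 P \<longleftrightarrow> (AE s in mu. P s)"
  unfolding ae01_def mu_def by (subst AE_restrict_space_iff) auto

lemma integral_mu: "integral\<^sup>L lborel (\<lambda>s. indicator I01 s * f s) = integral\<^sup>L mu (f :: real \<Rightarrow> real)"
  unfolding mu_def by (subst integral_restrict_space) auto

lemma integrable_mu: "integrable lborel (\<lambda>s. indicator I01 s * f s) \<longleftrightarrow> integrable mu (f :: real \<Rightarrow> real)"
  unfolding mu_def by (subst integrable_restrict_space) auto

lemma measurable_mu: "(\<lambda>s. indicator I01 s * f s) \<in> borel_measurable lborel \<longleftrightarrow> (f :: real \<Rightarrow> real) \<in> borel_measurable mu"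
  unfolding mu_def by (subst borel_measurable_restrict_space_iff) auto

lemma memH_mu: "memH x \<longleftrightarrow> x \<in> borel_measurable mu \<and> integrable mu (\<lambda>s. (x s)^2)"
  unfolding memH_def measurable_mu integrable_mu by simp

lemma nH_mu: "nH x = sqrt (integral\<^sup>L mu (\<lambda>s. (x s)^2))"
  unfolding nH_def integral_mu by simp

lemma borel_mu: "f \<in> borel_measurable borel \<Longrightarrow> f \<in> borel_measurable mu"
  unfolding mu_def by (rule measurable_restrict_space1) simp

lemma memH_measurable [measurable_dest]: "memH x \<Longrightarrow> x \<in> borel_measurable mu"
  unfolding memH_mu by (rule conjunct1)

lemma memH_sq: "memH x \<Longrightarrow> integrable mu (\<lambda>s. (x s)^2)"
  unfolding memH_mu by (rule conjunct2)

lemma memH_dom: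
  assumes [measurable]: "x \<in> borel_measurable mu" and "memH y" and "AE s in mu. \<bar>x s\<bar> \<le> \<bar>y s\<bar>"
  shows "memH x"
  unfolding memH_mu
proof
  show "integrable mu (\<lambda>s. (x s)^2)"
  proof (rule Bochner_Integration.integrable_bound[OF memH_sq[OF assms(2)]])
    show "AE s in mu. norm ((x s)\<^sup>2) \<le> norm ((y s)\<^sup>2)"
      using assms(3) by eventually_elim (simp add: abs_le_square_iff)
  qed measurable
qed fact

lemma memH_mult [simp]:
  assumes "memH x" "memH y" shows "integrable mu (\<lambda>s. x s * y s)"
proof (rule Bochner_Integration.integrable_bound[where f="\<lambda>s. (x s)^2 + (y s)^2"])
  note assms[measurable]
  show "(\<lambda>s. x s * y s) \<in> borel_measurable mu" by measurable
  show "integrable mu (\<lambda>s. (x s)\<^sup>2 + (y s)\<^sup>2)" using assms by (simp add: memH_sq)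
  have "\<bar>x s * y s\<bar> \<le> (x s)\<^sup>2 + (y s)\<^sup>2" for s
  proof -
    have "2 * \<bar>x s\<bar> * \<bar>y s\<bar> \<le> \<bar>x s\<bar>^2 + \<bar>y s\<bar>^2"
      by (rule sum_squares_bound)
    moreover have "0 \<le> \<bar>x s\<bar> * \<bar>y s\<bar>" by simp
    ultimately have "\<bar>x s\<bar> * \<bar>y s\<bar> \<le> (x s)\<^sup>2 + (y s)\<^sup>2"
      unfolding power2_abs by linarith
    then show ?thesis by (simp add: abs_mult)
  qed
  then show "AE s in mu. norm (x s * y s) \<le> norm ((x s)\<^sup>2 + (y s)\<^sup>2)" by simp
qed

lemma memH_add [simp]: assumes "memH x" "memH y" shows "memH (\<lambda>s. x s + y s)"
proof -
  note assms[measurable]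
  have "integrable mu (\<lambda>s. (x s)^2 + 2 * (x s * y s) + (y s)^2)"
    using assms by (intro Bochner_Integration.integrable_add integrable_mult_right memH_sq memH_mult)
  then have "integrable mu (\<lambda>s. (x s + y s)^2)"
    by (simp add: power2_sum algebra_simps)
  then show ?thesis by (simp add: memH_mu)
qed

lemma memH_cmult [simp]: assumes "memH x" shows "memH (\<lambda>s. c * x s)"
proof -
  note assms[measurable]
  show ?thesis using memH_sq[OF assms] by (simp add: memH_mu power_mult_distrib)
qed

lemma memH_uminus [simp]: "memH x \<Longrightarrow> memH (\<lambda>s. - x s)"
  using memH_cmult[of x "-1"] by simp

lemma memH_diff [simp]: "memH x \<Longrightarrow> memH y \<Longrightarrow> memH (\<lambda>s. x s - y s)"
  using memH_add[of x "\<lambda>s. - y s"] by simp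

lemma memH_divide [simp]: "memH x \<Longrightarrow> memH (\<lambda>s. x s / c)"
  using memH_cmult[of x "inverse c"] by (simp add: divide_inverse mult.commute)

lemma memH_const [simp]: "memH (\<lambda>s. c)"
  unfolding memH_mu by simp

lemma memH_bounded:
  assumes "x \<in> borel_measurable mu" "AE s in mu. \<bar>x s\<bar> \<le> C" shows "memH x"
proof (rule memH_dom[OF assms(1) memH_const[of C]])
  show "AE s in mu. \<bar>x s\<bar> \<le> \<bar>C\<bar>" using assms(2) by eventually_elim simp
qed

lemma memH_sum [simp]: "(\<And>i. i \<in> A \<Longrightarrow> memH (f i)) \<Longrightarrow> memH (\<lambda>s. \<Sum>i\<in>A. f i s)"
  by (induction A rule: infinite_finite_induct) auto

lemma memH_integrable: "memH x \<Longrightarrow> integrable mu x"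
  using memH_mult[of x "\<lambda>s. 1"] by simp

lemma nH_nonneg [simp]: "0 \<le> nH x"
  unfolding nH_mu by (simp add: integral_nonneg_AE)

lemma nH_sq: "nH x ^ 2 = integral\<^sup>L mu (\<lambda>s. (x s)^2)"
  unfolding nH_mu by (simp add: integral_nonneg_AE)

lemma Cauchy_Schwarz_mu:
  assumes "memH x" "memH y"
  shows "\<bar>\<integral>s. x s * y s \<partial>mu\<bar> \<le> nH x * nH y"
proof -
  define A B C where "A = (\<integral>s. (x s)^2 \<partial>mu)" and "B = (\<integral>s. x s * y s \<partial>mu)" and "C = (\<integral>s. (y s)^2 \<partial>mu)"
  have AC: "A \<ge> 0" "C \<ge> 0" by (auto simp: A_def C_def integral_nonneg_AE)
  have Q: "0 \<le> l^2 * A - 2 * l * m * B + m^2 * C" for l m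
  proof -
    have "0 \<le> (\<integral>s. (l * x s - m * y s)^2 \<partial>mu)" by simp
    also have "\<dots> = (\<integral>s. l^2 * (x s)^2 - (2 * l * m) * (x s * y s) + m^2 * (y s)^2 \<partial>mu)"
      by (rule Bochner_Integration.integral_cong) (auto simp: power2_eq_square algebra_simps)
    also have "\<dots> = l^2 * A - 2 * l * m * B + m^2 * C"
      using assms by (simp add: A_def B_def C_def memH_sq)
    finally show ?thesis .
  qed
  have "B^2 \<le> A * C"
  proof (cases "A = 0")
    case True
    have "B = 0"
    proof (rule ccontr)
      assume "B \<noteq> 0"
      \<comment> \<open>With A = 0 the form is affine in l. This l solves 2 * l * B = C + 1, which
        pushes the form down to -1.\<close>
      have "0 \<le> ((C + 1) / (2 * B))^2 * A - 2 * ((C + 1) / (2 * B)) * 1 * B + 1^2 * C" by (rule Q)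
      moreover have "((C + 1) / (2 * B))^2 * A - 2 * ((C + 1) / (2 * B)) * 1 * B + 1^2 * C = - 1"
        using \<open>B \<noteq> 0\<close> True by (simp add: divide_simps)
      ultimately show False by linarith
    qed
    then show ?thesis using True by simp
  next
    case False
    then have "A > 0" using AC by simp
    \<comment> \<open>At l = B, m = A the form is A times the discriminant, so no division is
      involved.\<close>
    have "0 \<le> A * (A * C - B^2)" using Q[of B A] by (simp add: power2_eq_square algebra_simps)
    then show ?thesis using \<open>A > 0\<close> by (simp add: zero_le_mult_iff)
  qed
  then have "sqrt (B^2) \<le> sqrt (A * C)" by (rule real_sqrt_le_mono)
  then show ?thesis by (simp add: nH_mu A_def B_def C_def real_sqrt_mult)
qed

lemma nH_triangle:
  assumes "memH x" "memH y" shows "nH (\<lambda>s. x s + y s) \<le> nH x + nH y"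
proof (rule power2_le_imp_le)
  have "nH (\<lambda>s. x s + y s)^2 = (\<integral>s. (x s)^2 + 2 * (x s * y s) + (y s)^2 \<partial>mu)"
    unfolding nH_sq by (rule Bochner_Integration.integral_cong) (auto simp: power2_eq_square algebra_simps)
  also have "\<dots> = nH x ^2 + 2 * (\<integral>s. x s * y s \<partial>mu) + nH y ^2"
    using assms by (simp add: nH_sq memH_sq)
  also have "\<dots> \<le> nH x ^2 + 2 * (nH x * nH y) + nH y ^2"
    using Cauchy_Schwarz_mu[OF assms] by simp
  finally show "(nH (\<lambda>s. x s + y s))\<^sup>2 \<le> (nH x + nH y)\<^sup>2"
    by (simp add: power2_eq_square algebra_simps)
qed simp

lemma nH_cmult: "nH (\<lambda>s. c * x s) = \<bar>c\<bar> * nH x"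
  unfolding nH_mu by (simp add: power_mult_distrib real_sqrt_mult)

lemma nH_uminus [simp]: "nH (\<lambda>s. - x s) = nH x"
  using nH_cmult[of "-1" x] by simp

lemma nH_minus_commute: "nH (\<lambda>s. x s - y s) = nH (\<lambda>s. y s - x s)"
  using nH_uminus[of "\<lambda>s. x s - y s"] by simp

lemma nH_divide: "nH (\<lambda>s. x s / c) = nH x / \<bar>c\<bar>"
  using nH_cmult[of "inverse c" x] by (simp add: divide_inverse mult.commute)

lemma nH_triangle_diff:
  assumes "memH x" "memH y" shows "nH (\<lambda>s. x s - y s) \<le> nH x + nH y"
  using nH_triangle[of x "\<lambda>s. - y s"] assms by simp

lemma nH_triangle_rev:
  assumes "memH x" "memH y" shows "nH x \<le> nH y + nH (\<lambda>s. x s - y s)"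
  using nH_triangle[of y "\<lambda>s. x s - y s"] assms by simp

lemma nH_mono:
  assumes "x \<in> borel_measurable mu" "memH y" "AE s in mu. \<bar>x s\<bar> \<le> \<bar>y s\<bar>" shows "nH x \<le> nH y"
proof -
  have "(\<integral>s. (x s)^2 \<partial>mu) \<le> (\<integral>s. (y s)^2 \<partial>mu)"
  proof (rule integral_mono_AE)
    show "integrable mu (\<lambda>s. (x s)^2)" using memH_dom[OF assms] by (rule memH_sq)
    show "integrable mu (\<lambda>s. (y s)^2)" using assms(2) by (rule memH_sq)
    show "AE s in mu. (x s)^2 \<le> (y s)^2" using assms(3) by eventually_elim (simp add: abs_le_square_iff)
  qed
  then show ?thesis by (simp add: nH_mu)
qed

lemma nH_const [simp]: "nH (\<lambda>s. c) = \<bar>c\<bar>"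
proof -
  have "measure mu I01 = 1" using emeasure_mu by (simp add: measure_def)
  then show ?thesis by (simp add: nH_mu)
qed

lemma nH_bound:
  assumes "x \<in> borel_measurable mu" "AE s in mu. \<bar>x s\<bar> \<le> C" shows "nH x \<le> \<bar>C\<bar>"
proof -
  have "nH x \<le> nH (\<lambda>s. C)"
    by (rule nH_mono[OF assms(1) memH_const]) (use assms(2) in eventually_elim, simp)
  then show ?thesis by simp
qed

lemma integral_mu_le_nH: "memH x \<Longrightarrow> \<bar>\<integral>s. x s \<partial>mu\<bar> \<le> nH x"
  using Cauchy_Schwarz_mu[of x "\<lambda>s. 1"] by simp

lemma nH_cong: 
  assumes "x \<in> borel_measurable mu" "y \<in> borel_measurable mu" "AE s in mu. x s = y s" shows "nH x = nH y"
  unfolding nH_mu using assms by (auto intro!: arg_cong[where f=sqrt] integral_cong_AE elim!: eventually_mono)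

lemma nH_eq_0:
  assumes "memH x" "nH x = 0" shows "AE s in mu. x s = 0"
proof -
  have "(\<integral>s. (x s)^2 \<partial>mu) = 0" using assms(2) by (simp add: nH_mu)
  then have "AE s in mu. (x s)^2 = 0"
    using integral_nonneg_eq_0_iff_AE[OF memH_sq[OF assms(1)]] by simp
  then show ?thesis by simp
qed

lemma nH_zero_AE: assumes "AE s in mu. x s = 0" shows "nH x = 0"
proof -
  have "integral\<^sup>L mu (\<lambda>s. (x s)^2) = 0"
    by (rule integral_eq_zero_AE) (use assms in eventually_elim, simp)
  then show ?thesis by (simp add: nH_mu)
qed

text \<open>Serves the contact set: a fixed function dominated by the error of a difference quotient
  has to vanish.\<close>

lemma nH_le_tendsto_0:
  assumes "memH x" "\<forall>\<^sub>F h in F. nH x \<le> e h" "(e \<longlongrightarrow> 0) F" "F \<noteq> bot"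
  shows "AE s in mu. x s = 0"
proof -
  have "nH x \<le> 0" using tendsto_lowerbound[OF assms(3,2,4)] .
  then show ?thesis using nH_eq_0[OF assms(1)] by (simp add: order_antisym)
qed

lemma AE_mu_iff_lborel: "(AE s in mu. P s) \<longleftrightarrow> (AE s in lborel. s \<in> I01 \<longrightarrow> P s)"
  using ae01_mu ae01_def by simp

lemma AE_mu_I: "(\<And>s. 0 < s \<Longrightarrow> s < 1 \<Longrightarrow> P s) \<Longrightarrow> AE s in mu. P s"
  by (rule AE_I2) (simp add: I01_def)

section \<open>Absolutely continuous curves in H\<close>

text \<open>Cousin's lemma with a gauge that keeps intervals tagged in the exceptional null set inside an
  open set of small measure, where absolute continuity controls the increments.\<close>
lemma abscontH_nonincreasing:
  fixes K :: "real \<Rightarrow> real"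
  assumes T: "T1 \<le> T2" and ac: "abscontH T1 T2 z" and C0: "0 \<le> C"
    and KC: "\<And>a c. T1 \<le> a \<Longrightarrow> a \<le> c \<Longrightarrow> c \<le> T2 \<Longrightarrow> \<bar>K c - K a\<bar> \<le> C * (nH (\<lambda>x. z c x - z a x) + (c - a))"
    and der: "AE t in lborel. T1 < t \<and> t < T2 \<longrightarrow> (\<exists>D\<le>0. (K has_real_derivative D) (at t))"
  shows "K T2 \<le> K T1"
proof -
  have main: "K T2 - K T1 \<le> e * (T2 - T1) + e" if e: "e > 0" for e
  proof -
    \<comment> \<open>Two error terms occur, the variation of \<open>z\<close> and the total length
      of the bad intervals. Each is multiplied by \<open>C\<close>, and this choice keeps
      \<open>C * e0 + C * e0\<close> strictly below \<open>e\<close>, also when \<open>C\<close> is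
      0.\<close>
    define e0 where "e0 = e / (2 * (C + 1))"
    have e0: "e0 > 0" using e C0 by (simp add: e0_def)
    have "(C + 1) * e0 = e / 2" using C0 by (simp add: e0_def divide_simps)
    then have Ce0: "C * e0 + C * e0 < e" using e0 by (simp add: algebra_simps)
    have "\<exists>d>0. \<forall>(n::nat) (a::nat\<Rightarrow>real) (c::nat\<Rightarrow>real). (\<forall>i<n. T1 \<le> a i \<and> a i \<le> c i \<and> c i \<le> T2) \<and>
     (\<forall>i<n. \<forall>j<n. i \<noteq> j \<longrightarrow> c i \<le> a j \<or> c j \<le> a i) \<and>
     (\<Sum>i<n. c i - a i) < d \<longrightarrow> (\<Sum>i<n. nH (\<lambda>x. z (c i) x - z (a i) x)) < e0"
      by (rule ac[unfolded abscontH_def, THEN spec, THEN mp, OF e0])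
    then obtain d0 where d0: "d0 > 0" and D0: "\<forall>(n::nat) (a::nat\<Rightarrow>real) (c::nat\<Rightarrow>real). (\<forall>i<n. T1 \<le> a i \<and> a i \<le> c i \<and> c i \<le> T2) \<and>
     (\<forall>i<n. \<forall>j<n. i \<noteq> j \<longrightarrow> c i \<le> a j \<or> c j \<le> a i) \<and>
     (\<Sum>i<n. c i - a i) < d0 \<longrightarrow> (\<Sum>i<n. nH (\<lambda>x. z (c i) x - z (a i) x)) < e0"
      by (elim exE conjE)
    define d where "d = min d0 e0"
    have d: "d > 0" using d0 e0 by (simp add: d_def)
    have small: "(\<Sum>i<n. K (c i) - K (a i)) < e"
      if 1: "\<And>i. i < n \<Longrightarrow> T1 \<le> a i \<and> a i \<le> c i \<and> c i \<le> T2"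
        and 2: "\<And>i j. i < n \<Longrightarrow> j < n \<Longrightarrow> i \<noteq> j \<Longrightarrow> c i \<le> a j \<or> c j \<le> a i"
        and 3: "(\<Sum>i<n. c i - a i) < d" for n :: nat and a c
    proof -
      have "(\<Sum>i<n. K (c i) - K (a i)) \<le> (\<Sum>i<n. C * (nH (\<lambda>x. z (c i) x - z (a i) x) + (c i - a i)))"
      proof (rule sum_mono)
        fix i assume "i \<in> {..<n}"
        then show "K (c i) - K (a i) \<le> C * (nH (\<lambda>x. z (c i) x - z (a i) x) + (c i - a i))"
          using KC[of "a i" "c i"] 1[of i] by auto
      qed
      also have "\<dots> = C * (\<Sum>i<n. nH (\<lambda>x. z (c i) x - z (a i) x)) + C * (\<Sum>i<n. c i - a i)"
        by (simp add: sum_distrib_left sum.distrib ring_distribs)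
      also have "\<dots> \<le> C * e0 + C * e0"
      proof (intro add_mono mult_left_mono C0)
        show "(\<Sum>i<n. nH (\<lambda>x. z (c i) x - z (a i) x)) \<le> e0"
          by (rule less_imp_le, rule D0[THEN spec, THEN spec, THEN spec, THEN mp]) (use 1 2 3 in \<open>auto simp: d_def\<close>)
        show "(\<Sum>i<n. c i - a i) \<le> e0" using 3 by (simp add: d_def)
      qed
      finally show ?thesis using Ce0 by simp
    qed
    obtain N where N: "N \<in> null_sets lborel"
      and NE: "\<And>t. T1 < t \<Longrightarrow> t < T2 \<Longrightarrow> t \<notin> N \<Longrightarrow> \<exists>D\<le>0. (K has_real_derivative D) (at t)"
      using der by (elim AE_E3) auto
    \<comment> \<open>The derivative is controlled only in the open interval, so the end points join
      the exceptional set; they are null anyway.\<close>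
    define E where "E = N \<union> {T1, T2}"
    have Enull: "E \<in> null_sets lborel"
      unfolding E_def by (intro null_sets.Un N) (simp add: finite_imp_null_set_lborel)
    obtain U where U: "open U" "E \<subseteq> U" "emeasure lborel (U - E) < ennreal d"
    proof (rule outer_regular_lborel)
      show "E \<in> sets borel" using Enull by auto
      show "0 < d" by (rule d)
    qed auto
    have Um: "emeasure lborel U < ennreal d"
    proof -
      have "U = (U - E) \<union> E" using U by auto
      then have "emeasure lborel U = emeasure lborel ((U - E) \<union> E)" by simp
      also have "\<dots> = emeasure lborel (U - E)" by (rule emeasure_Un_null_set) (use U Enull in auto)
      finally show ?thesis using U by simp
    qed
    \<comment> \<open>Straddle estimate: near a point of nonpositive derivative, increments to the
      left and to the right are at most \<open>e\<close> times the length, so they add up on an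
      interval tagged by that point.\<close>
    have "\<exists>r>0. \<forall>y. \<bar>y - t\<bar> < r \<longrightarrow> (y \<ge> t \<longrightarrow> K y - K t \<le> e * (y - t)) \<and> (y \<le> t \<longrightarrow> K t - K y \<le> e * (t - y))"
      if t: "T1 < t" "t < T2" "t \<notin> E" for t
    proof -
      obtain D where D: "D \<le> 0" "(K has_real_derivative D) (at t)" using NE t by (auto simp: E_def)
      then have "((\<lambda>y. (K y - K t) / (y - t)) \<longlongrightarrow> D) (at t)" by (simp add: has_field_derivative_iff)
      then have "\<forall>\<^sub>F y in at t. (K y - K t) / (y - t) < D + e"
        by (rule order_tendstoD) (use e in simp)
      then obtain r where r: "r > 0" "\<And>y. y \<noteq> t \<Longrightarrow> dist y t < r \<Longrightarrow> (K y - K t) / (y - t) < D + e"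
        unfolding eventually_at by auto
      have "(y \<ge> t \<longrightarrow> K y - K t \<le> e * (y - t)) \<and> (y \<le> t \<longrightarrow> K t - K y \<le> e * (t - y))"
        if "\<bar>y - t\<bar> < r" for y
      proof (cases "y = t")
        case False
        then have q: "(K y - K t) / (y - t) \<le> e" using r(2)[of y] that D by (auto simp: dist_real_def)
        show ?thesis
        proof (cases "y > t")
          case True then show ?thesis using q by (simp add: field_simps)
        next
          case False
          then have "y < t" using \<open>y \<noteq> t\<close> by simp
          then show ?thesis using q by (simp add: divide_simps algebra_simps split: if_splits)
        qed
      qed simp
      then show ?thesis using r(1) by blast
    qed
    then obtain r where r: "\<And>t. T1 < t \<Longrightarrow> t < T2 \<Longrightarrow> t \<notin> E \<Longrightarrow> r t > (0::real)"
      "\<And>t y. T1 < t \<Longrightarrow> t < T2 \<Longrightarrow> t \<notin> E \<Longrightarrow> \<bar>y - t\<bar> < r t \<Longrightarrow> (y \<ge> t \<longrightarrow> K y - K t \<le> e * (y - t)) \<and> (y \<le> t \<longrightarrow> K t - K y \<le> e * (t - y))"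
      by metis
    \<comment> \<open>An interval with a bad tag is forced into \<open>U\<close>, one with a good
      tag into the range of the straddle estimate. The last branch only makes \<open>g\<close> a
      gauge on the whole line.\<close>
    define g where "g t = (if t \<in> E then U else if T1 < t \<and> t < T2 then ball t (r t) else ball t 1)" for t
    have "gauge g" unfolding gauge_def g_def using U r(1) by auto
    then obtain p where p: "p tagged_division_of {T1..T2}" "g fine p" by (rule fine_division_exists_real)
    note pD = tagged_division_ofD[OF p(1)]
    have interval: "\<exists>a c. k = {a..c} \<and> a \<le> x \<and> x \<le> c \<and> T1 \<le> a \<and> c \<le> T2 \<and> Inf k = a \<and> Sup k = c"
      if xk: "(x, k) \<in> p" for x k
    proof -
      obtain a c where k: "k = {a..c}" using pD(4)[OF xk] by auto
      have "x \<in> k" using pD(2)[OF xk] .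
      then have ac: "a \<le> x" "x \<le> c" using k by auto
      then have "a \<in> k" "c \<in> k" using k by auto
      then have "T1 \<le> a" "c \<le> T2" using pD(3)[OF xk] by auto
      then show ?thesis using k ac by auto
    qed
    \<comment> \<open>Degenerate intervals are left out: their increment is 0, and disjointness of
      interiors gives the ordering required by \<open>abscontH\<close> only for intervals with
      nonempty interior.\<close>
    define q where "q = {(x,k) \<in> p. x \<in> E \<and> Inf k < Sup k}"
    have qp: "q \<subseteq> p" by (auto simp: q_def)
    have fin: "finite p" "finite q" using pD(1) finite_subset[OF qp] by auto
    have rest: "(\<Sum>(x,k)\<in>p - q. K (Sup k) - K (Inf k)) \<le> (\<Sum>(x,k)\<in>p - q. e * (Sup k - Inf k))"
    proof (rule sum_mono, clarify)
      fix x k assume xk: "(x, k) \<in> p" "(x, k) \<notin> q"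
      obtain a c where ac: "k = {a..c}" "a \<le> x" "x \<le> c" "T1 \<le> a" "c \<le> T2" "Inf k = a" "Sup k = c"
        using interval[OF xk(1)] by auto
      show "K (Sup k) - K (Inf k) \<le> e * (Sup k - Inf k)"
      proof (cases "x \<in> E")
        case True then have "a = c" using xk ac by (auto simp: q_def)
        then show ?thesis using ac by simp
      next
        case False
        then have xT: "T1 < x" "x < T2" using ac by (auto simp: E_def order.strict_iff_order)
        have "k \<subseteq> g x" using p(2) xk(1) by (auto simp: fine_def)
        then have "{a..c} \<subseteq> ball x (r x)" using xT False ac by (auto simp: g_def)
        then have "a \<in> ball x (r x)" "c \<in> ball x (r x)" using ac(2,3) subsetD[of "{a..c}" "ball x (r x)"] by (simp_all del: mem_ball)
        then have "K c - K x \<le> e * (c - x)" "K x - K a \<le> e * (x - a)"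
          using r(2)[OF xT False, of c] r(2)[OF xT False, of a] ac by (auto simp: dist_real_def)
        then show ?thesis using ac by (simp add: algebra_simps)
      qed
    qed
    also have "\<dots> \<le> (\<Sum>(x,k)\<in>p. e * (Sup k - Inf k))"
      using fin e by (intro sum_mono2) (auto dest!: interval)
    also have "\<dots> = e * (\<Sum>(x,k)\<in>p. Sup k - Inf k)" by (simp add: sum_distrib_left case_prod_unfold)
    also have "(\<Sum>(x,k)\<in>p. Sup k - Inf k) = T2 - T1"
      using additive_tagged_division_1[OF T p(1), of "\<lambda>x. x"] .
    finally have rest: "(\<Sum>(x,k)\<in>p - q. K (Sup k) - K (Inf k)) \<le> e * (T2 - T1)" .
    obtain h where h: "bij_betw h {0..<card q} q" using ex_bij_betw_nat_finite[OF fin(2)] by auto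
    then have h: "bij_betw h {..<card q} q" by (simp add: lessThan_atLeast0)
    define n where "n = card q"
    define a c where "a i = Inf (snd (h i))" and "c i = Sup (snd (h i))" for i
    have hq: "h i \<in> q" if "i < n" for i using h that by (auto simp: bij_betw_def n_def)
    have hi: "(fst (h i), snd (h i)) \<in> p \<and> fst (h i) \<in> E \<and> a i < c i" if "i < n" for i
      using hq[OF that] by (auto simp: q_def a_def c_def)
    have sk: "snd (h i) = {a i..c i} \<and> T1 \<le> a i \<and> c i \<le> T2" if "i < n" for i
      using interval[of "fst (h i)" "snd (h i)"] hi[OF that] by (auto simp: a_def c_def)
    have inj: "h i \<noteq> h j" if "i < n" "j < n" "i \<noteq> j" for i j
      using h that by (auto simp: bij_betw_def n_def inj_on_def)
    have dis: "{a i<..<c i} \<inter> {a j<..<c j} = {}" if "i < n" "j < n" "i \<noteq> j" for i j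
    proof -
      have "interior (snd (h i)) \<inter> interior (snd (h j)) = {}"
        by (rule pD(5)[of "fst (h i)" _ "fst (h j)"]) (use hi that inj in auto)
      then show ?thesis using sk that by (simp add: interior_atLeastAtMost_real)
    qed
    have sep: "c i \<le> a j \<or> c j \<le> a i" if "i < n" "j < n" "i \<noteq> j" for i j
    proof (rule ccontr)
      assume "\<not> ?thesis"
      then have "(max (a i) (a j) + min (c i) (c j)) / 2 \<in> {a i<..<c i} \<inter> {a j<..<c j}"
        using hi[OF that(1)] hi[OF that(2)] by (auto simp: max_def min_def)
      then show False using dis[OF that] by auto
    qed
    have "(\<Sum>i<n. c i - a i) < d"
    proof -
      have "ennreal (\<Sum>i<n. c i - a i) = (\<Sum>i<n. emeasure lborel {a i<..<c i})"
        using hi by (subst sum_ennreal[symmetric]) (auto intro!: sum.cong simp: less_imp_le)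
      also have "\<dots> = emeasure lborel (\<Union>i<n. {a i<..<c i})"
        by (rule sum_emeasure) (simp_all add: image_subset_iff disjoint_family_on_def dis del: greaterThanLessThan_iff Int_greaterThanLessThan)
      also have "\<dots> \<le> emeasure lborel U"
      proof (rule emeasure_mono)
        show "(\<Union>i<n. {a i<..<c i}) \<subseteq> U"
        proof clarify
          fix i y assume i: "i < n" and y: "y \<in> {a i<..<c i}"
          have "snd (h i) \<subseteq> g (fst (h i))" using fineD[OF p(2), of "fst (h i)" "snd (h i)"] hi[OF i] by blast
          then show "y \<in> U" using hi[OF i] sk[OF i] y by (auto simp: g_def)
        qed
      qed (use U in auto)
      finally have "ennreal (\<Sum>i<n. c i - a i) < ennreal d" using Um by (rule le_less_trans)
      moreover have "0 \<le> (\<Sum>i<n. c i - a i)" by (intro sum_nonneg) (use hi in \<open>force intro: less_imp_le\<close>)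
      ultimately show ?thesis using ennreal_less_iff by blast
    qed
    then have "(\<Sum>i<n. K (c i) - K (a i)) < e"
      using small[of n a c] sk hi sep by (force simp: less_imp_le)
    also have "(\<Sum>i<n. K (c i) - K (a i)) = (\<Sum>(x,k)\<in>q. K (Sup k) - K (Inf k))"
      using sum.reindex_bij_betw[OF h, of "\<lambda>(x,k). K (Sup k) - K (Inf k)"]
      by (simp add: a_def c_def n_def case_prod_unfold)
    finally have "(\<Sum>(x,k)\<in>q. K (Sup k) - K (Inf k)) < e" .
    moreover have "(\<Sum>(x,k)\<in>p. K (Sup k) - K (Inf k)) = (\<Sum>(x,k)\<in>p - q. K (Sup k) - K (Inf k)) + (\<Sum>(x,k)\<in>q. K (Sup k) - K (Inf k))"
      using sum.subset_diff[OF qp fin(1)] by (simp add: add.commute)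
    moreover have "(\<Sum>(x,k)\<in>p. K (Sup k) - K (Inf k)) = K T2 - K T1"
      using additive_tagged_division_1[OF T p(1)] .
    ultimately show ?thesis using rest by linarith
  qed
  show ?thesis
  proof (rule ccontr)
    assume "\<not> ?thesis"
    then have pos: "K T2 - K T1 > 0" by simp
    \<comment> \<open>Chosen so that \<open>main\<close> bounds the positive increment by half of
      itself; the summand 1 in the denominator also covers T1 = T2.\<close>
    define e where "e = (K T2 - K T1) / (2 * (T2 - T1 + 1))"
    have "e > 0" using pos T by (simp add: e_def)
    from main[OF this] have "K T2 - K T1 \<le> e * (T2 - T1 + 1)" by (simp add: algebra_simps)
    also have "\<dots> = (K T2 - K T1) / 2" using T by (simp add: e_def field_simps)
    finally show False using pos by simp
  qed
qed

section \<open>Absolutely continuous functions of a real variable\<close>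

text \<open>Absolute continuity on \<open>[a,b]\<close> with almost everywhere derivative \<open>P\<close>, encoded by the indefinite integral.\<close>
definition acd :: "real \<Rightarrow> real \<Rightarrow> (real \<Rightarrow> real) \<Rightarrow> (real \<Rightarrow> real) \<Rightarrow> bool" where
  "acd a b p P \<longleftrightarrow> integrable lborel (\<lambda>x. indicator {a..b} x * P x) \<and>
     (\<forall>x\<in>{a..b}. p x = p a + (\<integral>y. indicator {a..x} y * P y \<partial>lborel))"

lemma indicator_integrable_subset:
  fixes f :: "real \<Rightarrow> real"
  assumes "integrable lborel (\<lambda>x. indicator A x * f x)" "B \<subseteq> A" "B \<in> sets borel"
  shows "integrable lborel (\<lambda>x. indicator B x * f x)"
proof -
  have "integrable lborel (\<lambda>x. indicator B x * (indicator A x * f x))"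
    using integrable_mult_indicator[OF _ assms(1), of B] assms(3) by simp
  moreover have "(\<lambda>x. indicator B x * (indicator A x * f x)) = (\<lambda>x. indicator B x * f x)"
    using assms(2) by (auto simp: indicator_def fun_eq_iff)
  ultimately show ?thesis by simp
qed

lemma integral_indicator_split:
  fixes f :: "real \<Rightarrow> real"
  assumes "integrable lborel (\<lambda>x. indicator {a..b} x * f x)" "a \<le> c" "c \<le> d" "d \<le> b"
  shows "(\<integral>x. indicator {a..d} x * f x \<partial>lborel) =
    (\<integral>x. indicator {a..c} x * f x \<partial>lborel) + (\<integral>x. indicator {c..d} x * f x \<partial>lborel)"
proof -
  have i: "integrable lborel (\<lambda>x. indicator {a..d} x * f x)" "integrable lborel (\<lambda>x. indicator {a..c} x * f x)"
    "integrable lborel (\<lambda>x. indicator {c..d} x * f x)"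
    by (rule indicator_integrable_subset[OF assms(1)], use assms in auto)+
  have "(\<integral>x. indicator {a..d} x * f x \<partial>lborel) = (\<integral>x. indicator {a..c} x * f x + indicator {c..d} x * f x \<partial>lborel)"
  proof (rule integral_cong_AE)
    show "AE x in lborel. indicator {a..d} x * f x = indicator {a..c} x * f x + indicator {c..d} x * f x"
      using AE_lborel_singleton[of c] by eventually_elim (use assms in \<open>auto simp: indicator_def\<close>)
  qed (use i in auto)
  also have "\<dots> = (\<integral>x. indicator {a..c} x * f x \<partial>lborel) + (\<integral>x. indicator {c..d} x * f x \<partial>lborel)"
    using i by simp
  finally show ?thesis .
qed

lemma acd_integrable: "acd a b p P \<Longrightarrow> integrable lborel (\<lambda>x. indicator {a..b} x * P x)"
  unfolding acd_def by (rule conjunct1)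

lemma acd_eq: "acd a b p P \<Longrightarrow> x \<in> {a..b} \<Longrightarrow> p x = p a + (\<integral>y. indicator {a..x} y * P y \<partial>lborel)"
  unfolding acd_def by blast

lemma acd_subinterval:
  assumes "acd a b p P" "a \<le> c" "c \<le> d" "d \<le> b"
  shows "acd c d p P"
proof -
  note I = acd_integrable[OF assms(1)] and p = acd_eq[OF assms(1)]
  show ?thesis unfolding acd_def
  proof (intro conjI ballI)
    show "integrable lborel (\<lambda>x. indicator {c..d} x * P x)"
      by (rule indicator_integrable_subset[OF I]) (use assms in auto)
    fix x assume x: "x \<in> {c..d}"
    have "(\<integral>y. indicator {a..x} y * P y \<partial>lborel) = (\<integral>y. indicator {a..c} y * P y \<partial>lborel) + (\<integral>y. indicator {c..x} y * P y \<partial>lborel)"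
      by (rule integral_indicator_split[OF I]) (use assms x in auto)
    then show "p x = p c + (\<integral>y. indicator {c..x} y * P y \<partial>lborel)"
      using p[of x] p[of c] x assms(2-) by simp
  qed
qed

lemma acd_continuous:
  assumes "acd a b p P" shows "continuous_on {a..b} p"
proof -
  note I = acd_integrable[OF assms] and p = acd_eq[OF assms]
  have S: "set_integrable lborel {a..x} P" if "x \<in> {a..b}" for x
    unfolding set_integrable_def using indicator_integrable_subset[OF I, of "{a..x}"] that by auto
  have eq: "p x = p a + integral {a..x} P" if "x \<in> {a..b}" for x
    using set_borel_integral_eq_integral(2)[OF S[OF that]] p[OF that] by (simp add: set_lebesgue_integral_def)
  show ?thesis
  proof (cases "a \<le> b")
    case True
    have "P integrable_on {a..b}" using set_borel_integral_eq_integral(1)[OF S[of b]] True by auto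
    then have "continuous_on {a..b} (\<lambda>x. p a + integral {a..x} P)"
      by (intro continuous_on_add continuous_on_const indefinite_integral_continuous_1)
    then show ?thesis by (rule continuous_on_eq) (rule eq[symmetric])
  qed simp
qed

lemma continuous_on_Icc_bounded:
  fixes h :: "real \<Rightarrow> real"
  assumes "continuous_on {a..b} h"
  obtains B where "\<And>x. x \<in> {a..b} \<Longrightarrow> \<bar>h x\<bar> \<le> B"
proof -
  have "bounded (h ` {a..b})" by (rule compact_imp_bounded[OF compact_continuous_image[OF assms compact_Icc]])
  then obtain B where "\<forall>y\<in>h ` {a..b}. norm y \<le> B" by (auto simp: bounded_iff)
  then have "\<bar>h x\<bar> \<le> B" if "x \<in> {a..b}" for x using that by auto
  then show ?thesis by (rule that)
qed

lemma acd_C1: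
  assumes "a \<le> b" "\<And>x. a \<le> x \<Longrightarrow> x \<le> b \<Longrightarrow> (p has_real_derivative P x) (at x within {a..b})"
    and "continuous_on {a..b} P"
  shows "acd a b p P"
  unfolding acd_def
proof (intro conjI ballI)
  show "integrable lborel (\<lambda>x. indicator {a..b} x * P x)"
    using borel_integrable_atLeastAtMost'[OF assms(3)] by (simp add: set_integrable_def)
  fix x assume x: "x \<in> {a..b}"
  have "integral\<^sup>L lborel (\<lambda>y. indicator {a..x} y *\<^sub>R P y) = p x - p a"
  proof (rule integral_FTC_atLeastAtMost)
    show "a \<le> x" using x by simp
    show "continuous_on {a..x} P" by (rule continuous_on_subset[OF assms(3)]) (use x in auto)
    fix y assume "a \<le> y" "y \<le> x"
    then have "(p has_real_derivative P y) (at y within {a..x})"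
      using x by (intro DERIV_subset[OF assms(2)]) auto
    then show "(p has_vector_derivative P y) (at y within {a..x})"
      by (simp add: has_real_derivative_iff_has_vector_derivative)
  qed
  then show "p x = p a + (\<integral>y. indicator {a..x} y * P y \<partial>lborel)" by simp
qed

lemma integrable_indicator_mult_continuous:
  fixes f h :: "real \<Rightarrow> real"
  assumes I: "integrable lborel (\<lambda>x. indicator {a..b} x * f x)" and h: "continuous_on {a..b} h"
  shows "integrable lborel (\<lambda>x. indicator {a..b} x * (f x * h x))"
proof -
  have hm: "(\<lambda>x. indicator {a..b} x * h x) \<in> borel_measurable borel"
    using borel_measurable_continuous_on_indicator[OF _ h] by simp
  obtain B where B: "\<And>x. x \<in> {a..b} \<Longrightarrow> \<bar>h x\<bar> \<le> B"
    using continuous_on_Icc_bounded[OF h] by blast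
  have "integrable lborel (\<lambda>x. (indicator {a..b} x * f x) * (indicator {a..b} x * h x))"
  proof (rule Bochner_Integration.integrable_bound[where f="\<lambda>x. B * (indicator {a..b} x * f x)"])
    show "integrable lborel (\<lambda>x. B * (indicator {a..b} x * f x))" using I by simp
    show "(\<lambda>x. indicator {a..b} x * f x * (indicator {a..b} x * h x)) \<in> borel_measurable lborel"
      using hm borel_measurable_integrable[OF I] by auto
    have "\<bar>indicator {a..b} x * f x * (indicator {a..b} x * h x)\<bar> \<le> \<bar>B * (indicator {a..b} x * f x)\<bar>" for x
    proof (cases "x \<in> {a..b}")
      case True
      then have "\<bar>h x\<bar> \<le> \<bar>B\<bar>" using B by force
      then show ?thesis using True mult_left_mono[of "\<bar>h x\<bar>" "\<bar>B\<bar>" "\<bar>f x\<bar>"] by (simp add: abs_mult mult.commute)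
    qed simp
    then show "AE x in lborel. norm (indicator {a..b} x * f x * (indicator {a..b} x * h x)) \<le> norm (B * (indicator {a..b} x * f x))"
      by simp
  qed
  moreover have "(\<lambda>x. (indicator {a..b} x * f x) * (indicator {a..b} x * h x)) = (\<lambda>x. indicator {a..b} x * (f x * h x))"
    by (auto simp: indicator_def fun_eq_iff)
  ultimately show ?thesis by simp
qed

text \<open>Integration by parts by Fubini's theorem on the square \<open>[a,b]\<^sup>2\<close>, split along the diagonal.\<close>
lemma acd_by_parts:
  assumes ab: "a \<le> b" and p: "acd a b p P" and h: "acd a b h Q"
  shows "(\<integral>x. indicator {a..b} x * (P x * h x + p x * Q x) \<partial>lborel) = p b * h b - p a * h a"
proof -
  define P1 Q1 where "P1 x = indicator {a..b} x * P x" and "Q1 x = indicator {a..b} x * Q x" for x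
  have iP: "integrable lborel P1" and iQ: "integrable lborel Q1"
    unfolding P1_def Q1_def using p h by (auto intro: acd_integrable)
  note [measurable] = borel_measurable_integrable[OF iP] borel_measurable_integrable[OF iQ]
  note pp = acd_eq[OF p] and hh = acd_eq[OF h]
  have ind1: "(\<integral>y. indicator {..x} y * P1 y \<partial>lborel) = p x - p a" if "x \<in> {a..b}" for x
  proof -
    have "(\<lambda>y. indicator {..x} y * P1 y) = (\<lambda>y. indicator {a..x} y * P y)"
      using that by (auto simp: P1_def indicator_def fun_eq_iff)
    then show ?thesis using pp[OF that] by simp
  qed
  have ind2: "(\<integral>y. indicator {..x} y * Q1 y \<partial>lborel) = h x - h a" if "x \<in> {a..b}" for x
  proof -
    have "(\<lambda>y. indicator {..x} y * Q1 y) = (\<lambda>y. indicator {a..x} y * Q y)"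
      using that by (auto simp: Q1_def indicator_def fun_eq_iff)
    then show ?thesis using hh[OF that] by simp
  qed
  \<comment> \<open>The complement of the closed triangle is an open one, so the strict half-line
    occurs; the diagonal is null.\<close>
  have ind1': "(\<integral>y. indicator {..<x} y * P1 y \<partial>lborel) = p x - p a" if "x \<in> {a..b}" for x
  proof -
    have "AE y in lborel. y \<noteq> x" by (rule AE_lborel_singleton)
    then have "(\<integral>y. indicator {..<x} y * P1 y \<partial>lborel) = (\<integral>y. indicator {..x} y * P1 y \<partial>lborel)"
      by (intro integral_cong_AE) (auto elim!: eventually_mono simp: indicator_def)
    then show ?thesis using ind1[OF that] by simp
  qed
  define f where "f x y = P1 x * Q1 y" for x y
  \<comment> \<open>\<open>A\<close> is the part of the product on and below the diagonal,
    \<open>B\<close> the part above. Integrating \<open>A\<close> first in y gives \<open>P\<close>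
    times the increment of \<open>h\<close>, integrating \<open>B\<close> first in x gives
    \<open>Q\<close> times the increment of \<open>p\<close>.\<close>
  define A where "A x y = (if y \<le> x then f x y else 0)" for x y
  have fI: "integrable (lborel \<Otimes>\<^sub>M lborel) (case_prod f)"
  proof (rule lborel_pair.Fubini_integrable)
    show "(\<lambda>(x, y). f x y) \<in> borel_measurable (lborel \<Otimes>\<^sub>M lborel)" unfolding f_def by measurable
    show "integrable lborel (\<lambda>x. \<integral>y. norm (case (x, y) of (x, y) \<Rightarrow> f x y) \<partial>lborel)"
      using iP by (simp add: f_def abs_mult)
    show "AE x in lborel. integrable lborel (\<lambda>y. case (x, y) of (x, y) \<Rightarrow> f x y)"
      using iQ by (simp add: f_def)
  qed
  have AI: "integrable (lborel \<Otimes>\<^sub>M lborel) (case_prod A)"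
  proof (rule Bochner_Integration.integrable_bound[OF fI])
    show "(\<lambda>(x, y). A x y) \<in> borel_measurable (lborel \<Otimes>\<^sub>M lborel)" unfolding A_def f_def by measurable
  qed (auto simp: A_def)
  define B where "B x y = f x y - A x y" for x y
  have BI: "integrable (lborel \<Otimes>\<^sub>M lborel) (case_prod B)"
    using Bochner_Integration.integrable_diff[OF fI AI] by (simp add: B_def case_prod_unfold)
  have "(\<integral>x. (\<integral>y. f x y \<partial>lborel) \<partial>lborel) = (p b - p a) * (h b - h a)"
  proof -
    have "(\<integral>x. P1 x \<partial>lborel) = p b - p a" using pp[of b] ab by (simp add: P1_def)
    moreover have "(\<integral>x. Q1 x \<partial>lborel) = h b - h a" using hh[of b] ab by (simp add: Q1_def)
    ultimately show ?thesis by (simp add: f_def)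
  qed
  moreover have "(\<integral>x. (\<integral>y. f x y \<partial>lborel) \<partial>lborel) = (\<integral>x. (\<integral>y. A x y \<partial>lborel) \<partial>lborel) + (\<integral>x. (\<integral>y. B x y \<partial>lborel) \<partial>lborel)"
  proof -
    have "(\<integral>x. (\<integral>y. f x y \<partial>lborel) \<partial>lborel) = integral\<^sup>L (lborel \<Otimes>\<^sub>M lborel) (case_prod f)"
      by (rule lborel_pair.integral_fst[OF fI])
    also have "\<dots> = integral\<^sup>L (lborel \<Otimes>\<^sub>M lborel) (\<lambda>z. case_prod A z + case_prod B z)"
      by (simp add: B_def case_prod_unfold)
    also have "\<dots> = integral\<^sup>L (lborel \<Otimes>\<^sub>M lborel) (case_prod A) + integral\<^sup>L (lborel \<Otimes>\<^sub>M lborel) (case_prod B)"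
      by (rule Bochner_Integration.integral_add[OF AI BI])
    finally show ?thesis using lborel_pair.integral_fst[OF AI] lborel_pair.integral_fst[OF BI] by simp
  qed
  moreover have "(\<integral>x. (\<integral>y. A x y \<partial>lborel) \<partial>lborel) = (\<integral>x. indicator {a..b} x * (P x * (h x - h a)) \<partial>lborel)"
  proof (rule Bochner_Integration.integral_cong[OF refl])
    fix x
    have "(\<integral>y. A x y \<partial>lborel) = (\<integral>y. P1 x * (indicator {..x} y * Q1 y) \<partial>lborel)"
      by (rule Bochner_Integration.integral_cong) (auto simp: A_def f_def indicator_def)
    also have "\<dots> = P1 x * (\<integral>y. indicator {..x} y * Q1 y \<partial>lborel)" by simp
    finally show "(\<integral>y. A x y \<partial>lborel) = indicator {a..b} x * (P x * (h x - h a))"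
      using ind2[of x] by (cases "x \<in> {a..b}") (auto simp: P1_def)
  qed
  moreover have "(\<integral>x. (\<integral>y. B x y \<partial>lborel) \<partial>lborel) = (\<integral>y. indicator {a..b} y * (Q y * (p y - p a)) \<partial>lborel)"
  proof -
    have "(\<integral>x. (\<integral>y. B x y \<partial>lborel) \<partial>lborel) = (\<integral>y. (\<integral>x. B x y \<partial>lborel) \<partial>lborel)"
      by (rule lborel_pair.Fubini_integral[OF BI, symmetric])
    also have "\<dots> = (\<integral>y. indicator {a..b} y * (Q y * (p y - p a)) \<partial>lborel)"
    proof (rule Bochner_Integration.integral_cong[OF refl])
      fix y
      have "(\<integral>x. B x y \<partial>lborel) = (\<integral>x. Q1 y * (indicator {..<y} x * P1 x) \<partial>lborel)"
        by (rule Bochner_Integration.integral_cong) (auto simp: A_def B_def f_def indicator_def)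
      also have "\<dots> = Q1 y * (\<integral>x. indicator {..<y} x * P1 x \<partial>lborel)" by simp
      finally show "(\<integral>x. B x y \<partial>lborel) = indicator {a..b} y * (Q y * (p y - p a))"
        using ind1'[of y] by (cases "y \<in> {a..b}") (auto simp: Q1_def)
    qed
    finally show ?thesis .
  qed
  moreover have iPh: "integrable lborel (\<lambda>x. indicator {a..b} x * (P x * h x))"
    by (rule integrable_indicator_mult_continuous) (rule acd_integrable[OF p], rule acd_continuous[OF h])
  moreover have iQp: "integrable lborel (\<lambda>x. indicator {a..b} x * (Q x * p x))"
    by (rule integrable_indicator_mult_continuous) (rule acd_integrable[OF h], rule acd_continuous[OF p])
  moreover have "(\<integral>x. indicator {a..b} x * (P x * (h x - h a)) \<partial>lborel) = (\<integral>x. indicator {a..b} x * (P x * h x) \<partial>lborel) - h a * (p b - p a)"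
  proof -
    have "(\<integral>x. indicator {a..b} x * (P x * (h x - h a)) \<partial>lborel) = (\<integral>x. indicator {a..b} x * (P x * h x) - h a * P1 x \<partial>lborel)"
      by (rule Bochner_Integration.integral_cong) (auto simp: P1_def algebra_simps)
    also have "\<dots> = (\<integral>x. indicator {a..b} x * (P x * h x) \<partial>lborel) - h a * (\<integral>x. P1 x \<partial>lborel)"
      using iPh iP by simp
    finally show ?thesis using pp[of b] ab by (simp add: P1_def)
  qed
  moreover have "(\<integral>x. indicator {a..b} x * (Q x * (p x - p a)) \<partial>lborel) = (\<integral>x. indicator {a..b} x * (Q x * p x) \<partial>lborel) - p a * (h b - h a)"
  proof -
    have "(\<integral>x. indicator {a..b} x * (Q x * (p x - p a)) \<partial>lborel) = (\<integral>x. indicator {a..b} x * (Q x * p x) - p a * Q1 x \<partial>lborel)"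
      by (rule Bochner_Integration.integral_cong) (auto simp: Q1_def algebra_simps)
    also have "\<dots> = (\<integral>x. indicator {a..b} x * (Q x * p x) \<partial>lborel) - p a * (\<integral>x. Q1 x \<partial>lborel)"
      using iQp iQ by simp
    finally show ?thesis using hh[of b] ab by (simp add: Q1_def)
  qed
  moreover have "(\<integral>x. indicator {a..b} x * (P x * h x + p x * Q x) \<partial>lborel) =
     (\<integral>x. indicator {a..b} x * (P x * h x) \<partial>lborel) + (\<integral>x. indicator {a..b} x * (Q x * p x) \<partial>lborel)"
    using Bochner_Integration.integral_add[OF iPh iQp] by (simp add: algebra_simps)
  ultimately show ?thesis by (simp add: algebra_simps)
qed

lemma acd_mult:
  assumes p: "acd a b p P" and h: "acd a b h Q"
  shows "acd a b (\<lambda>x. p x * h x) (\<lambda>x. P x * h x + p x * Q x)"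
  unfolding acd_def
proof (intro conjI ballI)
  have "integrable lborel (\<lambda>x. indicator {a..b} x * (P x * h x))"
    by (rule integrable_indicator_mult_continuous) (rule acd_integrable[OF p], rule acd_continuous[OF h])
  moreover have "integrable lborel (\<lambda>x. indicator {a..b} x * (Q x * p x))"
    by (rule integrable_indicator_mult_continuous) (rule acd_integrable[OF h], rule acd_continuous[OF p])
  ultimately have "integrable lborel (\<lambda>x. indicator {a..b} x * (P x * h x) + indicator {a..b} x * (Q x * p x))"
    by (rule Bochner_Integration.integrable_add)
  then show "integrable lborel (\<lambda>x. indicator {a..b} x * (P x * h x + p x * Q x))"
    by (simp add: algebra_simps)
  fix x assume x: "x \<in> {a..b}"
  have "acd a x p P" "acd a x h Q" by (auto intro!: acd_subinterval[OF p] acd_subinterval[OF h] simp: x[simplified])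
  then show "p x * h x = p a * h a + (\<integral>y. indicator {a..x} y * (P y * h y + p y * Q y) \<partial>lborel)"
    using acd_by_parts[of a x p P h Q] x by simp
qed

lemma acd_affine:
  assumes "acd a b p P" shows "acd a b (\<lambda>x. k + m * p x) (\<lambda>x. m * P x)"
  unfolding acd_def
proof (intro conjI ballI)
  show "integrable lborel (\<lambda>x. indicator {a..b} x * (m * P x))"
    using integrable_mult_right[OF acd_integrable[OF assms], of m] by (simp add: mult_ac)
  fix x assume "x \<in> {a..b}"
  from acd_eq[OF assms this] have "k + m * p x = k + m * p a + m * (\<integral>y. indicator {a..x} y * P y \<partial>lborel)"
    by (simp add: algebra_simps)
  also have "m * (\<integral>y. indicator {a..x} y * P y \<partial>lborel) = (\<integral>y. indicator {a..x} y * (m * P y) \<partial>lborel)"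
    by (subst integral_mult_right_zero[symmetric]) (simp add: mult_ac)
  finally show "k + m * p x = k + m * p a + (\<integral>y. indicator {a..x} y * (m * P y) \<partial>lborel)" .
qed

text \<open>The chain rule for powers, obtained from the product rule by induction; it
  differentiates the polynomial cut-offs in \<open>acd_derivative_zero_on_zeros\<close>.\<close>

lemma acd_power:
  assumes p: "acd a b p P"
  shows "acd a b (\<lambda>x. p x ^ n) (\<lambda>x. real n * p x ^ (n - 1) * P x)"
proof (induction n)
  case 0
  show ?case by (simp add: acd_def)
next
  case (Suc n)
  have "real n * p x ^ (n - 1) * P x * p x + p x ^ n * P x = real (Suc n) * p x ^ n * P x" for x
    by (cases n) (simp_all add: algebra_simps)
  then show ?case using acd_mult[OF Suc p] by (simp add: mult.commute[of "p _ ^ _" "p _"])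
qed

text \<open>The positive and the negative part of \<open>Z\<close> are densities of two finite
  measures that agree on all half-lines, hence are equal. So both parts coincide a.e., which leaves
  only the value 0 for \<open>Z\<close>.\<close>

lemma null_if_integrals_zero:
  fixes Z :: "real \<Rightarrow> real"
  assumes I: "integrable lborel Z" and z: "\<And>x. (\<integral>y. indicator {x<..} y * Z y \<partial>lborel) = 0"
  shows "AE x in lborel. Z x = 0"
proof -
  define A B where "A x = max 0 (Z x)" and "B x = max 0 (- Z x)" for x
  have iA: "integrable lborel A" and iB: "integrable lborel B" 
    unfolding A_def B_def using I by (intro integrable_max integrable_zero Bochner_Integration.integrable_minus; assumption)+
  note [measurable] = borel_measurable_integrable[OF iA] borel_measurable_integrable[OF iB]
  have iA': "integrable lborel (\<lambda>y. indicator {x<..} y * A y)" and iB': "integrable lborel (\<lambda>y. indicator {x<..} y * B y)" for x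
    using integrable_mult_indicator[OF _ iA] integrable_mult_indicator[OF _ iB] by auto
  have e: "emeasure (density lborel f) {x<..} = ennreal (\<integral>y. indicator {x<..} y * f y \<partial>lborel)"
    if f: "integrable lborel f" "\<And>y. 0 \<le> f y" for f :: "real \<Rightarrow> real" and x
  proof -
    have "emeasure (density lborel f) {x<..} = (\<integral>\<^sup>+y. ennreal (f y) * indicator {x<..} y \<partial>lborel)"
      using borel_measurable_integrable[OF f(1)] by (intro emeasure_density) auto
    also have "\<dots> = (\<integral>\<^sup>+y. ennreal (indicator {x<..} y * f y) \<partial>lborel)"
      by (intro nn_integral_cong) (auto simp: indicator_def)
    also have "\<dots> = ennreal (\<integral>y. indicator {x<..} y * f y \<partial>lborel)"
    proof (rule nn_integral_eq_integral)
      show "integrable lborel (\<lambda>y. indicator {x<..} y * f y)"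
        using integrable_mult_indicator[OF _ f(1), of "{x<..}"] by simp
    qed (use f in auto)
    finally show ?thesis .
  qed
  have eA: "emeasure (density lborel A) {x<..} = ennreal (\<integral>y. indicator {x<..} y * A y \<partial>lborel)" for x
    by (rule e[OF iA]) (simp add: A_def)
  have eB: "emeasure (density lborel B) {x<..} = ennreal (\<integral>y. indicator {x<..} y * B y \<partial>lborel)" for x
    by (rule e[OF iB]) (simp add: B_def)
  have "density lborel A = density lborel B"
  proof (rule measure_eqI_lessThan)
    show "emeasure (density lborel A) {x<..} < \<infinity>" for x by (simp add: eA)
    fix x
    have "(\<integral>y. indicator {x<..} y * A y \<partial>lborel) - (\<integral>y. indicator {x<..} y * B y \<partial>lborel) = (\<integral>y. indicator {x<..} y * Z y \<partial>lborel)"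
      by (subst Bochner_Integration.integral_diff[OF iA' iB', symmetric], rule Bochner_Integration.integral_cong)
         (auto simp: A_def B_def indicator_def)
    then show "emeasure (density lborel A) {x<..} = emeasure (density lborel B) {x<..}"
      using z by (simp add: eA eB)
  qed auto
  then have "AE x in lborel. ennreal (A x) = ennreal (B x)"
    by (subst (asm) sigma_finite_measure.density_unique_iff[OF sigma_finite_lborel]) auto
  then show ?thesis
    by eventually_elim (auto simp: A_def B_def max_def split: if_splits)
qed

text \<open>Each of the first n powers of 1 - t is at least the last one, so n (1 - t)^(n-1) is at
  most the geometric sum, and t times that sum is 1 - (1 - t)^n.\<close>

lemma power_tail_bound:
  fixes t :: real assumes "0 \<le> t" "t \<le> 1"
  shows "real n * t * (1 - t) ^ (n - 1) \<le> 1"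
proof (cases n)
  case (Suc m)
  have "real n * (1 - t) ^ m = (\<Sum>k<n. (1 - t) ^ m)" by simp
  also have "\<dots> \<le> (\<Sum>k<n. (1 - t) ^ k)"
    using assms Suc by (intro sum_mono power_decreasing) auto
  finally have "t * (real n * (1 - t) ^ m) \<le> t * (\<Sum>k<n. (1 - t) ^ k)"
    using assms by (intro mult_left_mono) auto
  also have "\<dots> = 1 - (1 - t) ^ n"
    using one_diff_power_eq[of "1 - t" n] by simp
  also have "\<dots> \<le> 1" using assms by simp
  finally show ?thesis using Suc by (simp add: mult_ac)
qed simp

text \<open>The derivative of \<open>F\<^sub>n(p)\<close>, where \<open>F\<^sub>n(y) = y (1 - (y/M)\<^sup>2)\<^sup>n\<close>, converges boundedly to the
  derivative of \<open>p\<close> cut off to \<open>{p = 0}\<close>, while \<open>F\<^sub>n(p)\<close> tends to 0.\<close>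
lemma acd_derivative_zero_on_zeros:
  assumes ab: "a \<le> b" and p: "acd a b p P"
  shows "AE x in lborel. x \<in> {a..b} \<longrightarrow> p x = 0 \<longrightarrow> P x = 0"
proof -
  obtain M0 where M0: "\<And>x. x \<in> {a..b} \<Longrightarrow> \<bar>p x\<bar> \<le> M0"
    using continuous_on_Icc_bounded[OF acd_continuous[OF p]] by blast
  define M where "M = \<bar>M0\<bar> + 1"
  have M: "M > 0" "\<bar>p x\<bar> < M" if "x \<in> {a..b}" for x using M0[OF that] by (auto simp: M_def)
  have M': "M > 0" by (simp add: M_def)
  define t where "t x = (p x / M)^2" for x
  have t: "0 \<le> t x" "t x < 1" if "x \<in> {a..b}" for x
    using M[OF that] by (auto simp: t_def abs_square_less_1)
  \<comment> \<open>The derivative of the n-th cut-off, written in t = (p/M)^2. The second term is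
    at most 2 by \<open>power_tail_bound\<close>, which gives the majorant 3 uniformly in n.\<close>
  define D where "D n x = (1 - t x) ^ n - 2 * (real n * t x * (1 - t x) ^ (n - 1))" for n x
  have w: "acd a b (\<lambda>x. 1 - t x) (\<lambda>x. - 2 * p x * P x / M^2)"
    using acd_affine[OF acd_mult[OF p p], of 1 "- 1 / M^2"]
    by (simp add: t_def power2_eq_square algebra_simps)
  have F: "acd a b (\<lambda>x. p x * (1 - t x) ^ n) (\<lambda>x. D n x * P x)" for n
  proof -
    have "P x * (1 - t x) ^ n + p x * (real n * (1 - t x) ^ (n - 1) * (- 2 * p x * P x / M^2)) = D n x * P x" for x
      by (simp add: D_def t_def power2_eq_square algebra_simps)
    then show ?thesis using acd_mult[OF p acd_power[OF w, of n]] by simp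
  qed
  have Dlim: "(\<lambda>n. D n x) \<longlonglongrightarrow> (if p x = 0 then 1 else 0)" if x: "x \<in> {a..b}" for x
  proof (cases "p x = 0")
    case True then show ?thesis by (simp add: D_def t_def)
  next
    case False
    define s where "s = 1 - t x"
    have s: "0 \<le> s" "norm s < 1" using t[OF x] False M' by (auto simp: s_def t_def)
    have "(\<lambda>n. s ^ n) \<longlonglongrightarrow> 0" using s by (simp add: LIMSEQ_power_zero)
    moreover have "(\<lambda>n. real n * s ^ (n - 1)) \<longlonglongrightarrow> 0"
    proof (rule LIMSEQ_imp_Suc)
      have "(\<lambda>n. real n * s ^ n + s ^ n) \<longlonglongrightarrow> 0 + 0"
        using s by (intro tendsto_add powser_times_n_limit_0 LIMSEQ_power_zero) auto
      then show "(\<lambda>n. real (Suc n) * s ^ (Suc n - 1)) \<longlonglongrightarrow> 0" by (simp add: algebra_simps)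
    qed
    ultimately have "(\<lambda>n. s ^ n - 2 * (t x * (real n * s ^ (n - 1)))) \<longlonglongrightarrow> 0 - 2 * (t x * 0)"
      by (intro tendsto_diff tendsto_mult tendsto_const)
    then show ?thesis using False by (simp add: D_def s_def algebra_simps)
  qed
  have Dbd: "\<bar>D n x\<bar> \<le> 3" if x: "x \<in> {a..b}" for n x
  proof -
    have "0 \<le> (1 - t x) ^ n" "(1 - t x) ^ n \<le> 1" using t[OF x] by (auto intro: power_le_one)
    moreover have "0 \<le> real n * t x * (1 - t x) ^ (n - 1)" using t[OF x] by simp
    moreover have "real n * t x * (1 - t x) ^ (n - 1) \<le> 1" using t[OF x] by (intro power_tail_bound) auto
    ultimately show ?thesis unfolding D_def by linarith
  qed
  have Flim: "(\<lambda>n. p x * (1 - t x) ^ n) \<longlonglongrightarrow> 0" if x: "x \<in> {a..b}" for x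
  proof (cases "p x = 0")
    case False
    then have "norm (1 - t x) < 1" using t[OF x] M' by (auto simp: t_def)
    then show ?thesis using tendsto_mult[OF tendsto_const LIMSEQ_power_zero, of "1 - t x" "p x"] by simp
  qed simp
  define Z where "Z x = indicator {a..b} x * ((if p x = 0 then 1 else 0) * P x)" for x
  have iP: "integrable lborel (\<lambda>x. indicator {a..b} x * P x)" by (rule acd_integrable[OF p])
  have mD: "(\<lambda>y. indicator {a..x} y * (D n y * P y)) \<in> borel_measurable lborel" if "x \<in> {a..b}" for x n
    by (rule borel_measurable_integrable, rule indicator_integrable_subset[OF acd_integrable[OF F[of n]]]) (use that in auto)
  have limZ: "(\<lambda>n. indicator {a..x} y * (D n y * P y)) \<longlonglongrightarrow> indicator {a..x} y * Z y" if "x \<in> {a..b}" for x y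
  proof (cases "y \<in> {a..x}")
    case True
    then have "y \<in> {a..b}" using that by auto
    then show ?thesis using True tendsto_mult[OF Dlim tendsto_const[of "P y"]] by (simp add: Z_def)
  qed simp
  have mZ: "(\<lambda>y. indicator {a..x} y * Z y) \<in> borel_measurable lborel" if "x \<in> {a..b}" for x
    by (rule borel_measurable_LIMSEQ_metric[OF mD limZ]) (use that in auto)
  have int0: "(\<integral>y. indicator {a..x} y * Z y \<partial>lborel) = 0 \<and> integrable lborel (\<lambda>y. indicator {a..x} y * Z y)" if x: "x \<in> {a..b}" for x
  proof -
    have bd: "\<bar>indicator {a..x} y * (D n y * P y)\<bar> \<le> 3 * \<bar>indicator {a..b} y * P y\<bar>" for n y
    proof (cases "y \<in> {a..x}")
      case True
      then have "y \<in> {a..b}" using x by auto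
      then show ?thesis using True mult_right_mono[OF Dbd[of y n], of "\<bar>P y\<bar>"] by (simp add: abs_mult)
    qed simp
    have iw: "integrable lborel (\<lambda>y. 3 * \<bar>indicator {a..b} y * P y\<bar>)" using iP by simp
    have "(\<lambda>n. \<integral>y. indicator {a..x} y * (D n y * P y) \<partial>lborel) \<longlonglongrightarrow> (\<integral>y. indicator {a..x} y * Z y \<partial>lborel)"
      by (rule integral_dominated_convergence[where w="\<lambda>y. 3 * \<bar>indicator {a..b} y * P y\<bar>"])
         (use mZ[OF x] mD[OF x] iw limZ[OF x] bd in auto)
    moreover have "(\<integral>y. indicator {a..x} y * (D n y * P y) \<partial>lborel) = p x * (1 - t x) ^ n - p a * (1 - t a) ^ n" for n
      using acd_eq[OF F[of n] x] by simp
    moreover have "(\<lambda>n. p x * (1 - t x) ^ n - p a * (1 - t a) ^ n) \<longlonglongrightarrow> 0 - 0"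
      using x ab by (intro tendsto_diff Flim) auto
    ultimately have "(\<integral>y. indicator {a..x} y * Z y \<partial>lborel) = 0" using LIMSEQ_unique by fastforce
    moreover have "integrable lborel (\<lambda>y. indicator {a..x} y * Z y)"
      by (rule integrable_dominated_convergence[where w="\<lambda>y. 3 * \<bar>indicator {a..b} y * P y\<bar>" and s="\<lambda>n y. indicator {a..x} y * (D n y * P y)"])
         (use mZ[OF x] mD[OF x] iw limZ[OF x] bd in auto)
    ultimately show ?thesis by simp
  qed
  have Zb: "(\<lambda>y. indicator {a..b} y * Z y) = Z" by (auto simp: Z_def fun_eq_iff indicator_def)
  have iZ: "integrable lborel Z" and Z0: "(\<integral>y. Z y \<partial>lborel) = 0" using int0[of b] ab by (auto simp: Zb)
  have "AE x in lborel. Z x = 0"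
  proof (rule null_if_integrals_zero[OF iZ])
    fix x
    show "(\<integral>y. indicator {x<..} y * Z y \<partial>lborel) = 0"
    proof (cases "x < a")
      case True
      then have "(\<lambda>y. indicator {x<..} y * Z y) = Z" by (auto simp: Z_def fun_eq_iff indicator_def)
      then show ?thesis using Z0 by simp
    next
      case False
      show ?thesis
      proof (cases "x \<le> b")
        case True
        then have x: "x \<in> {a..b}" using False by simp
        have "(\<lambda>y. indicator {x<..} y * Z y) = (\<lambda>y. Z y - indicator {a..x} y * Z y)"
          using x by (auto simp: Z_def fun_eq_iff indicator_def)
        then show ?thesis using Z0 int0[OF x] iZ by simp
      next
        case False
        then have "(\<lambda>y. indicator {x<..} y * Z y) = (\<lambda>y. 0)" by (auto simp: Z_def fun_eq_iff indicator_def)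
        then show ?thesis by simp
      qed
    qed
  qed
  then show ?thesis by eventually_elim (auto simp: Z_def)
qed

section \<open>Convex entropies relative to the ground state\<close>

lemma memH_integrable_Icc:
  assumes "memH g" shows "integrable lborel (\<lambda>x. indicator {0..1} x * g x)"
proof -
  have i: "integrable lborel (\<lambda>x. indicator I01 x * g x)"
    using memH_integrable[OF assms] by (simp add: integrable_mu)
  have "(\<lambda>x. indicator {0..1} x * g x) = (\<lambda>x. indicator I01 x * g x + (indicator {0} x * g 0 + indicator {1} x * g 1))"
    by (auto simp: fun_eq_iff indicator_def I01_def)
  moreover have "integrable lborel (\<lambda>x. indicator I01 x * g x + (indicator {0} x * g 0 + indicator {1} x * g 1))"
    by (intro Bochner_Integration.integrable_add integrable_mult_left i) auto
  ultimately show ?thesis by simp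
qed

lemma indefinite_integral_C1:
  assumes g1: "continuous_on {0..1} g1"
    and g: "\<And>s. s \<in> {0..1} \<Longrightarrow> g s = (\<integral>r. indicator {0..s} r * g1 r \<partial>lborel)"
  shows "g 0 = 0" "x \<in> {0..1} \<Longrightarrow> (g has_real_derivative g1 x) (at x within {0..1::real})"
proof -
  have eq: "g s = integral {0..s} g1" if "s \<in> {0..1}" for s
  proof -
    have "set_integrable lborel {0..s} g1"
      by (rule borel_integrable_atLeastAtMost', rule continuous_on_subset[OF g1]) (use that in auto)
    from set_borel_integral_eq_integral(2)[OF this] show ?thesis
      using g[OF that] by (simp add: set_lebesgue_integral_def)
  qed
  show "g 0 = 0" using eq[of 0] by simp
  assume x: "x \<in> {0..1}"
  have "((\<lambda>s. integral {0..s} g1) has_real_derivative g1 x) (at x within {0..1})"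
    by (rule integral_has_real_derivative[OF g1 x])
  then show "(g has_real_derivative g1 x) (at x within {0..1})"
    by (rule has_field_derivative_transform_within[where d=1]) (use x eq in auto)
qed

text \<open>The working form of membership in D(A): a representative that is C^1 up to the boundary
  and whose derivative is absolutely continuous. The value 0 at the left end comes from
  \<open>g\<close> being an integral that starts there.\<close>

lemma isA_E:
  assumes "isA v w"
  obtains g g1 g2 where "memH v" "memH w" "memH g2" "acd 0 1 g1 g2" "continuous_on {0..1} g1"
    "\<And>x. x \<in> {0..1} \<Longrightarrow> (g has_real_derivative g1 x) (at x within {0..1})"
    "g 0 = 0" "g 1 = 0" "AE s in mu. v s = g s" "AE s in mu. w s = - g2 s"
proof -
  obtain g g1 g2 where H: "memH v" "memH w" "memH g2" "ae01 (\<lambda>s. v s = g s)"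
     "\<forall>s\<in>{0..1}. g1 s = g1 0 + integral\<^sup>L lborel (\<lambda>r. indicator {0..s} r * g2 r)"
     "\<forall>s\<in>{0..1}. g s = integral\<^sup>L lborel (\<lambda>r. indicator {0..s} r * g1 r)" "g 1 = 0"
     "ae01 (\<lambda>s. w s = - g2 s)"
    using assms unfolding isA_def by blast
  have a: "acd 0 1 g1 g2" unfolding acd_def using H(5) memH_integrable_Icc[OF H(3)] by blast
  have c: "continuous_on {0..1} g1" by (rule acd_continuous[OF a])
  note d = indefinite_integral_C1[OF c, of g]
  show ?thesis
    by (rule that[OF H(1-3) a c]) (use H(4,6-8) d in \<open>auto simp: ae01_mu\<close>)
qed

text \<open>Concavity of the sine puts it above its chord, so sin(pi x) is at least 2x on the left
  half; symmetry gives 2(1 - x) on the right half. The product is one formula below both and is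
  comparable to the distance from the boundary.\<close>

lemma sin_pi_ge: assumes "0 \<le> x" "x \<le> 1" shows "2 * x * (1 - x) \<le> sin (pi * x)"
proof -
  have half: "2 * x \<le> sin (pi * x)" if x: "0 \<le> x" "x \<le> 1/2" for x
  proof -
    have "convex_on {0..1/2} (\<lambda>x. - sin (pi * x))"
    proof (rule f''_ge0_imp_convex)
      show "convex {0..1/2::real}" by simp
      show "((\<lambda>x. - sin (pi * x)) has_real_derivative - (pi * cos (pi * x))) (at x)" for x
        by (auto intro!: derivative_eq_intros)
      show "((\<lambda>x. - (pi * cos (pi * x))) has_real_derivative pi^2 * sin (pi * x)) (at x)" for x
        by (auto intro!: derivative_eq_intros simp: power2_eq_square)
      show "0 \<le> pi\<^sup>2 * sin (pi * x)" if "x \<in> {0..1/2}" for x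
        using that by (intro mult_nonneg_nonneg sin_ge_zero) (auto intro: order_trans[of _ "pi * (1/2)"])
    qed
    then have "- sin (pi * ((1 - 2 * x) *\<^sub>R 0 + (2 * x) *\<^sub>R (1/2))) \<le> (1 - 2 * x) * - sin (pi * 0) + (2 * x) * - sin (pi * (1/2))"
      by (rule convex_onD) (use x in auto)
    then show ?thesis by simp
  qed
  show ?thesis
  proof (cases "x \<le> 1/2")
    case True
    have "2 * x * (1 - x) \<le> 2 * x" using assms by (simp add: mult_left_le)
    then show ?thesis using half[of x] True assms by linarith
  next
    case False
    have "2 * x * (1 - x) = (2 * (1 - x)) * x" by simp
    also have "\<dots> \<le> 2 * (1 - x)" using assms by (intro mult_left_le) auto
    also have "\<dots> \<le> sin (pi * (1 - x))" using half[of "1 - x"] False assms by simp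
    also have "sin (pi * (1 - x)) = sin (pi * x)" by (simp add: right_diff_distrib sin_diff)
    finally show ?thesis .
  qed
qed

lemma sin_pi_pos: "0 < x \<Longrightarrow> x < 1 \<Longrightarrow> 0 < sin (pi * x)"
  by (rule sin_gt_zero) auto

text \<open>Makes the quotient by the ground state bounded although its denominator vanishes at the
  ends. A Lipschitz bound from either end gives L min(x, 1 - x), and min(x, 1 - x) is at most 2x(1 -
  x) because the larger of x and 1 - x is at least 1/2.\<close>

lemma C1_zero_boundary_le_sin:
  assumes g: "\<And>x. x \<in> {0..1} \<Longrightarrow> (g has_real_derivative g1 x) (at x within {0..1})"
    and c: "continuous_on {0..1} g1" and z: "g 0 = 0" "g 1 = 0"
  obtains B where "B \<ge> 0" "\<And>x. 0 < x \<Longrightarrow> x < 1 \<Longrightarrow> \<bar>g x\<bar> \<le> B * sin (pi * x)"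
proof -
  obtain L where L: "\<And>x. x \<in> {0..1} \<Longrightarrow> \<bar>g1 x\<bar> \<le> L" using continuous_on_Icc_bounded[OF c] by blast
  have L0: "L \<ge> 0" using L[of 0] by simp
  have lip: "\<bar>g y - g x\<bar> \<le> L * \<bar>y - x\<bar>" if "x \<in> {0..1}" "y \<in> {0..1}" for x y
    using field_differentiable_bound[of "{0..1}" g g1 L y x] g L that by auto
  have "\<bar>g x\<bar> \<le> L * sin (pi * x)" if x: "0 < x" "x < 1" for x
  proof -
    have m: "\<bar>g x\<bar> \<le> L * x" "\<bar>g x\<bar> \<le> L * (1 - x)" using lip[of 0 x] lip[of x 1] z x by auto
    have "min x (1 - x) \<le> 2 * x * (1 - x)"
    proof (cases "x \<le> 1/2")
      case True
      then have "x * (1 - 2 * (1 - x)) \<le> 0" using x by (intro mult_nonneg_nonpos) auto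
      then show ?thesis by (simp add: algebra_simps)
    next
      case False
      then have "(1 - x) * (1 - 2 * x) \<le> 0" using x by (intro mult_nonneg_nonpos) auto
      then show ?thesis by (simp add: algebra_simps)
    qed
    then have "L * min x (1 - x) \<le> L * sin (pi * x)"
      using sin_pi_ge[of x] x L0 by (intro mult_left_mono) auto
    moreover have "\<bar>g x\<bar> \<le> L * min x (1 - x)" using m by (simp add: min_def)
    ultimately show ?thesis by linarith
  qed
  then show ?thesis using that L0 by blast
qed

lemma continuous_on_mu: "continuous_on I01 f \<Longrightarrow> (f :: real \<Rightarrow> real) \<in> borel_measurable mu"
  using borel_measurable_continuous_on_indicator[of I01 f] measurable_mu[of f] by simp

text \<open>\<open>F\<close> is a convex entropy with minimum 0 at 0. The bounds 0 and 1 for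
  \<open>f'\<close> give |f y| at most |y| and quadratic growth of \<open>F\<close>, so the
  functionals below are finite and differentiable on all of H.\<close>

locale entropy_pair =
  fixes F f f' :: "real \<Rightarrow> real"
  assumes dF: "(F has_real_derivative f y) (at y)" and df: "(f has_real_derivative f' y) (at y)"
    and cf': "continuous_on UNIV f'" and f'0: "0 \<le> f' y" and f'1: "f' y \<le> 1"
    and F0: "F 0 = 0" and f0: "f 0 = 0"
begin

lemma f_mono: "x \<le> y \<Longrightarrow> f x \<le> f y"
  by (rule DERIV_nonneg_imp_nondecreasing[of x y f]) (use df f'0 in blast)+

lemma f_lipschitz: "\<bar>f y - f x\<bar> \<le> \<bar>y - x\<bar>"
  using field_differentiable_bound[of UNIV f f' 1 y x] df f'0 f'1 by auto

lemma f_le: "\<bar>f y\<bar> \<le> \<bar>y\<bar>" using f_lipschitz[of y 0] f0 by simp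

lemma yf_nonneg: "0 \<le> y * f y"
  using f_mono[of 0 y] f_mono[of y 0] f0 by (cases "0 \<le> y") (auto simp: mult_nonpos_nonpos)

lemma mvt_F: obtains c where "min x y \<le> c" "c \<le> max x y" "F y - F x = f c * (y - x)"
proof (cases x y rule: linorder_cases)
  case less
  then obtain c where "c > x" "c < y" "F y - F x = (y - x) * f c" using MVT2[of x y F f] dF by auto
  then show ?thesis using that[of c] by auto
next
  case equal then show ?thesis using that[of x] by auto
next
  case greater
  then obtain c where "c > y" "c < x" "F x - F y = (x - y) * f c" using MVT2[of y x F f] dF by auto
  then show ?thesis using that[of c] by (auto simp: algebra_simps)
qed

text \<open>Convexity: the tangent at y lies below the graph at 0, where \<open>F\<close> vanishes.
  Through this bound the dissipation, which controls the integral of y f(y), controls the entropy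
  itself and produces exponential decay.\<close>

lemma F_le_yf: "F y \<le> y * f y"
proof -
  obtain c where c: "min 0 y \<le> c" "c \<le> max 0 y" "F y - F 0 = f c * (y - 0)" by (rule mvt_F)
  have "f c * y \<le> f y * y"
  proof (cases "0 \<le> y")
    case True then show ?thesis using c f_mono[of c y] by (intro mult_right_mono) auto
  next
    case False then show ?thesis using c f_mono[of y c] by (intro mult_right_mono_neg) auto
  qed
  then show ?thesis using c F0 by (simp add: mult.commute)
qed

lemma F_nonneg: "0 \<le> F y"
proof -
  obtain c where c: "min 0 y \<le> c" "c \<le> max 0 y" "F y - F 0 = f c * (y - 0)" by (rule mvt_F)
  show ?thesis
  proof (cases "0 \<le> y")
    case True then show ?thesis using c f_mono[of 0 c] f0 F0 by simp
  next
    case False then show ?thesis using c f_mono[of c 0] f0 F0 by (simp add: mult_nonpos_nonpos)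
  qed
qed

lemma F_diff: "\<bar>F y - F x\<bar> \<le> (\<bar>x\<bar> + \<bar>y\<bar>) * \<bar>y - x\<bar>"
proof -
  obtain c where c: "min x y \<le> c" "c \<le> max x y" "F y - F x = f c * (y - x)" by (rule mvt_F)
  have "\<bar>f c\<bar> \<le> \<bar>x\<bar> + \<bar>y\<bar>" using f_le[of c] c by linarith
  then show ?thesis using c(3) by (simp add: abs_mult mult_right_mono)
qed

lemma F_taylor: "\<bar>F y - F x - f x * (y - x)\<bar> \<le> (y - x)^2"
proof -
  obtain c where c: "min x y \<le> c" "c \<le> max x y" "F y - F x = f c * (y - x)" by (rule mvt_F)
  have "\<bar>f c - f x\<bar> \<le> \<bar>y - x\<bar>" using f_lipschitz[of c x] c by linarith
  then have "\<bar>f c - f x\<bar> * \<bar>y - x\<bar> \<le> \<bar>y - x\<bar> * \<bar>y - x\<bar>" by (intro mult_right_mono) auto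
  moreover have "F y - F x - f x * (y - x) = (f c - f x) * (y - x)" using c(3) by (simp add: algebra_simps)
  ultimately show ?thesis by (simp add: abs_mult power2_eq_square)
qed

lemma f_cont: "continuous_on A f" by (meson df DERIV_isCont continuous_at_imp_continuous_on)
lemma F_cont: "continuous_on A F" by (meson dF DERIV_isCont continuous_at_imp_continuous_on)

lemma f_measurable [measurable]: "f \<in> borel_measurable borel"
  by (rule borel_measurable_continuous_onI[OF f_cont])
lemma F_measurable [measurable]: "F \<in> borel_measurable borel"
  by (rule borel_measurable_continuous_onI[OF F_cont])

lemma sin_measurable_mu [measurable]: "(\<lambda>s. sin (pi * s)) \<in> borel_measurable mu"
  by (rule borel_mu) measurable

text \<open>Test functions \<open>S f(v/S)\<close> with the ground state \<open>S = sin(\<pi>\<cdot>)\<close>; \<open>p = S g' - S' g\<close> vanishes at the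
  end points, and integrating by parts leaves the nonnegative term \<open>f'(v/S) p\<^sup>2/S\<^sup>2\<close>.\<close>
abbreviation "test v \<equiv> (\<lambda>s. sin (pi * s) * f (v s / sin (pi * s)))"

lemma memH_test [simp]: assumes "memH v" shows "memH (test v)"
proof (rule memH_dom[OF _ assms])
  note assms[measurable]
  show "test v \<in> borel_measurable mu" by measurable
  show "AE s in mu. \<bar>test v s\<bar> \<le> \<bar>v s\<bar>"
  proof (rule AE_mu_I)
    fix s :: real assume "0 < s" "s < 1"
    then have S: "sin (pi * s) > 0" by (rule sin_pi_pos)
    have "\<bar>test v s\<bar> = sin (pi * s) * \<bar>f (v s / sin (pi * s))\<bar>" using S by (simp add: abs_mult)
    also have "\<dots> \<le> sin (pi * s) * \<bar>v s / sin (pi * s)\<bar>" using S by (intro mult_left_mono f_le) simp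
    finally show "\<bar>test v s\<bar> \<le> \<bar>v s\<bar>" using S by (simp add: abs_divide)
  qed
qed

text \<open>The quotient g/S is C^1 only inside (0,1), so the integration by parts is done on [a,b]
  with 0 < a and b < 1. The boundary terms p f(q) disappear in the limit because p tends to 0 while
  f(q) stays bounded by \<open>C1_zero_boundary_le_sin\<close>.\<close>

lemma energy_inequality:
  assumes "isA v w"
  shows "pi^2 * (\<integral>s. v s * test v s \<partial>mu) \<le> (\<integral>s. w s * test v s \<partial>mu)"
proof -
  obtain g g1 g2 where H: "memH v" "memH w" "memH g2" "acd 0 1 g1 g2" "continuous_on {0..1} g1"
    "\<And>x. x \<in> {0..1} \<Longrightarrow> (g has_real_derivative g1 x) (at x within {0..1})"
    "g 0 = 0" "g 1 = 0" "AE s in mu. v s = g s" "AE s in mu. w s = - g2 s"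
    by (rule isA_E[OF assms]) (rule that)
  obtain B where B: "B \<ge> 0" "\<And>x. 0 < x \<Longrightarrow> x < 1 \<Longrightarrow> \<bar>g x\<bar> \<le> B * sin (pi * x)"
    using C1_zero_boundary_le_sin[OF H(6,5,7,8)] by blast
  have gc: "continuous_on {0..1} g" by (rule DERIV_continuous_on[OF H(6)])
  have gm [measurable]: "g \<in> borel_measurable mu"
    by (rule continuous_on_mu, rule continuous_on_subset[OF gc]) (auto simp: I01_def)
  have gH: "memH g"
  proof (rule memH_bounded[OF gm])
    show "AE s in mu. \<bar>g s\<bar> \<le> B"
      by (rule AE_mu_I) (metis B mult_left_le order_trans sin_le_one)
  qed
  note H(3)[measurable]
  define q where "q x = g x / sin (pi * x)" for x
  define q' where "q' x = (g1 x * sin (pi * x) - g x * (pi * cos (pi * x))) / (sin (pi * x))^2" for x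
  define h where "h x = sin (pi * x) * f (q x)" for x
  define p where "p x = sin (pi * x) * g1 x - pi * cos (pi * x) * g x" for x
  define \<Psi> where "\<Psi> x = g2 x * h x + pi^2 * g x * h x" for x
  have hH: "memH h" unfolding h_def q_def by (rule memH_test[OF gH])
  have ineq: "(\<integral>x. indicator {a..b} x * \<Psi> x \<partial>lborel) \<le> p b * f (q b) - p a * f (q a)"
    if ab: "0 < a" "a \<le> b" "b < 1" for a b
  proof -
    have sub: "{a..b} \<subseteq> {0..1}" using ab by auto
    have S: "sin (pi * x) > 0" if "x \<in> {a..b}" for x using that ab by (intro sin_pi_pos) auto
    have dg: "(g has_real_derivative g1 x) (at x within {a..b})" if "x \<in> {a..b}" for x
      by (rule DERIV_subset[OF H(6)]) (use that sub in auto)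
    have dq: "(q has_real_derivative q' x) (at x within {a..b})" if "x \<in> {a..b}" for x
      unfolding q_def q'_def using S[OF that]
      by (auto intro!: derivative_eq_intros dg that simp: power2_eq_square)
    have dfq: "((\<lambda>x. f (q x)) has_real_derivative f' (q x) * q' x) (at x within {a..b})" if "x \<in> {a..b}" for x
      by (rule DERIV_chain2[OF df dq[OF that]])
    define h' where "h' x = pi * cos (pi * x) * f (q x) + sin (pi * x) * (f' (q x) * q' x)" for x
    \<comment> \<open>Subtracting the exact derivative \<open>G'\<close> completes the square: what
      is left of \<open>g1 * h'\<close> after removing \<open>pi^2 * g * h\<close> is f'(q) p q' =
      f'(q) p^2 / S^2, and \<open>G\<close> itself enters only through boundary values.\<close>
    define G where "G x = pi * cos (pi * x) * g x * f (q x)" for x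
    define G' where "G' x = - (pi^2 * sin (pi * x)) * g x * f (q x) + pi * cos (pi * x) * g1 x * f (q x)
       + pi * cos (pi * x) * g x * (f' (q x) * q' x)" for x
    have cg1: "continuous_on {a..b} g1" and cg: "continuous_on {a..b} g"
      by (rule continuous_on_subset[OF H(5) sub], rule continuous_on_subset[OF gc sub])
    have cq: "continuous_on {a..b} q" by (rule DERIV_continuous_on[OF dq])
    have cq': "continuous_on {a..b} q'" unfolding q'_def
      using S by (intro continuous_intros cg cg1) (auto dest!: S)
    have cfq: "continuous_on {a..b} (\<lambda>x. f (q x))" by (rule DERIV_continuous_on[OF dfq])
    have cf'q: "continuous_on {a..b} (\<lambda>x. f' (q x))"
      by (rule continuous_on_compose2[OF cf' cq]) auto
    have dh: "(h has_real_derivative h' x) (at x within {a..b})" if "x \<in> {a..b}" for x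
      unfolding h_def h'_def by (auto intro!: derivative_eq_intros dfq that)
    have dG: "(G has_real_derivative G' x) (at x within {a..b})" if "x \<in> {a..b}" for x
      unfolding G_def G'_def
      by (auto intro!: derivative_eq_intros dfq dg that simp: power2_eq_square algebra_simps)
    have ch': "continuous_on {a..b} h'" unfolding h'_def by (intro continuous_intros cfq cf'q cq')
    have cG': "continuous_on {a..b} G'" unfolding G'_def by (intro continuous_intros cfq cf'q cq' cg cg1)
    have ah: "acd a b h h'" by (rule acd_C1) (use ab dh ch' in auto)
    have aG: "acd a b G G'" by (rule acd_C1) (use ab dG cG' in auto)
    have ag1: "acd a b g1 g2" by (rule acd_subinterval[OF H(4)]) (use ab in auto)
    have i1: "integrable lborel (\<lambda>x. indicator {a..b} x * (g2 x * h x + g1 x * h' x))"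
      by (rule acd_integrable[OF acd_mult[OF ag1 ah]])
    have i2: "integrable lborel (\<lambda>x. indicator {a..b} x * G' x)" by (rule acd_integrable[OF aG])
    have i3: "integrable lborel (\<lambda>x. indicator {a..b} x * \<Psi> x)"
    proof -
      have "integrable lborel (\<lambda>x. indicator {a..b} x * (g2 x * h x))"
        by (rule integrable_indicator_mult_continuous[OF acd_integrable[OF ag1] acd_continuous[OF ah]])
      moreover have "integrable lborel (\<lambda>x. indicator {a..b} x * (pi^2 * g x * h x))"
      proof -
        have "continuous_on {a..b} (\<lambda>x. pi^2 * g x * h x)"
          by (intro continuous_intros cg acd_continuous[OF ah])
        from borel_integrable_atLeastAtMost'[OF this] show ?thesis by (simp add: set_integrable_def)
      qed
      ultimately show ?thesis using Bochner_Integration.integrable_add by (fastforce simp: \<Psi>_def ring_distribs)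
    qed
    have "(\<integral>x. indicator {a..b} x * \<Psi> x \<partial>lborel)
       \<le> (\<integral>x. indicator {a..b} x * (g2 x * h x + g1 x * h' x) - indicator {a..b} x * G' x \<partial>lborel)"
    proof (rule integral_mono)
      fix x :: real
      show "indicator {a..b} x * \<Psi> x \<le> indicator {a..b} x * (g2 x * h x + g1 x * h' x) - indicator {a..b} x * G' x"
      proof (cases "x \<in> {a..b}")
        case True
        define ss cc where "ss = sin (pi * x)" and "cc = pi * cos (pi * x)"
        have ss: "ss > 0" using S[OF True] by (simp add: ss_def)
        have "(ss * g1 x - cc * g x) * q' x = (ss * g1 x - cc * g x)^2 / ss^2"
          by (simp add: q'_def ss_def cc_def power2_eq_square algebra_simps)
        then have "0 \<le> f' (q x) * ((ss * g1 x - cc * g x) * q' x)" using f'0[of "q x"] by simp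
        moreover have "(g2 x * h x + g1 x * h' x) - G' x - \<Psi> x = f' (q x) * ((ss * g1 x - cc * g x) * q' x)"
          unfolding \<Psi>_def h'_def G'_def h_def ss_def[symmetric] cc_def[symmetric] by (simp add: algebra_simps)
        ultimately show ?thesis using True by simp
      qed simp
    qed (use i1 i2 i3 in auto)
    also have "\<dots> = (g1 b * h b - g1 a * h a) - (G b - G a)"
      using acd_by_parts[OF ab(2) ag1 ah] acd_eq[OF aG, of b] ab i1 i2 by simp
    also have "\<dots> = p b * f (q b) - p a * f (q a)"
      by (simp add: p_def h_def G_def algebra_simps)
    finally show ?thesis .
  qed
  have \<Psi>i: "integrable mu \<Psi>" unfolding \<Psi>_def mult.assoc
    using hH gH H(3) by (intro Bochner_Integration.integrable_add integrable_mult_right memH_mult)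
  \<comment> \<open>The offset 2 gives a(0) = b(0) = 1/2, so that a n never exceeds b n.\<close>
  define a b where "a n = inverse (real (Suc (Suc n)))" and "b n = 1 - inverse (real (Suc (Suc n)))" for n :: nat
  have ab: "0 < a n" "a n \<le> b n" "b n < 1" for n by (auto simp: a_def b_def field_simps)
  have al: "a \<longlonglongrightarrow> 0" unfolding a_def by (rule LIMSEQ_Suc[OF LIMSEQ_inverse_real_of_nat])
  have bl: "b \<longlonglongrightarrow> 1" unfolding b_def a_def[symmetric] using tendsto_diff[OF tendsto_const[of 1] al] by simp
  have "(\<lambda>n. \<integral>x. indicator {a n..b n} x * \<Psi> x \<partial>mu) \<longlonglongrightarrow> (\<integral>x. \<Psi> x \<partial>mu)"
  proof (rule integral_dominated_convergence[where w="\<lambda>x. \<bar>\<Psi> x\<bar>"])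
    show "\<Psi> \<in> borel_measurable mu" using \<Psi>i by auto
    show "(\<lambda>x. indicator {a n..b n} x * \<Psi> x) \<in> borel_measurable mu" for n
      by (intro borel_measurable_times borel_measurable_integrable[OF \<Psi>i] borel_mu) measurable
    show "integrable mu (\<lambda>x. \<bar>\<Psi> x\<bar>)" using \<Psi>i by simp
    show "AE x in mu. norm (indicator {a n..b n} x * \<Psi> x) \<le> \<bar>\<Psi> x\<bar>" for n
      by (auto simp: indicator_def)
    show "AE x in mu. (\<lambda>n. indicator {a n..b n} x * \<Psi> x) \<longlonglongrightarrow> \<Psi> x"
    proof (rule AE_mu_I)
      fix x :: real assume x: "0 < x" "x < 1"
      have "\<forall>\<^sub>F n in sequentially. a n < x" using order_tendstoD(2)[OF al x(1)] .
      moreover have "\<forall>\<^sub>F n in sequentially. x < b n" using order_tendstoD(1)[OF bl x(2)] .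
      ultimately have "\<forall>\<^sub>F n in sequentially. indicator {a n..b n} x * \<Psi> x = \<Psi> x"
        by eventually_elim simp
      then show "(\<lambda>n. indicator {a n..b n} x * \<Psi> x) \<longlonglongrightarrow> \<Psi> x" by (rule tendsto_eventually)
    qed
  qed
  moreover have "(\<integral>x. indicator {a n..b n} x * \<Psi> x \<partial>mu) = (\<integral>x. indicator {a n..b n} x * \<Psi> x \<partial>lborel)" for n
    unfolding integral_mu[symmetric]
    by (rule Bochner_Integration.integral_cong) (use ab[of n] in \<open>auto simp: indicator_def I01_def\<close>)
  ultimately have lim: "(\<lambda>n. \<integral>x. indicator {a n..b n} x * \<Psi> x \<partial>lborel) \<longlonglongrightarrow> (\<integral>x. \<Psi> x \<partial>mu)" by simp
  have pc: "continuous_on {0..1} p" unfolding p_def by (intro continuous_intros H(5) gc)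
  have p01: "p 0 = 0" "p 1 = 0" using H(7,8) by (auto simp: p_def)
  have ab01: "a n \<in> {0..1}" "b n \<in> {0..1}" for n using ab[of n] by auto
  have pa: "(\<lambda>n. p (a n)) \<longlonglongrightarrow> 0"
    using continuous_on_tendsto_compose[OF pc al _ always_eventually] ab01 p01 by simp
  have pb: "(\<lambda>n. p (b n)) \<longlonglongrightarrow> 0"
    using continuous_on_tendsto_compose[OF pc bl _ always_eventually] ab01 p01 by simp
  have fq: "\<bar>f (q x)\<bar> \<le> B" if "0 < x" "x < 1" for x
  proof -
    have "\<bar>q x\<bar> \<le> B" using B(2)[OF that] sin_pi_pos[OF that] by (simp add: q_def abs_divide divide_le_eq)
    then show ?thesis using f_le[of "q x"] by linarith
  qed
  have z: "(\<lambda>n. p (x n) * f (q (x n))) \<longlonglongrightarrow> 0" if "(\<lambda>n. p (x n)) \<longlonglongrightarrow> 0" "\<And>n. 0 < x n" "\<And>n. x n < 1" for x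
  proof (rule Lim_null_comparison)
    show "\<forall>\<^sub>F n in sequentially. norm (p (x n) * f (q (x n))) \<le> \<bar>p (x n)\<bar> * B"
      using fq that by (auto simp: abs_mult intro!: always_eventually mult_left_mono)
    show "(\<lambda>n. \<bar>p (x n)\<bar> * B) \<longlonglongrightarrow> 0" using tendsto_mult_left_zero[OF tendsto_rabs_zero[OF that(1)]] .
  qed
  have "(\<lambda>n. p (b n) * f (q (b n)) - p (a n) * f (q (a n))) \<longlonglongrightarrow> 0 - 0"
    using ab by (intro tendsto_diff z pa pb) (auto intro: less_le_trans le_less_trans)
  then have "(\<integral>x. \<Psi> x \<partial>mu) \<le> 0"
    using LIMSEQ_le[OF lim] ineq[OF ab] by fastforce
  moreover have "(\<integral>x. \<Psi> x \<partial>mu) = (\<integral>x. - (w x * test v x) + pi^2 * (v x * test v x) \<partial>mu)"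
  proof (rule integral_cong_AE)
    show "AE x in mu. \<Psi> x = - (w x * test v x) + pi^2 * (v x * test v x)"
      using H(9,10) by eventually_elim (simp add: \<Psi>_def h_def q_def)
    have "memH (test v)" by (rule memH_test[OF H(1)])
    then show "(\<lambda>x. - (w x * test v x) + pi\<^sup>2 * (v x * test v x)) \<in> borel_measurable mu"
      using H(1,2) by (intro borel_measurable_integrable Bochner_Integration.integrable_add Bochner_Integration.integrable_minus integrable_mult_right memH_mult)
  qed (use \<Psi>i in auto)
  moreover have "\<dots> = - (\<integral>x. w x * test v x \<partial>mu) + pi^2 * (\<integral>x. v x * test v x \<partial>mu)"
    using H(1,2) memH_mult[OF H(1) memH_test[OF H(1)]] memH_mult[OF H(2) memH_test[OF H(1)]] by simp
  ultimately show ?thesis by simp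
qed

end

section \<open>The comparison inequality\<close>

lemma nH_abs [simp]: "nH (\<lambda>s. \<bar>x s\<bar>) = nH x"
  by (simp add: nH_mu)

lemma memH_abs [simp]: assumes "memH x" shows "memH (\<lambda>s. \<bar>x s\<bar>)"
proof -
  note assms[measurable]
  show ?thesis by (rule memH_dom[OF _ assms]) auto
qed

lemma nH_diff_abs: "memH x \<Longrightarrow> memH y \<Longrightarrow> \<bar>nH x - nH y\<bar> \<le> nH (\<lambda>s. x s - y s)"
  using nH_triangle_rev[of x y] nH_triangle_rev[of y x] nH_minus_commute[of x y] by simp

lemma abscontH_small:
  assumes "abscontH T1 T2 z" "e > 0"
  obtains d where "d > 0" "\<And>a c. T1 \<le> a \<Longrightarrow> a \<le> c \<Longrightarrow> c \<le> T2 \<Longrightarrow> c - a < d \<Longrightarrow> nH (\<lambda>x. z c x - z a x) < e"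
proof -
  have "\<exists>d>0. \<forall>(n::nat) (a::nat\<Rightarrow>real) (c::nat\<Rightarrow>real). (\<forall>i<n. T1 \<le> a i \<and> a i \<le> c i \<and> c i \<le> T2) \<and>
     (\<forall>i<n. \<forall>j<n. i \<noteq> j \<longrightarrow> c i \<le> a j \<or> c j \<le> a i) \<and>
     (\<Sum>i<n. c i - a i) < d \<longrightarrow> (\<Sum>i<n. nH (\<lambda>x. z (c i) x - z (a i) x)) < e"
    by (rule assms(1)[unfolded abscontH_def, THEN spec, THEN mp, OF assms(2)])
  then obtain d where d: "d > 0" and D: "\<forall>(n::nat) (a::nat\<Rightarrow>real) (c::nat\<Rightarrow>real). (\<forall>i<n. T1 \<le> a i \<and> a i \<le> c i \<and> c i \<le> T2) \<and>
     (\<forall>i<n. \<forall>j<n. i \<noteq> j \<longrightarrow> c i \<le> a j \<or> c j \<le> a i) \<and>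
     (\<Sum>i<n. c i - a i) < d \<longrightarrow> (\<Sum>i<n. nH (\<lambda>x. z (c i) x - z (a i) x)) < e"
    by (elim exE conjE)
  show ?thesis
  proof (rule that[OF d])
    fix a c assume "T1 \<le> a" "a \<le> c" "c \<le> T2" "c - a < d"
    then show "nH (\<lambda>x. z c x - z a x) < e"
      using D[THEN spec[where x="1::nat"], THEN spec[where x="\<lambda>_. a"], THEN spec[where x="\<lambda>_. c"]] by simp
  qed
qed

lemma abscontH_bounded:
  assumes "abscontH T1 T2 z" and m: "\<And>t. T1 \<le> t \<Longrightarrow> t \<le> T2 \<Longrightarrow> memH (z t)"
  obtains B where "B \<ge> 0" "\<And>t. T1 \<le> t \<Longrightarrow> t \<le> T2 \<Longrightarrow> nH (z t) \<le> B"
proof -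
  have "continuous_on {T1..T2} (\<lambda>t. nH (z t))"
    unfolding continuous_on_iff
  proof (intro ballI allI impI)
    fix t e :: real assume t: "t \<in> {T1..T2}" and e: "e > 0"
    obtain d where d: "d > 0" "\<And>a c. T1 \<le> a \<Longrightarrow> a \<le> c \<Longrightarrow> c \<le> T2 \<Longrightarrow> c - a < d \<Longrightarrow> nH (\<lambda>x. z c x - z a x) < e"
      by (rule abscontH_small[OF assms(1) e]) (rule that)
    have "dist (nH (z s)) (nH (z t)) < e" if s: "s \<in> {T1..T2}" "dist s t < d" for s
    proof -
      have "nH (\<lambda>x. z s x - z t x) < e"
        using d(2)[of t s] d(2)[of s t] s t nH_minus_commute[of "z s" "z t"]
        by (cases "t \<le> s") (auto simp: dist_real_def)
      then show ?thesis using nH_diff_abs[of "z s" "z t"] m s t by (simp add: dist_real_def)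
    qed
    then show "\<exists>d>0. \<forall>s\<in>{T1..T2}. dist s t < d \<longrightarrow> dist (nH (z s)) (nH (z t)) < e" using d(1) by blast
  qed
  from continuous_on_Icc_bounded[OF this] obtain B where B: "\<And>t. t \<in> {T1..T2} \<Longrightarrow> \<bar>nH (z t)\<bar> \<le> B" by blast
  show ?thesis
    by (rule that[of "\<bar>B\<bar>"]) (use B in force)+
qed

context entropy_pair
begin

text \<open>The entropy functional. For F(y) = y^2/2 it is half the squared norm; for
  \<open>Fp\<close> it vanishes exactly on functions that are nonpositive a.e.\<close>

definition J :: "(real \<Rightarrow> real) \<Rightarrow> real" where
  "J z = (\<integral>s. (sin (pi * s))^2 * F (z s / sin (pi * s)) \<partial>mu)"

lemma density_le: assumes "0 < s" "s < 1" shows "(sin (pi * s))^2 * F (z s / sin (pi * s)) \<le> z s * test z s"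
proof -
  have S: "sin (pi * s) > 0" using assms by (rule sin_pi_pos)
  have "(sin (pi * s))^2 * F (z s / sin (pi * s)) \<le> (sin (pi * s))^2 * (z s / sin (pi * s) * f (z s / sin (pi * s)))"
    by (rule mult_left_mono[OF F_le_yf]) simp
  also have "\<dots> = z s * test z s" using S by (simp add: power2_eq_square)
  finally show ?thesis .
qed

lemma J_integrable: assumes "memH z" shows "integrable mu (\<lambda>s. (sin (pi * s))^2 * F (z s / sin (pi * s)))"
proof (rule Bochner_Integration.integrable_bound[OF memH_mult[OF assms memH_test[OF assms]]])
  note assms[measurable]
  show "(\<lambda>s. (sin (pi * s))^2 * F (z s / sin (pi * s))) \<in> borel_measurable mu" by measurable
  show "AE s in mu. norm ((sin (pi * s))\<^sup>2 * F (z s / sin (pi * s))) \<le> norm (z s * test z s)"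
  proof (rule AE_mu_I)
    fix s :: real assume "0 < s" "s < 1"
    then have "(sin (pi * s))^2 * F (z s / sin (pi * s)) \<le> z s * test z s" by (rule density_le)
    moreover have "0 \<le> (sin (pi * s))^2 * F (z s / sin (pi * s))" using F_nonneg by simp
    ultimately show "norm ((sin (pi * s))\<^sup>2 * F (z s / sin (pi * s))) \<le> norm (z s * test z s)" by simp
  qed
qed

lemma J_nonneg: "0 \<le> J z"
  unfolding J_def by (rule integral_nonneg_AE) (simp add: F_nonneg)

lemma J_le_test: assumes "memH z" shows "J z \<le> (\<integral>s. z s * test z s \<partial>mu)"
  unfolding J_def
  by (rule integral_mono_AE[OF J_integrable[OF assms] memH_mult[OF assms memH_test[OF assms]]])
     (rule AE_mu_I, rule density_le)

lemma nH_test: assumes "memH z" shows "nH (test z) \<le> nH z"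
proof (rule nH_mono[OF _ assms])
  show "test z \<in> borel_measurable mu" using memH_test[OF assms] by (rule memH_measurable)
  show "AE s in mu. \<bar>test z s\<bar> \<le> \<bar>z s\<bar>"
  proof (rule AE_mu_I)
    fix s :: real assume "0 < s" "s < 1"
    then have S: "sin (pi * s) > 0" by (rule sin_pi_pos)
    have "\<bar>test z s\<bar> = sin (pi * s) * \<bar>f (z s / sin (pi * s))\<bar>" using S by (simp add: abs_mult)
    also have "\<dots> \<le> sin (pi * s) * \<bar>z s / sin (pi * s)\<bar>" using S by (intro mult_left_mono f_le) simp
    finally show "\<bar>test z s\<bar> \<le> \<bar>z s\<bar>" using S by (simp add: abs_divide)
  qed
qed

lemma J_le: assumes "memH z" shows "J z \<le> nH z ^ 2"
proof -
  have "J z \<le> nH z * nH (test z)"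
    using J_le_test[OF assms] Cauchy_Schwarz_mu[OF assms memH_test[OF assms]] by linarith
  also have "\<dots> \<le> nH z * nH z" using nH_test[OF assms] by (intro mult_left_mono) auto
  finally show ?thesis by (simp add: power2_eq_square)
qed

text \<open>Lipschitz continuity on bounded sets. It turns absolute continuity of a curve in H into
  the increment bound demanded by \<open>abscontH_nonincreasing\<close>.\<close>

lemma J_diff:
  assumes x: "memH x" and y: "memH y"
  shows "\<bar>J y - J x\<bar> \<le> (nH x + nH y) * nH (\<lambda>s. y s - x s)"
proof -
  let ?d = "\<lambda>s. y s - x s"
  have d: "memH ?d" using x y by simp
  let ?G = "\<lambda>s. (sin (pi * s))^2 * F (y s / sin (pi * s)) - (sin (pi * s))^2 * F (x s / sin (pi * s))"
  have iG: "integrable mu ?G" using J_integrable[OF x] J_integrable[OF y] by simp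
  have iR: "integrable mu (\<lambda>s. \<bar>x s\<bar> * \<bar>?d s\<bar> + \<bar>y s\<bar> * \<bar>?d s\<bar>)"
    by (intro Bochner_Integration.integrable_add memH_mult memH_abs x y d)
  have "J y - J x = (\<integral>s. ?G s \<partial>mu)" unfolding J_def using J_integrable[OF x] J_integrable[OF y] by simp
  then have "\<bar>J y - J x\<bar> \<le> (\<integral>s. \<bar>?G s\<bar> \<partial>mu)" using integral_abs_bound[of mu ?G] by simp
  also have "\<dots> \<le> (\<integral>s. \<bar>x s\<bar> * \<bar>?d s\<bar> + \<bar>y s\<bar> * \<bar>?d s\<bar> \<partial>mu)"
  proof (rule integral_mono_AE[OF _ iR])
    show "AE s in mu. \<bar>?G s\<bar> \<le> \<bar>x s\<bar> * \<bar>?d s\<bar> + \<bar>y s\<bar> * \<bar>?d s\<bar>"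
    proof (rule AE_mu_I)
      fix s :: real assume "0 < s" "s < 1"
      then have S: "sin (pi * s) > 0" by (rule sin_pi_pos)
      define S where "S = sin (pi * s)"
      have S: "S > 0" using S by (simp add: S_def)
      have "\<bar>?G s\<bar> = S^2 * \<bar>F (y s / S) - F (x s / S)\<bar>"
        unfolding S_def[symmetric] right_diff_distrib[symmetric] by (simp add: abs_mult)
      also have "\<dots> \<le> S^2 * ((\<bar>x s / S\<bar> + \<bar>y s / S\<bar>) * \<bar>y s / S - x s / S\<bar>)"
        by (intro mult_left_mono F_diff) simp
      also have "\<dots> = (S * (\<bar>x s / S\<bar> + \<bar>y s / S\<bar>)) * (S * \<bar>y s / S - x s / S\<bar>)"
        by (simp add: power2_eq_square)
      also have "S * (\<bar>x s / S\<bar> + \<bar>y s / S\<bar>) = \<bar>x s\<bar> + \<bar>y s\<bar>"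
        using S by (simp add: abs_divide ring_distribs)
      also have "S * \<bar>y s / S - x s / S\<bar> = \<bar>?d s\<bar>"
        using S by (simp add: diff_divide_distrib[symmetric] abs_divide)
      finally show "\<bar>?G s\<bar> \<le> \<bar>x s\<bar> * \<bar>?d s\<bar> + \<bar>y s\<bar> * \<bar>?d s\<bar>" by (simp only: ring_distribs)
    qed
  qed (use iG in simp)
  also have "\<dots> = (\<integral>s. \<bar>x s\<bar> * \<bar>?d s\<bar> \<partial>mu) + (\<integral>s. \<bar>y s\<bar> * \<bar>?d s\<bar> \<partial>mu)"
    by (intro Bochner_Integration.integral_add memH_mult memH_abs x y d)
  also have "\<dots> \<le> nH x * nH ?d + nH y * nH ?d"
    using Cauchy_Schwarz_mu[OF memH_abs[OF x] memH_abs[OF d]] Cauchy_Schwarz_mu[OF memH_abs[OF y] memH_abs[OF d]]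
    by simp
  finally show ?thesis by (simp add: ring_distribs)
qed

text \<open>\<open>test x\<close> is the gradient of \<open>J\<close> at \<open>x\<close>, with a
  remainder quadratic in the norm of H: the pointwise estimate \<open>F_taylor\<close> is scaled by
  S^2, which cancels the denominators.\<close>

lemma J_taylor:
  assumes x: "memH x" and d: "memH d"
  shows "\<bar>J (\<lambda>s. x s + d s) - J x - (\<integral>s. d s * test x s \<partial>mu)\<bar> \<le> nH d ^ 2"
proof -
  let ?G = "\<lambda>s. (sin (pi * s))^2 * F ((x s + d s) / sin (pi * s)) - (sin (pi * s))^2 * F (x s / sin (pi * s)) - d s * test x s"
  have xd: "memH (\<lambda>s. x s + d s)" using x d by simp
  note I = J_integrable[OF x] J_integrable[OF xd] memH_mult[OF d memH_test[OF x]]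
  have iG: "integrable mu ?G" using I by simp
  have "J (\<lambda>s. x s + d s) - J x - (\<integral>s. d s * test x s \<partial>mu) = (\<integral>s. ?G s \<partial>mu)"
    unfolding J_def using I by simp
  then have "\<bar>J (\<lambda>s. x s + d s) - J x - (\<integral>s. d s * test x s \<partial>mu)\<bar> \<le> (\<integral>s. \<bar>?G s\<bar> \<partial>mu)" using integral_abs_bound[of mu ?G] by simp
  also have "\<dots> \<le> (\<integral>s. (d s)^2 \<partial>mu)"
  proof (rule integral_mono_AE[OF _ memH_sq[OF d]])
    show "AE s in mu. \<bar>?G s\<bar> \<le> (d s)^2"
    proof (rule AE_mu_I)
      fix s :: real assume s: "0 < s" "s < 1"
      define S where "S = sin (pi * s)"
      have S: "S > 0" using sin_pi_pos[OF s] by (simp add: S_def)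
      have "?G s = S^2 * (F ((x s + d s) / S) - F (x s / S) - f (x s / S) * ((x s + d s) / S - x s / S))"
        unfolding S_def[symmetric] using S by (simp add: add_divide_distrib power2_eq_square ring_distribs mult_ac)
      then have "\<bar>?G s\<bar> = S^2 * \<bar>F ((x s + d s) / S) - F (x s / S) - f (x s / S) * ((x s + d s) / S - x s / S)\<bar>"
        by (simp add: abs_mult)
      also have "\<dots> \<le> S^2 * ((x s + d s) / S - x s / S)^2"
        by (intro mult_left_mono F_taylor) simp
      also have "\<dots> = (d s)^2" using S by (simp add: add_divide_distrib power_divide)
      finally show "\<bar>?G s\<bar> \<le> (d s)^2" .
    qed
  qed (use iG in simp)
  finally show ?thesis by (simp add: nH_sq)
qed

lemma J_deriv:
  assumes z: "hasDerivH z z' t" and m: "\<forall>\<^sub>F s in nhds t. memH (z s)"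
  shows "((\<lambda>s. J (z s)) has_real_derivative (\<integral>s. z' s * test (z t) s \<partial>mu)) (at t)"
proof -
  have z': "memH z'" and lim: "((\<lambda>h. nH (\<lambda>x. (z (t + h) x - z t x) / h - z' x)) \<longlongrightarrow> 0) (at 0)"
    using z by (auto simp: hasDerivH_def)
  have mt: "memH (z t)" using m by (rule eventually_nhds_x_imp_x)
  let ?L = "\<integral>s. z' s * test (z t) s \<partial>mu"
  let ?e = "\<lambda>h. nH (\<lambda>x. (z (t + h) x - z t x) / h - z' x)"
  have mh: "\<forall>\<^sub>F h in at 0. memH (z (t + h))"
  proof -
    have "filterlim (\<lambda>h. t + h) (nhds t) (at 0)" by (auto intro!: tendsto_eq_intros)
    then show ?thesis using m unfolding filterlim_iff by blast
  qed
  have "((\<lambda>h. (J (z (t + h)) - J (z t)) / h - ?L) \<longlongrightarrow> 0) (at 0)"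
  proof (rule Lim_null_comparison)
    show "\<forall>\<^sub>F h in at 0. norm ((J (z (t + h)) - J (z t)) / h - ?L) \<le> ?e h * nH (test (z t)) + \<bar>h\<bar> * (?e h + nH z')^2"
      using mh eventually_neq_at_within[of "0::real" 0 UNIV]
    proof eventually_elim
      case (elim h)
      let ?d = "\<lambda>x. z (t + h) x - z t x"
      let ?q = "\<lambda>x. ?d x / h"
      have d: "memH ?d" and q: "memH ?q" using elim mt by auto
      have qz: "memH (\<lambda>x. ?q x - z' x)" using q z' by simp
      have T: "memH (test (z t))" using mt by simp
      have "\<bar>J (\<lambda>s. z t s + ?d s) - J (z t) - (\<integral>s. ?d s * test (z t) s \<partial>mu)\<bar> \<le> nH ?d ^ 2"
        by (rule J_taylor[OF mt d])
      then have "\<bar>J (z (t + h)) - J (z t) - (\<integral>s. ?d s * test (z t) s \<partial>mu)\<bar> \<le> nH ?d ^ 2" by simp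
      then have "\<bar>J (z (t + h)) - J (z t) - (\<integral>s. ?d s * test (z t) s \<partial>mu)\<bar> / \<bar>h\<bar> \<le> nH ?d ^ 2 / \<bar>h\<bar>"
        by (rule divide_right_mono) simp
      moreover have "nH ?d ^ 2 / \<bar>h\<bar> = \<bar>h\<bar> * nH ?q ^ 2"
      proof -
        have "nH ?d ^ 2 / \<bar>h\<bar> = \<bar>h\<bar> * (nH ?d / \<bar>h\<bar>) ^ 2"
          using elim by (simp add: power_divide power2_eq_square field_simps)
        then show ?thesis by (simp only: nH_divide)
      qed
      moreover have "(\<integral>s. ?d s * test (z t) s \<partial>mu) / h = (\<integral>s. ?q s * test (z t) s \<partial>mu)"
        by simp
      ultimately have 1: "\<bar>(J (z (t + h)) - J (z t)) / h - (\<integral>s. ?q s * test (z t) s \<partial>mu)\<bar> \<le> \<bar>h\<bar> * nH ?q ^ 2"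
        by (simp add: abs_divide[symmetric] diff_divide_distrib)
      have "(\<integral>s. ?q s * test (z t) s \<partial>mu) - ?L = (\<integral>s. (?q s - z' s) * test (z t) s \<partial>mu)"
        using memH_mult[OF q T] memH_mult[OF z' T] by (subst Bochner_Integration.integral_diff[symmetric]) (auto simp: left_diff_distrib)
      then have 2: "\<bar>(\<integral>s. ?q s * test (z t) s \<partial>mu) - ?L\<bar> \<le> ?e h * nH (test (z t))"
        using Cauchy_Schwarz_mu[OF qz T] by simp
      have "nH ?q \<le> ?e h + nH z'" using nH_triangle_rev[OF q z'] by simp
      then have "nH ?q ^ 2 \<le> (?e h + nH z')^2" by (intro power_mono) auto
      then have 3: "\<bar>h\<bar> * nH ?q ^ 2 \<le> \<bar>h\<bar> * (?e h + nH z')^2" by (intro mult_left_mono) auto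
      show ?case using 1 2 3 by simp
    qed
    have "((\<lambda>h. ?e h * nH (test (z t)) + \<bar>h\<bar> * (?e h + nH z')^2) \<longlongrightarrow> 0 * nH (test (z t)) + \<bar>0\<bar> * (0 + nH z')^2) (at 0)"
      by (intro tendsto_intros lim)
    then show "((\<lambda>h. ?e h * nH (test (z t)) + \<bar>h\<bar> * (?e h + nH z')^2) \<longlongrightarrow> 0) (at 0)" by simp
  qed
  then have "((\<lambda>h. (J (z (t + h)) - J (z t)) / h) \<longlongrightarrow> ?L) (at 0)" by (simp add: LIM_zero_iff)
  then show ?thesis by (simp add: DERIV_def)
qed

text \<open>exp((pi^2 - w1) t) J(z t) has nonpositive derivative at every time where the equation
  holds; \<open>abscontH_nonincreasing\<close> takes care of the remaining null set. Absolute
  continuity is available only on compact intervals after the initial time, so the initial time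
  itself is reached as a limit from the right.\<close>

lemma comparison:
  assumes m: "\<And>t. \<tau> \<le> t \<Longrightarrow> memH (z t)"
    and rc: "((\<lambda>t. nH (\<lambda>x. z t x - z \<tau> x)) \<longlongrightarrow> 0) (at_right \<tau>)"
    and ac: "\<And>T1 T2. \<tau> < T1 \<Longrightarrow> T1 < T2 \<Longrightarrow> abscontH T1 T2 z"
    and w1: "\<omega>1 \<le> pi^2"
    and eq: "AE t in lborel. \<tau> < t \<and> t < b \<longrightarrow> (\<exists>z' w. hasDerivH z z' t \<and> isA (z t) w \<and>
       (AE s in mu. (z' s + w s) * f (z t s / sin (pi * s)) \<le> \<omega>1 * (z t s * f (z t s / sin (pi * s)))))"
    and b: "\<tau> \<le> b"
  shows "J (z b) \<le> exp (- (pi^2 - \<omega>1) * (b - \<tau>)) * J (z \<tau>)"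
proof (cases "\<tau> = b")
  case False
  then have \<tau>b: "\<tau> < b" using b by simp
  define l where "l = pi^2 - \<omega>1"
  have l: "l \<ge> 0" using w1 by (simp add: l_def)
  define K where "K t = exp (l * t) * J (z t)" for t
  have Kmono: "K b \<le> K a" if a: "\<tau> < a" "a < b" for a
  proof -
    have aab: "abscontH a b z" by (rule ac[OF a])
    obtain B where B: "B \<ge> 0" "\<And>t. a \<le> t \<Longrightarrow> t \<le> b \<Longrightarrow> nH (z t) \<le> B"
      by (rule abscontH_bounded[OF aab]) (use m a that in auto)
    \<comment> \<open>Product rule for Lipschitz constants: \<open>J\<close> has constant
      \<open>2 * B\<close> on the ball of radius \<open>B\<close> and is at most \<open>B^2\<close>
      there, while the weight is bounded by \<open>exp (l * b)\<close> and has Lipschitz constant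
      \<open>l * exp (l * b)\<close>.\<close>
    define C where "C = exp (l * b) * (2 * B) + l * exp (l * b) * B^2"
    show ?thesis
    proof (rule abscontH_nonincreasing[OF _ aab, where C=C])
      show "a \<le> b" using a by simp
      show "0 \<le> C" using B l by (simp add: C_def)
      fix s t assume st: "a \<le> s" "s \<le> t" "t \<le> b"
      have ms: "memH (z s)" "memH (z t)" using m st a by auto
      have Bs: "nH (z s) \<le> B" "nH (z t) \<le> B" using B(2) st by auto
      have J1: "\<bar>J (z t) - J (z s)\<bar> \<le> 2 * B * nH (\<lambda>x. z t x - z s x)"
        using J_diff[OF ms] mult_right_mono[of "nH (z s) + nH (z t)" "2 * B" "nH (\<lambda>x. z t x - z s x)"] Bs by simp
      have J2: "\<bar>J (z s)\<bar> \<le> B^2"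
        using J_nonneg[of "z s"] J_le[OF ms(1)] power_mono[OF Bs(1), of 2] by simp
      have e: "\<bar>exp (l * t) - exp (l * s)\<bar> \<le> l * exp (l * b) * (t - s)"
      proof -
        have "exp (l * t) - exp (l * s) = exp (l * t) * (1 - exp (- (l * (t - s))))"
          by (simp add: right_diff_distrib exp_add[symmetric])
        also have "\<dots> \<le> exp (l * b) * (l * (t - s))"
        proof (intro mult_mono)
          show "exp (l * t) \<le> exp (l * b)" using st l by (simp add: mult_left_mono)
          show "1 - exp (- (l * (t - s))) \<le> l * (t - s)" using exp_ge_add_one_self[of "- (l * (t - s))"] by simp
          show "0 \<le> 1 - exp (- (l * (t - s)))" using st l by simp
        qed simp
        finally have "exp (l * t) - exp (l * s) \<le> l * exp (l * b) * (t - s)" by (simp add: mult_ac)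
        moreover have "exp (l * s) \<le> exp (l * t)" using st l by (simp add: mult_left_mono)
        ultimately show ?thesis by simp
      qed
      have "K t - K s = exp (l * t) * (J (z t) - J (z s)) + (exp (l * t) - exp (l * s)) * J (z s)"
        by (simp add: K_def algebra_simps)
      then have "\<bar>K t - K s\<bar> \<le> exp (l * t) * \<bar>J (z t) - J (z s)\<bar> + \<bar>exp (l * t) - exp (l * s)\<bar> * \<bar>J (z s)\<bar>"
        by (metis abs_triangle_ineq abs_mult abs_exp_cancel)
      also have "\<dots> \<le> exp (l * b) * (2 * B * nH (\<lambda>x. z t x - z s x)) + (l * exp (l * b) * (t - s)) * B^2"
        using st l e J1 J2 by (intro add_mono mult_mono) (auto intro: mult_left_mono)
      also have "\<dots> \<le> C * (nH (\<lambda>x. z t x - z s x) + (t - s))"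
      proof -
        have "0 \<le> exp (l * b) * (2 * B) * (t - s)" "0 \<le> (l * exp (l * b) * B^2) * nH (\<lambda>x. z t x - z s x)"
          using st l B by auto
        then show ?thesis by (simp add: C_def algebra_simps)
      qed
      finally show "\<bar>K t - K s\<bar> \<le> C * (nH (\<lambda>x. z t x - z s x) + (t - s))" .
    next
      show "AE t in lborel. a < t \<and> t < b \<longrightarrow> (\<exists>D\<le>0. (K has_real_derivative D) (at t))"
        using eq
      proof eventually_elim
        case (elim t)
        show ?case
        proof
          assume t: "a < t \<and> t < b"
          then obtain z' w where zw: "hasDerivH z z' t" "isA (z t) w"
            "AE s in mu. (z' s + w s) * f (z t s / sin (pi * s)) \<le> \<omega>1 * (z t s * f (z t s / sin (pi * s)))"
            using elim a by auto
          have mt: "memH (z t)" using m t a by auto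
          have z': "memH z'" using zw(1) by (simp add: hasDerivH_def)
          have w: "memH w" using zw(2) by (simp add: isA_def)
          have "\<forall>\<^sub>F s in nhds t. \<tau> < s" using t a by (intro eventually_nhds_in_open[of "{\<tau><..}", simplified]) auto
          then have mn: "\<forall>\<^sub>F s in nhds t. memH (z s)" by eventually_elim (simp add: m)
          let ?T = "test (z t)"
          have T: "memH ?T" using mt by simp
          define D where "D = (\<integral>s. z' s * ?T s \<partial>mu)"
          define E where "E = (\<integral>s. z t s * ?T s \<partial>mu)"
          have dJ: "((\<lambda>s. J (z s)) has_real_derivative D) (at t)" unfolding D_def by (rule J_deriv[OF zw(1) mn])
          have "D + (\<integral>s. w s * ?T s \<partial>mu) = (\<integral>s. z' s * ?T s + w s * ?T s \<partial>mu)"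
            unfolding D_def by (intro Bochner_Integration.integral_add[symmetric] memH_mult z' w T)
          also have "\<dots> \<le> (\<integral>s. \<omega>1 * (z t s * ?T s) \<partial>mu)"
          proof (rule integral_mono_AE)
            show "integrable mu (\<lambda>s. z' s * ?T s + w s * ?T s)" by (intro Bochner_Integration.integrable_add memH_mult z' w T)
            show "integrable mu (\<lambda>s. \<omega>1 * (z t s * ?T s))" by (intro integrable_mult_right memH_mult mt T)
            have "AE s in mu. 0 < sin (pi * s)" by (rule AE_mu_I, rule sin_pi_pos)
            with zw(3) show "AE s in mu. z' s * ?T s + w s * ?T s \<le> \<omega>1 * (z t s * ?T s)"
            proof eventually_elim
              case (elim s)
              from mult_left_mono[OF elim(1), of "sin (pi * s)"] elim(2) show ?case by (simp add: algebra_simps)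
            qed
          qed
          finally have "D + (\<integral>s. w s * ?T s \<partial>mu) \<le> \<omega>1 * E" by (simp add: E_def)
          moreover have "pi^2 * E \<le> (\<integral>s. w s * ?T s \<partial>mu)" unfolding E_def by (rule energy_inequality[OF zw(2)])
          \<comment> \<open>The gap \<open>l\<close> between pi^2 and the growth rate multiplies
            \<open>E\<close>, and convexity (\<open>J_le_test\<close>) exchanges \<open>E\<close>
            for the entropy; this uses that \<open>l\<close> is nonnegative.\<close>
          moreover have "l * J (z t) \<le> l * E" unfolding E_def using l J_le_test[OF mt] by (rule mult_left_mono[rotated])
          ultimately have "D + l * J (z t) \<le> 0" by (simp add: l_def algebra_simps)
          then have "exp (l * t) * (D + l * J (z t)) \<le> 0" by (simp add: mult_nonneg_nonpos)
          moreover have "(K has_real_derivative exp (l * t) * (D + l * J (z t))) (at t)"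
            unfolding K_def by (auto intro!: derivative_eq_intros dJ simp: algebra_simps)
          ultimately show "\<exists>D\<le>0. (K has_real_derivative D) (at t)" by blast
        qed
      qed
    qed
  qed
  have ev: "\<forall>\<^sub>F a in at_right \<tau>. \<tau> < a \<and> a < b"
    using \<tau>b by (auto simp: eventually_at_right)
  have "((\<lambda>a. J (z a) - J (z \<tau>)) \<longlongrightarrow> 0) (at_right \<tau>)"
  proof (rule Lim_null_comparison)
    let ?d = "\<lambda>a. nH (\<lambda>x. z a x - z \<tau> x)"
    show "\<forall>\<^sub>F a in at_right \<tau>. norm (J (z a) - J (z \<tau>)) \<le> (nH (z \<tau>) + (nH (z \<tau>) + ?d a)) * ?d a"
      using ev
    proof eventually_elim
      case (elim a)
      have ma: "memH (z a)" "memH (z \<tau>)" using m elim by auto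
      have "\<bar>J (z a) - J (z \<tau>)\<bar> \<le> (nH (z \<tau>) + nH (z a)) * ?d a" by (rule J_diff[OF ma(2,1)])
      also have "\<dots> \<le> (nH (z \<tau>) + (nH (z \<tau>) + ?d a)) * ?d a"
        using nH_triangle_rev[OF ma] by (intro mult_right_mono) auto
      finally show ?case by simp
    qed
    have "((\<lambda>a. (nH (z \<tau>) + (nH (z \<tau>) + ?d a)) * ?d a) \<longlongrightarrow> (nH (z \<tau>) + (nH (z \<tau>) + 0)) * 0) (at_right \<tau>)"
      by (intro tendsto_intros rc)
    then show "((\<lambda>a. (nH (z \<tau>) + (nH (z \<tau>) + ?d a)) * ?d a) \<longlongrightarrow> 0) (at_right \<tau>)" by simp
  qed
  then have Jl: "((\<lambda>a. J (z a)) \<longlongrightarrow> J (z \<tau>)) (at_right \<tau>)" by (simp add: LIM_zero_iff)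
  have "(K \<longlongrightarrow> exp (l * \<tau>) * J (z \<tau>)) (at_right \<tau>)"
    unfolding K_def by (intro tendsto_intros Jl)
  moreover have "\<forall>\<^sub>F a in at_right \<tau>. K b \<le> K a" using ev by eventually_elim (simp add: Kmono)
  ultimately have "K b \<le> exp (l * \<tau>) * J (z \<tau>)" by (rule tendsto_lowerbound) simp
  note Kb = this
  have "J (z b) = exp (- (l * b)) * K b" by (simp add: K_def exp_minus)
  also have "\<dots> \<le> exp (- (l * b)) * (exp (l * \<tau>) * J (z \<tau>))" by (rule mult_left_mono[OF Kb]) simp
  also have "\<dots> = exp (- (l * b) + l * \<tau>) * J (z \<tau>)" by (simp only: exp_add mult.assoc)
  also have "- (l * b) + l * \<tau> = - (pi^2 - \<omega>1) * (b - \<tau>)" by (simp add: l_def algebra_simps)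
  finally show ?thesis .
qed simp

end

section \<open>Positive parts and contact sets\<close>

text \<open>Here the test function is z itself, so \<open>comparison\<close> becomes the standard L2
  energy estimate.\<close>

interpretation quad: entropy_pair "\<lambda>y. y^2 / 2" "\<lambda>y. y" "\<lambda>_. 1"
  by unfold_locales (auto intro!: derivative_eq_intros)

lemma quad_J: "memH z \<Longrightarrow> quad.J z = nH z ^ 2 / 2"
proof -
  assume z: "memH z"
  have "quad.J z = (\<integral>s. (z s)^2 / 2 \<partial>mu)"
    unfolding quad.J_def
  proof (rule integral_cong_AE)
    show "AE s in mu. (sin (pi * s))\<^sup>2 * ((z s / sin (pi * s))\<^sup>2 / 2) = (z s)\<^sup>2 / 2"
    proof (rule AE_mu_I)
      fix s :: real assume "0 < s" "s < 1"
      then have "sin (pi * s) > 0" by (rule sin_pi_pos)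
      then show "(sin (pi * s))\<^sup>2 * ((z s / sin (pi * s))\<^sup>2 / 2) = (z s)\<^sup>2 / 2" by (simp add: power_divide)
    qed
    show "(\<lambda>s. (sin (pi * s))\<^sup>2 * ((z s / sin (pi * s))\<^sup>2 / 2)) \<in> borel_measurable mu"
      by (rule borel_measurable_integrable[OF quad.J_integrable[OF z]])
    show "(\<lambda>s. (z s)\<^sup>2 / 2) \<in> borel_measurable mu" using memH_sq[OF z] by auto
  qed
  then show ?thesis by (simp add: nH_sq)
qed

text \<open>Since the derivative vanishes at 0, the constant extension to the left fits in a C^1
  manner: at 0 its difference quotient is dominated by that of the original function.\<close>

lemma has_derivative_positive_part:
  assumes d: "\<And>x. 0 \<le> x \<Longrightarrow> (\<phi> has_real_derivative \<phi>' x) (at x)" and z: "\<phi>' 0 = 0"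
  shows "((\<lambda>y. \<phi> (max 0 y)) has_real_derivative \<phi>' (max 0 y)) (at y)"
proof (cases y "0::real" rule: linorder_cases)
  case less
  have "((\<lambda>y. \<phi> 0) has_real_derivative 0) (at y)" by simp
  then have "((\<lambda>y. \<phi> (max 0 y)) has_real_derivative 0) (at y)"
    by (rule has_field_derivative_transform_within_open[of _ _ _ "{..<0}"]) (use less in auto)
  then show ?thesis using less z by simp
next
  case greater
  have "(\<phi> has_real_derivative \<phi>' y) (at y)" using d greater by simp
  then have "((\<lambda>y. \<phi> (max 0 y)) has_real_derivative \<phi>' y) (at y)"
    by (rule has_field_derivative_transform_within_open[of _ _ _ "{0<..}"]) (use greater in auto)
  then show ?thesis using greater by simp
next
  case equal
  have "((\<lambda>h. (\<phi> h - \<phi> 0) / h) \<longlongrightarrow> 0) (at 0)"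
    using d[of 0] z by (simp add: DERIV_def)
  then have "((\<lambda>h. \<bar>(\<phi> h - \<phi> 0) / h\<bar>) \<longlongrightarrow> 0) (at 0)" by (rule tendsto_rabs_zero)
  then have "((\<lambda>h. (\<phi> (max 0 h) - \<phi> 0) / h) \<longlongrightarrow> 0) (at 0)"
    by (rule Lim_null_comparison[rotated]) (auto intro!: always_eventually simp: max_def divide_le_0_iff)
  then show ?thesis using equal z by (simp add: DERIV_def)
qed

text \<open>An entropy that vanishes exactly on the nonpositive half-line; its derivative is \<open>p\<^sup>2 / (1 + p)\<close>.\<close>
definition Fp :: "real \<Rightarrow> real" where "Fp y = (let p = max 0 y in p^2 / 2 - p + ln (1 + p))"
definition fp :: "real \<Rightarrow> real" where "fp y = (let p = max 0 y in p - 1 + 1 / (1 + p))"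
definition fp' :: "real \<Rightarrow> real" where "fp' y = (let p = max 0 y in 1 - 1 / (1 + p)^2)"

interpretation posp: entropy_pair Fp fp fp'
proof
  fix y :: real
  show "(Fp has_real_derivative fp y) (at y)"
    unfolding Fp_def fp_def Let_def
    by (rule has_derivative_positive_part[where \<phi>="\<lambda>p. p^2 / 2 - p + ln (1 + p)" and \<phi>'="\<lambda>p. p - 1 + 1 / (1 + p)"])
       (auto intro!: derivative_eq_intros)
  show "(fp has_real_derivative fp' y) (at y)"
    unfolding fp_def fp'_def Let_def
    by (rule has_derivative_positive_part[where \<phi>="\<lambda>p. p - 1 + 1 / (1 + p)" and \<phi>'="\<lambda>p. 1 - 1 / (1 + p)^2"])
       (auto intro!: derivative_eq_intros simp: power2_eq_square)
  show "continuous_on UNIV fp'"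
    unfolding fp'_def Let_def by (intro continuous_intros) (auto simp: max_def)
  have "1 \<le> (1 + max 0 y)^2" by (simp add: power2_eq_square mult_ge1_I)
  then show "0 \<le> fp' y" "fp' y \<le> 1" by (auto simp: fp'_def Let_def)
  show "Fp 0 = 0" "fp 0 = 0" by (simp_all add: Fp_def fp_def)
qed

lemma fp_pos: "0 < y \<Longrightarrow> 0 < fp y"
  by (simp add: fp_def Let_def field_simps)

lemma fp_neg: "y \<le> 0 \<Longrightarrow> fp y = 0"
  by (simp add: fp_def Let_def)

lemma Fp_pos: assumes "0 < y" shows "0 < Fp y"
proof -
  obtain c where "c > 0" "c < y" "Fp y - Fp 0 = (y - 0) * fp c"
    using MVT2[of 0 y Fp fp] posp.dF assms by auto
  then show ?thesis using fp_pos[of c] assms posp.F0 by simp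
qed

lemma Fp_neg: "y \<le> 0 \<Longrightarrow> Fp y = 0"
  by (simp add: Fp_def Let_def)

lemma posp_J_zero: assumes z: "AE s in mu. z s \<le> 0" shows "posp.J z = 0"
proof -
  have "AE s in mu. 0 < sin (pi * s)" by (rule AE_mu_I, rule sin_pi_pos)
  with z have "AE s in mu. (sin (pi * s))\<^sup>2 * Fp (z s / sin (pi * s)) = 0"
    by eventually_elim (simp add: Fp_neg divide_nonpos_pos)
  then show ?thesis unfolding posp.J_def by (rule integral_eq_zero_AE)
qed

lemma posp_J_zero_D: assumes z: "memH z" and J: "posp.J z \<le> 0" shows "AE s in mu. z s \<le> 0"
proof -
  have "posp.J z = 0" using J posp.J_nonneg[of z] by linarith
  then have "AE s in mu. (sin (pi * s))\<^sup>2 * Fp (z s / sin (pi * s)) = 0"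
    unfolding posp.J_def
    by (subst (asm) integral_nonneg_eq_0_iff_AE[OF posp.J_integrable[OF z]]) (auto simp: posp.F_nonneg)
  moreover have "AE s in mu. 0 < sin (pi * s)" by (rule AE_mu_I, rule sin_pi_pos)
  ultimately show ?thesis
  proof eventually_elim
    case (elim s)
    then have "Fp (z s / sin (pi * s)) = 0" by simp
    then have "\<not> 0 < z s / sin (pi * s)" using Fp_pos by force
    then show ?case using elim(2) by (simp add: zero_less_divide_iff not_less)
  qed
qed

lemma hasDerivH_diff:
  assumes u: "hasDerivH u u' t" and v: "hasDerivH v v' t"
    and mu: "\<forall>\<^sub>F s in nhds t. memH (u s)" and mv: "\<forall>\<^sub>F s in nhds t. memH (v s)"
  shows "hasDerivH (\<lambda>t x. u t x - v t x) (\<lambda>x. u' x - v' x) t"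
proof -
  have u': "memH u'" "((\<lambda>h. nH (\<lambda>x. (u (t + h) x - u t x) / h - u' x)) \<longlongrightarrow> 0) (at 0)"
    and v': "memH v'" "((\<lambda>h. nH (\<lambda>x. (v (t + h) x - v t x) / h - v' x)) \<longlongrightarrow> 0) (at 0)"
    using u v by (auto simp: hasDerivH_def)
  have "filterlim (\<lambda>h. t + h) (nhds t) (at 0)" by (auto intro!: tendsto_eq_intros)
  then have mh: "\<forall>\<^sub>F h in at 0. memH (u (t + h))" "\<forall>\<^sub>F h in at 0. memH (v (t + h))"
    using mu mv unfolding filterlim_iff by blast+
  have m: "memH (u t)" "memH (v t)" using mu mv by (auto intro: eventually_nhds_x_imp_x)
  have "((\<lambda>h. nH (\<lambda>x. ((u (t + h) x - v (t + h) x) - (u t x - v t x)) / h - (u' x - v' x))) \<longlongrightarrow> 0) (at 0)"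
  proof (rule Lim_null_comparison)
    show "\<forall>\<^sub>F h in at 0. norm (nH (\<lambda>x. ((u (t + h) x - v (t + h) x) - (u t x - v t x)) / h - (u' x - v' x)))
      \<le> nH (\<lambda>x. (u (t + h) x - u t x) / h - u' x) + nH (\<lambda>x. (v (t + h) x - v t x) / h - v' x)"
      using mh
    proof eventually_elim
      case (elim h)
      have "(\<lambda>x. ((u (t + h) x - v (t + h) x) - (u t x - v t x)) / h - (u' x - v' x)) =
        (\<lambda>x. ((u (t + h) x - u t x) / h - u' x) - ((v (t + h) x - v t x) / h - v' x))"
        by (auto simp: fun_eq_iff diff_divide_distrib)
      moreover have "nH (\<lambda>x. ((u (t + h) x - u t x) / h - u' x) - ((v (t + h) x - v t x) / h - v' x))
        \<le> nH (\<lambda>x. (u (t + h) x - u t x) / h - u' x) + nH (\<lambda>x. (v (t + h) x - v t x) / h - v' x)"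
        by (rule nH_triangle_diff) (use elim m u' v' in auto)
      ultimately show ?case by simp
    qed
    show "((\<lambda>h. nH (\<lambda>x. (u (t + h) x - u t x) / h - u' x) + nH (\<lambda>x. (v (t + h) x - v t x) / h - v' x)) \<longlongrightarrow> 0) (at 0)"
      using tendsto_add[OF u'(2) v'(2)] by simp
  qed
  then show ?thesis using u'(1) v'(1) by (simp add: hasDerivH_def)
qed

lemma abscontH_diff:
  assumes u: "abscontH T1 T2 u" and v: "abscontH T1 T2 v"
    and m: "\<And>t. T1 \<le> t \<Longrightarrow> t \<le> T2 \<Longrightarrow> memH (u t)" "\<And>t. T1 \<le> t \<Longrightarrow> t \<le> T2 \<Longrightarrow> memH (v t)"
  shows "abscontH T1 T2 (\<lambda>t x. u t x - v t x)"
  unfolding abscontH_def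
proof (intro allI impI)
  fix e :: real assume "e > 0"
  then have e: "e / 2 > 0" by simp
  let ?P = "\<lambda>z d e. \<forall>(n::nat) (a::nat\<Rightarrow>real) (c::nat\<Rightarrow>real). (\<forall>i<n. T1 \<le> a i \<and> a i \<le> c i \<and> c i \<le> T2) \<and>
     (\<forall>i<n. \<forall>j<n. i \<noteq> j \<longrightarrow> c i \<le> a j \<or> c j \<le> a i) \<and>
     (\<Sum>i<n. c i - a i) < d \<longrightarrow> (\<Sum>i<n. nH (\<lambda>x. z (c i) x - z (a i) x)) < e"
  have "\<exists>d>0. ?P u d (e/2)" by (rule u[unfolded abscontH_def, THEN spec, THEN mp, OF e])
  then obtain d1 where d1: "d1 > 0" "?P u d1 (e/2)" by (elim exE conjE)
  have "\<exists>d>0. ?P v d (e/2)" by (rule v[unfolded abscontH_def, THEN spec, THEN mp, OF e])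
  then obtain d2 where d2: "d2 > 0" "?P v d2 (e/2)" by (elim exE conjE)
  show "\<exists>d>0. ?P (\<lambda>t x. u t x - v t x) d e"
  proof (intro exI conjI allI impI)
    show "min d1 d2 > 0" using d1 d2 by simp
    fix n :: nat and a c :: "nat \<Rightarrow> real"
    assume H: "(\<forall>i<n. T1 \<le> a i \<and> a i \<le> c i \<and> c i \<le> T2) \<and>
     (\<forall>i<n. \<forall>j<n. i \<noteq> j \<longrightarrow> c i \<le> a j \<or> c j \<le> a i) \<and> (\<Sum>i<n. c i - a i) < min d1 d2"
    have 1: "(\<Sum>i<n. nH (\<lambda>x. u (c i) x - u (a i) x)) < e / 2"
      by (rule d1(2)[THEN spec, THEN spec, THEN spec, THEN mp]) (use H in auto)
    have 2: "(\<Sum>i<n. nH (\<lambda>x. v (c i) x - v (a i) x)) < e / 2"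
      by (rule d2(2)[THEN spec, THEN spec, THEN spec, THEN mp]) (use H in auto)
    have "(\<Sum>i<n. nH (\<lambda>x. (u (c i) x - v (c i) x) - (u (a i) x - v (a i) x))) \<le>
      (\<Sum>i<n. nH (\<lambda>x. u (c i) x - u (a i) x) + nH (\<lambda>x. v (c i) x - v (a i) x))"
    proof (rule sum_mono)
      fix i assume "i \<in> {..<n}"
      then have i: "T1 \<le> a i" "a i \<le> c i" "c i \<le> T2" using H by auto
      have M: "memH (u (c i))" "memH (u (a i))" "memH (v (c i))" "memH (v (a i))" using m i by auto
      have "nH (\<lambda>x. (u (c i) x - u (a i) x) - (v (c i) x - v (a i) x)) \<le> nH (\<lambda>x. u (c i) x - u (a i) x) + nH (\<lambda>x. v (c i) x - v (a i) x)"
        by (rule nH_triangle_diff) (use M in auto)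
      moreover have "(\<lambda>x. (u (c i) x - u (a i) x) - (v (c i) x - v (a i) x)) = (\<lambda>x. (u (c i) x - v (c i) x) - (u (a i) x - v (a i) x))"
        by auto
      ultimately show "nH (\<lambda>x. (u (c i) x - v (c i) x) - (u (a i) x - v (a i) x)) \<le> nH (\<lambda>x. u (c i) x - u (a i) x) + nH (\<lambda>x. v (c i) x - v (a i) x)"
        by simp
    qed
    also have "\<dots> < e" using 1 2 by (simp add: sum.distrib)
    finally show "(\<Sum>i<n. nH (\<lambda>x. (u (c i) x - v (c i) x) - (u (a i) x - v (a i) x))) < e" .
  qed
qed

lemma abscontH_lipschitz:
  assumes L: "L \<ge> 0" "\<And>s t. T1 \<le> s \<Longrightarrow> s \<le> t \<Longrightarrow> t \<le> T2 \<Longrightarrow> nH (\<lambda>x. z t x - z s x) \<le> L * (t - s)"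
  shows "abscontH T1 T2 z"
  unfolding abscontH_def
proof (intro allI impI)
  fix e :: real assume e: "e > 0"
  show "\<exists>d>0. \<forall>(n::nat) (a::nat\<Rightarrow>real) (c::nat\<Rightarrow>real). (\<forall>i<n. T1 \<le> a i \<and> a i \<le> c i \<and> c i \<le> T2) \<and>
     (\<forall>i<n. \<forall>j<n. i \<noteq> j \<longrightarrow> c i \<le> a j \<or> c j \<le> a i) \<and>
     (\<Sum>i<n. c i - a i) < d \<longrightarrow> (\<Sum>i<n. nH (\<lambda>x. z (c i) x - z (a i) x)) < e"
  proof (intro exI conjI allI impI)
    show "e / (L + 1) > 0" using e L by simp
    fix n :: nat and a c :: "nat \<Rightarrow> real"
    assume H: "(\<forall>i<n. T1 \<le> a i \<and> a i \<le> c i \<and> c i \<le> T2) \<and>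
     (\<forall>i<n. \<forall>j<n. i \<noteq> j \<longrightarrow> c i \<le> a j \<or> c j \<le> a i) \<and> (\<Sum>i<n. c i - a i) < e / (L + 1)"
    have "(\<Sum>i<n. nH (\<lambda>x. z (c i) x - z (a i) x)) \<le> (\<Sum>i<n. L * (c i - a i))"
      by (rule sum_mono) (use H L in auto)
    also have "\<dots> \<le> (\<Sum>i<n. (L + 1) * (c i - a i))"
      by (rule sum_mono) (use H in \<open>auto intro!: mult_right_mono\<close>)
    also have "\<dots> = (L + 1) * (\<Sum>i<n. c i - a i)" by (rule sum_distrib_left[symmetric])
    also have "\<dots> < (L + 1) * (e / (L + 1))" by (rule mult_strict_left_mono) (use H L in auto)
    also have "\<dots> = e" using L by simp
    finally show "(\<Sum>i<n. nH (\<lambda>x. z (c i) x - z (a i) x)) < e" .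
  qed
qed

lemma contH_tendsto:
  assumes "contH \<tau> u" shows "((\<lambda>t. nH (\<lambda>x. u t x - u \<tau> x)) \<longlongrightarrow> 0) (at_right \<tau>)"
proof (rule tendstoI)
  fix e :: real assume "e > 0"
  then obtain d where d: "d > 0" "\<And>s. s \<ge> \<tau> \<Longrightarrow> \<bar>s - \<tau>\<bar> < d \<Longrightarrow> nH (\<lambda>x. u s x - u \<tau> x) < e"
    using assms unfolding contH_def by blast
  have "\<forall>\<^sub>F t in at_right \<tau>. \<tau> < t \<and> t < \<tau> + d"
    unfolding eventually_at_right_field using d(1) by (intro exI[of _ "\<tau> + d"]) auto
  then show "\<forall>\<^sub>F t in at_right \<tau>. dist (nH (\<lambda>x. u t x - u \<tau> x)) 0 < e"
    by eventually_elim (simp add: d(2))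
qed

lemma isA_diff:
  assumes "isA v w" "isA v2 w2" shows "isA (\<lambda>s. v s - v2 s) (\<lambda>s. w s - w2 s)"
proof -
  obtain g g1 g2 where H: "memH v" "memH w" "memH g2" "ae01 (\<lambda>s. v s = g s)"
     "\<forall>s\<in>{0..1}. g1 s = g1 0 + integral\<^sup>L lborel (\<lambda>r. indicator {0..s} r * g2 r)"
     "\<forall>s\<in>{0..1}. g s = integral\<^sup>L lborel (\<lambda>r. indicator {0..s} r * g1 r)" "g 1 = 0"
     "ae01 (\<lambda>s. w s = - g2 s)"
    using assms(1) unfolding isA_def by blast
  obtain k k1 k2 where K: "memH v2" "memH w2" "memH k2" "ae01 (\<lambda>s. v2 s = k s)"
     "\<forall>s\<in>{0..1}. k1 s = k1 0 + integral\<^sup>L lborel (\<lambda>r. indicator {0..s} r * k2 r)"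
     "\<forall>s\<in>{0..1}. k s = integral\<^sup>L lborel (\<lambda>r. indicator {0..s} r * k1 r)" "k 1 = 0"
     "ae01 (\<lambda>s. w2 s = - k2 s)"
    using assms(2) unfolding isA_def by blast
  have ag: "acd 0 1 g1 g2" "acd 0 1 k1 k2"
    unfolding acd_def using H(5) K(5) memH_integrable_Icc[OF H(3)] memH_integrable_Icc[OF K(3)] by blast+
  have i1: "integrable lborel (\<lambda>r. indicator {0..s} r * f r)" if "continuous_on {0..1} f" "s \<in> {0..1}" for f :: "real \<Rightarrow> real" and s
    using borel_integrable_atLeastAtMost'[OF continuous_on_subset[OF that(1)], of 0 s] that(2)
    by (auto simp: set_integrable_def)
  have i2: "integrable lborel (\<lambda>r. indicator {0..s} r * f r)" if "memH f" "s \<in> {0..1}" for f s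
    by (rule indicator_integrable_subset[OF memH_integrable_Icc[OF that(1)]]) (use that(2) in auto)
  note c = acd_continuous[OF ag(1)] acd_continuous[OF ag(2)]
  show ?thesis
    unfolding isA_def
  proof (rule conjI, use H K in simp, rule conjI, use H K in simp, rule exI[of _ "\<lambda>s. g s - k s"],
      rule exI[of _ "\<lambda>s. g1 s - k1 s"], rule exI[of _ "\<lambda>s. g2 s - k2 s"], intro conjI ballI)
    show "ae01 (\<lambda>s. v s - v2 s = g s - k s)" using H(4) K(4) unfolding ae01_mu by eventually_elim simp
    show "ae01 (\<lambda>s. w s - w2 s = - (g2 s - k2 s))" using H(8) K(8) unfolding ae01_mu by eventually_elim simp
    fix s :: real assume s: "s \<in> {0..1}"
    show "g s - k s = (\<integral>r. indicator {0..s} r * (g1 r - k1 r) \<partial>lborel)"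
      unfolding right_diff_distrib using H(6) K(6) s by (subst Bochner_Integration.integral_diff[OF i1[OF c(1) s] i1[OF c(2) s]]) auto
    show "g1 s - k1 s = g1 0 - k1 0 + (\<integral>r. indicator {0..s} r * (g2 r - k2 r) \<partial>lborel)"
      unfolding right_diff_distrib using bspec[OF H(5) s] bspec[OF K(5) s]
      by (subst Bochner_Integration.integral_diff[OF i2[OF H(3) s] i2[OF K(3) s]]) linarith
  qed (use H K in auto)
qed

text \<open>A negative value would persist on an interval, which has positive measure.\<close>

lemma AE_mu_continuous_nonneg:
  assumes c: "continuous_on {0..1} g" and ae: "AE s in mu. 0 \<le> g s" and x: "0 < x" "x < 1"
  shows "0 \<le> (g x :: real)"
proof (rule ccontr)
  assume "\<not> ?thesis"
  then have gx: "g x < 0" by simp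
  have "isCont g x"
    using continuous_on_interior[OF c, of x] x by (simp add: interior_atLeastAtMost_real)
  then have "\<forall>\<^sub>F y in nhds x. g y < 0"
    using gx by (simp add: isCont_def tendsto_at_iff_tendsto_nhds order_tendstoD)
  then have "\<forall>\<^sub>F y in nhds x. g y < 0 \<and> y \<in> {0<..<1}"
    using eventually_nhds_in_open[of "{0<..<1}" x] x by (auto simp: eventually_conj_iff)
  then obtain d where d: "d > 0" "\<And>y. dist y x < d \<Longrightarrow> g y < 0 \<and> y \<in> {0<..<1}"
    unfolding eventually_nhds_metric by auto
  have "AE s in lborel. s \<in> I01 \<longrightarrow> 0 \<le> g s" using ae by (simp add: AE_mu_iff_lborel)
  then have "AE s in lborel. s \<notin> {x - d<..<x + d}"
  proof eventually_elim
    case (elim s)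
    show ?case
    proof
      assume "s \<in> {x - d<..<x + d}"
      then have "dist s x < d" by (auto simp: dist_real_def)
      then show False using d(2)[of s] elim by (auto simp: I01_def)
    qed
  qed
  then have "emeasure lborel {x - d<..<x + d} = 0"
    by (subst (asm) AE_iff_measurable[of "{x - d<..<x + d}"]) auto
  then show False using d(1) by simp
qed

text \<open>On the contact set \<open>{u(t) = 0}\<close> both the time derivative (two-sided difference quotients) and the
  second space derivative of a nonnegative solution vanish, so the selection in the multivalued term is 0.\<close>
lemma nonneg_contact_set:
  assumes d: "hasDerivH u u' t" and A: "isA (u t) w"
    and m: "\<forall>\<^sub>F s in nhds t. memH (u s)" and nn: "\<forall>\<^sub>F s in nhds t. (AE x in mu. 0 \<le> u s x)"
  shows "AE x in mu. u t x = 0 \<longrightarrow> u' x + w x = 0"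
proof -
  have u': "memH u'" "((\<lambda>h. nH (\<lambda>x. (u (t + h) x - u t x) / h - u' x)) \<longlongrightarrow> 0) (at 0)"
    using d by (auto simp: hasDerivH_def)
  let ?e = "\<lambda>h. nH (\<lambda>x. (u (t + h) x - u t x) / h - u' x)"
  have mt: "memH (u t)" using m by (rule eventually_nhds_x_imp_x)
  have fl: "filterlim (\<lambda>h. t + h) (nhds t) (at 0)" by (auto intro!: tendsto_eq_intros)
  have mh: "\<forall>\<^sub>F h in at 0. memH (u (t + h))" and nh: "\<forall>\<^sub>F h in at 0. (AE x in mu. 0 \<le> u (t + h) x)"
    using m nn fl unfolding filterlim_iff by blast+
  have le: "at_right (0::real) \<le> at 0" "at_left (0::real) \<le> at 0" by (simp_all add: at_le)
  \<comment> \<open>Negative and positive part of the time derivative on the contact set. A forward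
    quotient is nonnegative there, so it misses \<open>u'\<close> by at least |p|; a backward
    quotient is nonpositive and misses it by at least |n|. Both errors tend to 0.\<close>
  define p where "p x = indicator {0} (u t x) * min 0 (u' x)" for x
  define n where "n x = indicator {0} (u t x) * max 0 (u' x)" for x
  have pm [measurable]: "p \<in> borel_measurable mu" and nm [measurable]: "n \<in> borel_measurable mu"
    unfolding p_def n_def
    by (intro borel_measurable_times borel_measurable_min borel_measurable_max borel_measurable_const
      memH_measurable[OF u'(1)] measurable_compose[OF memH_measurable[OF mt] borel_measurable_indicator]; simp)+
  have pH: "memH p" by (rule memH_dom[OF pm u'(1)]) (auto simp: p_def indicator_def)
  have nHm: "memH n" by (rule memH_dom[OF nm u'(1)]) (auto simp: n_def indicator_def)
  have p0: "AE x in mu. p x = 0"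
  proof (rule nH_le_tendsto_0[OF pH])
    show "(?e \<longlongrightarrow> 0) (at_right 0)" using u'(2) le(1) by (rule filterlim_mono[OF _ order_refl])
    have "\<forall>\<^sub>F h in at_right (0::real). h > 0" by (simp add: eventually_at_right_less)
    with filter_leD[OF le(1) mh] filter_leD[OF le(1) nh]
    show "\<forall>\<^sub>F h in at_right 0. nH p \<le> ?e h"
    proof eventually_elim
      case (elim h)
      show ?case
      proof (rule nH_mono[OF pm])
        show "memH (\<lambda>x. (u (t + h) x - u t x) / h - u' x)" using elim mt u' by simp
        show "AE x in mu. \<bar>p x\<bar> \<le> \<bar>(u (t + h) x - u t x) / h - u' x\<bar>"
          using elim(2)
        proof eventually_elim
          case (elim x)
          then have "u t x = 0 \<Longrightarrow> 0 \<le> (u (t + h) x - u t x) / h" using \<open>h > 0\<close> by simp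
          then show ?case by (auto simp: p_def indicator_def min_def)
        qed
      qed
    qed
  qed simp
  have n0: "AE x in mu. n x = 0"
  proof (rule nH_le_tendsto_0[OF nHm])
    show "(?e \<longlongrightarrow> 0) (at_left 0)" using u'(2) le(2) by (rule filterlim_mono[OF _ order_refl])
    have "\<forall>\<^sub>F h in at_left (0::real). h < 0" by (auto simp: eventually_at_filter)
    with filter_leD[OF le(2) mh] filter_leD[OF le(2) nh]
    show "\<forall>\<^sub>F h in at_left 0. nH n \<le> ?e h"
    proof eventually_elim
      case (elim h)
      show ?case
      proof (rule nH_mono[OF nm])
        show "memH (\<lambda>x. (u (t + h) x - u t x) / h - u' x)" using elim mt u' by simp
        show "AE x in mu. \<bar>n x\<bar> \<le> \<bar>(u (t + h) x - u t x) / h - u' x\<bar>"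
          using elim(2)
        proof eventually_elim
          case (elim x)
          then have "u t x = 0 \<Longrightarrow> (u (t + h) x - u t x) / h \<le> 0" using \<open>h < 0\<close> by (simp add: divide_nonneg_neg)
          then show ?case by (auto simp: n_def indicator_def max_def)
        qed
      qed
    qed
  qed simp
  obtain g g1 g2 where H: "memH (u t)" "memH w" "memH g2" "acd 0 1 g1 g2" "continuous_on {0..1} g1"
    "\<And>x. x \<in> {0..1} \<Longrightarrow> (g has_real_derivative g1 x) (at x within {0..1})"
    "g 0 = 0" "g 1 = 0" "AE s in mu. u t s = g s" "AE s in mu. w s = - g2 s"
    by (rule isA_E[OF A]) (rule that)
  have gc: "continuous_on {0..1} g" by (rule DERIV_continuous_on[OF H(6)])
  have nt: "AE x in mu. 0 \<le> u t x" using nn by (rule eventually_nhds_x_imp_x)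
  have "AE x in mu. 0 \<le> g x" using H(9) nt by eventually_elim simp
  then have gnn: "0 \<le> g x" if "0 < x" "x < 1" for x by (rule AE_mu_continuous_nonneg[OF gc _ that])
  \<comment> \<open>A zero of the nonnegative representative is an interior minimum. Hence zeros of
    \<open>g\<close> are zeros of \<open>g1\<close>, and \<open>acd_derivative_zero_on_zeros\<close>
    for \<open>g1\<close> gives the vanishing second derivative.\<close>
  have g10: "g1 x = 0" if x: "0 < x" "x < 1" and "g x = 0" for x
  proof (rule DERIV_local_min)
    have "at x within {0..1} = at x" by (rule at_within_interior) (use x in \<open>simp add: interior_atLeastAtMost_real\<close>)
    then show "(g has_real_derivative g1 x) (at x)" using H(6)[of x] x by simp
    show "0 < min x (1 - x)" using x by simp
    show "\<forall>y. \<bar>x - y\<bar> < min x (1 - x) \<longrightarrow> g x \<le> g y" using \<open>g x = 0\<close> by (auto intro!: gnn)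
  qed
  have "AE x in lborel. x \<in> {0..1} \<longrightarrow> g1 x = 0 \<longrightarrow> g2 x = 0"
    by (rule acd_derivative_zero_on_zeros[OF _ H(4)]) simp
  then have "AE x in mu. g x = 0 \<longrightarrow> g2 x = 0"
    unfolding AE_mu_iff_lborel by eventually_elim (auto simp: I01_def g10)
  with p0 n0 H(9,10) show ?thesis
    by eventually_elim (auto simp: p_def n_def indicator_def min_def max_def split: if_splits)
qed

section \<open>A spreading subsolution\<close>

lemma memH_continuous:
  assumes c: "continuous_on {0..1} f" shows "memH f"
proof -
  obtain B where B: "\<And>x. x \<in> {0..1} \<Longrightarrow> \<bar>f x\<bar> \<le> B" using continuous_on_Icc_bounded[OF c] by blast
  have "f \<in> borel_measurable mu"
    by (rule continuous_on_mu, rule continuous_on_subset[OF c]) (auto simp: I01_def)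
  then show ?thesis by (rule memH_bounded[of _ B]) (auto intro!: AE_mu_I B)
qed

lemma isA_C2:
  assumes g: "\<And>s. s \<in> {0..1} \<Longrightarrow> (g has_real_derivative g1 s) (at s within {0..1})"
    and g1: "\<And>s. s \<in> {0..1} \<Longrightarrow> (g1 has_real_derivative g2 s) (at s within {0..1})"
    and c2: "continuous_on {0..1} g2" and z: "g 0 = 0" "g 1 = 0"
  shows "isA g (\<lambda>s. - g2 s)"
proof -
  have c1: "continuous_on {0..1} g1" by (rule DERIV_continuous_on[OF g1])
  have c0: "continuous_on {0..1} g" by (rule DERIV_continuous_on[OF g])
  have a1: "acd 0 1 g1 g2" by (rule acd_C1) (use g1 c2 in auto)
  have a0: "acd 0 1 g g1" by (rule acd_C1) (use g c1 in auto)
  show ?thesis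
    unfolding isA_def
  proof (rule conjI, rule memH_continuous[OF c0], rule conjI, rule memH_uminus[OF memH_continuous[OF c2]],
      rule exI[of _ g], rule exI[of _ g1], rule exI[of _ g2], intro conjI ballI)
    show "memH g2" by (rule memH_continuous[OF c2])
    show "g1 s = g1 0 + (\<integral>r. indicator {0..s} r * g2 r \<partial>lborel)" if "s \<in> {0..1}" for s
      by (rule acd_eq[OF a1 that])
    show "g s = (\<integral>r. indicator {0..s} r * g1 r \<partial>lborel)" if "s \<in> {0..1}" for s
      using acd_eq[OF a0 that] z by simp
  qed (use z in \<open>auto simp: ae01_mu\<close>)
qed

lemma C1_time_lipschitz:
  assumes d: "\<And>t s. ((\<lambda>t. v t s) has_real_derivative vt t s) (at t)"
    and cv: "\<And>t. continuous_on {0..1} (v t)"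
    and cvt: "continuous_on UNIV (\<lambda>p. vt (fst p) (snd p))"
  obtains L where "L \<ge> 0" "\<And>s t. T1 \<le> s \<Longrightarrow> s \<le> t \<Longrightarrow> t \<le> T2 \<Longrightarrow> nH (\<lambda>x. v t x - v s x) \<le> L * (t - s)"
proof -
  have "bounded ((\<lambda>p. vt (fst p) (snd p)) ` ({T1..T2} \<times> {0..1}))"
    by (intro compact_imp_bounded compact_continuous_image continuous_on_subset[OF cvt] compact_Times) auto
  then obtain L0 where L0: "\<And>t s. t \<in> {T1..T2} \<Longrightarrow> s \<in> {0..1} \<Longrightarrow> \<bar>vt t s\<bar> \<le> L0"
    unfolding bounded_iff by fastforce
  define L where "L = \<bar>L0\<bar>"
  have L: "L \<ge> 0" "\<And>t s. t \<in> {T1..T2} \<Longrightarrow> s \<in> {0..1} \<Longrightarrow> \<bar>vt t s\<bar> \<le> L"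
    using L0 by (auto simp: L_def intro: order_trans[OF _ abs_ge_self])
  have "nH (\<lambda>x. v t x - v s x) \<le> L * (t - s)" if st: "T1 \<le> s" "s \<le> t" "t \<le> T2" for s t
  proof -
    have "nH (\<lambda>x. v t x - v s x) \<le> \<bar>L * (t - s)\<bar>"
    proof (rule nH_bound)
      have "memH (\<lambda>x. v t x - v s x)" by (intro memH_diff memH_continuous cv)
      then show "(\<lambda>x. v t x - v s x) \<in> borel_measurable mu" by (rule memH_measurable)
      show "AE x in mu. \<bar>v t x - v s x\<bar> \<le> L * (t - s)"
      proof (rule AE_mu_I)
        fix x :: real assume "0 < x" "x < 1"
        then have "\<bar>v t x - v s x\<bar> \<le> L * \<bar>t - s\<bar>"
          using field_differentiable_bound[of "{T1..T2}" "\<lambda>t. v t x" "\<lambda>t. vt t x" L t s] st L(2)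
            has_field_derivative_at_within[OF d]
          by auto
        then show "\<bar>v t x - v s x\<bar> \<le> L * (t - s)" using st by simp
      qed
    qed
    then show ?thesis using L st by simp
  qed
  then show ?thesis using that L(1) by blast
qed

text \<open>The mean value theorem turns the quotient into a value of \<open>vt\<close> at a nearby
  time, and uniform continuity on [t-1,t+1] x [0,1] makes this uniform in space, hence small in
  H.\<close>

lemma C1_time_hasDerivH:
  assumes d: "\<And>t s. ((\<lambda>t. v t s) has_real_derivative vt t s) (at t)"
    and cv: "\<And>t. continuous_on {0..1} (v t)"
    and cvt: "continuous_on UNIV (\<lambda>p. vt (fst p) (snd p))"
  shows "hasDerivH v (vt t) t"
proof -
  have cvt': "continuous_on {0..1} (vt t)"
  proof -
    have "continuous_on {0..1} (\<lambda>s. (t, s))" by (intro continuous_on_Pair continuous_on_const continuous_on_id)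
    from continuous_on_compose2[OF cvt this] show ?thesis by simp
  qed
  have mt: "memH (vt t)" by (rule memH_continuous[OF cvt'])
  have "((\<lambda>h. nH (\<lambda>x. (v (t + h) x - v t x) / h - vt t x)) \<longlongrightarrow> 0) (at 0)"
  proof (rule tendstoI)
    fix e :: real assume e: "e > 0"
    have "uniformly_continuous_on ({t - 1..t + 1} \<times> {0..1}) (\<lambda>p. vt (fst p) (snd p))"
      by (intro compact_uniformly_continuous continuous_on_subset[OF cvt] compact_Times) auto
    then obtain k where k: "k > 0" "\<And>p p'. p \<in> {t - 1..t + 1} \<times> {0..1} \<Longrightarrow> p' \<in> {t - 1..t + 1} \<times> {0..1} \<Longrightarrow>
        dist p' p < k \<Longrightarrow> dist (vt (fst p') (snd p')) (vt (fst p) (snd p)) < e / 2"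
      unfolding uniformly_continuous_on_def using e half_gt_zero[OF e] by metis
    have key: "\<bar>(v (t + h) x - v t x) / h - vt t x\<bar> \<le> e / 2" if h: "h \<noteq> 0" "\<bar>h\<bar> < min k 1" and x: "0 < x" "x < 1" for h x
    proof -
      obtain c where c: "\<bar>c - t\<bar> \<le> \<bar>h\<bar>" "v (t + h) x - v t x = h * vt c x"
      proof (cases "h > 0")
        case True
        then obtain c where "c > t" "c < t + h" "v (t + h) x - v t x = (t + h - t) * vt c x"
          using MVT2[of t "t + h" "\<lambda>t. v t x" "\<lambda>t. vt t x"] d by auto
        then show ?thesis using that[of c] by auto
      next
        case False
        then have "t + h < t" using h by simp
        then obtain c where "c > t + h" "c < t" "v t x - v (t + h) x = (t - (t + h)) * vt c x"
          using MVT2[of "t + h" t "\<lambda>t. v t x" "\<lambda>t. vt t x"] d by auto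
        then show ?thesis using that[of c] by (auto simp: algebra_simps)
      qed
      have "dist (vt (fst (c, x)) (snd (c, x))) (vt (fst (t, x)) (snd (t, x))) < e / 2"
        by (rule k(2)) (use c(1) h x in \<open>auto simp: dist_Pair_Pair dist_real_def\<close>)
      then show ?thesis using c(2) h by (simp add: dist_real_def)
    qed
    have "\<forall>\<^sub>F h in at 0. h \<noteq> 0 \<and> \<bar>h\<bar> < min k 1"
      unfolding eventually_at using k(1) by (intro exI[of _ "min k 1"]) (auto simp: dist_real_def)
    then show "\<forall>\<^sub>F h in at 0. dist (nH (\<lambda>x. (v (t + h) x - v t x) / h - vt t x)) 0 < e"
    proof eventually_elim
      case (elim h)
      have "memH (\<lambda>x. (v (t + h) x - v t x) / h - vt t x)"
        by (intro memH_diff memH_divide memH_continuous cv cvt')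
      then have "nH (\<lambda>x. (v (t + h) x - v t x) / h - vt t x) \<le> \<bar>e / 2\<bar>"
        by (intro nH_bound memH_measurable AE_mu_I key) (use elim in auto)
      then show ?case using e by simp
    qed
  qed
  then show ?thesis using mt by (simp add: hasDerivH_def)
qed

text \<open>The pointwise inequality v_t - v_xx <= 0 for e^(-alpha t) h^3. With D^2 = R^2 - h a
  factor h splits off and the rest is at most -alpha h^2 + M h - 24 Rm^2. The 12 k in
  \<open>M\<close> comes from the speeds, the 30 is 24 + 6 from the second derivative, and
  \<open>\<alpha>\<close> makes the discriminant of this quadratic vanish.\<close>

lemma subsolution_inequality:
  fixes h R D R' c' k Rm M \<alpha> :: real
  assumes h: "0 < h" "h = R^2 - D^2" and Rm: "0 < Rm" "Rm \<le> R" "R \<le> 1" and D: "\<bar>D\<bar> \<le> 1"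
    and k: "\<bar>R'\<bar> \<le> k" "\<bar>c'\<bar> \<le> k" and M: "M = 12 * k + 30" and \<alpha>: "\<alpha> = M^2 / (96 * Rm^2)"
  shows "- \<alpha> * h^3 + 3 * h^2 * (2 * R * R' + 2 * D * c') - (24 * h * D^2 - 6 * h^2) \<le> 0"
proof -
  have R1: "R * R' \<le> k"
  proof -
    have "\<bar>R * R'\<bar> \<le> 1 * k" unfolding abs_mult using Rm k by (intro mult_mono) auto
    then show ?thesis by simp
  qed
  have D1: "D * c' \<le> k"
  proof -
    have "\<bar>D * c'\<bar> \<le> 1 * k" unfolding abs_mult using D k by (intro mult_mono) auto
    then show ?thesis by simp
  qed
  have "h * (6 * (R * R') + 6 * (D * c') + 30) \<le> h * M" using h R1 D1 M by (intro mult_left_mono) auto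
  moreover have "M * h - \<alpha> * h^2 \<le> 24 * Rm^2"
  proof -
    have "0 \<le> (M * h - 48 * Rm^2)^2" by simp
    also have "\<dots> = 96 * Rm^2 * (\<alpha> * h^2 - M * h + 24 * Rm^2)"
      using Rm by (simp add: \<alpha> power2_eq_square field_simps)
    finally have "0 \<le> \<alpha> * h^2 - M * h + 24 * Rm^2" using Rm by (simp add: zero_le_mult_iff)
    then show ?thesis by simp
  qed
  moreover have "Rm^2 \<le> R^2" using Rm by (intro power_mono) auto
  ultimately have "- \<alpha> * h^2 + h * (6 * (R * R') + 6 * (D * c') + 30) - 24 * R^2 \<le> 0" by (simp add: algebra_simps)
  then have "h * (- \<alpha> * h^2 + h * (6 * (R * R') + 6 * (D * c') + 30) - 24 * R^2) \<le> 0"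
    using h by (simp add: mult_nonneg_nonpos)
  moreover have D2: "D^2 = R^2 - h" using h by simp
  have "- \<alpha> * h^3 + 3 * h^2 * (2 * R * R' + 2 * D * c') - (24 * h * D^2 - 6 * h^2)
     = h * (- \<alpha> * h^2 + h * (6 * (R * R') + 6 * (D * c') + 30) - 24 * R^2)"
    unfolding D2 by (simp add: power2_eq_square power3_eq_cube algebra_simps)
  ultimately show ?thesis by simp
qed

lemma max0_power3_deriv: "((\<lambda>y. (max 0 y)^3) has_real_derivative 3 * (max 0 y)^2) (at (y::real))"
  by (rule has_derivative_positive_part[where \<phi>="\<lambda>y. y^3" and \<phi>'="\<lambda>y. 3 * y^2"]) (auto intro!: derivative_eq_intros)

lemma max0_power2_deriv: "((\<lambda>y. (max 0 y)^2) has_real_derivative 2 * max 0 y) (at (y::real))"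
  by (rule has_derivative_positive_part[where \<phi>="\<lambda>y. y^2" and \<phi>'="\<lambda>y. 2 * y"]) (auto intro!: derivative_eq_intros)

text \<open>A compactly supported subsolution \<open>\<kappa> e\<^bsup>-\<alpha>(t-t0)\<^esup> (R(t)\<^sup>2 - (x-c(t))\<^sup>2)\<^sub>+\<^sup>3\<close> of the heat equation whose support moves
  linearly from \<open>[x0-\<delta>,x0+\<delta>]\<close> to \<open>[a,1-a]\<close>.\<close>
lemma spreading_subsolution:
  fixes t0 T x0 \<delta> \<kappa> a :: real
  assumes T: "t0 < T" and x0: "0 < \<delta>" "\<delta> \<le> x0" "x0 + \<delta> \<le> 1" and \<kappa>: "0 < \<kappa>" and a: "0 < a" "a < 1/2"
  obtains v vt :: "real \<Rightarrow> real \<Rightarrow> real" where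
    "\<And>t s. ((\<lambda>t. v t s) has_real_derivative vt t s) (at t)"
    "\<And>t. continuous_on {0..1} (v t)" "continuous_on UNIV (\<lambda>p. vt (fst p) (snd p))"
    "\<And>t. t0 < t \<Longrightarrow> t < T \<Longrightarrow> \<exists>w. isA (v t) w \<and> (\<forall>s. 0 < s \<longrightarrow> s < 1 \<longrightarrow> vt t s + w s \<le> 0)"
    "\<And>s. 0 < s \<Longrightarrow> s < 1 \<Longrightarrow> v t0 s \<le> (if \<bar>s - x0\<bar> < \<delta> then \<kappa> else 0)"
    "\<And>s. a < s \<Longrightarrow> s < 1 - a \<Longrightarrow> 0 < v T s"
proof -
  \<comment> \<open>In normalised time the centre and the radius each travel a distance at most 1,
    so \<open>k\<close> bounds both speeds. \<open>Rm\<close> bounds the radius from below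
    throughout, because the radius interpolates linearly between its end values.\<close>
  define k where "k = 1 / (T - t0)"
  define Rm where "Rm = min \<delta> (1/2 - a)"
  define M where "M = 12 * k + 30"
  define \<alpha> where "\<alpha> = M^2 / (96 * Rm^2)"
  define \<theta> where "\<theta> t = (t - t0) * k" for t
  define R where "R t = \<delta> + \<theta> t * (1/2 - a - \<delta>)" for t
  define c where "c t = x0 + \<theta> t * (1/2 - x0)" for t
  define R' where "R' = k * (1/2 - a - \<delta>)"
  define c' where "c' = k * (1/2 - x0)"
  define h where "h t s = (R t)^2 - (s - c t)^2" for t s
  define ht where "ht t s = 2 * R t * R' + 2 * (s - c t) * c'" for t s
  define E where "E t = \<kappa> * exp (- \<alpha> * (t - t0))" for t
  \<comment> \<open>The third power makes the positive part twice continuously differentiable, so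
    \<open>v t\<close> lies in D(A) with continuous second derivative. The ball never leaves [0,1],
    which gives the boundary values.\<close>
  define v where "v t s = E t * (max 0 (h t s))^3" for t s
  define vt where "vt t s = E t * (- \<alpha> * (max 0 (h t s))^3 + 3 * (max 0 (h t s))^2 * ht t s)" for t s
  have k: "k > 0" using T by (simp add: k_def)
  have d\<theta>: "(\<theta> has_real_derivative k) (at t)" for t
    unfolding \<theta>_def by (auto intro!: derivative_eq_intros)
  have dR: "(R has_real_derivative R') (at t)" for t
    unfolding R_def R'_def by (auto intro!: derivative_eq_intros d\<theta>)
  have dc: "(c has_real_derivative c') (at t)" for t
    unfolding c_def c'_def by (auto intro!: derivative_eq_intros d\<theta>)
  have dh: "((\<lambda>t. h t s) has_real_derivative ht t s) (at t)" for t s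
    unfolding h_def ht_def by (auto intro!: derivative_eq_intros dR dc)
  have dE: "(E has_real_derivative - \<alpha> * E t) (at t)" for t
    unfolding E_def by (auto intro!: derivative_eq_intros)
  have dh3: "((\<lambda>t. (max 0 (h t s))^3) has_real_derivative 3 * (max 0 (h t s))^2 * ht t s) (at t)" for t s
    by (rule DERIV_chain2[OF max0_power3_deriv dh])
  have dv: "((\<lambda>t. v t s) has_real_derivative vt t s) (at t)" for t s
    unfolding v_def vt_def by (rule DERIV_cong[OF DERIV_mult[OF dE dh3]]) (simp add: algebra_simps)
  have cv: "continuous_on {0..1} (v t)" for t
    unfolding v_def h_def by (intro continuous_intros)
  have cvt: "continuous_on UNIV (\<lambda>p. vt (fst p) (snd p))"
    unfolding vt_def h_def ht_def E_def R_def c_def \<theta>_def by (intro continuous_intros)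
  have \<theta>1: "0 \<le> \<theta> t" "\<theta> t \<le> 1" if "t0 \<le> t" "t \<le> T" for t
    using that T by (auto simp: \<theta>_def k_def divide_simps)
  have Rb: "Rm \<le> R t" "R t \<le> 1" "R t \<le> c t" "c t + R t \<le> 1" if "t0 \<le> t" "t \<le> T" for t
  proof -
    note th = \<theta>1[OF that]
    have "(1 - \<theta> t) * Rm + \<theta> t * Rm \<le> (1 - \<theta> t) * \<delta> + \<theta> t * (1/2 - a)"
      using th by (intro add_mono mult_left_mono) (auto simp: Rm_def)
    then show "Rm \<le> R t" by (simp add: R_def algebra_simps)
    have "0 \<le> (1 - \<theta> t) * (x0 - \<delta>) + \<theta> t * a"
      using th x0 a by (intro add_nonneg_nonneg mult_nonneg_nonneg) auto
    then show 1: "R t \<le> c t" by (simp add: R_def c_def algebra_simps)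
    have "0 \<le> (1 - \<theta> t) * (1 - x0 - \<delta>) + \<theta> t * a"
      using th x0 a by (intro add_nonneg_nonneg mult_nonneg_nonneg) auto
    then show 2: "c t + R t \<le> 1" by (simp add: R_def c_def algebra_simps)
    have "0 \<le> (1 - \<theta> t) * \<delta> + \<theta> t * (1/2 - a)"
      using th x0 a by (intro add_nonneg_nonneg mult_nonneg_nonneg) auto
    then have "0 \<le> R t" by (simp add: R_def algebra_simps)
    then show "R t \<le> 1" using 1 2 by linarith
  qed
  have Rm: "Rm > 0" using x0 a by (simp add: Rm_def)
  have R'b: "\<bar>R'\<bar> \<le> k" "\<bar>c'\<bar> \<le> k"
    using k x0 a by (auto simp: R'_def c'_def abs_mult intro!: mult_left_le)
  have sub: "\<exists>w. isA (v t) w \<and> (\<forall>s. 0 < s \<longrightarrow> s < 1 \<longrightarrow> vt t s + w s \<le> 0)" if t: "t0 < t" "t < T" for t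
  proof -
    have t': "t0 \<le> t" "t \<le> T" using t by auto
    define g1 where "g1 s = E t * (3 * (max 0 (h t s))^2 * (- 2 * (s - c t)))" for s
    define g2 where "g2 s = E t * (3 * (2 * max 0 (h t s) * (- 2 * (s - c t))) * (- 2 * (s - c t)) + 3 * (max 0 (h t s))^2 * (- 2))" for s
    have dhs: "(h t has_real_derivative - 2 * (s - c t)) (at s within {0..1})" for s
      unfolding h_def by (auto intro!: derivative_eq_intros)
    have d3: "((\<lambda>s. (max 0 (h t s))^3) has_real_derivative 3 * (max 0 (h t s))^2 * (- 2 * (s - c t))) (at s within {0..1})" for s
      by (rule DERIV_chain2[OF max0_power3_deriv dhs])
    have d2: "((\<lambda>s. (max 0 (h t s))^2) has_real_derivative 2 * max 0 (h t s) * (- 2 * (s - c t))) (at s within {0..1})" for s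
      by (rule DERIV_chain2[OF max0_power2_deriv dhs])
    have A: "isA (v t) (\<lambda>s. - g2 s)"
    proof (rule isA_C2)
      show "(v t has_real_derivative g1 s) (at s within {0..1})" for s
        unfolding v_def g1_def by (rule DERIV_cmult[OF d3])
      have "((\<lambda>s. 3 * (max 0 (h t s))^2 * (- 2 * (s - c t))) has_real_derivative
         3 * (2 * max 0 (h t s) * (- 2 * (s - c t))) * (- 2 * (s - c t)) + 3 * (max 0 (h t s))^2 * (- 2)) (at s within {0..1})" for s
      proof -
        have "((\<lambda>s. - 2 * (s - c t)) has_real_derivative - 2) (at s within {0..1})"
          by (auto intro!: derivative_eq_intros)
        from DERIV_mult[OF DERIV_cmult[OF d2] this] show ?thesis by (rule DERIV_cong) simp
      qed
      then show "(g1 has_real_derivative g2 s) (at s within {0..1})" for s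
        unfolding g1_def g2_def by (rule DERIV_cmult)
      show "continuous_on {0..1} g2"
        unfolding g2_def h_def by (intro continuous_intros)
      have "(R t)^2 \<le> (c t)^2" "(R t)^2 \<le> (1 - c t)^2"
        using Rb[OF t'] Rm by (intro power_mono; linarith)+
      then show "v t 0 = 0" "v t 1 = 0" by (auto simp: v_def h_def)
    qed
    have "vt t s - g2 s \<le> 0" if s: "0 < s" "s < 1" for s
    proof (cases "0 < h t s")
      case False
      then show ?thesis by (simp add: vt_def g2_def)
    next
      case True
      have D: "\<bar>s - c t\<bar> \<le> 1" using s Rb[OF t'] Rm by auto
      have "- \<alpha> * (h t s)^3 + 3 * (h t s)^2 * (2 * R t * R' + 2 * (s - c t) * c') - (24 * h t s * (s - c t)^2 - 6 * (h t s)^2) \<le> 0"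
        by (rule subsolution_inequality[OF True _ Rm Rb(1,2)[OF t'] D R'b M_def \<alpha>_def]) (simp add: h_def)
      then have "E t * (- \<alpha> * (h t s)^3 + 3 * (h t s)^2 * (2 * R t * R' + 2 * (s - c t) * c') - (24 * h t s * (s - c t)^2 - 6 * (h t s)^2)) \<le> 0"
        using \<kappa> by (simp add: E_def mult_nonneg_nonpos)
      moreover have "vt t s - g2 s = E t * (- \<alpha> * (h t s)^3 + 3 * (h t s)^2 * (2 * R t * R' + 2 * (s - c t) * c') - (24 * h t s * (s - c t)^2 - 6 * (h t s)^2))"
        using True by (simp add: vt_def g2_def ht_def power2_eq_square algebra_simps)
      ultimately show ?thesis by simp
    qed
    then show ?thesis using A by (intro exI[of _ "\<lambda>s. - g2 s"]) auto
  qed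
  have init: "v t0 s \<le> (if \<bar>s - x0\<bar> < \<delta> then \<kappa> else 0)" for s
  proof -
    have h0: "h t0 s = \<delta>^2 - (s - x0)^2" by (simp add: h_def R_def c_def \<theta>_def)
    have "max 0 (h t0 s) \<le> 1"
    proof -
      have "\<delta>^2 \<le> 1" using x0 by (intro power_le_one) auto
      moreover have "0 \<le> (s - x0)^2" by simp
      ultimately have "h t0 s \<le> 1" unfolding h0 by linarith
      then show ?thesis by simp
    qed
    then have "(max 0 (h t0 s))^3 \<le> 1" by (intro power_le_one) auto
    then have 1: "v t0 s \<le> \<kappa>" using \<kappa> by (simp add: v_def E_def mult_left_le)
    have "h t0 s \<le> 0" if "\<not> \<bar>s - x0\<bar> < \<delta>"
      using that x0 power_mono[of \<delta> "\<bar>s - x0\<bar>" 2] by (simp add: h0)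
    then show ?thesis using 1 by (auto simp: v_def)
  qed
  have fin: "0 < v T s" if "a < s" "s < 1 - a" for s
  proof -
    have "\<theta> T = 1" using T by (simp add: \<theta>_def k_def)
    then have h1: "h T s = (1/2 - a)^2 - (s - 1/2)^2" by (simp add: h_def R_def c_def)
    have "\<bar>s - 1/2\<bar> < 1/2 - a" using that by (simp add: abs_less_iff)
    then have "\<bar>s - 1/2\<bar>^2 < (1/2 - a)^2" by (intro power_strict_mono) auto
    then have "0 < h T s" by (simp add: h1)
    then show ?thesis using \<kappa> by (simp add: v_def E_def)
  qed
  show ?thesis by (rule that[OF dv cv cvt sub init fin])
qed

text \<open>The common regularity of solutions, smooth subsolutions and sine series, and what
  \<open>comparison\<close> asks for: continuity from the right at the initial time, absolute
  continuity only strictly after it.\<close>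

definition regH :: "real \<Rightarrow> (real \<Rightarrow> fn) \<Rightarrow> bool" where
  "regH \<tau> u \<longleftrightarrow> (\<forall>t\<ge>\<tau>. memH (u t)) \<and> ((\<lambda>t. nH (\<lambda>x. u t x - u \<tau> x)) \<longlongrightarrow> 0) (at_right \<tau>) \<and>
     (\<forall>T1 T2. \<tau> < T1 \<longrightarrow> T1 < T2 \<longrightarrow> abscontH T1 T2 u)"

lemma regH_diff:
  assumes "regH \<tau> u" "regH \<tau> v" shows "regH \<tau> (\<lambda>t x. u t x - v t x)"
  unfolding regH_def
proof (intro conjI allI impI)
  have m: "memH (u t)" "memH (v t)" if "t \<ge> \<tau>" for t using assms that by (auto simp: regH_def)
  show "memH (\<lambda>x. u t x - v t x)" if "t \<ge> \<tau>" for t using m[OF that] by simp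
  show "abscontH T1 T2 (\<lambda>t x. u t x - v t x)" if "\<tau> < T1" "T1 < T2" for T1 T2
    by (rule abscontH_diff) (use assms that m in \<open>auto simp: regH_def\<close>)
  have l: "((\<lambda>t. nH (\<lambda>x. u t x - u \<tau> x) + nH (\<lambda>x. v t x - v \<tau> x)) \<longlongrightarrow> 0) (at_right \<tau>)"
    using tendsto_add[of "\<lambda>t. nH (\<lambda>x. u t x - u \<tau> x)" 0 _ "\<lambda>t. nH (\<lambda>x. v t x - v \<tau> x)" 0] assms by (auto simp: regH_def)
  show "((\<lambda>t. nH (\<lambda>x. u t x - v t x - (u \<tau> x - v \<tau> x))) \<longlongrightarrow> 0) (at_right \<tau>)"
  proof (rule Lim_null_comparison[OF _ l])
    have "\<forall>\<^sub>F t in at_right \<tau>. \<tau> < t" by (simp add: eventually_at_right_less)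
    then show "\<forall>\<^sub>F t in at_right \<tau>. norm (nH (\<lambda>x. u t x - v t x - (u \<tau> x - v \<tau> x))) \<le> nH (\<lambda>x. u t x - u \<tau> x) + nH (\<lambda>x. v t x - v \<tau> x)"
    proof eventually_elim
      case (elim t)
      have "nH (\<lambda>x. (u t x - u \<tau> x) - (v t x - v \<tau> x)) \<le> nH (\<lambda>x. u t x - u \<tau> x) + nH (\<lambda>x. v t x - v \<tau> x)"
        by (rule nH_triangle_diff) (use m elim in auto)
      moreover have "(\<lambda>x. (u t x - u \<tau> x) - (v t x - v \<tau> x)) = (\<lambda>x. u t x - v t x - (u \<tau> x - v \<tau> x))" by auto
      ultimately show ?case by simp
    qed
  qed
qed

lemma regH_C1_time:
  assumes d: "\<And>t s. ((\<lambda>t. v t s) has_real_derivative vt t s) (at t)"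
    and cv: "\<And>t. continuous_on {0..1} (v t)"
    and cvt: "continuous_on UNIV (\<lambda>p. vt (fst p) (snd p))"
  shows "regH \<tau> v"
  unfolding regH_def
proof (intro conjI allI impI)
  show "memH (v t)" for t by (rule memH_continuous[OF cv])
  show "abscontH T1 T2 v" for T1 T2
    by (rule C1_time_lipschitz[OF d cv cvt, of T1 T2]) (rule abscontH_lipschitz)
  obtain L where L: "L \<ge> 0" "\<And>s t. \<tau> \<le> s \<Longrightarrow> s \<le> t \<Longrightarrow> t \<le> \<tau> + 1 \<Longrightarrow> nH (\<lambda>x. v t x - v s x) \<le> L * (t - s)"
    by (rule C1_time_lipschitz[OF d cv cvt, of \<tau> "\<tau> + 1"]) (rule that)
  show "((\<lambda>t. nH (\<lambda>x. v t x - v \<tau> x)) \<longlongrightarrow> 0) (at_right \<tau>)"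
  proof (rule Lim_null_comparison)
    have "\<forall>\<^sub>F t in at_right \<tau>. \<tau> < t \<and> t < \<tau> + 1"
      unfolding eventually_at_right_field by (intro exI[of _ "\<tau> + 1"]) auto
    then show "\<forall>\<^sub>F t in at_right \<tau>. norm (nH (\<lambda>x. v t x - v \<tau> x)) \<le> L * (t - \<tau>)"
      by eventually_elim (simp add: L)
    have "((\<lambda>t. L * (t - \<tau>)) \<longlongrightarrow> L * (\<tau> - \<tau>)) (at_right \<tau>)" by (intro tendsto_intros)
    then show "((\<lambda>t. L * (t - \<tau>)) \<longlongrightarrow> 0) (at_right \<tau>)" by simp
  qed
qed

section \<open>Strong positivity and exponential decay\<close>

lemma regH_sol: "sol \<sigma> \<tau> x u \<Longrightarrow> regH \<tau> u"
  unfolding regH_def sol_def using contH_tendsto[of \<tau> u] by (auto simp: contH_def)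

lemma sol_eq:
  assumes "sol \<sigma> \<tau> x u"
  shows "AE t in lborel. t > \<tau> \<longrightarrow> (\<exists>u' w. hasDerivH u u' t \<and> isA (u t) w \<and>
    (AE s in mu. u' s + w s \<in> (\<lambda>z. fst \<sigma> t * z + snd \<sigma> t * u t s) ` H0 (u t s)))"
proof -
  obtain r where r: "AE t in lborel. t > \<tau> \<longrightarrow>
           ae01 (\<lambda>s. r t s \<in> (\<lambda>z. fst \<sigma> t * z + snd \<sigma> t * u t s) ` H0 (u t s))"
       "AE t in lborel. t > \<tau> \<longrightarrow>
           (\<exists>u' w. hasDerivH u u' t \<and> isA (u t) w \<and> ae01 (\<lambda>s. u' s + w s = r t s))"
    using assms unfolding sol_def by blast
  from r show ?thesis
  proof eventually_elim
    case (elim t)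
    show ?case
    proof
      assume "t > \<tau>"
      then obtain u' w where H: "hasDerivH u u' t" "isA (u t) w" "AE s in mu. u' s + w s = r t s"
        and R: "AE s in mu. r t s \<in> (\<lambda>z. fst \<sigma> t * z + snd \<sigma> t * u t s) ` H0 (u t s)"
        using elim by (auto simp: ae01_mu)
      from H(3) R have "AE s in mu. u' s + w s \<in> (\<lambda>z. fst \<sigma> t * z + snd \<sigma> t * u t s) ` H0 (u t s)"
        by eventually_elim simp
      then show "\<exists>u' w. hasDerivH u u' t \<and> isA (u t) w \<and>
        (AE s in mu. u' s + w s \<in> (\<lambda>z. fst \<sigma> t * z + snd \<sigma> t * u t s) ` H0 (u t s))" using H by blast
    qed
  qed
qed

lemma eventually_nhds_greater: "(\<tau>::real) < t \<Longrightarrow> \<forall>\<^sub>F s in nhds t. \<tau> < s"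
  using eventually_nhds_in_open[of "{\<tau><..}" t] by simp

text \<open>The inclusion becomes an equation with a determined source: where u > 0 the set
  \<open>H0\<close> is a singleton, and on the contact set \<open>nonneg_contact_set\<close> makes
  the left side vanish.\<close>

lemma nonneg_source:
  assumes s: "sol \<sigma> \<tau> x u" and nn: "\<And>t. t \<ge> \<tau> \<Longrightarrow> AE s in mu. 0 \<le> u t s"
  shows "AE t in lborel. t > \<tau> \<longrightarrow> (\<exists>u' w. hasDerivH u u' t \<and> isA (u t) w \<and>
    (AE s in mu. u' s + w s = (if u t s = 0 then 0 else fst \<sigma> t + snd \<sigma> t * u t s)))"
  using sol_eq[OF s]
proof eventually_elim
  case (elim t)
  show ?case
  proof
    assume t: "t > \<tau>"
    then obtain u' w where H: "hasDerivH u u' t" "isA (u t) w"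
      "AE s in mu. u' s + w s \<in> (\<lambda>z. fst \<sigma> t * z + snd \<sigma> t * u t s) ` H0 (u t s)" using elim by auto
    have e: "\<forall>\<^sub>F s in nhds t. \<tau> < s" by (rule eventually_nhds_greater[OF t])
    have "\<forall>\<^sub>F s in nhds t. memH (u s)"
      using e by eventually_elim (use regH_sol[OF s] in \<open>simp add: regH_def\<close>)
    moreover have "\<forall>\<^sub>F s in nhds t. (AE x in mu. 0 \<le> u s x)"
      using e by eventually_elim (simp add: nn)
    ultimately have "AE x in mu. u t x = 0 \<longrightarrow> u' x + w x = 0"
      by (rule nonneg_contact_set[OF H(1,2)])
    moreover have "AE x in mu. 0 \<le> u t x" using nn t by simp
    ultimately have "AE s in mu. u' s + w s = (if u t s = 0 then 0 else fst \<sigma> t + snd \<sigma> t * u t s)"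
      using H(3) by eventually_elim (auto simp: H0_def split: if_splits)
    then show "\<exists>u' w. hasDerivH u u' t \<and> isA (u t) w \<and>
       (AE s in mu. u' s + w s = (if u t s = 0 then 0 else fst \<sigma> t + snd \<sigma> t * u t s))" using H by blast
  qed
qed

lemma AE_lborel_interval:
  assumes P: "AE t in lborel. P t" and ab: "a < (b::real)"
  obtains t where "a < t" "t < b" "P t"
proof (rule ccontr)
  assume "\<not> thesis"
  then have "\<And>t. a < t \<Longrightarrow> t < b \<Longrightarrow> \<not> P t" using that by blast
  then have "AE t in lborel. t \<notin> {a<..<b}" using P by (auto elim!: eventually_mono)
  then have "emeasure lborel {a<..<b} = 0"
    by (subst (asm) AE_iff_measurable[of "{a<..<b}"]) auto
  then show False using ab by simp
qed

text \<open>A spreading subsolution is placed below a bump of \<open>u\<close> and compared by means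
  of the entropy \<open>Fp\<close>, which sees only the region where the subsolution exceeds
  \<open>u\<close>. Each subsolution gives positivity on (a, 1 - a); countably many values of a
  exhaust (0,1).\<close>

lemma strong_positivity:
  assumes u: "regH \<tau> u" and nn: "\<And>t. t \<ge> \<tau> \<Longrightarrow> AE s in mu. 0 \<le> u t s"
    and eq: "AE t in lborel. t > \<tau> \<longrightarrow> (\<exists>u' w. hasDerivH u u' t \<and> isA (u t) w \<and> (AE s in mu. 0 \<le> u' s + w s))"
    and nz: "\<not> (AE s in mu. u \<tau> s = 0)" and t: "\<tau> < t"
  shows "AE s in mu. 0 < u t s"
proof -
  have m: "memH (u s)" if "s \<ge> \<tau>" for s using u that by (simp add: regH_def)
  have "nH (u \<tau>) \<noteq> 0" using nz nH_eq_0[OF m[OF order_refl]] by blast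
  then have pos: "nH (u \<tau>) > 0" using nH_nonneg[of "u \<tau>"] by linarith
  have "((\<lambda>t. nH (\<lambda>x. u t x - u \<tau> x)) \<longlongrightarrow> 0) (at_right \<tau>)" using u by (simp add: regH_def)
  from order_tendstoD(2)[OF this pos] obtain d where d: "d > \<tau>"
    "\<And>s. \<tau> < s \<Longrightarrow> s < d \<Longrightarrow> nH (\<lambda>x. u s x - u \<tau> x) < nH (u \<tau>)"
    unfolding eventually_at_right_field by auto
  \<comment> \<open>The time t0 has to be close enough to the initial time for the state to be still
    nonzero, and generic enough for the state to lie in D(A), which supplies a continuous
    representative and thus a bump.\<close>
  have "\<tau> < min d t" using d t by simp
  from AE_lborel_interval[OF eq this] obtain t0 where t1: "\<tau> < t0" "t0 < min d t"
    "t0 > \<tau> \<longrightarrow> (\<exists>u' w. hasDerivH u u' t0 \<and> isA (u t0) w \<and> (AE s in mu. 0 \<le> u' s + w s))" by blast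
  have t0: "\<tau> < t0" "t0 < d" "t0 < t" using t1 by auto
  obtain w where w: "isA (u t0) w" using t1 by blast
  obtain g g1 g2 where H: "memH (u t0)" "memH w" "memH g2" "acd 0 1 g1 g2" "continuous_on {0..1} g1"
    "\<And>x. x \<in> {0..1} \<Longrightarrow> (g has_real_derivative g1 x) (at x within {0..1})"
    "g 0 = 0" "g 1 = 0" "AE s in mu. u t0 s = g s" "AE s in mu. w s = - g2 s"
    by (rule isA_E[OF w]) (rule that)
  have gc: "continuous_on {0..1} g" by (rule DERIV_continuous_on[OF H(6)])
  have "AE s in mu. 0 \<le> u t0 s" using nn t0 by simp
  then have "AE s in mu. 0 \<le> g s" using H(9) by eventually_elim simp
  then have gnn: "0 \<le> g x" if "0 < x" "x < 1" for x by (rule AE_mu_continuous_nonneg[OF gc _ that])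
  have "\<exists>x0. 0 < x0 \<and> x0 < 1 \<and> g x0 > 0"
  proof (rule ccontr)
    assume "\<not> ?thesis"
    then have "g x = 0" if "0 < x" "x < 1" for x using gnn[OF that] that by force
    then have "AE s in mu. g s = 0" by (intro AE_mu_I)
    then have "AE s in mu. u t0 s = 0" using H(9) by eventually_elim simp
    then have "nH (u t0) = 0" by (rule nH_zero_AE)
    moreover have "nH (u \<tau>) \<le> nH (u t0) + nH (\<lambda>x. u t0 x - u \<tau> x)"
      using nH_triangle_rev[OF m[of \<tau>] m[of t0]] t0 nH_minus_commute[of "u \<tau>" "u t0"] by simp
    ultimately show False using d(2)[of t0] t0 by simp
  qed
  then obtain x0 where x0: "0 < x0" "x0 < 1" "g x0 > 0" by auto
  define \<kappa> where "\<kappa> = g x0 / 2"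
  have \<kappa>: "\<kappa> > 0" "\<kappa> < g x0" using x0 by (auto simp: \<kappa>_def)
  have "isCont g x0" using continuous_on_interior[OF gc, of x0] x0 by (simp add: interior_atLeastAtMost_real)
  then have "\<forall>\<^sub>F y in nhds x0. \<kappa> < g y"
    using \<kappa> by (simp add: isCont_def tendsto_at_iff_tendsto_nhds order_tendstoD)
  then obtain \<delta>0 where \<delta>0: "\<delta>0 > 0" "\<And>y. dist y x0 < \<delta>0 \<Longrightarrow> \<kappa> < g y" unfolding eventually_nhds_metric by auto
  define \<delta> where "\<delta> = min \<delta>0 (min x0 (1 - x0))"
  have \<delta>: "0 < \<delta>" "\<delta> \<le> x0" "x0 + \<delta> \<le> 1" using \<delta>0 x0 by (auto simp: \<delta>_def)
  have gk: "\<kappa> < g y" if "\<bar>y - x0\<bar> < \<delta>" for y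
    using \<delta>0(2)[of y] that by (simp add: \<delta>_def dist_real_def)
  have loc: "AE s in mu. a < s \<and> s < 1 - a \<longrightarrow> 0 < u t s" if a: "0 < a" "a < 1/2" for a
  proof -
    obtain v vt :: "real \<Rightarrow> real \<Rightarrow> real" where v:
      "\<And>t s. ((\<lambda>t. v t s) has_real_derivative vt t s) (at t)"
      "\<And>t. continuous_on {0..1} (v t)" "continuous_on UNIV (\<lambda>p. vt (fst p) (snd p))"
      and vs: "\<And>r. t0 < r \<Longrightarrow> r < t \<Longrightarrow> \<exists>w. isA (v r) w \<and> (\<forall>s. 0 < s \<longrightarrow> s < 1 \<longrightarrow> vt r s + w s \<le> 0)"
      and v0: "\<And>s. 0 < s \<Longrightarrow> s < 1 \<Longrightarrow> v t0 s \<le> (if \<bar>s - x0\<bar> < \<delta> then \<kappa> else 0)"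
      and v1: "\<And>s. a < s \<Longrightarrow> s < 1 - a \<Longrightarrow> 0 < v t s"
      by (rule spreading_subsolution[OF t0(3) \<delta> \<kappa>(1) a]) (rule that)
    have rv: "regH t0 v" by (rule regH_C1_time[OF v])
    have mv: "memH (v s)" for s by (rule memH_continuous[OF v(2)])
    \<comment> \<open>After the initial time, continuity from the right is a consequence of absolute
      continuity on [t0, t0 + 1].\<close>
    have ru: "regH t0 u"
      unfolding regH_def
    proof (intro conjI allI impI)
      show "memH (u s)" if "s \<ge> t0" for s using m that t0 by simp
      show "abscontH T1 T2 u" if "t0 < T1" "T1 < T2" for T1 T2 using u that t0 by (simp add: regH_def)
      have "abscontH t0 (t0 + 1) u" using u t0 by (simp add: regH_def)
      show "((\<lambda>t. nH (\<lambda>x. u t x - u t0 x)) \<longlongrightarrow> 0) (at_right t0)"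
      proof (rule tendstoI)
        fix e :: real assume e: "e > 0"
        obtain d where d: "d > 0" "\<And>a c. t0 \<le> a \<Longrightarrow> a \<le> c \<Longrightarrow> c \<le> t0 + 1 \<Longrightarrow> c - a < d \<Longrightarrow> nH (\<lambda>x. u c x - u a x) < e"
          by (rule abscontH_small[OF \<open>abscontH t0 (t0 + 1) u\<close> e]) (rule that)
        have "\<forall>\<^sub>F s in at_right t0. t0 < s \<and> s < t0 + min d 1"
          unfolding eventually_at_right_field using d(1) by (intro exI[of _ "t0 + min d 1"]) auto
        then show "\<forall>\<^sub>F s in at_right t0. dist (nH (\<lambda>x. u s x - u t0 x)) 0 < e"
          by eventually_elim (use d(2)[of t0] in auto)
      qed
    qed
    have rz: "regH t0 (\<lambda>t x. v t x - u t x)" by (rule regH_diff[OF rv ru])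
    \<comment> \<open>The growth rate is 0 here: \<open>v\<close> is a subsolution and
      \<open>u\<close> a supersolution of the pure heat equation, so the sign of \<open>fp\<close>
      suffices. The initial entropy is 0 because \<open>v\<close> starts below
      \<open>u\<close>.\<close>
    have "posp.J (\<lambda>x. v t x - u t x) \<le> exp (- (pi^2 - 0) * (t - t0)) * posp.J (\<lambda>x. v t0 x - u t0 x)"
    proof (rule posp.comparison)
      show "AE r in lborel. t0 < r \<and> r < t \<longrightarrow> (\<exists>z' wz. hasDerivH (\<lambda>t x. v t x - u t x) z' r \<and> isA (\<lambda>x. v r x - u r x) wz \<and>
        (AE s in mu. (z' s + wz s) * fp ((v r s - u r s) / sin (pi * s)) \<le> 0 * ((v r s - u r s) * fp ((v r s - u r s) / sin (pi * s)))))"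
        using eq
      proof eventually_elim
        case (elim r)
        show ?case
        proof
          assume r: "t0 < r \<and> r < t"
          then obtain u' wu where U: "hasDerivH u u' r" "isA (u r) wu" "AE s in mu. 0 \<le> u' s + wu s"
            using elim t0 by auto
          obtain wv where V: "isA (v r) wv" "\<And>s. 0 < s \<Longrightarrow> s < 1 \<Longrightarrow> vt r s + wv s \<le> 0" using vs r by blast
          have "\<forall>\<^sub>F s in nhds r. t0 < s" by (rule eventually_nhds_greater) (use r in simp)
          then have mu: "\<forall>\<^sub>F s in nhds r. memH (u s)" by eventually_elim (use m t0 in simp)
          have D: "hasDerivH (\<lambda>t x. v t x - u t x) (\<lambda>x. vt r x - u' x) r"
            by (rule hasDerivH_diff[OF C1_time_hasDerivH[OF v] U(1) _ mu]) (simp add: mv)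
          have A: "isA (\<lambda>x. v r x - u r x) (\<lambda>x. wv x - wu x)" by (rule isA_diff[OF V(1) U(2)])
          have "AE s in mu. vt r s + wv s \<le> 0" by (intro AE_mu_I V(2))
          with U(3) have "AE s in mu. ((vt r s - u' s) + (wv s - wu s)) * fp ((v r s - u r s) / sin (pi * s)) \<le> 0 * ((v r s - u r s) * fp ((v r s - u r s) / sin (pi * s)))"
          proof eventually_elim
            case (elim s)
            have "0 \<le> fp ((v r s - u r s) / sin (pi * s))"
              using fp_pos fp_neg by (metis less_eq_real_def linorder_not_less)
            then show ?case using elim by (simp add: mult_nonpos_nonneg)
          qed
          then show "\<exists>z' wz. hasDerivH (\<lambda>t x. v t x - u t x) z' r \<and> isA (\<lambda>x. v r x - u r x) wz \<and>
            (AE s in mu. (z' s + wz s) * fp ((v r s - u r s) / sin (pi * s)) \<le> 0 * ((v r s - u r s) * fp ((v r s - u r s) / sin (pi * s))))"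
            using D A by blast
        qed
      qed
    qed (use rz t0 in \<open>auto simp: regH_def\<close>)
    moreover have "posp.J (\<lambda>x. v t0 x - u t0 x) = 0"
    proof (rule posp_J_zero)
      have "AE s in mu. v t0 s \<le> (if \<bar>s - x0\<bar> < \<delta> then \<kappa> else 0)" by (intro AE_mu_I v0)
      moreover have "AE s in mu. 0 \<le> u t0 s" using nn t0 by simp
      ultimately show "AE s in mu. v t0 s - u t0 s \<le> 0"
        using H(9)
      proof eventually_elim
        case (elim s)
        then show ?case using gk[of s] by (cases "\<bar>s - x0\<bar> < \<delta>") auto
      qed
    qed
    ultimately have "AE s in mu. v t s - u t s \<le> 0"
      using m t0 mv by (intro posp_J_zero_D) auto
    then show ?thesis by eventually_elim (use v1 in force)
  qed
  \<comment> \<open>The offset 3 keeps a below 1/2 for every n; countability allows the exceptional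
    null sets to be united.\<close>
  have "AE s in mu. \<forall>n. 1 / (real n + 3) < s \<and> s < 1 - 1 / (real n + 3) \<longrightarrow> 0 < u t s"
    unfolding AE_all_countable by (intro allI loc) (auto simp: field_simps)
  moreover have "AE s in mu. 0 < s \<and> s < 1" by (rule AE_mu_I) simp
  ultimately show ?thesis
  proof eventually_elim
    case (elim s)
    define q where "q = min s (1 - s)"
    have q: "q > 0" using elim(2) by (simp add: q_def)
    obtain n where "1 / q < real n" using reals_Archimedean2 by blast
    then have "1 / q < real n + 3" by simp
    then have "1 / (real n + 3) < q"
      using q by (simp add: divide_less_eq mult.commute)
    then show ?case using elim(1)[rule_format, of n] by (simp add: q_def)
  qed
qed

text \<open>The common source cancels in the difference, which solves the homogeneous equation with
  potential at most \<open>\<omega>1\<close>; the quadratic entropy then gives the rate for the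
  squared norm.\<close>

lemma linear_decay:
  assumes u: "regH \<tau> u" and X: "regH \<tau> X" and w: "\<And>t. \<omega> t \<le> \<omega>1" "\<omega>1 \<le> pi^2" and b: "\<tau> \<le> b"
    and equ: "AE t in lborel. t > \<tau> \<longrightarrow> (\<exists>u' w. hasDerivH u u' t \<and> isA (u t) w \<and> (AE s in mu. u' s + w s = \<beta> t + \<omega> t * u t s))"
    and eqX: "AE t in lborel. t > \<tau> \<longrightarrow> (\<exists>u' w. hasDerivH X u' t \<and> isA (X t) w \<and> (AE s in mu. u' s + w s = \<beta> t + \<omega> t * X t s))"
  shows "nH (\<lambda>s. u b s - X b s)^2 \<le> exp (- (pi^2 - \<omega>1) * (b - \<tau>)) * nH (\<lambda>s. u \<tau> s - X \<tau> s)^2"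
proof -
  have m: "memH (u s)" "memH (X s)" if "s \<ge> \<tau>" for s using u X that by (auto simp: regH_def)
  have rz: "regH \<tau> (\<lambda>t x. u t x - X t x)" by (rule regH_diff[OF u X])
  have "quad.J (\<lambda>x. u b x - X b x) \<le> exp (- (pi^2 - \<omega>1) * (b - \<tau>)) * quad.J (\<lambda>x. u \<tau> x - X \<tau> x)"
  proof (rule quad.comparison)
    show "AE t in lborel. \<tau> < t \<and> t < b \<longrightarrow> (\<exists>z' w. hasDerivH (\<lambda>t x. u t x - X t x) z' t \<and> isA (\<lambda>x. u t x - X t x) w \<and>
       (AE s in mu. (z' s + w s) * ((u t s - X t s) / sin (pi * s)) \<le> \<omega>1 * ((u t s - X t s) * ((u t s - X t s) / sin (pi * s)))))"
      using equ eqX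
    proof eventually_elim
      case (elim t)
      show ?case
      proof
        assume t: "\<tau> < t \<and> t < b"
        then obtain u' wu where U: "hasDerivH u u' t" "isA (u t) wu" "AE s in mu. u' s + wu s = \<beta> t + \<omega> t * u t s" using elim by blast
        obtain x' wx where V: "hasDerivH X x' t" "isA (X t) wx" "AE s in mu. x' s + wx s = \<beta> t + \<omega> t * X t s" using elim t by blast
        have e: "\<forall>\<^sub>F s in nhds t. \<tau> < s" by (rule eventually_nhds_greater) (use t in simp)
        have mu: "\<forall>\<^sub>F s in nhds t. memH (u s)" using e by eventually_elim (use m in simp)
        have mx: "\<forall>\<^sub>F s in nhds t. memH (X s)" using e by eventually_elim (use m in simp)
        have D: "hasDerivH (\<lambda>t x. u t x - X t x) (\<lambda>x. u' x - x' x) t" by (rule hasDerivH_diff[OF U(1) V(1) mu mx])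
        have A: "isA (\<lambda>x. u t x - X t x) (\<lambda>x. wu x - wx x)" by (rule isA_diff[OF U(2) V(2)])
        have "AE s in mu. 0 < sin (pi * s)" by (intro AE_mu_I sin_pi_pos)
        with U(3) V(3) have "AE s in mu. ((u' s - x' s) + (wu s - wx s)) * ((u t s - X t s) / sin (pi * s)) \<le> \<omega>1 * ((u t s - X t s) * ((u t s - X t s) / sin (pi * s)))"
        proof eventually_elim
          case (elim s)
          define z where "z = u t s - X t s"
          have "(u' s - x' s) + (wu s - wx s) = \<omega> t * z" using elim(1,2) by (simp add: z_def algebra_simps)
          moreover have "\<omega> t * (z * (z / sin (pi * s))) \<le> \<omega>1 * (z * (z / sin (pi * s)))"
            using w(1) elim(3) by (intro mult_right_mono) auto
          ultimately show ?case by (simp add: z_def mult.assoc)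
        qed
        then show "\<exists>z' w. hasDerivH (\<lambda>t x. u t x - X t x) z' t \<and> isA (\<lambda>x. u t x - X t x) w \<and>
         (AE s in mu. (z' s + w s) * ((u t s - X t s) / sin (pi * s)) \<le> \<omega>1 * ((u t s - X t s) * ((u t s - X t s) / sin (pi * s))))"
          using D A by blast
      qed
    qed
  qed (use rz w b in \<open>auto simp: regH_def\<close>)
  then show ?thesis using m b by (simp add: quad_J)
qed

text \<open>After strong positivity the multivalued term is single-valued almost everywhere.\<close>
lemma nonneg_sol_linear:
  assumes s: "sol \<sigma> \<tau> x u" and nn: "\<And>t. t \<ge> \<tau> \<Longrightarrow> AE s in mu. 0 \<le> u t s"
    and nz: "\<not> (AE s in mu. u \<tau> s = 0)" and b: "\<And>t. 0 \<le> fst \<sigma> t" "\<And>t. 0 \<le> snd \<sigma> t"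
  shows "AE t in lborel. t > \<tau> \<longrightarrow> (\<exists>u' w. hasDerivH u u' t \<and> isA (u t) w \<and> (AE s in mu. u' s + w s = fst \<sigma> t + snd \<sigma> t * u t s))"
    and "\<And>t. t > \<tau> \<Longrightarrow> AE s in mu. 0 < u t s"
proof -
  have src: "AE t in lborel. t > \<tau> \<longrightarrow> (\<exists>u' w. hasDerivH u u' t \<and> isA (u t) w \<and>
    (AE s in mu. u' s + w s = (if u t s = 0 then 0 else fst \<sigma> t + snd \<sigma> t * u t s)))"
    by (rule nonneg_source[OF s nn])
  have eq: "AE t in lborel. t > \<tau> \<longrightarrow> (\<exists>u' w. hasDerivH u u' t \<and> isA (u t) w \<and> (AE s in mu. 0 \<le> u' s + w s))"
    using src
  proof eventually_elim
    case (elim t)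
    show ?case
    proof
      assume t: "t > \<tau>"
      then obtain u' w where H: "hasDerivH u u' t" "isA (u t) w"
        "AE s in mu. u' s + w s = (if u t s = 0 then 0 else fst \<sigma> t + snd \<sigma> t * u t s)" using elim by blast
      have "AE s in mu. 0 \<le> u t s" using nn t by simp
      with H(3) have "AE s in mu. 0 \<le> u' s + w s" by eventually_elim (use b in simp)
      then show "\<exists>u' w. hasDerivH u u' t \<and> isA (u t) w \<and> (AE s in mu. 0 \<le> u' s + w s)" using H by blast
    qed
  qed
  show pos: "AE s in mu. 0 < u t s" if "t > \<tau>" for t
    by (rule strong_positivity[OF regH_sol[OF s] nn eq nz that])
  show "AE t in lborel. t > \<tau> \<longrightarrow> (\<exists>u' w. hasDerivH u u' t \<and> isA (u t) w \<and> (AE s in mu. u' s + w s = fst \<sigma> t + snd \<sigma> t * u t s))"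
    using src
  proof eventually_elim
    case (elim t)
    show ?case
    proof
      assume t: "t > \<tau>"
      then obtain u' w where H: "hasDerivH u u' t" "isA (u t) w"
        "AE s in mu. u' s + w s = (if u t s = 0 then 0 else fst \<sigma> t + snd \<sigma> t * u t s)" using elim by blast
      have "AE s in mu. u' s + w s = fst \<sigma> t + snd \<sigma> t * u t s"
        using H(3) pos[OF t] by eventually_elim simp
      then show "\<exists>u' w. hasDerivH u u' t \<and> isA (u t) w \<and> (AE s in mu. u' s + w s = fst \<sigma> t + snd \<sigma> t * u t s)" using H by blast
    qed
  qed
qed

section \<open>Sine series\<close>

lemma Liminf_le_bound:
  fixes f :: "nat \<Rightarrow> ennreal"
  assumes "\<forall>\<^sub>F n in sequentially. f n \<le> C" shows "liminf f \<le> C"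
  by (rule Liminf_le[OF _ assms]) simp

text \<open>On a finite measure space an L2-Cauchy sequence is L1-Cauchy and has an a.e. convergent
  subsequence. Its limit is square integrable and is the L2 limit by Fatou's lemma applied to the
  squared differences.\<close>

lemma L2_complete:
  assumes m: "\<And>n. memH (f n)" and C: "\<And>e. e > 0 \<Longrightarrow> \<exists>N. \<forall>i\<ge>N. \<forall>j\<ge>N. nH (\<lambda>x. f i x - f j x) < e"
  obtains g where "memH g" "(\<lambda>n. nH (\<lambda>x. g x - f n x)) \<longlonglongrightarrow> 0"
proof -
  have fm: "f n \<in> borel_measurable mu" for n using m by (rule memH_measurable)
  have fi: "integrable mu (f n)" for n using m by (rule memH_integrable)
  have "\<exists>N. \<forall>i\<ge>N. \<forall>j\<ge>N. (LINT x|mu. norm (f i x - f j x)) < e" if e: "e > 0" for e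
  proof -
    obtain N where N: "\<forall>i\<ge>N. \<forall>j\<ge>N. nH (\<lambda>x. f i x - f j x) < e" using C[OF e] by blast
    have "(LINT x|mu. norm (f i x - f j x)) < e" if "i \<ge> N" "j \<ge> N" for i j
    proof -
      have "(LINT x|mu. \<bar>f i x - f j x\<bar>) \<le> nH (\<lambda>x. \<bar>f i x - f j x\<bar>)"
        using integral_mu_le_nH[of "\<lambda>x. \<bar>f i x - f j x\<bar>"] m by simp
      also have "\<dots> < e" using N that by simp
      finally show ?thesis by simp
    qed
    then show ?thesis by blast
  qed
  then obtain r where r: "strict_mono r" "AE x in mu. Cauchy (\<lambda>i. f (r i) x)"
    using cauchy_L1_AE_cauchy_subseq[of mu f, OF fi] by blast
  define g where "g x = lim (\<lambda>i. f (r i) x)" for x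
  have gm: "g \<in> borel_measurable mu" unfolding g_def by (rule borel_measurable_lim_metric) (rule fm)
  have conv: "AE x in mu. (\<lambda>i. f (r i) x) \<longlonglongrightarrow> g x"
    using r(2) by eventually_elim (simp add: g_def Cauchy_convergent convergent_LIMSEQ_iff[symmetric])
  have est: "(\<integral>\<^sup>+x. ennreal ((g x - f n x)^2) \<partial>mu) \<le> ennreal (e^2)"
    if e: "e > 0" and N: "\<forall>i\<ge>N. \<forall>j\<ge>N. nH (\<lambda>x. f i x - f j x) < e" and n: "n \<ge> N" for e N n
  proof -
    have "(\<integral>\<^sup>+x. ennreal ((g x - f n x)^2) \<partial>mu) = (\<integral>\<^sup>+x. liminf (\<lambda>i. ennreal ((f (r i) x - f n x)^2)) \<partial>mu)"
    proof (rule nn_integral_cong_AE)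
      show "AE x in mu. ennreal ((g x - f n x)^2) = liminf (\<lambda>i. ennreal ((f (r i) x - f n x)^2))"
        using conv
      proof eventually_elim
        case (elim x)
        have "(\<lambda>i. ennreal ((f (r i) x - f n x)^2)) \<longlonglongrightarrow> ennreal ((g x - f n x)^2)"
          by (intro tendsto_ennrealI tendsto_intros elim)
        then show ?case by (intro lim_imp_Liminf[symmetric]) auto
      qed
    qed
    also have "\<dots> \<le> liminf (\<lambda>i. \<integral>\<^sup>+x. ennreal ((f (r i) x - f n x)^2) \<partial>mu)"
      by (intro nn_integral_liminf measurable_compose[OF _ measurable_ennreal] borel_measurable_integrable memH_sq memH_diff m)
    also have "\<dots> \<le> ennreal (e^2)"
    proof (rule Liminf_le_bound)
      have "\<forall>\<^sub>F i in sequentially. i \<ge> N" by (rule eventually_ge_at_top)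
      then show "\<forall>\<^sub>F i in sequentially. (\<integral>\<^sup>+x. ennreal ((f (r i) x - f n x)^2) \<partial>mu) \<le> ennreal (e^2)"
      proof eventually_elim
        case (elim i)
        then have "r i \<ge> N" using seq_suble[OF r(1), of i] by linarith
        then have "nH (\<lambda>x. f (r i) x - f n x) < e" using N n by blast
        then have "nH (\<lambda>x. f (r i) x - f n x)^2 \<le> e^2" by (intro power_mono) auto
        moreover have "(\<integral>\<^sup>+x. ennreal ((f (r i) x - f n x)^2) \<partial>mu) = ennreal (nH (\<lambda>x. f (r i) x - f n x)^2)"
          unfolding nH_sq using m by (intro nn_integral_eq_integral memH_sq memH_diff) auto
        ultimately show ?case by (simp add: ennreal_leI)
      qed
    qed
    finally show ?thesis .
  qed
  have dH: "memH (\<lambda>x. g x - f n x) \<and> nH (\<lambda>x. g x - f n x) \<le> e"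
    if e: "e > 0" and N: "\<forall>i\<ge>N. \<forall>j\<ge>N. nH (\<lambda>x. f i x - f j x) < e" and n: "n \<ge> N" for e N n
  proof -
    note E = est[OF that]
    have i: "integrable mu (\<lambda>x. (g x - f n x)^2)"
    proof (rule integrableI_nonneg)
      show "(\<integral>\<^sup>+x. ennreal ((g x - f n x)^2) \<partial>mu) < \<infinity>" using E by (rule le_less_trans) simp
      show "(\<lambda>x. (g x - f n x)^2) \<in> borel_measurable mu" by (intro borel_measurable_power borel_measurable_diff gm fm)
    qed simp
    then have mm: "memH (\<lambda>x. g x - f n x)"
      unfolding memH_mu by (intro conjI borel_measurable_diff gm fm)
    have "ennreal (nH (\<lambda>x. g x - f n x)^2) \<le> ennreal (e^2)"
      unfolding nH_sq using E nn_integral_eq_integral[OF i] by simp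
    then have "nH (\<lambda>x. g x - f n x)^2 \<le> e^2" by simp
    then have "nH (\<lambda>x. g x - f n x) \<le> e" by (rule power2_le_imp_le) (rule less_imp_le[OF e])
    then show ?thesis using mm by simp
  qed
  obtain N where N: "\<forall>i\<ge>N. \<forall>j\<ge>N. nH (\<lambda>x. f i x - f j x) < 1" using C[of 1] by auto
  have "memH (\<lambda>x. (g x - f N x) + f N x)" using dH[OF _ N order_refl] m by (intro memH_add) auto
  then have gH: "memH g" by simp
  have "(\<lambda>n. nH (\<lambda>x. g x - f n x)) \<longlonglongrightarrow> 0"
  proof (rule tendstoI)
    fix e :: real assume e: "e > 0"
    obtain N where N: "\<forall>i\<ge>N. \<forall>j\<ge>N. nH (\<lambda>x. f i x - f j x) < e / 2" using C[of "e/2"] e by auto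
    have "\<forall>\<^sub>F n in sequentially. n \<ge> N" by (rule eventually_ge_at_top)
    then show "\<forall>\<^sub>F n in sequentially. dist (nH (\<lambda>x. g x - f n x)) 0 < e"
      by eventually_elim (use dH[OF _ N] e in force)
  qed
  then show ?thesis using that gH by blast
qed

section \<open>Odd sine functions, their orthogonality and expansions\<close>

definition kap :: "nat \<Rightarrow> real" where "kap j = (2 * real j + 1) * pi"
definition sn :: "nat \<Rightarrow> real \<Rightarrow> real" where "sn j x = sin (kap j * x)"

lemma kap_pos [simp]: "0 < kap j" by (simp add: kap_def)
lemma kap_ne [simp]: "kap j \<noteq> 0" using kap_pos[of j] by linarith
lemma kap_ge: "pi \<le> kap j" by (simp add: kap_def)
lemma kap_ge_j: "real j + 1 \<le> kap j"
proof -
  have "real j + 1 \<le> (2 * real j + 1) * 1" by simp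
  also have "\<dots> \<le> (2 * real j + 1) * pi" using pi_gt3 by (intro mult_left_mono) auto
  finally show ?thesis by (simp add: kap_def)
qed

lemma sin_kap [simp]: "sin (kap j) = 0" and cos_kap [simp]: "cos (kap j) = - 1"
proof -
  have "kap j = real (2 * j + 1) * pi" by (simp add: kap_def)
  then show "sin (kap j) = 0" "cos (kap j) = - 1"
    by (simp_all only: sin_npi cos_npi) simp
qed

lemma memH_sn [simp]: "memH (sn j)"
  unfolding sn_def by (rule memH_continuous) (intro continuous_intros)

lemma sums_inverse_squares: "(\<lambda>n. 1 / (real n + 1)^2) sums (pi^2 / 6)"
proof -
  have "(\<lambda>n. 1 / real ((n + 1)^2)) = (\<lambda>n. 1 / (real n + 1)^2)" by (simp add: fun_eq_iff add.commute)
  then show ?thesis using inverse_squares_sums by simp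
qed

lemma summable_inverse_kap2: "summable (\<lambda>j. (1 / kap j)^2)"
proof (rule summable_comparison_test')
  show "summable (\<lambda>j. 1 / (real j + 1)^2)" using sums_inverse_squares by (rule sums_summable)
  show "norm ((1 / kap j)^2) \<le> 1 / (real j + 1)^2" for j
    using kap_ge_j[of j] by (simp add: power_divide frac_le power_mono)
qed

lemma integral_mu_FTC:
  assumes "\<And>x. x \<in> {0..1} \<Longrightarrow> (F has_real_derivative f x) (at x within {0..1})" "continuous_on {0..1} f"
  shows "(\<integral>x. f x \<partial>mu) = F 1 - F 0"
proof -
  have "(\<integral>x. f x \<partial>mu) = (\<integral>x. indicator I01 x * f x \<partial>lborel)" by (rule integral_mu[symmetric])
  also have "\<dots> = (\<integral>x. indicator {0..1} x * f x \<partial>lborel)"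
  proof (rule integral_cong_AE)
    show "AE x in lborel. indicator I01 x * f x = indicator {0..1} x * f x"
      using AE_lborel_singleton[of 0] AE_lborel_singleton[of 1]
      by eventually_elim (auto simp: indicator_def I01_def)
    show "(\<lambda>x. indicator I01 x * f x) \<in> borel_measurable lborel"
      by (rule measurable_mu[THEN iffD2, OF memH_measurable[OF memH_continuous[OF assms(2)]]])
    show "(\<lambda>x. indicator {0..1} x * f x) \<in> borel_measurable lborel"
      using borel_integrable_atLeastAtMost'[OF assms(2)] by (auto simp: set_integrable_def)
  qed
  also have "\<dots> = F 1 - F 0"
    using acd_eq[OF acd_C1[OF _ assms], of 1] by simp
  finally show ?thesis .
qed

lemma integral_cos_even: assumes "k \<noteq> 0" shows "(\<integral>x. cos (2 * of_int k * pi * x) \<partial>mu) = 0"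
proof -
  have "(\<integral>x. cos (2 * of_int k * pi * x) \<partial>mu) = sin (2 * of_int k * pi * 1) / (2 * of_int k * pi) - sin (2 * of_int k * pi * 0) / (2 * of_int k * pi)"
    using assms by (intro integral_mu_FTC) (auto intro!: derivative_eq_intros continuous_intros)
  moreover have "sin (2 * of_int k * pi) = 0" using sin_int_2pin[of k] by (simp add: mult_ac)
  ultimately show ?thesis by simp
qed

text \<open>The product formula leaves cosines with 2(i - j) and 2(i + j + 1) half-periods. The
  second number is never 0, which is where oddness of the frequencies enters, and the first is 0
  only on the diagonal.\<close>

lemma sn_orthogonal: "(\<integral>x. sn i x * sn j x \<partial>mu) = (if i = j then 1 / 2 else 0)"
proof -
  have eq: "sn i x * sn j x = (cos (2 * of_int (int i - int j) * pi * x) - cos (2 * of_int (int i + int j + 1) * pi * x)) / 2" for x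
  proof -
    have "2 * of_int (int i - int j) * pi * x = kap i * x - kap j * x" "2 * of_int (int i + int j + 1) * pi * x = kap i * x + kap j * x"
      by (simp_all add: kap_def algebra_simps)
    then show ?thesis by (simp add: sn_def sin_times_sin)
  qed
  have i: "integrable mu (\<lambda>x. cos (c * x))" for c :: real
    by (intro memH_integrable memH_continuous continuous_intros)
  have "(\<integral>x. sn i x * sn j x \<partial>mu) = ((\<integral>x. cos (2 * of_int (int i - int j) * pi * x) \<partial>mu) - (\<integral>x. cos (2 * of_int (int i + int j + 1) * pi * x) \<partial>mu)) / 2"
    unfolding eq using i by simp
  also have "(\<integral>x. cos (2 * of_int (int i + int j + 1) * pi * x) \<partial>mu) = 0" by (rule integral_cos_even) linarith
  also have "(\<integral>x. cos (2 * of_int (int i - int j) * pi * x) \<partial>mu) = (if i = j then 1 else 0)"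
  proof (cases "i = j")
    case True
    have "measure mu I01 = 1" using emeasure_mu by (simp add: measure_def)
    then show ?thesis using True by simp
  next
    case False then show ?thesis using integral_cos_even[of "int i - int j"] by simp
  qed
  finally show ?thesis by (cases "i = j") auto
qed

lemma nH_sine_sum: assumes "finite A" shows "nH (\<lambda>x. \<Sum>j\<in>A. d j * sn j x)^2 = (\<Sum>j\<in>A. (d j)^2) / 2"
proof -
  have "(\<Sum>j\<in>A. d j * sn j x)^2 = (\<Sum>i\<in>A. \<Sum>j\<in>A. d i * d j * (sn i x * sn j x))" for x
    by (simp add: power2_eq_square sum_product mult_ac)
  then have "nH (\<lambda>x. \<Sum>j\<in>A. d j * sn j x)^2 = (\<integral>x. (\<Sum>i\<in>A. \<Sum>j\<in>A. d i * d j * (sn i x * sn j x)) \<partial>mu)"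
    by (simp add: nH_sq)
  also have "\<dots> = (\<Sum>i\<in>A. \<Sum>j\<in>A. d i * d j * (\<integral>x. sn i x * sn j x \<partial>mu))"
    by (subst Bochner_Integration.integral_sum; (subst Bochner_Integration.integral_sum)?) (auto intro!: Bochner_Integration.integrable_sum integrable_mult_right memH_mult)
  also have "\<dots> = (\<Sum>i\<in>A. (d i)^2 / 2)"
    using assms by (auto simp: sn_orthogonal power2_eq_square if_distrib cong: if_cong intro!: sum.cong)
  finally show ?thesis by (simp add: sum_divide_distrib)
qed

text \<open>Only odd frequencies are needed because the forcing is constant in space.\<close>
definition sine_series :: "(nat \<Rightarrow> real) \<Rightarrow> (real \<Rightarrow> real) \<Rightarrow> bool" where
  "sine_series d f \<longleftrightarrow> memH f \<and> (\<lambda>n. nH (\<lambda>x. f x - (\<Sum>j<n. d j * sn j x))) \<longlonglongrightarrow> 0"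

lemma memH_sine_sum [simp]: "memH (\<lambda>x. \<Sum>j\<in>A. d j * sn j x)"
  by (intro memH_sum memH_cmult memH_sn)

lemma sine_series_exists:
  assumes "summable (\<lambda>j. (d j)^2)" obtains f where "sine_series d f"
proof -
  let ?S = "\<lambda>n x. \<Sum>j<n. d j * sn j x"
  have diff: "nH (\<lambda>x. ?S n x - ?S m x)^2 = (\<Sum>j=m..<n. (d j)^2) / 2" if "m \<le> n" for m n
  proof -
    have "(\<lambda>x. ?S n x - ?S m x) = (\<lambda>x. \<Sum>j\<in>{m..<n}. d j * sn j x)"
      using sum_diff_nat_ivl[of 0 m n "\<lambda>j. d j * sn j _"] that by (auto simp: lessThan_atLeast0)
    then show ?thesis using nH_sine_sum[of "{m..<n}" d] by simp
  qed
  have "\<exists>N. \<forall>i\<ge>N. \<forall>j\<ge>N. nH (\<lambda>x. ?S i x - ?S j x) < e" if e: "e > 0" for e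
  proof -
    obtain N where N: "\<And>m n. m \<ge> N \<Longrightarrow> norm (\<Sum>j=m..<n. (d j)^2) < e^2"
      using summable_Cauchy[of "\<lambda>j. (d j)^2"] assms e by (meson zero_less_power)
    have le: "nH (\<lambda>x. ?S n x - ?S m x) < e" if "N \<le> m" "m \<le> n" for m n
    proof -
      have "nH (\<lambda>x. ?S n x - ?S m x)^2 \<le> (\<Sum>j=m..<n. (d j)^2)"
        unfolding diff[OF that(2)] by (simp add: sum_nonneg)
      also have "\<dots> < e^2" using N[OF that(1), of n] by simp
      finally show ?thesis using e by (simp add: power2_less_imp_less)
    qed
    have "nH (\<lambda>x. ?S i x - ?S j x) < e" if "i \<ge> N" "j \<ge> N" for i j
      using le[of i j] le[of j i] that nH_minus_commute[of "?S i" "?S j"] by (cases "i \<le> j") auto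
    then show ?thesis by blast
  qed
  from L2_complete[of ?S, OF memH_sine_sum this] obtain f where "memH f" "(\<lambda>n. nH (\<lambda>x. f x - ?S n x)) \<longlonglongrightarrow> 0"
    by blast
  then show ?thesis using that by (simp add: sine_series_def)
qed

text \<open>Bessel's bound with the factor 1/2 dropped. The hypothesis concerns partial sums, which
  is the form that \<open>tannery_bound\<close> and \<open>square_summable\<close> deliver.\<close>

lemma sine_series_norm:
  assumes s: "sine_series d f" and B: "\<And>n. (\<Sum>j<n. (d j)^2) \<le> B" shows "nH f ^ 2 \<le> B"
proof -
  have f: "memH f" "(\<lambda>n. nH (\<lambda>x. f x - (\<Sum>j<n. d j * sn j x))) \<longlonglongrightarrow> 0" using s by (auto simp: sine_series_def)
  have B0: "B \<ge> 0" using B[of 0] by simp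
  have "nH f \<le> sqrt B + nH (\<lambda>x. f x - (\<Sum>j<n. d j * sn j x))" for n
  proof -
    have "nH (\<lambda>x. \<Sum>j<n. d j * sn j x)^2 \<le> B"
      using B[of n] by (simp add: nH_sine_sum sum_nonneg order_trans[OF divide_right_mono])
         (smt (verit) sum_nonneg zero_le_power2)
    then have "nH (\<lambda>x. \<Sum>j<n. d j * sn j x) \<le> sqrt B" by (rule real_le_rsqrt)
    then show ?thesis using nH_triangle_rev[OF f(1) memH_sine_sum, of d "{..<n}"] by linarith
  qed
  moreover have "(\<lambda>n. sqrt B + nH (\<lambda>x. f x - (\<Sum>j<n. d j * sn j x))) \<longlonglongrightarrow> sqrt B + 0"
    by (intro tendsto_intros f)
  ultimately have "nH f \<le> sqrt B" using LIMSEQ_le_const[of _ "sqrt B + 0" "nH f"] by auto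
  then have "nH f ^ 2 \<le> sqrt B ^ 2" by (intro power_mono) auto
  then show ?thesis using B0 by simp
qed

lemma sine_series_add:
  assumes "sine_series d f" "sine_series e g" shows "sine_series (\<lambda>j. d j + e j) (\<lambda>x. f x + g x)"
proof -
  have f: "memH f" "(\<lambda>n. nH (\<lambda>x. f x - (\<Sum>j<n. d j * sn j x))) \<longlonglongrightarrow> 0" using assms by (auto simp: sine_series_def)
  have g: "memH g" "(\<lambda>n. nH (\<lambda>x. g x - (\<Sum>j<n. e j * sn j x))) \<longlonglongrightarrow> 0" using assms by (auto simp: sine_series_def)
  have "(\<lambda>n. nH (\<lambda>x. f x + g x - (\<Sum>j<n. (d j + e j) * sn j x))) \<longlonglongrightarrow> 0"
  proof (rule Lim_null_comparison)
    show "(\<lambda>n. nH (\<lambda>x. f x - (\<Sum>j<n. d j * sn j x)) + nH (\<lambda>x. g x - (\<Sum>j<n. e j * sn j x))) \<longlonglongrightarrow> 0"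
      using tendsto_add[OF f(2) g(2)] by simp
    have "nH (\<lambda>x. f x + g x - (\<Sum>j<n. (d j + e j) * sn j x)) \<le> nH (\<lambda>x. f x - (\<Sum>j<n. d j * sn j x)) + nH (\<lambda>x. g x - (\<Sum>j<n. e j * sn j x))" for n
    proof -
      have "(\<lambda>x. f x + g x - (\<Sum>j<n. (d j + e j) * sn j x)) = (\<lambda>x. (f x - (\<Sum>j<n. d j * sn j x)) + (g x - (\<Sum>j<n. e j * sn j x)))"
        by (auto simp: fun_eq_iff sum.distrib ring_distribs)
      then show ?thesis using nH_triangle[of "\<lambda>x. f x - (\<Sum>j<n. d j * sn j x)" "\<lambda>x. g x - (\<Sum>j<n. e j * sn j x)"] f g by simp
    qed
    then show "\<forall>\<^sub>F n in sequentially. norm (nH (\<lambda>x. f x + g x - (\<Sum>j<n. (d j + e j) * sn j x))) \<le>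
       nH (\<lambda>x. f x - (\<Sum>j<n. d j * sn j x)) + nH (\<lambda>x. g x - (\<Sum>j<n. e j * sn j x))" by simp
  qed
  then show ?thesis using f g by (simp add: sine_series_def)
qed

lemma sine_series_cmult:
  assumes "sine_series d f" shows "sine_series (\<lambda>j. c * d j) (\<lambda>x. c * f x)"
proof -
  have f: "memH f" "(\<lambda>n. nH (\<lambda>x. f x - (\<Sum>j<n. d j * sn j x))) \<longlonglongrightarrow> 0" using assms by (auto simp: sine_series_def)
  have "nH (\<lambda>x. c * f x - (\<Sum>j<n. c * d j * sn j x)) = \<bar>c\<bar> * nH (\<lambda>x. f x - (\<Sum>j<n. d j * sn j x))" for n
    unfolding nH_cmult[symmetric] by (simp add: right_diff_distrib sum_distrib_left mult_ac)
  moreover have "(\<lambda>n. \<bar>c\<bar> * nH (\<lambda>x. f x - (\<Sum>j<n. d j * sn j x))) \<longlonglongrightarrow> 0"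
    using tendsto_mult[OF tendsto_const f(2), of "\<bar>c\<bar>"] by simp
  ultimately show ?thesis using f by (simp add: sine_series_def)
qed

lemma sine_series_diff:
  assumes "sine_series d f" "sine_series e g" shows "sine_series (\<lambda>j. d j - e j) (\<lambda>x. f x - g x)"
  using sine_series_add[OF assms(1) sine_series_cmult[OF assms(2), of "-1"]] by simp

text \<open>The way equations between functions are verified: it is enough that all coefficients of
  the difference vanish.\<close>

lemma sine_series_zero:
  assumes "sine_series (\<lambda>_. 0) f" shows "AE x in mu. f x = 0"
proof -
  have f: "memH f" "(\<lambda>n. nH f) \<longlonglongrightarrow> 0" using assms by (auto simp: sine_series_def)
  then have "nH f = 0" using LIMSEQ_unique[OF f(2) tendsto_const] by simp
  then show ?thesis by (rule nH_eq_0[OF f(1)])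
qed

lemma abs_sn_le [simp]: "\<bar>sn j x\<bar> \<le> 1" by (simp add: sn_def)

lemma sine_series_absolute:
  assumes s: "summable (\<lambda>j. \<bar>d j\<bar>)" shows "sine_series d (\<lambda>x. \<Sum>j. d j * sn j x)"
proof -
  have sx: "summable (\<lambda>j. d j * sn j x)" for x
    by (rule summable_comparison_test'[OF s]) (simp add: abs_mult mult_left_le)
  let ?f = "\<lambda>x. \<Sum>j. d j * sn j x"
  have fm: "?f \<in> borel_measurable mu"
    by (rule borel_measurable_suminf) (rule memH_measurable[OF memH_cmult[OF memH_sn]])
  have tail: "\<bar>?f x - (\<Sum>j<n. d j * sn j x)\<bar> \<le> (\<Sum>j. \<bar>d (j + n)\<bar>)" for x n
  proof -
    have "?f x - (\<Sum>j<n. d j * sn j x) = (\<Sum>j. d (j + n) * sn (j + n) x)"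
      using suminf_minus_initial_segment[OF sx] by simp
    also have "\<bar>\<dots>\<bar> \<le> (\<Sum>j. \<bar>d (j + n)\<bar>)"
    proof (rule order_trans[OF summable_rabs])
      have sm: "summable (\<lambda>j. \<bar>d (j + n)\<bar>)" using s by (rule summable_ignore_initial_segment)
      show s2: "summable (\<lambda>j. \<bar>d (j + n) * sn (j + n) x\<bar>)"
        by (rule summable_comparison_test'[OF sm]) (simp add: abs_mult mult_left_le)
      show "(\<Sum>j. \<bar>d (j + n) * sn (j + n) x\<bar>) \<le> (\<Sum>j. \<bar>d (j + n)\<bar>)"
        by (rule suminf_le[OF _ s2 sm]) (simp add: abs_mult mult_left_le)
    qed
    finally show ?thesis .
  qed
  have fH: "memH ?f"
    by (rule memH_bounded[OF fm, of "\<Sum>j. \<bar>d (j + 0)\<bar>"]) (use tail[of _ 0] in simp)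
  have "(\<lambda>n. nH (\<lambda>x. ?f x - (\<Sum>j<n. d j * sn j x))) \<longlonglongrightarrow> 0"
  proof (rule Lim_null_comparison)
    show "(\<lambda>n. \<Sum>j. \<bar>d (j + n)\<bar>) \<longlonglongrightarrow> 0" by (rule suminf_exist_split2[OF s])
    have "nH (\<lambda>x. ?f x - (\<Sum>j<n. d j * sn j x)) \<le> \<bar>\<Sum>j. \<bar>d (j + n)\<bar>\<bar>" for n
    proof (rule nH_bound)
      show "(\<lambda>x. ?f x - (\<Sum>j<n. d j * sn j x)) \<in> borel_measurable mu"
        by (intro memH_measurable memH_diff fH memH_sine_sum)
    qed (use tail in simp)
    moreover have "0 \<le> (\<Sum>j. \<bar>d (j + n)\<bar>)" for n
      by (rule suminf_nonneg[OF summable_ignore_initial_segment[OF s]]) simp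
    ultimately show "\<forall>\<^sub>F n in sequentially. norm (nH (\<lambda>x. ?f x - (\<Sum>j<n. d j * sn j x))) \<le> (\<Sum>j. \<bar>d (j + n)\<bar>)"
      by simp
  qed
  then show ?thesis using fH by (simp add: sine_series_def)
qed

text \<open>Pairing consecutive terms of the series for pi^2/6 separates odd and even denominators;
  the even ones contribute a quarter of the whole, pi^2/24.\<close>

lemma sums_odd_squares: "(\<lambda>j. 1 / (2 * real j + 1)^2) sums (pi^2 / 8)"
proof -
  have "(\<lambda>n. 1 / (real n + 1)^2) sums (pi^2 / 6)" by (rule sums_inverse_squares)
  then have "(\<lambda>n. \<Sum>i\<in>{n * 2..<n * 2 + 2}. 1 / (real i + 1)^2) sums (pi^2 / 6)"
    by (rule sums_group) simp
  moreover have "(\<Sum>i\<in>{n * 2..<n * 2 + 2}. 1 / (real i + 1)^2) = 1 / (2 * real n + 1)^2 + 1 / (2 * real n + 2)^2" for n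
  proof -
    have "{n * 2..<n * 2 + 2} = {n * 2, n * 2 + 1}" by auto
    then show ?thesis by (simp add: add_ac mult.commute)
  qed
  ultimately have 1: "(\<lambda>n. 1 / (2 * real n + 1)^2 + 1 / (2 * real n + 2)^2) sums (pi^2 / 6)" by simp
  have "(\<lambda>n. (1/4) * (1 / (real n + 1)^2)) sums ((1/4) * (pi^2 / 6))"
    by (intro sums_mult sums_inverse_squares)
  moreover have "(1/4) * (1 / (real n + 1)^2) = 1 / (2 * real n + 2)^2" for n
  proof -
    have "(2 * real n + 2)^2 = 4 * (real n + 1)^2" by (simp add: power2_eq_square algebra_simps)
    then show ?thesis by simp
  qed
  ultimately have "(\<lambda>n. 1 / (2 * real n + 2)^2) sums (pi^2 / 24)" by simp
  from sums_diff[OF 1 this] show ?thesis by simp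
qed

text \<open>The Fourier expansion of the constant forcing. By orthogonality the squared error of the
  n-th partial sum is exactly 1 - sum 8/kap^2, and this tends to 0 by the value pi^2/8 of the odd
  series.\<close>

lemma sine_series_one: "sine_series (\<lambda>j. 4 / kap j) (\<lambda>x. 1)"
proof -
  let ?S = "\<lambda>n x. \<Sum>j<n. 4 / kap j * sn j x"
  have c: "(\<integral>x. sn j x \<partial>mu) = 2 / kap j" for j
  proof -
    have "(\<integral>x. sn j x \<partial>mu) = - cos (kap j * 1) / kap j - - cos (kap j * 0) / kap j"
      unfolding sn_def by (rule integral_mu_FTC) (auto intro!: derivative_eq_intros continuous_intros)
    then show ?thesis by simp
  qed
  have nS: "nH (\<lambda>x. 1 - ?S n x)^2 = 1 - (\<Sum>j<n. 8 / (kap j)^2)" for n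
  proof -
    have "nH (\<lambda>x. 1 - ?S n x)^2 = (\<integral>x. 1 - 2 * ?S n x + (?S n x)^2 \<partial>mu)"
      unfolding nH_sq by (rule Bochner_Integration.integral_cong) (auto simp: power2_diff)
    also have "\<dots> = (\<integral>x. 1 \<partial>mu) - 2 * (\<integral>x. ?S n x \<partial>mu) + (\<integral>x. (?S n x)^2 \<partial>mu)"
    proof -
      have i: "integrable mu (?S n)" "integrable mu (\<lambda>x. (?S n x)^2)" "integrable mu (\<lambda>x. 1 :: real)"
        by (rule memH_integrable[OF memH_sine_sum] memH_sq[OF memH_sine_sum] memH_integrable[OF memH_const])+
      have i2: "integrable mu (\<lambda>x. 2 * ?S n x)" by (rule integrable_mult_right[OF i(1)])
      show ?thesis
        unfolding Bochner_Integration.integral_add[OF Bochner_Integration.integrable_diff[OF i(3) i2] i(2)]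
          Bochner_Integration.integral_diff[OF i(3) i2] integral_mult_right_zero ..
    qed
    also have "(\<integral>x. 1 \<partial>mu) = (1 :: real)"
      using nH_sq[of "\<lambda>_. 1"] by (simp del: lebesgue_integral_const)
    also have "(\<integral>x. ?S n x \<partial>mu) = (\<Sum>j<n. 4 / kap j * (2 / kap j))"
      unfolding c[symmetric] by (subst Bochner_Integration.integral_sum) (auto intro!: memH_integrable memH_cmult)
    also have "(\<integral>x. (?S n x)^2 \<partial>mu) = (\<Sum>j<n. (4 / kap j)^2) / 2"
      unfolding nH_sq[symmetric] by (rule nH_sine_sum) simp
    also have "1 - 2 * (\<Sum>j<n. 4 / kap j * (2 / kap j)) + (\<Sum>j<n. (4 / kap j)^2) / 2 = 1 - (\<Sum>j<n. 8 / (kap j)^2)"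
      by (simp add: sum_distrib_left sum_divide_distrib power2_eq_square algebra_simps sum_subtractf[symmetric] sum.distrib[symmetric])
    finally show ?thesis .
  qed
  have "(\<lambda>j. (8 / pi^2) * (1 / (2 * real j + 1)^2)) sums ((8 / pi^2) * (pi^2 / 8))"
    by (rule sums_mult[OF sums_odd_squares])
  then have "(\<lambda>j. 8 / (kap j)^2) sums 1" by (simp add: kap_def power_mult_distrib mult.commute)
  then have "(\<lambda>n. 1 - (\<Sum>j<n. 8 / (kap j)^2)) \<longlonglongrightarrow> 1 - 1" unfolding sums_def by (intro tendsto_intros)
  then have "(\<lambda>n. nH (\<lambda>x. 1 - ?S n x)^2) \<longlonglongrightarrow> 0" unfolding nS by simp
  then have "(\<lambda>n. sqrt (nH (\<lambda>x. 1 - ?S n x)^2)) \<longlonglongrightarrow> sqrt 0" by (rule tendsto_real_sqrt)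
  then have "(\<lambda>n. nH (\<lambda>x. 1 - ?S n x)) \<longlonglongrightarrow> 0"
    by (simp only: real_sqrt_abs abs_of_nonneg[OF nH_nonneg] real_sqrt_zero)
  then show ?thesis unfolding sine_series_def by (intro conjI memH_const)
qed

text \<open>Dominated convergence for series, phrased for all partial sums at once: beyond some N
  the majorant contributes less than e/2, and the first N terms tend to 0 one by one.\<close>

lemma tannery_bound:
  assumes B: "summable B" and y: "\<forall>\<^sub>F h in F. \<forall>j. 0 \<le> y h j \<and> y h j \<le> B j"
    and l: "\<And>j. ((\<lambda>h. y h j) \<longlongrightarrow> 0) F" and e: "(e::real) > 0"
  shows "\<forall>\<^sub>F h in F. \<forall>n. (\<Sum>j<n. y h j) \<le> e"
proof -
  have "(\<lambda>n. \<Sum>j. B (j + n)) \<longlonglongrightarrow> 0" by (rule suminf_exist_split2[OF B])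
  then have "\<forall>\<^sub>F n in sequentially. (\<Sum>j. B (j + n)) < e / 2" by (rule order_tendstoD) (use e in simp)
  then obtain N where N: "(\<Sum>j. B (j + N)) < e / 2" by (auto simp: eventually_sequentially)
  have "((\<lambda>h. \<Sum>j<N. y h j) \<longlongrightarrow> (\<Sum>j<N. 0)) F" by (intro tendsto_sum l)
  then have "((\<lambda>h. \<Sum>j<N. y h j) \<longlongrightarrow> 0) F" by simp
  then have "\<forall>\<^sub>F h in F. (\<Sum>j<N. y h j) < e / 2" by (rule order_tendstoD) (use e in simp)
  with y show ?thesis
  proof eventually_elim
    case (elim h)
    show ?case
    proof
      fix n
      have BN: "summable (\<lambda>j. B (j + N))" by (rule summable_ignore_initial_segment[OF B])
      have B0: "0 \<le> B j" for j using elim(1)[rule_format, of j] by linarith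
      have "(\<Sum>j<n. y h j) \<le> (\<Sum>j<N + n. y h j)" using elim by (intro sum_mono2) auto
      also have "\<dots> = (\<Sum>j<N. y h j) + (\<Sum>j<n. y h (j + N))"
        by (induction n) (simp_all add: add.commute)
      also have "(\<Sum>j<n. y h (j + N)) \<le> (\<Sum>j<n. B (j + N))" using elim by (intro sum_mono) auto
      also have "\<dots> \<le> (\<Sum>j. B (j + N))" using B0 by (intro sum_le_suminf[OF BN]) auto
      finally show "(\<Sum>j<n. y h j) \<le> e" using elim N by simp
    qed
  qed
qed

section \<open>The bounded positive complete trajectory\<close>

lemma antiderivative_real:
  assumes "continuous_on UNIV (p :: real \<Rightarrow> real)"
  obtains P where "\<And>t. (P has_real_derivative p t) (at t)"
proof -
  have "\<exists>F. \<forall>x. -\<infinity> < ereal x \<longrightarrow> ereal x < \<infinity> \<longrightarrow> (F has_vector_derivative p x) (at x)"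
    by (rule einterval_antiderivative) (use assms in \<open>auto simp: continuous_on_eq_continuous_at\<close>)
  then show ?thesis using that by (auto simp: has_real_derivative_iff_has_vector_derivative)
qed

text \<open>The solution \<open>c(t) = \<integral>\<^sub>-\<^sub>\<infinity>\<^sup>t exp(-(P(t)-P(s))) q(s) ds\<close>; the improper integral is realised as the
  infimum of an increasing antiderivative.\<close>
lemma bounded_ode_solution:
  fixes p q :: "real \<Rightarrow> real"
  assumes p: "continuous_on UNIV p" "\<And>t. m \<le> p t" "0 < m"
    and q: "continuous_on UNIV q" "\<And>t. 0 \<le> q t" "\<And>t. q t \<le> \<beta>"
  obtains c where "\<And>t. (c has_real_derivative q t - p t * c t) (at t)" "\<And>t. 0 \<le> c t" "\<And>t. c t \<le> \<beta> / m"
proof -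
  obtain P where P: "\<And>t. (P has_real_derivative p t) (at t)" using antiderivative_real[OF p(1)] by blast
  have cP: "continuous_on UNIV P" by (rule DERIV_continuous_on) (rule P)
  have "continuous_on UNIV (\<lambda>t. exp (P t) * q t)" by (intro continuous_intros cP q(1))
  then obtain G where G: "\<And>t. (G has_real_derivative exp (P t) * q t) (at t)" using antiderivative_real by blast
  have \<beta>: "0 \<le> \<beta>" using q(2)[of 0] q(3)[of 0] by linarith
  define k where "k = \<beta> / m"
  have k: "0 \<le> k" "k * m = \<beta>" using \<beta> p(3) by (auto simp: k_def)
  \<comment> \<open>Because q <= k m <= k p, this modification of \<open>G\<close> is nonincreasing.
    Every value of it therefore lies below every value of \<open>G\<close>: the infimum of
    \<open>G\<close> is finite, and the upper bound for \<open>c\<close> follows from the same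
    comparison.\<close>
  define H where "H t = G t - k * exp (P t)" for t
  have dH: "(H has_real_derivative exp (P t) * (q t - k * p t)) (at t)" for t
    unfolding H_def by (auto intro!: derivative_eq_intros P G simp: algebra_simps)
  have Hdec: "H t \<le> H s" if "s \<le> t" for s t
  proof (rule DERIV_nonpos_imp_nonincreasing[OF that])
    fix x
    have "q x \<le> k * m" using q(3) k by simp
    also have "\<dots> \<le> k * p x" using p(2)[of x] k by (intro mult_left_mono) auto
    finally have "exp (P x) * (q x - k * p x) \<le> 0" by (simp add: mult_nonneg_nonpos)
    then show "\<exists>y. (H has_real_derivative y) (at x) \<and> y \<le> 0" using dH by blast
  qed
  have Ginc: "G s \<le> G t" if "s \<le> t" for s t
    by (rule DERIV_nonneg_imp_nondecreasing[OF that]) (use G q(2) in \<open>auto intro!: exI mult_nonneg_nonneg\<close>)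
  have HG: "H t \<le> G t" for t using k by (simp add: H_def)
  have low: "H t \<le> G s" for s t
  proof (cases "s \<le> t")
    case True then show ?thesis using Hdec[OF True] HG[of s] by linarith
  next
    case False then show ?thesis using Ginc[of t s] HG[of t] by linarith
  qed
  define L where "L = Inf (range G)"
  have bb: "bdd_below (range G)" using low[of 0] by (auto simp: bdd_below_def)
  have LG: "L \<le> G t" for t unfolding L_def by (rule cInf_lower[OF _ bb]) simp
  have HL: "H t \<le> L" for t unfolding L_def by (rule cInf_greatest) (use low in auto)
  define c where "c t = exp (- P t) * (G t - L)" for t
  show ?thesis
  proof (rule that[of c])
    fix t
    have e: "exp (P t) * exp (- P t) = 1" by (rule exp_minus_inverse)
    have "(c has_real_derivative exp (- P t) * (- p t) * (G t - L) + (exp (P t) * q t) * exp (- P t)) (at t)"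
      unfolding c_def by (rule DERIV_mult) (auto intro!: derivative_eq_intros P G)
    moreover have "exp (- P t) * (- p t) * (G t - L) + (exp (P t) * q t) * exp (- P t) = (exp (P t) * exp (- P t)) * q t - p t * c t"
      by (simp add: c_def algebra_simps)
    ultimately show "(c has_real_derivative q t - p t * c t) (at t)" by (simp only: e mult_1)
    show "0 \<le> c t" using LG by (simp add: c_def)
    have "G t - L \<le> k * exp (P t)" using HL[of t] by (simp add: H_def)
    then have "c t \<le> exp (- P t) * (k * exp (P t))" unfolding c_def by (intro mult_left_mono) auto
    also have "\<dots> = (exp (P t) * exp (- P t)) * k" by (simp only: mult_ac)
    finally show "c t \<le> \<beta> / m" by (simp only: e mult_1 k_def)
  qed
qed

text \<open>Dissipative equations forget their past: the discrepancy at -T is damped by exp(-m T),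
  so closeness of the data on [-T,0] alone controls the difference at 0.\<close>

lemma bounded_ode_dependence:
  fixes c d :: "real \<Rightarrow> real"
  assumes c: "\<And>t. (c has_real_derivative q1 t - p1 t * c t) (at t)" and d: "\<And>t. (d has_real_derivative q2 t - p2 t * d t) (at t)"
    and m: "0 < m" "\<And>t. m \<le> p1 t" and B: "\<bar>c (-T)\<bar> \<le> B" "\<And>t. \<bar>d t\<bar> \<le> B" and T: "0 \<le> T"
    and \<delta>: "\<And>t. -T \<le> t \<Longrightarrow> t \<le> 0 \<Longrightarrow> \<bar>q1 t - q2 t\<bar> + \<bar>p1 t - p2 t\<bar> * B \<le> \<delta>"
  shows "(c 0 - d 0)^2 \<le> \<delta>^2 / m^2 + exp (- m * T) * (2 * B)^2"
proof -
  define y where "y t = c t - d t" for t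
  define h where "h t = (q1 t - q2 t) - (p1 t - p2 t) * d t" for t
  have dy: "(y has_real_derivative h t - p1 t * y t) (at t)" for t
    unfolding y_def h_def by (auto intro!: derivative_eq_intros c d simp: algebra_simps)
  \<comment> \<open>The weighted excess of the squared difference over its equilibrium level.
    Young's inequality 2|y|d <= m y^2 + d^2/m, with d the bound on the perturbation, cancels both
    the damping and this level, so \<open>W\<close> is nonincreasing.\<close>
  define W where "W t = exp (m * t) * ((y t)^2 - \<delta>^2 / m^2)" for t
  have dW: "(W has_real_derivative exp (m * t) * (m * ((y t)^2 - \<delta>^2 / m^2) + 2 * y t * (h t - p1 t * y t))) (at t)" for t
  proof -
    have "((\<lambda>t. exp (m * t) * ((y t)^2 - r)) has_real_derivative exp (m * t) * (m * ((y t)^2 - r) + 2 * y t * (h t - p1 t * y t))) (at t)" for r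
      by (auto intro!: derivative_eq_intros dy simp: algebra_simps)
    then show ?thesis unfolding W_def .
  qed
  have "W 0 \<le> W (-T)"
  proof (rule DERIV_nonpos_imp_nonincreasing[of "-T" 0 W])
    show "-T \<le> 0" using T by simp
    fix t assume t: "-T \<le> t" "t \<le> 0"
    have "\<bar>h t\<bar> \<le> \<bar>q1 t - q2 t\<bar> + \<bar>(p1 t - p2 t) * d t\<bar>" unfolding h_def by linarith
    also have "\<bar>(p1 t - p2 t) * d t\<bar> \<le> \<bar>p1 t - p2 t\<bar> * B" unfolding abs_mult using B(2) by (intro mult_left_mono) auto
    finally have h: "\<bar>h t\<bar> \<le> \<delta>" using \<delta>[OF t] by linarith
    have "2 * y t * h t \<le> 2 * (\<bar>y t\<bar> * \<bar>h t\<bar>)" by (simp add: abs_mult[symmetric])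
    also have "\<dots> \<le> 2 * (\<bar>y t\<bar> * \<delta>)" using h by (intro mult_left_mono) auto
    finally have 1: "2 * y t * h t \<le> 2 * (\<bar>y t\<bar> * \<delta>)" .
    have 2: "m * (y t)^2 \<le> p1 t * (y t)^2" using m(2) by (intro mult_right_mono) auto
    have "0 \<le> (m * \<bar>y t\<bar> - \<delta>)^2" by simp
    then have "2 * (m * (\<bar>y t\<bar> * \<delta>)) \<le> m^2 * (y t)^2 + \<delta>^2" by (simp add: power2_diff power_mult_distrib algebra_simps)
    then have "2 * (\<bar>y t\<bar> * \<delta>) \<le> m * (y t)^2 + m * (\<delta>^2 / m^2)"
      using m(1) by (simp add: power2_eq_square field_simps)
    then have "m * ((y t)^2 - \<delta>^2 / m^2) + 2 * y t * (h t - p1 t * y t) \<le> 0"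
      using 1 2 by (simp add: algebra_simps power2_eq_square)
    then have "exp (m * t) * (m * ((y t)^2 - \<delta>^2 / m^2) + 2 * y t * (h t - p1 t * y t)) \<le> 0"
      by (simp add: mult_nonneg_nonpos)
    then show "\<exists>z. (W has_real_derivative z) (at t) \<and> z \<le> 0" using dW by blast
  qed
  also have "W (-T) \<le> exp (- m * T) * (2 * B)^2"
  proof -
    have "\<bar>y (-T)\<bar> \<le> 2 * B" using B(1) B(2)[of "-T"] unfolding y_def by linarith
    then have "(y (-T))^2 \<le> (2 * B)^2" by (metis abs_ge_zero power2_abs power_mono)
    moreover have "0 \<le> \<delta>^2 / m^2" by simp
    ultimately have "(y (-T))^2 - \<delta>^2 / m^2 \<le> (2 * B)^2" by linarith
    then show ?thesis by (simp add: W_def)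
  qed
  finally show ?thesis by (simp add: W_def y_def)
qed

section \<open>The sine coefficients of the positive trajectory and the regularity of its
  series\<close>

locale bounds =
  fixes b0 b1 w1 :: real
  assumes b0: "0 < b0" and b01: "b0 \<le> b1" and w1: "w1 < pi^2" and w10: "0 \<le> w1"
begin

definition adm :: "(real \<Rightarrow> real) \<Rightarrow> (real \<Rightarrow> real) \<Rightarrow> bool" where
  "adm \<beta> w \<longleftrightarrow> continuous_on UNIV \<beta> \<and> continuous_on UNIV w \<and> (\<forall>t. b0 \<le> \<beta> t \<and> \<beta> t \<le> b1 \<and> 0 \<le> w t \<and> w t \<le> w1)"

text \<open>The relative gap between \<open>w1\<close> and the first eigenvalue pi^2; it gives kap^2
  - w >= eta kap^2 for all frequencies. \<open>C0\<close> is then the bound (4/kap) b1 / (eta kap^2)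
  with the power of kap removed, and \<open>K0\<close> bounds the time derivatives in the same
  way.\<close>

definition eta :: real where "eta = 1 - w1 / pi^2"
definition C0 :: real where "C0 = 4 * b1 / eta"
definition K0 :: real where "K0 = 4 * b1 + C0"

lemma abs_kap [simp]: "\<bar>kap j\<bar> = kap j" by (rule abs_of_pos) simp

lemma eta_pos: "0 < eta" using w1 by (simp add: eta_def)
lemma b1_pos: "0 < b1" using b0 b01 by simp
lemma C0_pos: "0 < C0" using eta_pos b1_pos by (simp add: C0_def)
lemma K0_pos: "0 < K0" using C0_pos b1_pos by (simp add: K0_def)

lemma kap_gap: "v \<le> w1 \<Longrightarrow> eta * (kap j)^2 \<le> (kap j)^2 - v"
proof -
  assume "v \<le> w1"
  have "pi^2 \<le> (kap j)^2" using kap_ge by (intro power_mono) auto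
  then have "(w1 / pi^2) * pi^2 \<le> (w1 / pi^2) * (kap j)^2" using w10 by (intro mult_left_mono) auto
  then have "w1 \<le> (w1 / pi^2) * (kap j)^2" by simp
  then show ?thesis using \<open>v \<le> w1\<close> by (simp add: eta_def algebra_simps)
qed

text \<open>The index \<open>j\<close> stands for the frequency \<open>2j+1\<close>; \<open>4 / kap j\<close> is the corresponding sine coefficient of the constant 1.\<close>
definition coeffs :: "(real \<Rightarrow> real) \<Rightarrow> (real \<Rightarrow> real) \<Rightarrow> (nat \<Rightarrow> real \<Rightarrow> real) \<Rightarrow> bool" where
  "coeffs \<beta> w c \<longleftrightarrow> (\<forall>j t. (c j has_real_derivative 4 / kap j * \<beta> t - ((kap j)^2 - w t) * c j t) (at t) \<and>
     0 \<le> c j t \<and> c j t \<le> C0 / (kap j)^3)"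

lemma coeffs_exist:
  assumes a: "adm \<beta> w" obtains c where "coeffs \<beta> w c"
proof -
  have "\<exists>c. \<forall>t. (c has_real_derivative 4 / kap j * \<beta> t - ((kap j)^2 - w t) * c t) (at t) \<and> 0 \<le> c t \<and> c t \<le> C0 / (kap j)^3" for j
  proof -
    have m: "0 < eta * (kap j)^2" using eta_pos by simp
    have "0 \<le> \<beta> t" for t using a b0 unfolding adm_def by (meson less_imp_le order_trans)
    then have q: "continuous_on UNIV (\<lambda>t. 4 / kap j * \<beta> t)" "\<And>t. 0 \<le> 4 / kap j * \<beta> t"
      using a by (auto simp: adm_def less_imp_le intro!: continuous_intros)
    have q2: "4 / kap j * \<beta> t \<le> 4 / kap j * b1" for t
      by (rule mult_left_mono) (use a in \<open>auto simp: adm_def less_imp_le\<close>)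
    have p: "continuous_on UNIV (\<lambda>t. (kap j)^2 - w t)" "\<And>t. eta * (kap j)^2 \<le> (kap j)^2 - w t"
      using a by (auto simp: adm_def intro!: continuous_intros kap_gap)
    obtain c where c: "\<And>t. (c has_real_derivative 4 / kap j * \<beta> t - ((kap j)^2 - w t) * c t) (at t)" "\<And>t. 0 \<le> c t"
       "\<And>t. c t \<le> (4 / kap j * b1) / (eta * (kap j)^2)"
      using bounded_ode_solution[OF p m q q2] by blast
    have "(4 / kap j * b1) / (eta * (kap j)^2) = C0 / (kap j)^3"
      using eta_pos by (simp add: C0_def power2_eq_square power3_eq_cube field_simps)
    then show ?thesis using c by auto
  qed
  then obtain c where "\<And>j t. (c j has_real_derivative 4 / kap j * \<beta> t - ((kap j)^2 - w t) * c j t) (at t) \<and> 0 \<le> c j t \<and> c j t \<le> C0 / (kap j)^3"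
    by metis
  then show ?thesis using that by (auto simp: coeffs_def)
qed

definition sol_of :: "(nat \<Rightarrow> real \<Rightarrow> real) \<Rightarrow> real \<Rightarrow> real \<Rightarrow> real" where
  "sol_of c t x = (\<Sum>j. c j t * sn j x)"

context
  fixes \<beta> w c assumes a: "adm \<beta> w" and c: "coeffs \<beta> w c"
begin

definition c1 where "c1 j t = 4 / kap j * \<beta> t - ((kap j)^2 - w t) * c j t"

lemma c_deriv: "(c j has_real_derivative c1 j t) (at t)" and c_nonneg: "0 \<le> c j t" and c_le: "c j t \<le> C0 / (kap j)^3"
  using c by (auto simp: coeffs_def c1_def)

lemma c_abs: "\<bar>c j t\<bar> \<le> C0 / (kap j)^3" using c_nonneg c_le by simp

lemma C0_le: "C0 / (kap j)^3 \<le> C0 * (1 / kap j)^2"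
proof -
  have "1 \<le> kap j" using kap_ge[of j] pi_gt3 by linarith
  then have "1 / (kap j)^3 \<le> 1 / (kap j)^2" by (intro divide_left_mono power_increasing) auto
  then show ?thesis using C0_pos mult_left_mono[of "1 / (kap j)^3" "1 / (kap j)^2" C0] by (simp add: power_divide)
qed

lemma c_abs2: "\<bar>c j t\<bar> \<le> C0 * (1 / kap j)^2" using c_abs[of j t] C0_le[of j] by linarith

text \<open>Cubic decay of the coefficients leaves order 1/kap after two space derivatives. This is
  still square summable, so the series lies in D(A) at every time.\<close>

lemma kap2c_abs: "\<bar>(kap j)^2 * c j t\<bar> \<le> C0 * (1 / kap j)"
proof -
  have "\<bar>(kap j)^2 * c j t\<bar> = (kap j)^2 * \<bar>c j t\<bar>" by (simp add: abs_mult)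
  also have "\<dots> \<le> (kap j)^2 * (C0 / (kap j)^3)" using c_abs by (intro mult_left_mono) auto
  also have "\<dots> = C0 * (1 / kap j)" by (simp add: power2_eq_square power3_eq_cube)
  finally show ?thesis .
qed

lemma c1_abs: "\<bar>c1 j t\<bar> \<le> K0 * (1 / kap j)"
proof -
  have wt: "0 \<le> w t" "w t \<le> w1" "b0 \<le> \<beta> t" "\<beta> t \<le> b1" using a by (auto simp: adm_def)
  have "0 \<le> eta * (kap j)^2" using eta_pos by simp
  then have "0 \<le> (kap j)^2 - w t" using kap_gap[OF wt(2), of j] by linarith
  then have 1: "\<bar>((kap j)^2 - w t) * c j t\<bar> \<le> (kap j)^2 * c j t"
    using wt c_nonneg[of j t] by (simp add: abs_mult mult_right_mono)
  have "0 \<le> 4 / kap j * \<beta> t" by (rule mult_nonneg_nonneg) (use wt b0 in \<open>auto simp: less_imp_le\<close>)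
  moreover have "4 / kap j * \<beta> t \<le> 4 / kap j * b1" by (rule mult_left_mono) (use wt in \<open>auto simp: less_imp_le\<close>)
  ultimately have "\<bar>4 / kap j * \<beta> t\<bar> \<le> 4 / kap j * b1" by linarith
  then have "\<bar>c1 j t\<bar> \<le> 4 / kap j * b1 + (kap j)^2 * c j t" unfolding c1_def using 1 by linarith
  also have "\<dots> \<le> 4 / kap j * b1 + C0 * (1 / kap j)" using kap2c_abs[of j t] by linarith
  also have "\<dots> = K0 * (1 / kap j)" by (simp add: K0_def algebra_simps)
  finally show ?thesis .
qed

lemma c_lipschitz: "\<bar>c j t - c j s\<bar> \<le> K0 * (1 / kap j) * \<bar>t - s\<bar>"
  using field_differentiable_bound[of UNIV "c j" "c1 j" "K0 * (1 / kap j)" t s] c_deriv c1_abs by auto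

lemma summable_c: "summable (\<lambda>j. \<bar>c j t\<bar>)"
  by (rule summable_comparison_test'[OF summable_mult[OF summable_inverse_kap2, of C0]]) (simp add: c_abs2)

lemma sol_series: "sine_series (\<lambda>j. c j t) (sol_of c t)"
  using sine_series_absolute[OF summable_c[of t]] by (simp add: sol_of_def[abs_def])

lemma square_summable:
  assumes "\<And>j. \<bar>d j\<bar> \<le> M * (1 / kap j)" shows "summable (\<lambda>j. (d j)^2)" "(\<Sum>j<n. (d j)^2) \<le> M^2 * (\<Sum>j. (1 / kap j)^2)"
proof -
  have sq: "(d j)^2 \<le> M^2 * (1 / kap j)^2" for j
    using power_mono[OF assms[of j], of 2] by (simp add: power_mult_distrib power_divide)
  have sm: "summable (\<lambda>j. M^2 * (1 / kap j)^2)" by (rule summable_mult[OF summable_inverse_kap2])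
  show s: "summable (\<lambda>j. (d j)^2)" by (rule summable_comparison_test'[OF sm]) (use sq in simp)
  have "(\<Sum>j<n. (d j)^2) \<le> (\<Sum>j. (d j)^2)" by (rule sum_le_suminf[OF s]) auto
  also have "\<dots> \<le> (\<Sum>j. M^2 * (1 / kap j)^2)" by (rule suminf_le[OF sq s sm])
  also have "\<dots> = M^2 * (\<Sum>j. (1 / kap j)^2)" by (rule suminf_mult[OF summable_inverse_kap2])
  finally show "(\<Sum>j<n. (d j)^2) \<le> M^2 * (\<Sum>j. (1 / kap j)^2)" .
qed

definition S2 :: real where "S2 = (\<Sum>j. (1 / kap j)^2)"

lemma S2_nonneg: "0 \<le> S2" unfolding S2_def by (rule suminf_nonneg[OF summable_inverse_kap2]) simp

lemma sol_lipschitz: "nH (\<lambda>x. sol_of c t x - sol_of c s x) \<le> (K0 * sqrt S2) * \<bar>t - s\<bar>"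
proof -
  have ser: "sine_series (\<lambda>j. c j t - c j s) (\<lambda>x. sol_of c t x - sol_of c s x)"
    by (rule sine_series_diff[OF sol_series sol_series])
  have "nH (\<lambda>x. sol_of c t x - sol_of c s x)^2 \<le> (K0 * \<bar>t - s\<bar>)^2 * S2"
    unfolding S2_def
  proof (rule sine_series_norm[OF ser])
    show "(\<Sum>j<n. (c j t - c j s)^2) \<le> (K0 * \<bar>t - s\<bar>)^2 * (\<Sum>j. (1 / kap j)^2)" for n
      by (rule square_summable(2)) (use c_lipschitz[of _ t s] in \<open>simp add: mult_ac\<close>)
  qed
  also have "\<dots> = ((K0 * sqrt S2) * \<bar>t - s\<bar>)^2" using S2_nonneg by (simp add: power_mult_distrib)
  finally show ?thesis by (rule power2_le_imp_le) (use K0_pos S2_nonneg in auto)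
qed

lemma sol_abs: "\<bar>sol_of c t x\<bar> \<le> C0 * S2"
proof -
  have sm: "summable (\<lambda>j. C0 * (1 / kap j)^2)" by (rule summable_mult[OF summable_inverse_kap2])
  have le: "\<bar>c j t * sn j x\<bar> \<le> C0 * (1 / kap j)^2" for j
    using mult_mono[OF c_abs2[of j t] abs_sn_le[of j x]] C0_pos by (simp add: abs_mult)
  have s: "summable (\<lambda>j. \<bar>c j t * sn j x\<bar>)" by (rule summable_comparison_test'[OF sm]) (use le in simp)
  have "\<bar>sol_of c t x\<bar> \<le> (\<Sum>j. \<bar>c j t * sn j x\<bar>)" unfolding sol_of_def by (rule summable_rabs[OF s])
  also have "\<dots> \<le> (\<Sum>j. C0 * (1 / kap j)^2)" by (rule suminf_le[OF le s sm])
  also have "\<dots> = C0 * S2" unfolding S2_def by (rule suminf_mult[OF summable_inverse_kap2])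
  finally show ?thesis .
qed

lemma sol_measurable: "(\<lambda>p. sol_of c (fst p) (snd p)) \<in> borel_measurable (lborel \<Otimes>\<^sub>M lborel)"
proof -
  have "(\<lambda>p. c j (fst p) * sn j (snd p)) \<in> borel_measurable (lborel \<Otimes>\<^sub>M lborel)" for j
  proof (rule borel_measurable_times)
    have "continuous_on UNIV (c j)" by (rule DERIV_continuous_on) (rule c_deriv)
    then have "c j \<in> borel_measurable borel" by (rule borel_measurable_continuous_onI)
    then have "c j \<in> borel_measurable lborel" unfolding measurable_lborel2 .
    then show "(\<lambda>p. c j (fst p)) \<in> borel_measurable (lborel \<Otimes>\<^sub>M lborel)"
      by (rule measurable_compose[OF measurable_fst])
    have "continuous_on UNIV (sn j)" unfolding sn_def by (intro continuous_intros)
    then have "sn j \<in> borel_measurable borel" by (rule borel_measurable_continuous_onI)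
    then have "sn j \<in> borel_measurable lborel" unfolding measurable_lborel2 .
    then show "(\<lambda>p. sn j (snd p)) \<in> borel_measurable (lborel \<Otimes>\<^sub>M lborel)"
      by (rule measurable_compose[OF measurable_snd])
  qed
  then show ?thesis unfolding sol_of_def by (rule borel_measurable_suminf)
qed

text \<open>The difference quotient is differentiated coefficientwise. Both the quotients and their
  limits are bounded by K0/kap, which gives the square summable majorant for
  \<open>tannery_bound\<close>.\<close>

lemma sol_hasDeriv:
  assumes X': "sine_series (\<lambda>j. c1 j t) X'"
  shows "hasDerivH (sol_of c) X' t"
proof -
  let ?q = "\<lambda>h x. (sol_of c (t + h) x - sol_of c t x) / h - X' x"
  let ?y = "\<lambda>h j. ((c j (t + h) - c j t) / h - c1 j t)^2"
  have ser: "sine_series (\<lambda>j. (c j (t + h) - c j t) / h - c1 j t) (?q h)" for h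
    using sine_series_diff[OF sine_series_cmult[OF sine_series_diff[OF sol_series[of "t + h"] sol_series[of t]], of "1 / h"] X']
    by simp
  have "((\<lambda>h. nH (?q h)) \<longlongrightarrow> 0) (at 0)"
  proof (rule tendstoI)
    fix e :: real assume e: "e > 0"
    have "\<forall>\<^sub>F h in at 0. \<forall>n. (\<Sum>j<n. ?y h j) \<le> (e / 2)^2"
    proof (rule tannery_bound)
      show "summable (\<lambda>j. (2 * K0)^2 * (1 / kap j)^2)" by (rule summable_mult[OF summable_inverse_kap2])
      have "\<forall>\<^sub>F h in at (0::real). h \<noteq> 0" by (rule eventually_neq_at_within)
      then show "\<forall>\<^sub>F h in at 0. \<forall>j. 0 \<le> ?y h j \<and> ?y h j \<le> (2 * K0)^2 * (1 / kap j)^2"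
      proof eventually_elim
        case (elim h)
        show ?case
        proof (intro allI conjI)
          fix j
          have "\<bar>(c j (t + h) - c j t) / h\<bar> \<le> K0 * (1 / kap j)"
            using c_lipschitz[of j "t + h" t] elim by (simp add: abs_divide divide_le_eq)
          then have "\<bar>(c j (t + h) - c j t) / h - c1 j t\<bar> \<le> 2 * K0 * (1 / kap j)"
            using c1_abs[of j t] by linarith
          from power_mono[OF this, of 2] show "?y h j \<le> (2 * K0)^2 * (1 / kap j)^2"
            by (simp add: power_mult_distrib power_divide)
        qed simp
      qed
      show "((\<lambda>h. ?y h j) \<longlongrightarrow> 0) (at 0)" for j
      proof -
        have "((\<lambda>h. (c j (t + h) - c j t) / h) \<longlongrightarrow> c1 j t) (at 0)" using c_deriv[of j t] by (simp add: DERIV_def)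
        then have "((\<lambda>h. ?y h j) \<longlongrightarrow> (c1 j t - c1 j t)^2) (at 0)" by (intro tendsto_intros)
        then show ?thesis by simp
      qed
      show "0 < (e / 2)^2" using e by simp
    qed
    then show "\<forall>\<^sub>F h in at 0. dist (nH (?q h)) 0 < e"
    proof eventually_elim
      case (elim h)
      have "nH (?q h)^2 \<le> (e / 2)^2" by (rule sine_series_norm[OF ser]) (use elim in blast)
      then have "nH (?q h) \<le> e / 2" by (rule power2_le_imp_le) (use e in simp)
      then show ?case using e by simp
    qed
  qed
  then show ?thesis using X' by (simp add: hasDerivH_def sine_series_def)
qed

lemma integral_indicator_mu:
  assumes f: "memH f" and s: "s \<in> {0..1}"
  shows "(\<integral>r. indicator {0..s} r * f r \<partial>lborel) = (\<integral>r. indicator {0..s} r * f r \<partial>mu)"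
  unfolding integral_mu[symmetric]
proof (rule integral_cong_AE)
  have i: "integrable lborel (\<lambda>r. indicator {0..s} r * f r)"
    by (rule indicator_integrable_subset[OF memH_integrable_Icc[OF f]]) (use s in auto)
  then show "(\<lambda>r. indicator {0..s} r * f r) \<in> borel_measurable lborel" by (rule borel_measurable_integrable)
  then show "(\<lambda>r. indicator I01 r * (indicator {0..s} r * f r)) \<in> borel_measurable lborel"
    by (rule borel_measurable_times[rotated]) simp
  show "AE r in lborel. indicator {0..s} r * f r = indicator I01 r * (indicator {0..s} r * f r)"
    using AE_lborel_singleton[of 0] AE_lborel_singleton[of 1]
    by eventually_elim (use s in \<open>auto simp: indicator_def I01_def\<close>)
qed

text \<open>L2 convergence passes to indefinite integrals by testing with an indicator.\<close>

lemma integral_indicator_tendsto: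
  assumes f: "memH f" and fn: "\<And>n. memH (fn n)" and l: "(\<lambda>n. nH (\<lambda>x. f x - fn n x)) \<longlonglongrightarrow> 0" and s: "s \<in> {0..1}"
  shows "(\<lambda>n. \<integral>r. indicator {0..s} r * fn n r \<partial>lborel) \<longlonglongrightarrow> (\<integral>r. indicator {0..s} r * f r \<partial>lborel)"
proof -
  have ind: "memH (indicator {0..s})"
  proof (rule memH_bounded)
    show "indicator {0..s} \<in> borel_measurable mu" by (rule borel_mu, rule borel_measurable_indicator) simp
    show "AE r in mu. \<bar>indicator {0..s} r :: real\<bar> \<le> 1" by (rule AE_I2) (simp add: indicator_def)
  qed
  have bd: "norm ((\<integral>r. indicator {0..s} r * fn n r \<partial>lborel) - (\<integral>r. indicator {0..s} r * f r \<partial>lborel)) \<le> nH (indicator {0..s}) * nH (\<lambda>x. f x - fn n x)" for n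
  proof -
    have "(\<integral>r. indicator {0..s} r * f r \<partial>lborel) - (\<integral>r. indicator {0..s} r * fn n r \<partial>lborel) = (\<integral>r. indicator {0..s} r * (f r - fn n r) \<partial>mu)"
      unfolding integral_indicator_mu[OF f s] integral_indicator_mu[OF fn s] right_diff_distrib
      by (intro Bochner_Integration.integral_diff[symmetric] memH_mult ind f fn)
    moreover have "\<bar>\<integral>r. indicator {0..s} r * (f r - fn n r) \<partial>mu\<bar> \<le> nH (indicator {0..s}) * nH (\<lambda>x. f x - fn n x)"
      by (rule Cauchy_Schwarz_mu[OF ind memH_diff[OF f fn]])
    ultimately show ?thesis by simp
  qed
  have "(\<lambda>n. nH (indicator {0..s}) * nH (\<lambda>x. f x - fn n x)) \<longlonglongrightarrow> 0"
    using tendsto_mult[OF tendsto_const l] by simp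
  then have "(\<lambda>n. (\<integral>r. indicator {0..s} r * fn n r \<partial>lborel) - (\<integral>r. indicator {0..s} r * f r \<partial>lborel)) \<longlonglongrightarrow> 0"
    by (rule Lim_null_comparison[OF always_eventually[OF allI[OF bd]]])
  then show ?thesis by (simp add: LIM_zero_iff)
qed

text \<open>The differentiated series converges uniformly, the twice differentiated one only in L2.
  Both integral identities in \<open>isA\<close> hold for partial sums by calculus and survive these
  limits.\<close>

lemma sol_isA:
  assumes W: "sine_series (\<lambda>j. (kap j)^2 * c j t) W"
  shows "isA (sol_of c t) W"
proof -
  define g1 where "g1 x = (\<Sum>j. c j t * kap j * cos (kap j * x))" for x
  define p1 where "p1 n x = (\<Sum>j<n. c j t * kap j * cos (kap j * x))" for n x
  have ck: "\<bar>c j t * kap j\<bar> \<le> C0 * (1 / kap j)^2" for j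
  proof -
    have "\<bar>c j t * kap j\<bar> \<le> (C0 / (kap j)^3) * kap j"
      unfolding abs_mult using c_abs[of j t] by (intro mult_mono) (auto intro: less_imp_le)
    then show ?thesis by (simp add: power2_eq_square power3_eq_cube)
  qed
  have sm: "summable (\<lambda>j. C0 * (1 / kap j)^2)" by (rule summable_mult[OF summable_inverse_kap2])
  have sk: "summable (\<lambda>j. \<bar>c j t * kap j\<bar>)" by (rule summable_comparison_test'[OF sm]) (use ck in simp)
  have le: "\<bar>c j t * kap j * cos (kap j * x)\<bar> \<le> \<bar>c j t * kap j\<bar>" for j x
  proof -
    have "\<bar>c j t * kap j * cos (kap j * x)\<bar> = \<bar>c j t * kap j\<bar> * \<bar>cos (kap j * x)\<bar>" by (rule abs_mult)
    also have "\<dots> \<le> \<bar>c j t * kap j\<bar> * 1" by (intro mult_left_mono abs_cos_le_one) simp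
    finally show ?thesis by simp
  qed
  have s1: "summable (\<lambda>j. c j t * kap j * cos (kap j * x))" for x
    by (rule summable_comparison_test'[OF sk]) (use le in simp)
  have uni: "uniform_limit UNIV p1 g1 sequentially"
    unfolding p1_def g1_def by (rule Weierstrass_m_test[OF _ sk]) (use le in simp)
  have cp: "continuous_on UNIV (p1 n)" for n unfolding p1_def by (intro continuous_intros)
  have cg: "continuous_on UNIV g1"
    by (rule uniform_limit_theorem[OF always_eventually uni]) (use cp in auto)
  have mg: "memH g1" by (rule memH_continuous[OF continuous_on_subset[OF cg]]) simp
  have mp: "memH (p1 n)" for n by (rule memH_continuous[OF continuous_on_subset[OF cp]]) simp
  have l1: "(\<lambda>n. nH (\<lambda>x. g1 x - p1 n x)) \<longlonglongrightarrow> 0"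
  proof (rule tendstoI)
    fix e :: real assume e: "e > 0"
    then have "\<forall>\<^sub>F n in sequentially. \<forall>x\<in>UNIV. dist (p1 n x) (g1 x) < e / 2"
      by (intro uniform_limitD[OF uni]) simp
    then show "\<forall>\<^sub>F n in sequentially. dist (nH (\<lambda>x. g1 x - p1 n x)) 0 < e"
    proof eventually_elim
      case (elim n)
      have "nH (\<lambda>x. g1 x - p1 n x) \<le> \<bar>e / 2\<bar>"
        by (rule nH_bound[OF memH_measurable[OF memH_diff[OF mg mp]]])
           (use elim in \<open>auto simp: dist_real_def abs_minus_commute less_imp_le\<close>)
      then show ?case using e by simp
    qed
  qed
  have Wm: "memH W" "(\<lambda>n. nH (\<lambda>x. W x - (\<Sum>j<n. (kap j)^2 * c j t * sn j x))) \<longlonglongrightarrow> 0" using W by (auto simp: sine_series_def)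
  let ?Wn = "\<lambda>n x. \<Sum>j<n. (kap j)^2 * c j t * sn j x"
  have partial1: "p1 n s = p1 n 0 + (\<integral>r. indicator {0..s} r * - ?Wn n r \<partial>lborel)" if "s \<in> {0..1}" for n s
  proof -
    have "acd 0 1 (p1 n) (\<lambda>x. - ?Wn n x)"
    proof (rule acd_C1)
      show "(p1 n has_real_derivative - ?Wn n x) (at x within {0..1})" for x
        unfolding p1_def sn_def sum_negf[symmetric]
        by (auto intro!: derivative_eq_intros sum.cong simp: power2_eq_square)
      show "continuous_on {0..1} (\<lambda>x. - ?Wn n x)" unfolding sn_def by (intro continuous_intros)
    qed simp
    then show ?thesis using that by (rule acd_eq)
  qed
  have partial0: "(\<Sum>j<n. c j t * sn j s) = (\<integral>r. indicator {0..s} r * p1 n r \<partial>lborel)" if "s \<in> {0..1}" for n s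
  proof -
    have "acd 0 1 (\<lambda>x. \<Sum>j<n. c j t * sn j x) (p1 n)"
    proof (rule acd_C1)
      show "((\<lambda>x. \<Sum>j<n. c j t * sn j x) has_real_derivative p1 n x) (at x within {0..1})" for x
        unfolding p1_def sn_def by (auto intro!: derivative_eq_intros sum.cong)
      show "continuous_on {0..1} (p1 n)" by (rule continuous_on_subset[OF cp]) simp
    qed simp
    from acd_eq[OF this that] show ?thesis by (simp add: sn_def)
  qed
  have p1l: "(\<lambda>n. p1 n x) \<longlonglongrightarrow> g1 x" for x
    using s1[of x] unfolding p1_def g1_def by (rule summable_LIMSEQ)
  have sx: "(\<lambda>n. \<Sum>j<n. c j t * sn j x) \<longlonglongrightarrow> sol_of c t x" for x
    unfolding sol_of_def
    by (rule summable_LIMSEQ, rule summable_comparison_test'[OF summable_c[of t]]) (simp add: abs_mult mult_left_le)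
  have mW: "memH (?Wn n)" for n by (rule memH_sine_sum)
  have eq1: "g1 s = g1 0 + (\<integral>r. indicator {0..s} r * - W r \<partial>lborel)" if s: "s \<in> {0..1}" for s
  proof -
    have "(\<lambda>n. nH (\<lambda>x. - W x - - ?Wn n x)) \<longlonglongrightarrow> 0"
      using Wm(2) nH_minus_commute[of W] by (simp add: algebra_simps)
    then have "(\<lambda>n. \<integral>r. indicator {0..s} r * - ?Wn n r \<partial>lborel) \<longlonglongrightarrow> (\<integral>r. indicator {0..s} r * - W r \<partial>lborel)"
      by (intro integral_indicator_tendsto s memH_uminus Wm mW)
    then have "(\<lambda>n. p1 n 0 + (\<integral>r. indicator {0..s} r * - ?Wn n r \<partial>lborel)) \<longlonglongrightarrow> g1 0 + (\<integral>r. indicator {0..s} r * - W r \<partial>lborel)"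
      by (intro tendsto_add p1l)
    then have "(\<lambda>n. p1 n s) \<longlonglongrightarrow> g1 0 + (\<integral>r. indicator {0..s} r * - W r \<partial>lborel)"
      by (simp only: partial1[OF s, symmetric])
    then show ?thesis using p1l[of s] LIMSEQ_unique by blast
  qed
  have eq0: "sol_of c t s = (\<integral>r. indicator {0..s} r * g1 r \<partial>lborel)" if s: "s \<in> {0..1}" for s
  proof -
    have "(\<lambda>n. \<integral>r. indicator {0..s} r * p1 n r \<partial>lborel) \<longlonglongrightarrow> (\<integral>r. indicator {0..s} r * g1 r \<partial>lborel)"
      by (rule integral_indicator_tendsto[OF mg mp l1 s])
    then have "(\<lambda>n. \<Sum>j<n. c j t * sn j s) \<longlonglongrightarrow> (\<integral>r. indicator {0..s} r * g1 r \<partial>lborel)"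
      by (simp only: partial0[OF s, symmetric])
    then show ?thesis using sx[of s] LIMSEQ_unique by blast
  qed
  show ?thesis
    unfolding isA_def
  proof (rule conjI[OF _ conjI[OF Wm(1)]])
    show "memH (sol_of c t)" using sol_series by (simp add: sine_series_def)
    show "\<exists>g g1 g2. memH g2 \<and> ae01 (\<lambda>s. sol_of c t s = g s) \<and>
     (\<forall>s\<in>{0..1}. g1 s = g1 0 + integral\<^sup>L lborel (\<lambda>r. indicator {0..s} r * g2 r)) \<and>
     (\<forall>s\<in>{0..1}. g s = integral\<^sup>L lborel (\<lambda>r. indicator {0..s} r * g1 r)) \<and> g 1 = 0 \<and>
     ae01 (\<lambda>s. W s = - g2 s)"
    proof (rule exI[of _ "sol_of c t"], rule exI[of _ g1], rule exI[of _ "\<lambda>x. - W x"], intro conjI ballI)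
      show "memH (\<lambda>x. - W x)" using Wm by simp
      show "sol_of c t 1 = 0" by (simp add: sol_of_def sn_def)
      show "ae01 (\<lambda>s. sol_of c t s = sol_of c t s)" "ae01 (\<lambda>s. W s = - (- W s))" by (simp_all add: ae01_mu)
      show "g1 s = g1 0 + (\<integral>r. indicator {0..s} r * - W r \<partial>lborel)" if "s \<in> {0..1}" for s by (rule eq1[OF that])
      show "sol_of c t s = (\<integral>r. indicator {0..s} r * g1 r \<partial>lborel)" if "s \<in> {0..1}" for s by (rule eq0[OF that])
    qed
  qed
qed

text \<open>Every term is a sine series, the constant 1 with coefficients 4/kap; the scalar
  equations say that the combined coefficients vanish.\<close>

lemma sol_equation:
  "\<exists>X' W. hasDerivH (sol_of c) X' t \<and> isA (sol_of c t) W \<and> (AE s in mu. X' s + W s = \<beta> t + w t * sol_of c t s)"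
proof -
  obtain X' where X': "sine_series (\<lambda>j. c1 j t) X'" by (rule sine_series_exists[OF square_summable(1)[of "\<lambda>j. c1 j t" K0, OF c1_abs]]) (rule that)
  obtain W where W: "sine_series (\<lambda>j. (kap j)^2 * c j t) W" by (rule sine_series_exists[OF square_summable(1)[of "\<lambda>j. (kap j)^2 * c j t" C0, OF kap2c_abs]]) (rule that)
  have "sine_series (\<lambda>j. (c1 j t + (kap j)^2 * c j t) - (\<beta> t * (4 / kap j) + w t * c j t))
     (\<lambda>x. (X' x + W x) - (\<beta> t * 1 + w t * sol_of c t x))"
    by (intro sine_series_diff sine_series_add X' W sine_series_cmult sine_series_one sol_series)
  moreover have "(c1 j t + (kap j)^2 * c j t) - (\<beta> t * (4 / kap j) + w t * c j t) = 0" for j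
    by (simp add: c1_def algebra_simps)
  ultimately have "AE x in mu. (X' x + W x) - (\<beta> t * 1 + w t * sol_of c t x) = 0"
    by (intro sine_series_zero) simp
  then have "AE x in mu. X' x + W x = \<beta> t + w t * sol_of c t x" by eventually_elim simp
  then show ?thesis using sol_hasDeriv[OF X'] sol_isA[OF W] by blast
qed

end

end

section \<open>The hull of the symbol\<close>

definition cont2 :: "sig \<Rightarrow> bool" where
  "cont2 \<sigma> \<longleftrightarrow> continuous_on UNIV (fst \<sigma>) \<and> continuous_on UNIV (snd \<sigma>)"

definition sdist :: "sig \<Rightarrow> sig \<Rightarrow> real \<Rightarrow> real" where
  "sdist \<sigma>1 \<sigma>2 s = \<bar>fst \<sigma>1 s - fst \<sigma>2 s\<bar> + \<bar>snd \<sigma>1 s - snd \<sigma>2 s\<bar>"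

lemma sdist_nonneg [simp]: "0 \<le> sdist \<sigma>1 \<sigma>2 s" by (simp add: sdist_def)

lemma sdist_commute: "sdist \<sigma>1 \<sigma>2 s = sdist \<sigma>2 \<sigma>1 s" by (simp add: sdist_def abs_minus_commute)

lemma sdist_triangle: "sdist \<sigma>1 \<sigma>3 s \<le> sdist \<sigma>1 \<sigma>2 s + sdist \<sigma>2 \<sigma>3 s" by (simp add: sdist_def)

lemma supd_sdist: "supd n \<sigma>1 \<sigma>2 = (SUP s\<in>{- real n .. real n}. sdist \<sigma>1 \<sigma>2 s)"
  by (simp add: supd_def sdist_def)

lemma supd_le: "(\<And>s. \<bar>s\<bar> \<le> real n \<Longrightarrow> sdist \<sigma>1 \<sigma>2 s \<le> C) \<Longrightarrow> supd n \<sigma>1 \<sigma>2 \<le> C"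
  unfolding supd_sdist by (rule cSUP_least) (auto simp: abs_le_iff)

lemma supd_ge:
  assumes "cont2 \<sigma>1" "cont2 \<sigma>2" "\<bar>s\<bar> \<le> real n" shows "sdist \<sigma>1 \<sigma>2 s \<le> supd n \<sigma>1 \<sigma>2"
  unfolding supd_sdist
proof (rule cSUP_upper)
  have "continuous_on UNIV (sdist \<sigma>1 \<sigma>2)"
    unfolding sdist_def[abs_def] using assms by (intro continuous_intros) (auto simp: cont2_def)
  then have "continuous_on {- real n..real n} (sdist \<sigma>1 \<sigma>2)" by (rule continuous_on_subset) simp
  from continuous_on_Icc_bounded[OF this] obtain B where "\<And>x. x \<in> {- real n..real n} \<Longrightarrow> \<bar>sdist \<sigma>1 \<sigma>2 x\<bar> \<le> B" by blast
  then show "bdd_above (sdist \<sigma>1 \<sigma>2 ` {- real n..real n})" by (intro bdd_aboveI[of _ B]) force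
qed (use assms(3) in auto)

lemma supd_nonneg: "cont2 \<sigma>1 \<Longrightarrow> cont2 \<sigma>2 \<Longrightarrow> 0 \<le> supd n \<sigma>1 \<sigma>2"
  using order_trans[OF sdist_nonneg supd_ge[of \<sigma>1 \<sigma>2 0 n]] by simp

lemma rho_summable:
  assumes "cont2 \<sigma>1" "cont2 \<sigma>2" shows "summable (\<lambda>n. (1/2)^n * min 1 (supd n \<sigma>1 \<sigma>2))"
proof (rule summable_comparison_test')
  show "summable (\<lambda>n. (1/2::real)^n)" by (rule summable_geometric) simp
  show "norm ((1/2)^n * min 1 (supd n \<sigma>1 \<sigma>2)) \<le> (1/2)^n" for n
    using supd_nonneg[OF assms, of n] by (simp add: abs_mult mult_left_le)
qed

lemma rho_nonneg: "cont2 \<sigma>1 \<Longrightarrow> cont2 \<sigma>2 \<Longrightarrow> 0 \<le> rho \<sigma>1 \<sigma>2"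
  unfolding rho_def by (rule suminf_nonneg[OF rho_summable]) (auto simp: supd_nonneg)

lemma supd_le_rho:
  assumes c: "cont2 \<sigma>1" "cont2 \<sigma>2" shows "min 1 (supd n \<sigma>1 \<sigma>2) \<le> 2^n * rho \<sigma>1 \<sigma>2"
proof -
  have "(\<Sum>k\<in>{n}. (1/2)^k * min 1 (supd k \<sigma>1 \<sigma>2)) \<le> rho \<sigma>1 \<sigma>2"
    unfolding rho_def by (rule sum_le_suminf[OF rho_summable[OF c]]) (auto simp: supd_nonneg[OF c])
  then show ?thesis by (simp add: field_simps power_one_over)
qed

text \<open>Terms below N involve only the interval on which the bound e holds; the others are
  truncated at 1 and their weights add up to 2 (1/2)^N.\<close>

lemma rho_le:
  assumes c: "cont2 \<sigma>1" "cont2 \<sigma>2" and e: "\<And>s. \<bar>s\<bar> \<le> real N \<Longrightarrow> sdist \<sigma>1 \<sigma>2 s \<le> e"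
  shows "rho \<sigma>1 \<sigma>2 \<le> 2 * e + 2 * (1/2)^N"
proof -
  have e0: "0 \<le> e" using e[of 0] sdist_nonneg[of \<sigma>1 \<sigma>2 0] by (simp del: sdist_nonneg)
  have g: "(\<lambda>n. (1/2::real)^n) sums 2" using geometric_sums[of "1/2::real"] by simp
  have s1: "summable (\<lambda>n. (1/2)^n * e)" using sums_mult2[OF g, of e] by (rule sums_summable)
  have g2: "(\<lambda>n. if n \<ge> N then (1/2::real)^n else 0) sums (2 * (1/2)^N)"
  proof -
    have "(\<lambda>n. (1/2::real)^(n + N)) sums (2 * (1/2)^N)" using sums_mult2[OF g, of "(1/2)^N"] by (simp add: power_add)
    then have "(\<lambda>n. if n + N \<ge> N then (1/2::real)^(n + N) else 0) sums (2 * (1/2)^N)" by simp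
    then show ?thesis
      using sums_iff_shift[of "\<lambda>n. if n \<ge> N then (1/2::real)^n else 0" N "2 * (1/2)^N"] by simp
  qed
  have "rho \<sigma>1 \<sigma>2 \<le> (\<Sum>n. (1/2)^n * e + (if n \<ge> N then (1/2)^n else 0))"
    unfolding rho_def
  proof (rule suminf_le[OF _ rho_summable[OF c]])
    show "summable (\<lambda>n. (1/2)^n * e + (if n \<ge> N then (1/2)^n else 0))"
      by (rule summable_add[OF s1 sums_summable[OF g2]])
    show "(1/2)^n * min 1 (supd n \<sigma>1 \<sigma>2) \<le> (1/2)^n * e + (if n \<ge> N then (1/2)^n else 0)" for n
    proof (cases "n \<ge> N")
      case True
      have "(1/2)^n * min 1 (supd n \<sigma>1 \<sigma>2) \<le> (1/2)^n * 1" by (intro mult_left_mono) auto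
      also have "\<dots> \<le> (1/2)^n * e + (1/2)^n" using e0 by simp
      finally show ?thesis using True by simp
    next
      case False
      have "supd n \<sigma>1 \<sigma>2 \<le> e" by (rule supd_le, rule e) (use False in auto)
      then have "(1/2)^n * min 1 (supd n \<sigma>1 \<sigma>2) \<le> (1/2)^n * e" by (intro mult_left_mono) auto
      then show ?thesis using False by simp
    qed
  qed
  also have "\<dots> = 2 * e + 2 * (1/2)^N"
    using sums_unique[OF sums_add[OF sums_mult2[OF g, of e] g2]] by simp
  finally show ?thesis .
qed

definition locunif :: "(nat \<Rightarrow> sig) \<Rightarrow> sig \<Rightarrow> bool" where
  "locunif f \<sigma> \<longleftrightarrow> (\<forall>T e. e > 0 \<longrightarrow> (\<forall>\<^sub>F n in sequentially. \<forall>s. \<bar>s\<bar> \<le> T \<longrightarrow> sdist (f n) \<sigma> s \<le> e))"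

lemma rho_approx:
  assumes "e > (0::real)" obtains N d where "d > 0" "\<And>\<sigma>1 \<sigma>2. cont2 \<sigma>1 \<Longrightarrow> cont2 \<sigma>2 \<Longrightarrow>
    (\<And>s. \<bar>s\<bar> \<le> real N \<Longrightarrow> sdist \<sigma>1 \<sigma>2 s \<le> d) \<Longrightarrow> rho \<sigma>1 \<sigma>2 < e"
proof -
  obtain N where N: "(1/2::real)^N < e / 4" using real_arch_pow_inv[of "e/4" "1/2"] assms by auto
  show ?thesis
  proof (rule that[of "e/8" N])
    show "e / 8 > 0" using assms by simp
    fix \<sigma>1 \<sigma>2 assume "cont2 \<sigma>1" "cont2 \<sigma>2" "\<And>s. \<bar>s\<bar> \<le> real N \<Longrightarrow> sdist \<sigma>1 \<sigma>2 s \<le> e / 8"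
    from rho_le[of \<sigma>1 \<sigma>2 N "e / 8", OF this] show "rho \<sigma>1 \<sigma>2 < e" using N assms by simp
  qed
qed

lemma locunif_rho:
  assumes "\<And>n. cont2 (f n)" "cont2 \<sigma>" "locunif f \<sigma>" shows "(\<lambda>n. rho (f n) \<sigma>) \<longlonglongrightarrow> 0"
proof (rule tendstoI)
  fix e :: real assume "e > 0"
  then obtain N d where d: "d > 0" "\<And>\<sigma>1 \<sigma>2. cont2 \<sigma>1 \<Longrightarrow> cont2 \<sigma>2 \<Longrightarrow>
    (\<And>s. \<bar>s\<bar> \<le> real N \<Longrightarrow> sdist \<sigma>1 \<sigma>2 s \<le> d) \<Longrightarrow> rho \<sigma>1 \<sigma>2 < e" by (rule rho_approx) blast
  have "\<forall>\<^sub>F n in sequentially. \<forall>s. \<bar>s\<bar> \<le> real N \<longrightarrow> sdist (f n) \<sigma> s \<le> d" using assms(3) d(1) by (simp add: locunif_def)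
  then show "\<forall>\<^sub>F n in sequentially. dist (rho (f n) \<sigma>) 0 < e"
  proof eventually_elim
    case (elim n)
    then have "rho (f n) \<sigma> < e" using d(2) assms by blast
    then show ?case using rho_nonneg[of "f n" \<sigma>] assms by simp
  qed
qed

locale symbol =
  fixes b w :: "real \<Rightarrow> real" and b0 b1 w0 w1 :: real
  assumes ub: "uniformly_continuous_on UNIV b" and uw: "uniformly_continuous_on UNIV w"
    and bb: "b0 \<le> b t" "b t \<le> b1" and wb: "w0 \<le> w t" "w t \<le> w1"
begin

lemma cont2_bw: "cont2 (shift t (b, w))"
proof -
  have "continuous_on UNIV b" "continuous_on UNIV w" using ub uw by (auto intro: uniformly_continuous_imp_continuous)
  then show ?thesis
    unfolding cont2_def shift_def
    by (auto intro!: continuous_on_compose2[of UNIV b] continuous_on_compose2[of UNIV w] continuous_intros)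
qed

lemma Sig_cont: "\<sigma> \<in> Sig b w \<Longrightarrow> cont2 \<sigma>" by (simp add: Sig_def cont2_def)

text \<open>Trades the metric for uniform approximation by translates on bounded intervals, a form
  in which shifts, pointwise bounds and limits are immediate.\<close>

lemma Sig_iff: "\<sigma> \<in> Sig b w \<longleftrightarrow> cont2 \<sigma> \<and> (\<forall>T e. e > 0 \<longrightarrow> (\<exists>t. \<forall>s. \<bar>s\<bar> \<le> T \<longrightarrow> sdist \<sigma> (shift t (b, w)) s \<le> e))"
proof (intro iffI conjI allI impI)
  assume S: "\<sigma> \<in> Sig b w"
  then show c: "cont2 \<sigma>" by (rule Sig_cont)
  fix T e :: real assume e: "e > 0"
  obtain n where n: "T \<le> real n" using real_arch_simple by blast
  obtain t where t: "rho \<sigma> (shift t (b, w)) < min 1 e / 2^n"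
    using S e unfolding Sig_def by (auto dest!: spec[of _ "min 1 e / 2^n"])
  have "min 1 (supd n \<sigma> (shift t (b, w))) \<le> 2^n * rho \<sigma> (shift t (b, w))" by (rule supd_le_rho[OF c cont2_bw])
  also have "\<dots> < min 1 e" using t by (simp add: field_simps)
  finally have "supd n \<sigma> (shift t (b, w)) \<le> e" by (auto simp: min_def split: if_splits)
  then show "\<exists>t. \<forall>s. \<bar>s\<bar> \<le> T \<longrightarrow> sdist \<sigma> (shift t (b, w)) s \<le> e"
    using supd_ge[OF c cont2_bw, of _ n t] n by (intro exI[of _ t]) (meson order_trans)
next
  assume R: "cont2 \<sigma> \<and> (\<forall>T e. e > 0 \<longrightarrow> (\<exists>t. \<forall>s. \<bar>s\<bar> \<le> T \<longrightarrow> sdist \<sigma> (shift t (b, w)) s \<le> e))"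
  have "\<exists>t. rho \<sigma> (shift t (b, w)) < e" if e: "e > 0" for e
  proof -
    obtain N d where d: "d > 0" "\<And>\<sigma>1 \<sigma>2. cont2 \<sigma>1 \<Longrightarrow> cont2 \<sigma>2 \<Longrightarrow>
      (\<And>s. \<bar>s\<bar> \<le> real N \<Longrightarrow> sdist \<sigma>1 \<sigma>2 s \<le> d) \<Longrightarrow> rho \<sigma>1 \<sigma>2 < e" by (rule rho_approx[OF e]) blast
    obtain t where "\<forall>s. \<bar>s\<bar> \<le> real N \<longrightarrow> sdist \<sigma> (shift t (b, w)) s \<le> d" using R d(1) by blast
    then show ?thesis using d(2)[of \<sigma> "shift t (b, w)"] R cont2_bw by blast
  qed
  then show "\<sigma> \<in> Sig b w" using R by (simp add: Sig_def cont2_def)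
qed

lemma Sig_approx:
  assumes "\<sigma> \<in> Sig b w" "e > 0" obtains t where "\<And>s. \<bar>s\<bar> \<le> T \<Longrightarrow> sdist \<sigma> (shift t (b, w)) s \<le> e"
  using assms unfolding Sig_iff by blast

lemma Sig_bw: "(b, w) \<in> Sig b w"
  unfolding Sig_iff
proof (intro conjI allI impI exI[of _ 0])
  show "cont2 (b, w)" using cont2_bw[of 0] by (simp add: shift_def)
qed (auto simp: sdist_def shift_def)

lemma Sig_shift: assumes "\<sigma> \<in> Sig b w" shows "shift r \<sigma> \<in> Sig b w"
  unfolding Sig_iff
proof (intro conjI allI impI)
  have "continuous_on UNIV (fst \<sigma>)" "continuous_on UNIV (snd \<sigma>)" using Sig_cont[OF assms] by (auto simp: cont2_def)
  then show "cont2 (shift r \<sigma>)"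
    unfolding cont2_def shift_def
    by (auto intro!: continuous_on_compose2[of UNIV "fst \<sigma>"] continuous_on_compose2[of UNIV "snd \<sigma>"] continuous_intros)
  fix T e :: real assume "e > 0"
  then obtain t where t: "\<And>s. \<bar>s\<bar> \<le> T + \<bar>r\<bar> \<Longrightarrow> sdist \<sigma> (shift t (b, w)) s \<le> e" by (rule Sig_approx[OF assms]) blast
  have "sdist (shift r \<sigma>) (shift (t + r) (b, w)) s \<le> e" if "\<bar>s\<bar> \<le> T" for s
    using t[of "s + r"] that by (simp add: sdist_def shift_def add_ac)
  then show "\<exists>t. \<forall>s. \<bar>s\<bar> \<le> T \<longrightarrow> sdist (shift r \<sigma>) (shift t (b, w)) s \<le> e" by blast
qed

lemma Sig_bounds:
  assumes "\<sigma> \<in> Sig b w" shows "b0 \<le> fst \<sigma> t" "fst \<sigma> t \<le> b1" "w0 \<le> snd \<sigma> t" "snd \<sigma> t \<le> w1"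
proof -
  have "b0 \<le> fst \<sigma> t + e \<and> fst \<sigma> t \<le> b1 + e \<and> w0 \<le> snd \<sigma> t + e \<and> snd \<sigma> t \<le> w1 + e" if e: "e > 0" for e
  proof -
    obtain r where "\<And>s. \<bar>s\<bar> \<le> \<bar>t\<bar> \<Longrightarrow> sdist \<sigma> (shift r (b, w)) s \<le> e" by (rule Sig_approx[OF assms e]) blast
    from this[of t] have "\<bar>fst \<sigma> t - b (t + r)\<bar> \<le> e" "\<bar>snd \<sigma> t - w (t + r)\<bar> \<le> e" by (auto simp: sdist_def shift_def)
    then show ?thesis using bb[of "t + r"] wb[of "t + r"] by linarith
  qed
  then show "b0 \<le> fst \<sigma> t" "fst \<sigma> t \<le> b1" "w0 \<le> snd \<sigma> t" "snd \<sigma> t \<le> w1"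
    by (auto intro: field_le_epsilon)
qed

text \<open>Translates of \<open>b\<close> and \<open>w\<close> share one modulus of continuity, and
  approximation at the two points involved passes it to the closure, so a single \<open>d\<close>
  serves the whole hull.\<close>

lemma Sig_equicontinuous:
  assumes e: "e > 0"
  obtains d where "d > 0" "\<And>\<sigma> s s'. \<sigma> \<in> Sig b w \<Longrightarrow> \<bar>s - s'\<bar> < d \<Longrightarrow> \<bar>fst \<sigma> s - fst \<sigma> s'\<bar> + \<bar>snd \<sigma> s - snd \<sigma> s'\<bar> < e"
proof -
  have e8: "e / 8 > 0" using e by simp
  obtain d1 where d1: "d1 > 0" "\<And>s s'. dist s' s < d1 \<Longrightarrow> dist (b s') (b s) < e / 8"
    using ub e8 unfolding uniformly_continuous_on_def by (metis UNIV_I)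
  obtain d2 where d2: "d2 > 0" "\<And>s s'. dist s' s < d2 \<Longrightarrow> dist (w s') (w s) < e / 8"
    using uw e8 unfolding uniformly_continuous_on_def by (metis UNIV_I)
  show ?thesis
  proof (rule that[of "min d1 d2"])
    show "min d1 d2 > 0" using d1 d2 by simp
    fix \<sigma> s s' assume \<sigma>: "\<sigma> \<in> Sig b w" and ss: "\<bar>s - s'\<bar> < min d1 d2"
    obtain r where r: "\<And>x. \<bar>x\<bar> \<le> max \<bar>s\<bar> \<bar>s'\<bar> \<Longrightarrow> sdist \<sigma> (shift r (b, w)) x \<le> e / 8"
      by (rule Sig_approx[OF \<sigma> e8]) blast
    have "\<bar>fst \<sigma> s - b (s + r)\<bar> + \<bar>snd \<sigma> s - w (s + r)\<bar> \<le> e / 8" "\<bar>fst \<sigma> s' - b (s' + r)\<bar> + \<bar>snd \<sigma> s' - w (s' + r)\<bar> \<le> e / 8"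
      using r[of s] r[of s'] by (auto simp: sdist_def shift_def)
    moreover have "\<bar>b (s + r) - b (s' + r)\<bar> < e / 8" "\<bar>w (s + r) - w (s' + r)\<bar> < e / 8"
      using d1(2)[of "s + r" "s' + r"] d2(2)[of "s + r" "s' + r"] ss by (auto simp: dist_real_def)
    ultimately show "\<bar>fst \<sigma> s - fst \<sigma> s'\<bar> + \<bar>snd \<sigma> s - snd \<sigma> s'\<bar> < e" using e by linarith
  qed
qed

text \<open>Arzela--Ascoli on \<open>[-1,1]\<close> after the substitution \<open>s = y/(1-|y|)\<close> and multiplication by \<open>1-|y|\<close>.\<close>
lemma Sig_compact:
  fixes f :: "nat \<Rightarrow> sig"
  assumes f: "\<And>n. f n \<in> Sig b w"
  obtains \<sigma> and h :: "nat \<Rightarrow> nat" where "\<sigma> \<in> Sig b w" "strict_mono h" "locunif (\<lambda>n. f (h n)) \<sigma>"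
proof -
  define B where "B = \<bar>b0\<bar> + \<bar>b1\<bar> + \<bar>w0\<bar> + \<bar>w1\<bar>"
  define v where "v n s = (fst (f n) s, snd (f n) s)" for n s
  have vB: "norm (v n s) \<le> B" for n s
  proof -
    have "norm (v n s) \<le> \<bar>fst (f n) s\<bar> + \<bar>snd (f n) s\<bar>" unfolding v_def by (rule norm_Pair_le[THEN order_trans]) simp
    then show ?thesis using Sig_bounds[OF f[of n], of s] unfolding B_def by linarith
  qed
  have B0: "B \<ge> 0" by (simp add: B_def)
  \<comment> \<open>The damping factor makes the bounded functions tend to 0 at the ends, uniformly
    in n, which gives equicontinuity there. At |y| = 1 the quotient takes the default value 0,
    harmless since the factor is 0.\<close>
  define F where "F n y = (1 - \<bar>y\<bar>) *\<^sub>R v n (y / (1 - \<bar>y\<bar>))" for n :: nat and y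
  have eqc: "\<exists>d>0. \<forall>n y. y \<in> {-1..1} \<and> norm (x - y) < d \<longrightarrow> norm (F n x - F n y) < e"
    if x: "x \<in> {-1..1}" and e: "e > 0" for x e
  proof (cases "\<bar>x\<bar> = 1")
    case True
    show ?thesis
    proof (intro exI conjI allI impI)
      show "e / (B + 1) > 0" using e B0 by simp
      fix n y assume y: "y \<in> {-1..1} \<and> norm (x - y) < e / (B + 1)"
      have "1 - \<bar>y\<bar> \<le> \<bar>x - y\<bar>" using True by linarith
      have "norm (F n y) = (1 - \<bar>y\<bar>) * norm (v n (y / (1 - \<bar>y\<bar>)))" using y by (auto simp: F_def abs_le_iff)
      also have "\<dots> \<le> \<bar>x - y\<bar> * (B + 1)"
        using vB[of n "y / (1 - \<bar>y\<bar>)"] \<open>1 - \<bar>y\<bar> \<le> \<bar>x - y\<bar>\<close> y B0 by (intro mult_mono) auto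
      also have "\<dots> < e" using y B0 by (simp add: pos_less_divide_eq)
      finally show "norm (F n x - F n y) < e" using True by (simp add: F_def)
    qed
  next
    case False
    then have x1: "\<bar>x\<bar> < 1" using x by (auto simp: abs_le_iff abs_less_iff)
    obtain d where d: "d > 0" "\<And>\<sigma> s s'. \<sigma> \<in> Sig b w \<Longrightarrow> \<bar>s - s'\<bar> < d \<Longrightarrow> \<bar>fst \<sigma> s - fst \<sigma> s'\<bar> + \<bar>snd \<sigma> s - snd \<sigma> s'\<bar> < e / 2"
      using Sig_equicontinuous[of "e / 2"] e by (metis half_gt_zero)
    have "isCont (\<lambda>y. y / (1 - \<bar>y\<bar>)) x" using x1 by (intro continuous_intros) auto
    then obtain d1 where d1: "d1 > 0" "\<And>y. \<bar>y - x\<bar> < d1 \<Longrightarrow> \<bar>y / (1 - \<bar>y\<bar>) - x / (1 - \<bar>x\<bar>)\<bar> < d"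
      unfolding continuous_at_eps_delta using d(1) by (auto simp: dist_real_def)
    show ?thesis
    proof (intro exI conjI allI impI)
      show "min d1 (e / (2 * (B + 1))) > 0" using d1 e B0 by simp
      fix n y assume y: "y \<in> {-1..1} \<and> norm (x - y) < min d1 (e / (2 * (B + 1)))"
      define p q where "p = x / (1 - \<bar>x\<bar>)" and "q = y / (1 - \<bar>y\<bar>)"
      have "\<bar>p - q\<bar> < d" using d1(2)[of y] y by (simp add: p_def q_def abs_minus_commute)
      then have vd: "norm (v n p - v n q) < e / 2"
        using d(2)[OF f[of n], of p q] norm_Pair_le[of "fst (f n) p - fst (f n) q" "snd (f n) p - snd (f n) q"]
        by (simp add: v_def)
      have eq: "F n x - F n y = (\<bar>y\<bar> - \<bar>x\<bar>) *\<^sub>R v n p + (1 - \<bar>y\<bar>) *\<^sub>R (v n p - v n q)"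
        by (simp add: F_def p_def q_def algebra_simps)
      have "norm (F n x - F n y) \<le> \<bar>\<bar>y\<bar> - \<bar>x\<bar>\<bar> * norm (v n p) + \<bar>1 - \<bar>y\<bar>\<bar> * norm (v n p - v n q)"
        unfolding eq by (rule norm_triangle_le) simp
      also have "\<bar>\<bar>y\<bar> - \<bar>x\<bar>\<bar> * norm (v n p) \<le> \<bar>x - y\<bar> * (B + 1)"
        using vB[of n p] B0 by (intro mult_mono) auto
      also have "\<bar>1 - \<bar>y\<bar>\<bar> * norm (v n p - v n q) \<le> 1 * norm (v n p - v n q)"
        using y by (intro mult_right_mono) auto
      also have "\<bar>x - y\<bar> * (B + 1) < e / 2"
      proof -
        have "\<bar>x - y\<bar> < e / (2 * (B + 1))" using y by simp
        then have "\<bar>x - y\<bar> * (B + 1) < e / (2 * (B + 1)) * (B + 1)" using B0 by (intro mult_strict_right_mono) auto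
        also have "\<dots> = e / 2" using B0 by (simp add: field_simps)
        finally show ?thesis .
      qed
      finally show "norm (F n x - F n y) < e" using vd by simp
    qed
  qed
  have nb: "norm (F n y) \<le> B" if "y \<in> {-1..1}" for n y
  proof -
    have "norm (F n y) = (1 - \<bar>y\<bar>) * norm (v n (y / (1 - \<bar>y\<bar>)))" using that by (auto simp: F_def abs_le_iff)
    also have "\<dots> \<le> 1 * B" using vB B0 that by (intro mult_mono) (auto simp: abs_le_iff)
    finally show ?thesis by simp
  qed
  obtain G and h :: "nat \<Rightarrow> nat" where G: "continuous_on {-1..1} G" "strict_mono h"
    "\<And>e. 0 < e \<Longrightarrow> \<exists>N. \<forall>n x. n \<ge> N \<and> x \<in> {-1..1} \<longrightarrow> norm (F (h n) x - G x) < e"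
  proof (rule Arzela_Ascoli[of "{-1..1::real}" F B])
    show "compact {-1..1::real}" by (rule compact_Icc)
    show "norm (F n x) \<le> B" if "x \<in> {-1..1}" for n x by (rule nb[OF that])
    show "\<exists>d>0. \<forall>n y. y \<in> {-1..1} \<and> norm (x - y) < d \<longrightarrow> norm (F n x - F n y) < e"
      if "x \<in> {-1..1}" "0 < e" for x e by (rule eqc[OF that])
    fix G and k :: "nat \<Rightarrow> nat"
    assume "continuous_on {-1..1} G" "strict_mono k"
      "\<And>e. 0 < e \<Longrightarrow> \<exists>N. \<forall>n x. n \<ge> N \<and> x \<in> {-1..1} \<longrightarrow> norm (F (k n) x - G x) < e"
    then show thesis by (rule that)
  qed
  \<comment> \<open>The inverse substitution; 1 - |Y s| = 1/(1 + |s|), so undoing the damping costs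
    a factor 1 + |s|, which is bounded on compact intervals.\<close>
  define Y where "Y s = s / (1 + \<bar>s\<bar>)" for s :: real
  have Y: "\<bar>Y s\<bar> < 1" "1 - \<bar>Y s\<bar> = 1 / (1 + \<bar>s\<bar>)" "Y s / (1 - \<bar>Y s\<bar>) = s" for s
  proof -
    have 1: "1 + \<bar>s\<bar> > 0" by linarith
    have a: "\<bar>Y s\<bar> = \<bar>s\<bar> / (1 + \<bar>s\<bar>)" using 1 by (simp add: Y_def abs_divide)
    then show "\<bar>Y s\<bar> < 1" using 1 by simp
    show 2: "1 - \<bar>Y s\<bar> = 1 / (1 + \<bar>s\<bar>)" unfolding a using 1 by (simp add: field_simps)
    show "Y s / (1 - \<bar>Y s\<bar>) = s" unfolding 2 using 1 by (simp add: Y_def)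
  qed
  have Y1: "Y s \<in> {-1..1}" for s using Y(1)[of s] by auto
  have cY: "continuous_on UNIV Y" unfolding Y_def by (intro continuous_intros) (auto simp: add_nonneg_eq_0_iff)
  define g where "g s = (1 + \<bar>s\<bar>) *\<^sub>R G (Y s)" for s
  have cg: "continuous_on UNIV g" unfolding g_def
    by (intro continuous_intros continuous_on_compose2[OF G(1) cY]) (use Y1 in auto)
  have vF: "v n s = (1 + \<bar>s\<bar>) *\<^sub>R F n (Y s)" for n s
  proof -
    have "F n (Y s) = (1 / (1 + \<bar>s\<bar>)) *\<^sub>R v n s" by (simp only: F_def Y(3)) (simp only: Y(2))
    then show ?thesis by (simp add: add_nonneg_eq_0_iff)
  qed
  define \<sigma> where "\<sigma> = ((\<lambda>s. fst (g s)), (\<lambda>s. snd (g s)))"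
  have c\<sigma>: "cont2 \<sigma>" unfolding cont2_def \<sigma>_def using cg by (auto intro!: continuous_intros)
  have sd: "sdist (f n) \<sigma> s \<le> 2 * norm (v n s - g s)" for n s
  proof -
    have "\<bar>fst z\<bar> + \<bar>snd z\<bar> \<le> 2 * norm z" for z :: "real \<times> real"
      using norm_fst_le[of "fst z" "snd z"] norm_snd_le[of "snd z" "fst z"] by simp
    from this[of "v n s - g s"] show ?thesis by (simp add: sdist_def \<sigma>_def v_def)
  qed
  have lu: "locunif (\<lambda>n. f (h n)) \<sigma>"
    unfolding locunif_def
  proof (intro allI impI)
    fix T e :: real assume e: "e > 0"
    define k where "k = e / (2 * (1 + \<bar>T\<bar>))"
    have T1: "1 + \<bar>T\<bar> > 0" by linarith
    then have k: "k > 0" using e by (simp add: k_def)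
    obtain N where N: "\<And>n x. n \<ge> N \<Longrightarrow> x \<in> {-1..1} \<Longrightarrow> norm (F (h n) x - G x) < k" using G(3)[OF k] by blast
    have "sdist (f (h n)) \<sigma> s \<le> e" if n: "n \<ge> N" and s: "\<bar>s\<bar> \<le> T" for n s
    proof -
      have "v (h n) s - g s = (1 + \<bar>s\<bar>) *\<^sub>R (F (h n) (Y s) - G (Y s))" by (simp add: vF g_def scaleR_diff_right)
      then have "norm (v (h n) s - g s) = (1 + \<bar>s\<bar>) * norm (F (h n) (Y s) - G (Y s))" by simp
      also have "\<dots> \<le> (1 + \<bar>T\<bar>) * k" using s N[OF n Y1[of s]] by (intro mult_mono) auto
      also have "\<dots> = e / 2" using T1 by (simp add: k_def field_simps)
      finally show ?thesis using sd[of "h n" s] by simp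
    qed
    then show "\<forall>\<^sub>F n in sequentially. \<forall>s. \<bar>s\<bar> \<le> T \<longrightarrow> sdist (f (h n)) \<sigma> s \<le> e"
      unfolding eventually_sequentially by blast
  qed
  have "\<sigma> \<in> Sig b w"
    unfolding Sig_iff
  proof (intro conjI c\<sigma> allI impI)
    fix T e :: real assume e: "e > 0"
    have "\<forall>\<^sub>F n in sequentially. \<forall>s. \<bar>s\<bar> \<le> T \<longrightarrow> sdist (f (h n)) \<sigma> s \<le> e / 2"
      by (rule lu[unfolded locunif_def, THEN spec, THEN spec, THEN mp]) (use e in simp)
    then obtain n where n: "\<And>s. \<bar>s\<bar> \<le> T \<Longrightarrow> sdist (f (h n)) \<sigma> s \<le> e / 2" by (auto simp: eventually_sequentially)
    obtain t where t: "\<And>s. \<bar>s\<bar> \<le> T \<Longrightarrow> sdist (f (h n)) (shift t (b, w)) s \<le> e / 2"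
      using Sig_approx[OF f[of "h n"], of "e / 2"] e by (metis half_gt_zero)
    have "sdist \<sigma> (shift t (b, w)) s \<le> e" if "\<bar>s\<bar> \<le> T" for s
      using sdist_triangle[of \<sigma> "shift t (b, w)" s "f (h n)"] n[OF that] t[OF that] sdist_commute[of \<sigma> "f (h n)" s] by simp
    then show "\<exists>t. \<forall>s. \<bar>s\<bar> \<le> T \<longrightarrow> sdist \<sigma> (shift t (b, w)) s \<le> e" by blast
  qed
  then show ?thesis using that G(2) lu by blast
qed

end

section \<open>Properties of the bounded positive trajectory\<close>

lemma regH_lipschitz:
  assumes m: "\<And>t. memH (u t)" and L: "0 \<le> L" "\<And>s t. nH (\<lambda>x. u t x - u s x) \<le> L * \<bar>t - s\<bar>"
  shows "regH \<tau> u"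
  unfolding regH_def
proof (intro conjI allI impI m)
  show "abscontH T1 T2 u" for T1 T2
    by (rule abscontH_lipschitz[OF L(1)]) (use L(2) in \<open>metis abs_of_nonneg diff_ge_0_iff_ge\<close>)
  show "((\<lambda>t. nH (\<lambda>x. u t x - u \<tau> x)) \<longlongrightarrow> 0) (at_right \<tau>)"
  proof (rule Lim_null_comparison)
    show "\<forall>\<^sub>F t in at_right \<tau>. norm (nH (\<lambda>x. u t x - u \<tau> x)) \<le> L * \<bar>t - \<tau>\<bar>" by (simp add: L(2))
    have "((\<lambda>t. L * \<bar>t - \<tau>\<bar>) \<longlongrightarrow> L * \<bar>\<tau> - \<tau>\<bar>) (at_right \<tau>)" by (intro tendsto_intros)
    then show "((\<lambda>t. L * \<bar>t - \<tau>\<bar>) \<longlongrightarrow> 0) (at_right \<tau>)" by simp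
  qed
qed

section \<open>Stability of the solution concept under a.e. equality, and auxiliary curves\<close>

lemma isA_cong:
  assumes "isA u w" "memH v" "AE s in mu. v s = u s" shows "isA v w"
proof -
  obtain g g1 g2 where H: "memH w" "memH g2" "ae01 (\<lambda>s. u s = g s)"
     "\<forall>s\<in>{0..1}. g1 s = g1 0 + integral\<^sup>L lborel (\<lambda>r. indicator {0..s} r * g2 r)"
     "\<forall>s\<in>{0..1}. g s = integral\<^sup>L lborel (\<lambda>r. indicator {0..s} r * g1 r)" "g 1 = 0"
     "ae01 (\<lambda>s. w s = - g2 s)"
    using assms(1) unfolding isA_def by blast
  have "ae01 (\<lambda>s. v s = g s)" using H(3) assms(3) unfolding ae01_mu by eventually_elim simp
  then show ?thesis using H assms(2) unfolding isA_def by blast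
qed

lemma hasDerivH_cong:
  assumes d: "hasDerivH u u' t" and m: "\<forall>\<^sub>F s in nhds t. memH (u s) \<and> memH (v s) \<and> (AE x in mu. v s x = u s x)"
  shows "hasDerivH v u' t"
proof -
  have u': "memH u'" "((\<lambda>h. nH (\<lambda>x. (u (t + h) x - u t x) / h - u' x)) \<longlongrightarrow> 0) (at 0)"
    using d by (auto simp: hasDerivH_def)
  have mt: "memH (u t)" "memH (v t)" "AE x in mu. v t x = u t x" using eventually_nhds_x_imp_x[OF m] by auto
  have "filterlim (\<lambda>h. t + h) (nhds t) (at 0)" by (auto intro!: tendsto_eq_intros)
  then have "\<forall>\<^sub>F h in at 0. memH (u (t + h)) \<and> memH (v (t + h)) \<and> (AE x in mu. v (t + h) x = u (t + h) x)"
    using m unfolding filterlim_iff by blast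
  then have "\<forall>\<^sub>F h in at 0. nH (\<lambda>x. (v (t + h) x - v t x) / h - u' x) = nH (\<lambda>x. (u (t + h) x - u t x) / h - u' x)"
  proof eventually_elim
    case (elim h)
    show ?case
    proof (rule nH_cong)
      have E: "memH (v (t + h))" "memH (u (t + h))" using elim by blast+
      show "(\<lambda>x. (v (t + h) x - v t x) / h - u' x) \<in> borel_measurable mu"
        "(\<lambda>x. (u (t + h) x - u t x) / h - u' x) \<in> borel_measurable mu"
        by (intro memH_measurable memH_diff memH_divide E mt(1,2) u'(1))+
      have "AE x in mu. v (t + h) x = u (t + h) x" using elim by simp
      with mt(3) show "AE x in mu. (v (t + h) x - v t x) / h - u' x = (u (t + h) x - u t x) / h - u' x"
        by eventually_elim simp
    qed
  qed
  then have "((\<lambda>h. nH (\<lambda>x. (v (t + h) x - v t x) / h - u' x)) \<longlongrightarrow> 0) (at 0)"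
    using u'(2) tendsto_cong[of "\<lambda>h. nH (\<lambda>x. (v (t + h) x - v t x) / h - u' x)"] by fast
  then show ?thesis using u'(1) by (simp add: hasDerivH_def)
qed

text \<open>Points of M1, and the pieces of a complete trajectory, are tied to a given solution only
  a.e. in space or only from some time on. All ingredients of \<open>sol\<close> depend on a.e.
  classes after the initial time, so the selection \<open>r\<close> can be kept.\<close>

lemma sol_cong:
  assumes s: "sol \<sigma> \<tau> x u" and m: "\<And>t. t \<ge> \<tau> \<Longrightarrow> memH (v t)" and e: "\<And>t. t \<ge> \<tau> \<Longrightarrow> AE x in mu. v t x = u t x"
  shows "sol \<sigma> \<tau> (v \<tau>) v"
proof -
  have mu: "memH (u t)" if "t \<ge> \<tau>" for t using s that by (simp add: sol_def contH_def)
  have n: "nH (\<lambda>x. v t x - v r x) = nH (\<lambda>x. u t x - u r x)" if "t \<ge> \<tau>" "r \<ge> \<tau>" for t r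
  proof (rule nH_cong)
    show "(\<lambda>x. v t x - v r x) \<in> borel_measurable mu" "(\<lambda>x. u t x - u r x) \<in> borel_measurable mu"
      by (rule memH_measurable, intro memH_diff m mu that)+
    show "AE x in mu. v t x - v r x = u t x - u r x"
      using e[OF that(1)] e[OF that(2)] by eventually_elim simp
  qed
  have near: "\<forall>\<^sub>F s in nhds t. memH (u s) \<and> memH (v s) \<and> (AE x in mu. v s x = u s x)" if "t > \<tau>" for t
    using eventually_nhds_greater[OF that] by eventually_elim (use m mu e in simp)
  obtain r where r: "L2locH \<tau> r" "AE t in lborel. t > \<tau> \<longrightarrow>
           ae01 (\<lambda>s. r t s \<in> (\<lambda>z. fst \<sigma> t * z + snd \<sigma> t * u t s) ` H0 (u t s))"
       "AE t in lborel. t > \<tau> \<longrightarrow> (\<exists>u' w. hasDerivH u u' t \<and> isA (u t) w \<and> ae01 (\<lambda>s. u' s + w s = r t s))"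
    using s unfolding sol_def by blast
  show ?thesis
    unfolding sol_def
  proof (intro conjI allI impI)
    show "contH \<tau> v"
      unfolding contH_def
    proof (intro conjI allI impI m)
      fix t e :: real assume t: "t \<ge> \<tau>" and e: "e > 0"
      obtain d where d: "d > 0" "\<And>r. r \<ge> \<tau> \<Longrightarrow> \<bar>r - t\<bar> < d \<Longrightarrow> nH (\<lambda>x. u r x - u t x) < e"
        using s t e unfolding sol_def contH_def by blast
      then show "\<exists>d>0. \<forall>s\<ge>\<tau>. \<bar>s - t\<bar> < d \<longrightarrow> nH (\<lambda>x. v s x - v t x) < e" using n[OF _ t] by auto
    qed
    show "v \<tau> = v \<tau>" ..
    show "abscontH T1 T2 v" if T: "\<tau> < T1 \<and> T1 < T2" for T1 T2
      unfolding abscontH_def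
    proof (intro allI impI)
      fix e :: real assume e: "e > 0"
      have a: "abscontH T1 T2 u" using s T by (simp add: sol_def)
      have "\<exists>d>0. \<forall>(n::nat) (a::nat\<Rightarrow>real) (c::nat\<Rightarrow>real). (\<forall>i<n. T1 \<le> a i \<and> a i \<le> c i \<and> c i \<le> T2) \<and>
        (\<forall>i<n. \<forall>j<n. i \<noteq> j \<longrightarrow> c i \<le> a j \<or> c j \<le> a i) \<and>
        (\<Sum>i<n. c i - a i) < d \<longrightarrow> (\<Sum>i<n. nH (\<lambda>x. u (c i) x - u (a i) x)) < e"
        by (rule a[unfolded abscontH_def, THEN spec, THEN mp, OF e])
      then obtain d where d: "d > 0" and D: "\<forall>(n::nat) (a::nat\<Rightarrow>real) (c::nat\<Rightarrow>real). (\<forall>i<n. T1 \<le> a i \<and> a i \<le> c i \<and> c i \<le> T2) \<and>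
        (\<forall>i<n. \<forall>j<n. i \<noteq> j \<longrightarrow> c i \<le> a j \<or> c j \<le> a i) \<and>
        (\<Sum>i<n. c i - a i) < d \<longrightarrow> (\<Sum>i<n. nH (\<lambda>x. u (c i) x - u (a i) x)) < e"
        by (elim exE conjE)
      show "\<exists>d>0. \<forall>(n::nat) (a::nat\<Rightarrow>real) (c::nat\<Rightarrow>real). (\<forall>i<n. T1 \<le> a i \<and> a i \<le> c i \<and> c i \<le> T2) \<and>
        (\<forall>i<n. \<forall>j<n. i \<noteq> j \<longrightarrow> c i \<le> a j \<or> c j \<le> a i) \<and>
        (\<Sum>i<n. c i - a i) < d \<longrightarrow> (\<Sum>i<n. nH (\<lambda>x. v (c i) x - v (a i) x)) < e"
      proof (intro exI[of _ d] conjI allI impI d)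
        fix k :: nat and a c :: "nat \<Rightarrow> real"
        assume H: "(\<forall>i<k. T1 \<le> a i \<and> a i \<le> c i \<and> c i \<le> T2) \<and>
          (\<forall>i<k. \<forall>j<k. i \<noteq> j \<longrightarrow> c i \<le> a j \<or> c j \<le> a i) \<and> (\<Sum>i<k. c i - a i) < d"
        have "(\<Sum>i<k. nH (\<lambda>x. v (c i) x - v (a i) x)) = (\<Sum>i<k. nH (\<lambda>x. u (c i) x - u (a i) x))"
        proof (rule sum.cong[OF refl])
          fix i assume "i \<in> {..<k}"
          then have "T1 \<le> a i" "a i \<le> c i" using H by auto
          then show "nH (\<lambda>x. v (c i) x - v (a i) x) = nH (\<lambda>x. u (c i) x - u (a i) x)" using T by (intro n) auto
        qed
        also have "\<dots> < e" by (rule D[THEN spec, THEN spec, THEN spec, THEN mp, OF H])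
        finally show "(\<Sum>i<k. nH (\<lambda>x. v (c i) x - v (a i) x)) < e" .
      qed
    qed
    show "AE t in lborel. t > \<tau> \<longrightarrow> (\<exists>w. isA (v t) w)"
      using r(3)
    proof eventually_elim
      case (elim t)
      then show ?case using isA_cong[of "u t" _ "v t"] m[of t] e[of t] by (meson less_imp_le)
    qed
    show "\<exists>r. L2locH \<tau> r \<and>
        (AE t in lborel. t > \<tau> \<longrightarrow> ae01 (\<lambda>s. r t s \<in> (\<lambda>z. fst \<sigma> t * z + snd \<sigma> t * v t s) ` H0 (v t s))) \<and>
        (AE t in lborel. t > \<tau> \<longrightarrow> (\<exists>u' w. hasDerivH v u' t \<and> isA (v t) w \<and> ae01 (\<lambda>s. u' s + w s = r t s)))"
    proof (intro exI[of _ r] conjI r(1))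
      show "AE t in lborel. t > \<tau> \<longrightarrow> ae01 (\<lambda>s. r t s \<in> (\<lambda>z. fst \<sigma> t * z + snd \<sigma> t * v t s) ` H0 (v t s))"
        using r(2)
      proof eventually_elim
        case (elim t)
        show ?case
        proof
          assume t: "t > \<tau>"
          then have 1: "AE s in mu. r t s \<in> (\<lambda>z. fst \<sigma> t * z + snd \<sigma> t * u t s) ` H0 (u t s)" using elim by (simp add: ae01_mu)
          have 2: "AE s in mu. v t s = u t s" using e t by simp
          from 1 2 show "ae01 (\<lambda>s. r t s \<in> (\<lambda>z. fst \<sigma> t * z + snd \<sigma> t * v t s) ` H0 (v t s))"
            unfolding ae01_mu by eventually_elim simp
        qed
      qed
      show "AE t in lborel. t > \<tau> \<longrightarrow> (\<exists>u' w. hasDerivH v u' t \<and> isA (v t) w \<and> ae01 (\<lambda>s. u' s + w s = r t s))"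
        using r(3)
      proof eventually_elim
        case (elim t)
        show ?case
        proof
          assume t: "t > \<tau>"
          then obtain u' w where U: "hasDerivH u u' t" "isA (u t) w" "ae01 (\<lambda>s. u' s + w s = r t s)" using elim by blast
          have "hasDerivH v u' t" by (rule hasDerivH_cong[OF U(1) near[OF t]])
          moreover have "isA (v t) w" by (rule isA_cong[OF U(2)]) (use m e t in auto)
          ultimately show "\<exists>u' w. hasDerivH v u' t \<and> isA (v t) w \<and> ae01 (\<lambda>s. u' s + w s = r t s)" using U(3) by blast
        qed
      qed
    qed
  qed
qed

lemma hasDerivH_const: "memH \<phi> \<Longrightarrow> hasDerivH (\<lambda>_. \<phi>) (\<lambda>_. 0) t"
  by (simp add: hasDerivH_def)

lemma regH_const: "memH \<phi> \<Longrightarrow> regH \<tau> (\<lambda>_. \<phi>)"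
  by (rule regH_lipschitz[of _ 0]) auto

lemma isA_parabola: "isA (\<lambda>s. k * (s * (1 - s)) / 2) (\<lambda>_. k)"
proof -
  have "isA (\<lambda>s. k * (s * (1 - s)) / 2) (\<lambda>_. - (- k))"
    by (rule isA_C2[where ?g1.0 = "\<lambda>s. k * (1 - 2 * s) / 2"]) (auto intro!: derivative_eq_intros simp: field_simps)
  then show ?thesis by simp
qed

lemma L2locH_bounded:
  assumes m: "(\<lambda>p. r (fst p) (snd p)) \<in> borel_measurable (lborel \<Otimes>\<^sub>M lborel)" and B: "\<And>t s. \<bar>r t s\<bar> \<le> B"
  shows "L2locH \<tau> r"
  unfolding L2locH_def
proof (intro conjI allI impI)
  have S: "A \<times> I01 \<in> sets (lborel \<Otimes>\<^sub>M lborel)" if "A \<in> sets borel" for A :: "real set"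
    by (rule pair_measureI) (use that in auto)
  show "(\<lambda>p. indicator ({\<tau><..} \<times> I01) p * r (fst p) (snd p)) \<in> borel_measurable (lborel \<Otimes>\<^sub>M lborel)"
    by (intro borel_measurable_times m borel_measurable_indicator S) simp
  fix T1 T2 :: real
  have "integrable (lborel \<Otimes>\<^sub>M lborel) (\<lambda>p. indicator ({T1..T2} \<times> I01) p *\<^sub>R (r (fst p) (snd p))^2)"
  proof (rule integrableI_bounded_set_indicator[where B="B^2"])
    show "{T1..T2} \<times> I01 \<in> sets (lborel \<Otimes>\<^sub>M lborel)" by (rule S) simp
    show "(\<lambda>p. (r (fst p) (snd p))^2) \<in> borel_measurable (lborel \<Otimes>\<^sub>M lborel)" by (intro borel_measurable_power m)
    have "emeasure (lborel \<Otimes>\<^sub>M lborel) ({T1..T2} \<times> I01) = emeasure lborel {T1..T2} * emeasure lborel I01"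
      by (rule lborel.emeasure_pair_measure_Times) auto
    also have "\<dots> < \<infinity>" by (cases "T1 \<le> T2") (auto simp: I01_def ennreal_mult_less_top)
    finally show "emeasure (lborel \<Otimes>\<^sub>M lborel) ({T1..T2} \<times> I01) < \<infinity>" .
    have "(r t s)^2 \<le> B^2" for t s using power_mono[OF B[of t s], of 2] by simp
    then show "AE p in lborel \<Otimes>\<^sub>M lborel. p \<in> {T1..T2} \<times> I01 \<longrightarrow> norm ((r (fst p) (snd p))^2) \<le> B^2" by simp
  qed
  then show "integrable (lborel \<Otimes>\<^sub>M lborel) (\<lambda>p. indicator ({T1..T2} \<times> I01) p * (r (fst p) (snd p))^2)" by simp
qed

lemma not_AE_mu_False: "\<not> (AE s in mu. False)"
  using emeasure_mu ae_filter_eq_bot_iff[of mu] by (simp add: eventually_False)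

text \<open>The pullback limit: the estimate holds for every starting time n units in the past, with
  one and the same bound \<open>R\<close> there.\<close>

lemma exp_decay_zero:
  fixes a :: real assumes l: "0 < l" and R: "0 \<le> R" and le: "\<And>n::nat. a \<le> exp (- l * real n) * R"
  shows "a \<le> 0"
proof -
  have "(\<lambda>n. exp (- l) ^ n) \<longlonglongrightarrow> 0" by (rule LIMSEQ_power_zero) (use l in simp)
  from tendsto_mult[OF this tendsto_const[of R]]
  have "(\<lambda>n. exp (- l) ^ n * R) \<longlonglongrightarrow> 0 * R" .
  moreover have "exp (- l) ^ n = exp (- l * real n)" for n by (simp add: exp_of_nat_mult[symmetric] mult.commute)
  ultimately have "(\<lambda>n. exp (- l * real n) * R) \<longlonglongrightarrow> 0" by simp
  then show ?thesis by (rule LIMSEQ_le_const) (use le in blast)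
qed

section \<open>The positive complete trajectory: barrier, admissibility and uniqueness\<close>

locale problem = bounds b0 b1 w1 + symbol b w b0 b1 0 w1 for b w b0 b1 w1
begin

definition lam :: real where "lam = pi^2 - w1"
lemma lam_pos: "0 < lam" using w1 by (simp add: lam_def)

lemma adm_Sig: "\<sigma> \<in> Sig b w \<Longrightarrow> adm (fst \<sigma>) (snd \<sigma>)"
  using Sig_bounds[of \<sigma>] Sig_cont[of \<sigma>] by (auto simp: adm_def cont2_def)

text \<open>The paper's \<open>\<xi>\<^sub>M\<^sub>,\<^sub>\<sigma>\<close>, as a sine series with coefficients given by bounded solutions of scalar equations.\<close>
definition ftraj :: "sig \<Rightarrow> (real \<Rightarrow> fn) \<Rightarrow> bool" where
  "ftraj \<sigma> X \<longleftrightarrow> \<sigma> \<in> Sig b w \<and> (\<exists>c. coeffs (fst \<sigma>) (snd \<sigma>) c \<and> X = sol_of c)"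

lemma ftraj_exists: assumes "\<sigma> \<in> Sig b w" obtains X where "ftraj \<sigma> X"
  using coeffs_exist[OF adm_Sig[OF assms]] assms unfolding ftraj_def by blast

lemma ftraj_shift: assumes "ftraj \<sigma> X" shows "ftraj (shift r \<sigma>) (\<lambda>t. X (t + r))"
proof -
  obtain c where c: "\<sigma> \<in> Sig b w" "coeffs (fst \<sigma>) (snd \<sigma>) c" "X = sol_of c" using assms by (auto simp: ftraj_def)
  have "coeffs (fst (shift r \<sigma>)) (snd (shift r \<sigma>)) (\<lambda>j t. c j (t + r))"
    using c(2) unfolding coeffs_def shift_def DERIV_shift[symmetric] by simp
  moreover have "(\<lambda>t. X (t + r)) = sol_of (\<lambda>j t. c j (t + r))" by (auto simp: c(3) sol_of_def fun_eq_iff)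
  ultimately show ?thesis using Sig_shift[OF c(1)] unfolding ftraj_def by blast
qed

definition CX :: real where "CX = \<bar>C0 * S2\<bar>"

lemma ftraj_facts:
  assumes "ftraj \<sigma> X"
  shows ftraj_memH: "memH (X t)" and ftraj_regH: "regH \<tau> X"
    and ftraj_eq: "\<exists>X' W. hasDerivH X X' t \<and> isA (X t) W \<and> (AE s in mu. X' s + W s = fst \<sigma> t + snd \<sigma> t * X t s)"
    and ftraj_bound: "nH (X t) \<le> CX" and ftraj_abs: "\<bar>X t s\<bar> \<le> CX"
    and ftraj_measurable: "(\<lambda>p. X (fst p) (snd p)) \<in> borel_measurable (lborel \<Otimes>\<^sub>M lborel)"
proof -
  obtain c where c: "\<sigma> \<in> Sig b w" "coeffs (fst \<sigma>) (snd \<sigma>) c" "X = sol_of c" using assms by (auto simp: ftraj_def)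
  note A = adm_Sig[OF c(1)] c(2)
  show m: "memH (X t)" for t using sol_series[OF A, of t] by (simp add: sine_series_def c(3))
  show "regH \<tau> X"
    by (rule regH_lipschitz[OF m, of "K0 * sqrt S2"]) (use K0_pos S2_nonneg[OF A] sol_lipschitz[OF A] c(3) in auto)
  show "\<exists>X' W. hasDerivH X X' t \<and> isA (X t) W \<and> (AE s in mu. X' s + W s = fst \<sigma> t + snd \<sigma> t * X t s)"
    using sol_equation[OF A] c(3) by simp
  show ab: "\<bar>X t s\<bar> \<le> CX" for s using sol_abs[OF A, of t s] by (simp add: CX_def c(3))
  have "nH (X t) \<le> \<bar>CX\<bar>" by (rule nH_bound[OF memH_measurable[OF m]]) (rule AE_I2, rule ab)
  then show "nH (X t) \<le> CX" by (simp add: CX_def)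
  show "(\<lambda>p. X (fst p) (snd p)) \<in> borel_measurable (lborel \<Otimes>\<^sub>M lborel)"
    unfolding c(3) by (rule sol_measurable[OF A])
qed

text \<open>Pullback comparison with a stationary function. The entropy of
  \<open>\<phi> - X t\<close> is bounded uniformly in time and contracts on [t - n, t], so it is 0.
  The condition \<open>H\<close> is confined to points where the barrier exceeds \<open>X\<close>,
  since \<open>fp\<close> vanishes elsewhere.\<close>

lemma ftraj_ge:
  assumes X: "ftraj \<sigma> X" and \<phi>: "isA \<phi> (\<lambda>_. k)"
    and H: "\<And>t. AE s in mu. \<phi> s - X t s > 0 \<longrightarrow> k - (fst \<sigma> t + snd \<sigma> t * X t s) \<le> w1 * (\<phi> s - X t s)"
  shows "AE s in mu. \<phi> s \<le> X t s"
proof -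
  have m\<phi>: "memH \<phi>" using \<phi> by (simp add: isA_def)
  note mX = ftraj_memH[OF X]
  let ?z = "\<lambda>t s. \<phi> s - X t s"
  have mz: "memH (?z t)" for t using m\<phi> mX by simp
  define R where "R = (nH \<phi> + CX)^2"
  have Jb: "posp.J (?z t) \<le> R" for t
  proof -
    have "nH (?z t) \<le> nH \<phi> + CX" using nH_triangle_diff[OF m\<phi> mX[of t]] ftraj_bound[OF X, of t] by linarith
    then have "nH (?z t)^2 \<le> R" unfolding R_def by (intro power_mono) auto
    then show ?thesis using posp.J_le[OF mz[of t]] by linarith
  qed
  have step: "posp.J (?z t) \<le> exp (- (pi^2 - w1) * (t - (t - real n))) * posp.J (?z (t - real n))" for n :: nat
  proof (rule posp.comparison[where z="?z"])
    have rz: "regH (t - real n) ?z" by (rule regH_diff[OF regH_const[OF m\<phi>] ftraj_regH[OF X]])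
    show "((\<lambda>r. nH (\<lambda>x. (\<phi> x - X r x) - (\<phi> x - X (t - real n) x))) \<longlongrightarrow> 0) (at_right (t - real n))"
      using rz by (simp add: regH_def)
    show "abscontH T1 T2 ?z" if "t - real n < T1" "T1 < T2" for T1 T2 using rz that by (simp add: regH_def)
    show "AE r in lborel. t - real n < r \<and> r < t \<longrightarrow> (\<exists>z' W. hasDerivH ?z z' r \<and> isA (?z r) W \<and>
       (AE s in mu. (z' s + W s) * fp ((\<phi> s - X r s) / sin (pi * s)) \<le> w1 * ((\<phi> s - X r s) * fp ((\<phi> s - X r s) / sin (pi * s)))))"
    proof (rule AE_I2, rule impI)
      fix r
      obtain X' W where E: "hasDerivH X X' r" "isA (X r) W" "AE s in mu. X' s + W s = fst \<sigma> r + snd \<sigma> r * X r s"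
        using ftraj_eq[OF X, of r] by blast
      have D: "hasDerivH ?z (\<lambda>x. 0 - X' x) r"
        by (rule hasDerivH_diff[OF hasDerivH_const[OF m\<phi>] E(1)]) (simp_all add: m\<phi> mX)
      have A: "isA (?z r) (\<lambda>x. k - W x)" by (rule isA_diff[OF \<phi> E(2)])
      have "AE s in mu. 0 < sin (pi * s)" by (rule AE_mu_I, rule sin_pi_pos)
      with E(3) H[of r] have "AE s in mu. ((0 - X' s) + (k - W s)) * fp ((\<phi> s - X r s) / sin (pi * s)) \<le> w1 * ((\<phi> s - X r s) * fp ((\<phi> s - X r s) / sin (pi * s)))"
      proof eventually_elim
        case (elim s)
        show ?case
        proof (cases "\<phi> s - X r s > 0")
          case True
          then have "0 < fp ((\<phi> s - X r s) / sin (pi * s))" using elim(3) by (intro fp_pos) simp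
          moreover have "(0 - X' s) + (k - W s) \<le> w1 * (\<phi> s - X r s)" using elim True by simp
          ultimately show ?thesis by (simp add: mult.assoc[symmetric] mult_right_mono)
        next
          case False
          then have "fp ((\<phi> s - X r s) / sin (pi * s)) = 0" using elim(3) by (intro fp_neg) (simp add: divide_le_0_iff)
          then show ?thesis by simp
        qed
      qed
      then show "\<exists>z' W. hasDerivH ?z z' r \<and> isA (?z r) W \<and>
       (AE s in mu. (z' s + W s) * fp ((\<phi> s - X r s) / sin (pi * s)) \<le> w1 * ((\<phi> s - X r s) * fp ((\<phi> s - X r s) / sin (pi * s))))"
        using D A by blast
    qed
  qed (use mz w1 in auto)
  have "posp.J (?z t) \<le> exp (- lam * real n) * R" for n
  proof -
    have "posp.J (?z t) \<le> exp (- lam * real n) * posp.J (?z (t - real n))" using step[of n] by (simp add: lam_def)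
    also have "\<dots> \<le> exp (- lam * real n) * R" by (intro mult_left_mono Jb) simp
    finally show ?thesis .
  qed
  then have "posp.J (?z t) \<le> 0" by (rule exp_decay_zero[OF lam_pos, rotated]) (simp add: R_def)
  from posp_J_zero_D[OF mz this] show ?thesis by eventually_elim simp
qed

definition phi :: fn where "phi s = b0 * (s * (1 - s)) / 2"

lemma phi_pos: "0 < s \<Longrightarrow> s < 1 \<Longrightarrow> 0 < phi s" using b0 by (simp add: phi_def)

text \<open>Two passes: comparison with 0 shows that \<open>X\<close> is nonnegative; then the term
  w X has a favourable sign, the total source is at least \<open>b0\<close>, and the solution of
  -phi'' = b0 becomes a barrier.\<close>

lemma ftraj_ge_phi:
  assumes X: "ftraj \<sigma> X" shows "AE s in mu. phi s \<le> X t s"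
proof -
  have \<sigma>: "\<sigma> \<in> Sig b w" using X by (simp add: ftraj_def)
  note bd = Sig_bounds[OF \<sigma>]
  have nn: "AE s in mu. 0 \<le> X t s" for t
  proof (rule ftraj_ge[OF X])
    show "isA (\<lambda>_. 0) (\<lambda>_. 0)" using isA_parabola[of 0] by simp
    show "AE s in mu. 0 - X t s > 0 \<longrightarrow> 0 - (fst \<sigma> t + snd \<sigma> t * X t s) \<le> w1 * (0 - X t s)" for t
    proof (rule AE_I2, rule impI)
      fix s assume p: "0 - X t s > 0"
      have "snd \<sigma> t * (0 - X t s) \<le> w1 * (0 - X t s)" using bd p by (intro mult_right_mono) auto
      then show "0 - (fst \<sigma> t + snd \<sigma> t * X t s) \<le> w1 * (0 - X t s)" using bd(1)[of t] b0 by simp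
    qed
  qed
  show ?thesis
  proof (rule ftraj_ge[OF X])
    show "isA phi (\<lambda>_. b0)" unfolding phi_def[abs_def] by (rule isA_parabola)
    show "AE s in mu. phi s - X t s > 0 \<longrightarrow> b0 - (fst \<sigma> t + snd \<sigma> t * X t s) \<le> w1 * (phi s - X t s)" for t
      using nn[of t]
    proof eventually_elim
      case (elim s)
      show ?case
      proof
        assume "phi s - X t s > 0"
        then have "0 \<le> w1 * (phi s - X t s)" using w10 by simp
        moreover have "0 \<le> snd \<sigma> t * X t s" using bd(3) elim by simp
        ultimately show "b0 - (fst \<sigma> t + snd \<sigma> t * X t s) \<le> w1 * (phi s - X t s)" using bd(1)[of t] by linarith
      qed
    qed
  qed
qed

lemma ftraj_pos: "ftraj \<sigma> X \<Longrightarrow> AE s in mu. 0 < X t s"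
proof -
  assume "ftraj \<sigma> X"
  from ftraj_ge_phi[OF this, of t] have "AE s in mu. phi s \<le> X t s" .
  moreover have "AE s in mu. 0 < phi s" by (rule AE_mu_I, rule phi_pos)
  ultimately show ?thesis by eventually_elim simp
qed

definition m0 :: real where "m0 = nH phi"

lemma memH_phi: "memH phi" using isA_parabola[of b0] by (simp add: isA_def phi_def[abs_def])

lemma m0_pos: "0 < m0"
proof -
  have "m0 \<noteq> 0"
  proof
    assume "m0 = 0"
    then have "AE s in mu. phi s = 0" using nH_eq_0[OF memH_phi] by (simp add: m0_def)
    moreover have "AE s in mu. 0 < phi s" by (rule AE_mu_I, rule phi_pos)
    ultimately have "AE s in mu. False" by eventually_elim simp
    then show False using not_AE_mu_False by blast
  qed
  then show ?thesis using nH_nonneg[of phi] unfolding m0_def by linarith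
qed

lemma ftraj_lower: assumes X: "ftraj \<sigma> X" shows "m0 \<le> nH (X t)"
  unfolding m0_def
proof (rule nH_mono[OF memH_measurable[OF memH_phi] ftraj_memH[OF X]])
  have "AE s in mu. 0 < phi s" by (rule AE_mu_I, rule phi_pos)
  with ftraj_ge_phi[OF X, of t] show "AE s in mu. \<bar>phi s\<bar> \<le> \<bar>X t s\<bar>" by eventually_elim simp
qed

text \<open>The linear solution solves the inclusion because it is positive a.e., where
  \<open>H0\<close> contains only 1. Boundedness of the source provides the local square
  integrability.\<close>

lemma ftraj_sol: assumes X: "ftraj \<sigma> X" shows "sol \<sigma> \<tau> (X \<tau>) X"
proof -
  have \<sigma>: "\<sigma> \<in> Sig b w" using X by (simp add: ftraj_def)
  note bd = Sig_bounds[OF \<sigma>] and c = Sig_cont[OF \<sigma>]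
  obtain c where cc: "coeffs (fst \<sigma>) (snd \<sigma>) c" "X = sol_of c" using X by (auto simp: ftraj_def)
  note A = adm_Sig[OF \<sigma>] cc(1)
  define r where "r t s = fst \<sigma> t + snd \<sigma> t * X t s" for t s
  define K where "K = K0 * sqrt S2"
  have K: "0 \<le> K" "\<And>s t. nH (\<lambda>x. X t x - X s x) \<le> K * \<bar>t - s\<bar>"
    using K0_pos S2_nonneg[OF A] sol_lipschitz[OF A] cc(2) by (auto simp: K_def)
  have rm: "(\<lambda>p. r (fst p) (snd p)) \<in> borel_measurable (lborel \<Otimes>\<^sub>M lborel)"
  proof -
    have "fst \<sigma> \<in> borel_measurable lborel" "snd \<sigma> \<in> borel_measurable lborel"
      unfolding measurable_lborel2 by (rule borel_measurable_continuous_onI, use c in \<open>simp add: cont2_def\<close>)+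
    from this[THEN measurable_compose[OF measurable_fst]]
    show ?thesis unfolding r_def
      by (intro borel_measurable_add borel_measurable_times ftraj_measurable[OF X])
  qed
  have CX0: "0 \<le> CX" by (simp add: CX_def)
  have rb: "\<bar>r t s\<bar> \<le> b1 + w1 * CX" for t s
  proof -
    have "\<bar>snd \<sigma> t * X t s\<bar> \<le> w1 * CX" unfolding abs_mult
      using bd(3,4)[of t] ftraj_abs[OF X, of t s] w10 by (intro mult_mono) auto
    then show ?thesis using bd(1,2)[of t] b0 unfolding r_def by linarith
  qed
  show ?thesis
    unfolding sol_def
  proof (intro conjI allI impI)
    show "contH \<tau> X"
      unfolding contH_def
    proof (intro conjI allI impI ftraj_memH[OF X])
      fix t e :: real assume e: "e > 0"
      show "\<exists>d>0. \<forall>s\<ge>\<tau>. \<bar>s - t\<bar> < d \<longrightarrow> nH (\<lambda>x. X s x - X t x) < e"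
      proof (intro exI conjI allI impI)
        show "e / (K + 1) > 0" using e K by simp
        fix s assume s: "\<bar>s - t\<bar> < e / (K + 1)"
        have "nH (\<lambda>x. X s x - X t x) \<le> K * \<bar>s - t\<bar>" by (rule K(2))
        also have "\<dots> \<le> (K + 1) * \<bar>s - t\<bar>" by (intro mult_right_mono) auto
        also have "\<dots> < (K + 1) * (e / (K + 1))" using K s by (intro mult_strict_left_mono) auto
        also have "\<dots> = e" using K by simp
        finally show "nH (\<lambda>x. X s x - X t x) < e" .
      qed
    qed
    show "X \<tau> = X \<tau>" ..
    show "abscontH T1 T2 X" if "\<tau> < T1 \<and> T1 < T2" for T1 T2
      using ftraj_regH[OF X, of \<tau>] that by (simp add: regH_def)
    show "AE t in lborel. t > \<tau> \<longrightarrow> (\<exists>w. isA (X t) w)" using ftraj_eq[OF X] by (intro AE_I2) blast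
    show "\<exists>r. L2locH \<tau> r \<and>
        (AE t in lborel. t > \<tau> \<longrightarrow> ae01 (\<lambda>s. r t s \<in> (\<lambda>z. fst \<sigma> t * z + snd \<sigma> t * X t s) ` H0 (X t s))) \<and>
        (AE t in lborel. t > \<tau> \<longrightarrow> (\<exists>u' w. hasDerivH X u' t \<and> isA (X t) w \<and> ae01 (\<lambda>s. u' s + w s = r t s)))"
    proof (intro exI[of _ r] conjI)
      show "L2locH \<tau> r" by (rule L2locH_bounded[OF rm rb])
      show "AE t in lborel. t > \<tau> \<longrightarrow> ae01 (\<lambda>s. r t s \<in> (\<lambda>z. fst \<sigma> t * z + snd \<sigma> t * X t s) ` H0 (X t s))"
      proof (rule AE_I2, rule impI)
        fix t
        show "ae01 (\<lambda>s. r t s \<in> (\<lambda>z. fst \<sigma> t * z + snd \<sigma> t * X t s) ` H0 (X t s))"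
          unfolding ae01_mu using ftraj_pos[OF X, of t] by eventually_elim (simp add: H0_def r_def)
      qed
      show "AE t in lborel. t > \<tau> \<longrightarrow> (\<exists>u' w. hasDerivH X u' t \<and> isA (X t) w \<and> ae01 (\<lambda>s. u' s + w s = r t s))"
        unfolding ae01_mu r_def using ftraj_eq[OF X] by (intro AE_I2 impI)
    qed
  qed
qed

text \<open>\<open>memD\<close> asks for positivity at every point, the barrier gives it a.e.;
  continuity of the representative and of \<open>phi\<close> bridges the two.\<close>

lemma ftraj_memD: assumes X: "ftraj \<sigma> X" shows "memD (X t)"
proof -
  obtain W where "isA (X t) W" using ftraj_eq[OF X, of t] by blast
  then obtain g g1 g2 where H: "memH g2" "ae01 (\<lambda>s. X t s = g s)"
     "\<forall>s\<in>{0..1}. g1 s = g1 0 + integral\<^sup>L lborel (\<lambda>r. indicator {0..s} r * g2 r)"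
     "\<forall>s\<in>{0..1}. g s = integral\<^sup>L lborel (\<lambda>r. indicator {0..s} r * g1 r)" "g 1 = 0"
    unfolding isA_def by blast
  have "acd 0 1 g1 g2" unfolding acd_def using H(3) memH_integrable_Icc[OF H(1)] by blast
  then have c1: "continuous_on {0..1} g1" by (rule acd_continuous)
  have "continuous_on {0..1} g"
    by (rule DERIV_continuous_on, rule indefinite_integral_C1(2)[OF c1]) (use H(4) in auto)
  then have c: "continuous_on {0..1} (\<lambda>s. g s - phi s)" unfolding phi_def by (intro continuous_intros) auto
  have "AE s in mu. 0 \<le> g s - phi s"
    using ftraj_ge_phi[OF X, of t] H(2)[unfolded ae01_mu] by eventually_elim simp
  then have "0 \<le> g s - phi s" if "0 < s" "s < 1" for s by (rule AE_mu_continuous_nonneg[OF c _ that])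
  then have "\<forall>s\<in>I01. g s > 0" using phi_pos by (fastforce simp: I01_def)
  then show ?thesis unfolding memD_def using ftraj_memH[OF X] memH_continuous[OF c1] H by blast
qed

lemma ftraj_complete: "ftraj \<sigma> X \<Longrightarrow> bdd_complete_traj_D \<sigma> X"
  unfolding bdd_complete_traj_D_def using ftraj_sol ftraj_bound ftraj_memD by blast

lemma decay:
  assumes s: "sol \<sigma> \<tau> x u" and nn: "\<And>t. t \<ge> \<tau> \<Longrightarrow> AE s in mu. 0 \<le> u t s"
    and nz: "\<not> (AE s in mu. u \<tau> s = 0)" and X: "ftraj \<sigma> X" and t: "\<tau> \<le> t"
  shows "nH (\<lambda>s. u t s - X t s)^2 \<le> exp (- lam * (t - \<tau>)) * nH (\<lambda>s. u \<tau> s - X \<tau> s)^2"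
proof -
  have \<sigma>: "\<sigma> \<in> Sig b w" using X by (simp add: ftraj_def)
  note bd = Sig_bounds[OF \<sigma>]
  have b: "0 \<le> fst \<sigma> t" for t using bd(1)[of t] b0 by linarith
  show ?thesis unfolding lam_def
  proof (rule linear_decay[where \<omega>="snd \<sigma>" and \<beta>="fst \<sigma>"])
    show "regH \<tau> u" by (rule regH_sol[OF s])
    show "regH \<tau> X" by (rule ftraj_regH[OF X])
    show "AE t in lborel. t > \<tau> \<longrightarrow> (\<exists>u' w. hasDerivH u u' t \<and> isA (u t) w \<and> (AE s in mu. u' s + w s = fst \<sigma> t + snd \<sigma> t * u t s))"
      by (rule nonneg_sol_linear(1)[OF s nn nz b bd(3)])
    show "AE t in lborel. t > \<tau> \<longrightarrow> (\<exists>u' w. hasDerivH X u' t \<and> isA (X t) w \<and> (AE s in mu. u' s + w s = fst \<sigma> t + snd \<sigma> t * X t s))"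
      using ftraj_eq[OF X] by (intro AE_I2 impI)
  qed (use bd w1 t in auto)
qed

text \<open>Uniqueness of the bounded complete trajectory in D: contraction over [-n,0] between two
  bounded curves forces equality at 0. From here on M1 is described by the explicit series.\<close>

lemma M1_iff:
  assumes X: "ftraj \<sigma> X" shows "(x, \<sigma>) \<in> M1 b w \<longleftrightarrow> memH x \<and> (AE s in mu. x s = X 0 s)"
proof
  assume "(x, \<sigma>) \<in> M1 b w"
  then obtain \<xi> where x: "memH x" "AE s in mu. x s = \<xi> 0 s" and \<xi>: "bdd_complete_traj_D \<sigma> \<xi>"
    by (auto simp: M1_def ae01_mu)
  have s: "sol \<sigma> \<tau> (\<xi> \<tau>) \<xi>" for \<tau> using \<xi> by (simp add: bdd_complete_traj_D_def)
  obtain B where B: "\<And>t. nH (\<xi> t) \<le> B" using \<xi> by (auto simp: bdd_complete_traj_D_def)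
  have m: "memH (\<xi> t)" for t using s[of t] by (simp add: sol_def contH_def)
  have p: "AE s in mu. 0 < \<xi> t s" for t
  proof -
    obtain g where g: "ae01 (\<lambda>s. \<xi> t s = g s)" "\<forall>s\<in>I01. g s > 0" using \<xi> unfolding bdd_complete_traj_D_def memD_def by blast
    have "AE s in mu. 0 < g s" by (rule AE_mu_I) (use g(2) in \<open>auto simp: I01_def\<close>)
    with g(1)[unfolded ae01_mu] show ?thesis by eventually_elim simp
  qed
  have nn: "AE s in mu. 0 \<le> \<xi> t s" for t using p[of t] by eventually_elim simp
  have nz: "\<not> (AE s in mu. \<xi> t s = 0)" for t
  proof
    assume "AE s in mu. \<xi> t s = 0"
    with p[of t] have "AE s in mu. False" by eventually_elim simp
    then show False using not_AE_mu_False by blast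
  qed
  have "nH (\<lambda>s. \<xi> 0 s - X 0 s)^2 \<le> exp (- lam * real n) * (B + CX)^2" for n
  proof -
    have "nH (\<lambda>s. \<xi> 0 s - X 0 s)^2 \<le> exp (- lam * (0 - (- real n))) * nH (\<lambda>s. \<xi> (- real n) s - X (- real n) s)^2"
      by (rule decay[OF s nn nz X]) simp
    also have "\<dots> \<le> exp (- lam * (0 - (- real n))) * (B + CX)^2"
    proof (intro mult_left_mono power_mono)
      show "nH (\<lambda>s. \<xi> (- real n) s - X (- real n) s) \<le> B + CX"
        using nH_triangle_diff[OF m ftraj_memH[OF X]] B ftraj_bound[OF X] by (meson add_mono order_trans)
    qed auto
    finally show ?thesis by simp
  qed
  then have "nH (\<lambda>s. \<xi> 0 s - X 0 s)^2 \<le> 0" by (rule exp_decay_zero[OF lam_pos, rotated]) simp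
  then have "nH (\<lambda>s. \<xi> 0 s - X 0 s) = 0" by simp
  then have "AE s in mu. \<xi> 0 s - X 0 s = 0" by (intro nH_eq_0 memH_diff m ftraj_memH[OF X])
  with x(2) have "AE s in mu. x s = X 0 s" by eventually_elim simp
  then show "memH x \<and> (AE s in mu. x s = X 0 s)" using x by simp
next
  assume "memH x \<and> (AE s in mu. x s = X 0 s)"
  moreover have "\<sigma> \<in> Sig b w" using X by (simp add: ftraj_def)
  ultimately show "(x, \<sigma>) \<in> M1 b w" using ftraj_complete[OF X] by (auto simp: M1_def ae01_mu)
qed

end

section \<open>The dynamics of the skew product\<close>

context problem
begin

text \<open>Continuity of the map from symbols to \<open>X 0\<close>. Each coefficient converges by
  \<open>bounded_ode_dependence\<close>: first a window length N is fixed, then local uniform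
  convergence is used on [-N,0]. Decay of the coefficients supplies the majorant for summing over
  j.\<close>

lemma coeffs_converge:
  assumes f: "\<And>n. f n \<in> Sig b w" and \<sigma>: "\<sigma> \<in> Sig b w" and lu: "locunif f \<sigma>"
    and C: "\<And>n. coeffs (fst (f n)) (snd (f n)) (C n)" and c: "coeffs (fst \<sigma>) (snd \<sigma>) c"
  shows "(\<lambda>n. nH (\<lambda>x. sol_of (C n) 0 x - sol_of c 0 x)) \<longlonglongrightarrow> 0"
proof -
  note An = adm_Sig[OF f] C and A = adm_Sig[OF \<sigma>] c
  have lim: "(\<lambda>n. (C n j 0 - c j 0)^2) \<longlonglongrightarrow> 0" for j
  proof (rule tendstoI)
    fix e :: real assume e: "e > 0"
    define m where "m = eta * (kap j)^2"
    define B where "B = C0 / (kap j)^3"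
    \<comment> \<open>The weight with which a perturbation of the symbol enters the scalar equation:
      4/kap through the forcing and the bound \<open>B\<close> on the coefficient through the
      potential.\<close>
    define L where "L = 4 / kap j + B"
    have m: "m > 0" using eta_pos by (simp add: m_def)
    have B: "B > 0" using C0_pos by (simp add: B_def)
    have L: "L > 0" using B by (simp add: L_def add_pos_pos)
    have "(\<lambda>n. exp (- m) ^ n * (2 * B)^2) \<longlonglongrightarrow> 0 * (2 * B)^2"
      by (intro tendsto_intros LIMSEQ_power_zero) (use m in simp)
    then have "\<forall>\<^sub>F n in sequentially. exp (- m) ^ n * (2 * B)^2 < e / 2" using e by (intro order_tendstoD) auto
    then obtain N where "exp (- m) ^ N * (2 * B)^2 < e / 2" by (auto simp: eventually_sequentially)
    moreover have "exp (- m) ^ N = exp (- m * real N)" by (simp add: exp_of_nat_mult[symmetric] mult.commute)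
    ultimately have N: "exp (- m * real N) * (2 * B)^2 < e / 2" by simp
    \<comment> \<open>Makes the perturbation term equal to e/4, to be added to the e/2 left for the
      forgotten past.\<close>
    define \<delta> where "\<delta> = m * sqrt (e / 4)"
    have \<delta>: "\<delta> > 0" "\<delta>^2 / m^2 = e / 4" using m e by (auto simp: \<delta>_def power_mult_distrib)
    have "\<forall>\<^sub>F n in sequentially. \<forall>s. \<bar>s\<bar> \<le> real N \<longrightarrow> sdist (f n) \<sigma> s \<le> \<delta> / L"
      by (rule lu[unfolded locunif_def, THEN spec, THEN spec, THEN mp]) (use \<delta> L in simp)
    then show "\<forall>\<^sub>F n in sequentially. dist ((C n j 0 - c j 0)^2) 0 < e"
    proof eventually_elim
      case (elim n)
      have "(C n j 0 - c j 0)^2 \<le> \<delta>^2 / m^2 + exp (- m * real N) * (2 * B)^2"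
      proof (rule bounded_ode_dependence)
        show "(C n j has_real_derivative 4 / kap j * fst (f n) t - ((kap j)^2 - snd (f n) t) * C n j t) (at t)" for t
          using C[of n] unfolding coeffs_def by blast
        show "(c j has_real_derivative 4 / kap j * fst \<sigma> t - ((kap j)^2 - snd \<sigma> t) * c j t) (at t)" for t
          using c unfolding coeffs_def by blast
        show "m \<le> (kap j)^2 - snd (f n) t" for t unfolding m_def by (rule kap_gap) (rule Sig_bounds(4)[OF f])
        show "\<bar>C n j (- real N)\<bar> \<le> B" unfolding B_def by (rule c_abs[OF An])
        show "\<bar>c j t\<bar> \<le> B" for t unfolding B_def by (rule c_abs[OF A])
        fix t assume "- real N \<le> t" "t \<le> 0"
        then have sd: "sdist (f n) \<sigma> t \<le> \<delta> / L" using elim by simp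
        have "4 / kap j * fst (f n) t - 4 / kap j * fst \<sigma> t = 4 / kap j * (fst (f n) t - fst \<sigma> t)" by (simp add: right_diff_distrib)
        then have 1: "\<bar>4 / kap j * fst (f n) t - 4 / kap j * fst \<sigma> t\<bar> = 4 / kap j * \<bar>fst (f n) t - fst \<sigma> t\<bar>"
          by (simp only: abs_mult) (use kap_ge[of j] in simp)
        have "\<bar>fst (f n) t - fst \<sigma> t\<bar> \<le> sdist (f n) \<sigma> t" "\<bar>snd (f n) t - snd \<sigma> t\<bar> \<le> sdist (f n) \<sigma> t"
          by (auto simp: sdist_def)
        then have "4 / kap j * \<bar>fst (f n) t - fst \<sigma> t\<bar> + \<bar>snd (f n) t - snd \<sigma> t\<bar> * B \<le> 4 / kap j * sdist (f n) \<sigma> t + sdist (f n) \<sigma> t * B"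
          using B by (intro add_mono mult_left_mono mult_right_mono) (auto simp: less_imp_le)
        also have "\<dots> = L * sdist (f n) \<sigma> t" by (simp add: L_def algebra_simps)
        also have "\<dots> \<le> L * (\<delta> / L)" using sd L by (intro mult_left_mono) auto
        also have "\<dots> = \<delta>" using L by simp
        finally show "\<bar>4 / kap j * fst (f n) t - 4 / kap j * fst \<sigma> t\<bar> + \<bar>((kap j)^2 - snd (f n) t) - ((kap j)^2 - snd \<sigma> t)\<bar> * B \<le> \<delta>"
          unfolding 1 by (simp add: abs_minus_commute)
      qed (use m in auto)
      then have "(C n j 0 - c j 0)^2 < e" using N \<delta>(2) e by linarith
      then show ?case by simp
    qed
  qed
  have ser: "sine_series (\<lambda>j. C n j 0 - c j 0) (\<lambda>x. sol_of (C n) 0 x - sol_of c 0 x)" for n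
    by (rule sine_series_diff[OF sol_series[OF An] sol_series[OF A]])
  have bnd: "(C n j 0 - c j 0)^2 \<le> (2 * C0)^2 * (1 / kap j)^2" for n j
  proof -
    have k1: "1 / kap j \<le> 1" using kap_ge[of j] pi_gt3 by simp
    have "(1 / kap j)^2 \<le> 1 / kap j" using power_decreasing[of 1 2 "1 / kap j"] k1 by (simp add: less_imp_le)
    then have "C0 * (1 / kap j)^2 \<le> C0 * (1 / kap j)" using C0_pos by (intro mult_left_mono) auto
    then have "\<bar>C n j 0 - c j 0\<bar> \<le> 2 * C0 * (1 / kap j)"
      using c_abs2[OF An, of n j 0] c_abs2[OF A, of j 0] by linarith
    from power_mono[OF this, of 2] show ?thesis by (simp add: power_mult_distrib power_divide)
  qed
  show ?thesis
  proof (rule tendstoI)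
    fix e :: real assume e: "e > 0"
    have "\<forall>\<^sub>F n in sequentially. \<forall>k. (\<Sum>j<k. (C n j 0 - c j 0)^2) \<le> (e / 2)^2"
      by (rule tannery_bound[OF summable_mult[OF summable_inverse_kap2, of "(2 * C0)^2"] always_eventually lim])
         (use bnd e in auto)
    then show "\<forall>\<^sub>F n in sequentially. dist (nH (\<lambda>x. sol_of (C n) 0 x - sol_of c 0 x)) 0 < e"
    proof eventually_elim
      case (elim n)
      have "nH (\<lambda>x. sol_of (C n) 0 x - sol_of c 0 x)^2 \<le> (e / 2)^2" by (rule sine_series_norm[OF ser]) (use elim in blast)
      then have "nH (\<lambda>x. sol_of (C n) 0 x - sol_of c 0 x) \<le> e / 2" by (rule power2_le_imp_le) (use e in simp)
      then show ?case using e by simp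
    qed
  qed
qed

section \<open>Distances to M1 and M2 in the product space\<close>

lemma rho_self: "\<sigma> \<in> Sig b w \<Longrightarrow> rho \<sigma> \<sigma> = 0"
proof -
  assume s: "\<sigma> \<in> Sig b w"
  have "rho \<sigma> \<sigma> \<le> e" if e: "e > 0" for e
  proof -
    obtain N d where d: "d > 0" "\<And>\<sigma>1 \<sigma>2. cont2 \<sigma>1 \<Longrightarrow> cont2 \<sigma>2 \<Longrightarrow>
      (\<And>s. \<bar>s\<bar> \<le> real N \<Longrightarrow> sdist \<sigma>1 \<sigma>2 s \<le> d) \<Longrightarrow> rho \<sigma>1 \<sigma>2 < e" by (rule rho_approx[OF e]) blast
    have "rho \<sigma> \<sigma> < e" by (rule d(2)[OF Sig_cont[OF s] Sig_cont[OF s]]) (use d(1) in \<open>simp add: sdist_def\<close>)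
    then show ?thesis by simp
  qed
  then have "rho \<sigma> \<sigma> \<le> 0" by (rule field_le_epsilon[of _ 0, simplified])
  then show ?thesis using rho_nonneg[OF Sig_cont[OF s] Sig_cont[OF s]] by simp
qed

lemma dX_ge: "snd y \<in> Sig b w \<Longrightarrow> snd z \<in> Sig b w \<Longrightarrow> nH (\<lambda>s. fst y s - fst z s) \<le> dX y z"
  unfolding dX_def using rho_nonneg[OF Sig_cont Sig_cont] by simp

lemma dX_nonneg: "snd y \<in> Sig b w \<Longrightarrow> snd z \<in> Sig b w \<Longrightarrow> 0 \<le> dX y z"
  using dX_ge[of y z] nH_nonneg order_trans by blast

lemma distset_le:
  assumes "snd y \<in> Sig b w" "z \<in> M" "\<And>z. z \<in> M \<Longrightarrow> snd z \<in> Sig b w" shows "distset y M \<le> dX y z"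
  unfolding distset_def
  by (rule cINF_lower[OF bdd_belowI2 assms(2)]) (rule dX_nonneg[OF assms(1) assms(3)])

lemma distset_nonneg:
  assumes "snd y \<in> Sig b w" "M \<noteq> {}" "\<And>z. z \<in> M \<Longrightarrow> snd z \<in> Sig b w" shows "0 \<le> distset y M"
  unfolding distset_def by (rule cINF_greatest[OF assms(2)]) (rule dX_nonneg[OF assms(1) assms(3)])

lemma distset_less:
  assumes "distset y M < e" "M \<noteq> {}" "snd y \<in> Sig b w" "\<And>z. z \<in> M \<Longrightarrow> snd z \<in> Sig b w"
  obtains z where "z \<in> M" "nH (\<lambda>s. fst y s - fst z s) < e"
proof -
  have "Inf (dX y ` M) < e" using assms(1) by (simp add: distset_def)
  from cInf_lessD[OF _ this] obtain a where "a \<in> dX y ` M" "a < e" using assms(2) by blast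
  then obtain z where z: "z \<in> M" "dX y z < e" by blast
  from dX_ge[OF assms(3) assms(4)[OF z(1)]] z(2) have "nH (\<lambda>s. fst y s - fst z s) < e" by (rule order.strict_trans1)
  with z(1) show ?thesis by (rule that)
qed

lemma M1_Sig: "z \<in> M1 b w \<Longrightarrow> snd z \<in> Sig b w" by (auto simp: M1_def)
lemma M2_Sig: "z \<in> M2 b w \<Longrightarrow> snd z \<in> Sig b w" by (auto simp: M2_def)

lemma ftraj_in_M1: assumes "ftraj \<sigma> X" shows "(X t, shift t \<sigma>) \<in> M1 b w"
  using M1_iff[OF ftraj_shift[OF assms, of t], of "X t"] ftraj_memH[OF assms] by simp

lemma zero_in_M2: "\<sigma> \<in> Sig b w \<Longrightarrow> ((\<lambda>_. 0), \<sigma>) \<in> M2 b w"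
  by (simp add: M2_def ae01_mu)

lemma M1_ne: "M1 b w \<noteq> {}"
  using ftraj_exists[OF Sig_bw] ftraj_in_M1 by (metis empty_iff)

lemma M2_ne: "M2 b w \<noteq> {}" using zero_in_M2[OF Sig_bw] by blast

lemma M1_E:
  assumes "z \<in> M1 b w"
  obtains X where "ftraj (snd z) X" "memH (fst z)" "AE s in mu. fst z s = X 0 s"
proof -
  obtain X where X: "ftraj (snd z) X" using ftraj_exists[OF M1_Sig[OF assms]] by blast
  show ?thesis by (rule that[OF X]) (use M1_iff[OF X, of "fst z"] assms in auto)
qed

lemma M1_bounds: assumes "z \<in> M1 b w" shows "m0 \<le> nH (fst z)" "nH (fst z) \<le> CX"
proof -
  obtain X where X: "ftraj (snd z) X" "memH (fst z)" "AE s in mu. fst z s = X 0 s" by (rule M1_E[OF assms])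
  have "nH (fst z) = nH (X 0)" by (rule nH_cong) (use X ftraj_memH[OF X(1)] memH_measurable in auto)
  then show "m0 \<le> nH (fst z)" "nH (fst z) \<le> CX" using ftraj_lower[OF X(1)] ftraj_bound[OF X(1)] by auto
qed

lemma M2_zero: "z \<in> M2 b w \<Longrightarrow> memH (fst z) \<and> (AE s in mu. fst z s = 0)"
  by (auto simp: M2_def ae01_mu)

lemma shift_add: "shift t (shift s \<sigma>) = shift (t + s) \<sigma>" by (simp add: shift_def add_ac)
lemma shift_0: "shift 0 \<sigma> = \<sigma>" by (simp add: shift_def)

text \<open>The definition offers a separate symbol and solution for every starting time. Overlaps
  force all symbols to be translates of the one at time 0, also at negative times by shifting back;
  each solution agrees with the trajectory only for t >= 0, whence \<open>sol_cong\<close>.\<close>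

lemma complete_trajE:
  assumes "complete_traj b w \<Phi>"
  obtains \<sigma> where "\<sigma> \<in> Sig b w" "\<And>t. snd (\<Phi> t) = shift t \<sigma>" "\<And>t. memH (fst (\<Phi> t))" "\<And>t. AE s in mu. 0 \<le> fst (\<Phi> t) s"
    "\<And>s. sol (shift s \<sigma>) 0 (fst (\<Phi> s)) (\<lambda>t. fst (\<Phi> (t + s)))"
proof -
  define \<sigma> where "\<sigma> = snd (\<Phi> 0)"
  have E: "\<exists>\<sigma>' u. \<sigma>' \<in> Sig b w \<and> nonneg_sol \<sigma>' 0 (u 0) u \<and> (\<forall>t\<ge>0. \<Phi> (t + s) = (u t, shift t \<sigma>'))" for s
    using assms unfolding complete_traj_def by blast
  have S: "snd (\<Phi> (t + s)) = shift t (snd (\<Phi> s))" if "t \<ge> 0" for t s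
  proof -
    obtain \<sigma>' u where H: "\<forall>t\<ge>0. \<Phi> (t + s) = (u t, shift t \<sigma>')" using E[of s] by blast
    have "\<Phi> (0 + s) = (u 0, shift 0 \<sigma>')" using H by blast
    then have "snd (\<Phi> s) = \<sigma>'" by (simp add: shift_0)
    then show ?thesis using H that by simp
  qed
  have St: "snd (\<Phi> t) = shift t \<sigma>" for t
  proof (cases "t \<ge> 0")
    case True then show ?thesis using S[of t 0] by (simp add: \<sigma>_def)
  next
    case False
    then have "\<sigma> = shift (- t) (snd (\<Phi> t))" using S[of "- t" t] by (simp add: \<sigma>_def)
    then have "shift t \<sigma> = shift (t + - t) (snd (\<Phi> t))" by (simp add: shift_add)
    then show ?thesis by (simp add: shift_0)
  qed
  have main: "\<sigma> \<in> Sig b w \<and> memH (fst (\<Phi> s)) \<and> (AE x in mu. 0 \<le> fst (\<Phi> s) x) \<and> sol (shift s \<sigma>) 0 (fst (\<Phi> s)) (\<lambda>t. fst (\<Phi> (t + s)))" for s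
  proof -
    obtain \<sigma>' u where H: "\<sigma>' \<in> Sig b w" "nonneg_sol \<sigma>' 0 (u 0) u" "\<forall>t\<ge>0. \<Phi> (t + s) = (u t, shift t \<sigma>')" using E[of s] by blast
    have "\<Phi> (0 + s) = (u 0, shift 0 \<sigma>')" using H by blast
    then have P: "\<Phi> s = (u 0, \<sigma>')" by (simp add: shift_0)
    then have \<sigma>': "\<sigma>' = shift s \<sigma>" using St[of s] by simp
    then have "\<sigma> = shift (- s) \<sigma>'" by (simp add: shift_add shift_0)
    then have "\<sigma> \<in> Sig b w" using Sig_shift[OF H(1)] by simp
    moreover have mu: "memH (u t)" if "t \<ge> 0" for t using H(2) that by (auto simp: nonneg_sol_def sol_def contH_def)
    moreover have "AE x in mu. 0 \<le> u 0 x" using H(2) by (auto simp: nonneg_sol_def ae01_mu)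
    moreover have "sol \<sigma>' 0 (fst (\<Phi> (0 + s))) (\<lambda>t. fst (\<Phi> (t + s)))"
      by (rule sol_cong[of \<sigma>' 0 "u 0" u]) (use H mu in \<open>auto simp: nonneg_sol_def\<close>)
    ultimately show ?thesis using P \<sigma>' by simp
  qed
  show ?thesis by (rule that[of \<sigma>]) (use main St in auto)
qed

text \<open>\<open>decay\<close> with time translated by s: solutions inside a complete trajectory
  start at time 0, so \<open>X\<close> and the symbol are shifted along.\<close>

lemma trajectory_dichotomy:
  assumes \<Phi>: "complete_traj b w \<Phi>" and s: "\<not> (AE x in mu. fst (\<Phi> s) x = 0)"
    and \<sigma>: "\<sigma> \<in> Sig b w" "\<And>t. snd (\<Phi> t) = shift t \<sigma>" and X: "ftraj \<sigma> X" and t: "s \<le> t"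
  shows "nH (\<lambda>x. fst (\<Phi> t) x - X t x)^2 \<le> exp (- lam * (t - s)) * nH (\<lambda>x. fst (\<Phi> s) x - X s x)^2"
proof -
  obtain \<sigma>' where H: "\<sigma>' \<in> Sig b w" "\<And>t. snd (\<Phi> t) = shift t \<sigma>'" "\<And>t. memH (fst (\<Phi> t))" "\<And>t. AE s in mu. 0 \<le> fst (\<Phi> t) s"
    "\<And>s. sol (shift s \<sigma>') 0 (fst (\<Phi> s)) (\<lambda>t. fst (\<Phi> (t + s)))" using complete_trajE[OF \<Phi>] by metis
  have "\<sigma>' = \<sigma>" using H(2)[of 0] \<sigma>(2)[of 0] by (simp add: shift_0)
  then have so: "sol (shift s \<sigma>) 0 (fst (\<Phi> s)) (\<lambda>t. fst (\<Phi> (t + s)))" using H(5) by simp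
  have "nH (\<lambda>x. fst (\<Phi> ((t - s) + s)) x - X ((t - s) + s) x)^2 \<le> exp (- lam * ((t - s) - 0)) * nH (\<lambda>x. fst (\<Phi> (0 + s)) x - X (0 + s) x)^2"
    by (rule decay[OF so _ _ ftraj_shift[OF X]]) (use H(4) s t in auto)
  then show ?thesis by simp
qed

text \<open>For every n there is a nonzero state before t - n; both curves are bounded there, so the
  distance at t is at most exp(-lam n / 2) times a constant.\<close>

lemma bounded_nonzero_in_M1:
  assumes \<Phi>: "complete_traj b w \<Phi>" and nz: "\<And>s. \<exists>s'<s. \<not> (AE x in mu. fst (\<Phi> s') x = 0)"
    and B: "\<And>t. nH (fst (\<Phi> t)) \<le> B"
  shows "\<Phi> t \<in> M1 b w"
proof -
  obtain \<sigma> where H: "\<sigma> \<in> Sig b w" "\<And>t. snd (\<Phi> t) = shift t \<sigma>" "\<And>t. memH (fst (\<Phi> t))" using complete_trajE[OF \<Phi>] by metis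
  obtain X where X: "ftraj \<sigma> X" using ftraj_exists[OF H(1)] by blast
  have "nH (\<lambda>x. fst (\<Phi> t) x - X t x)^2 \<le> exp (- lam * real n) * (B + CX)^2" for n
  proof -
    obtain s where s: "s < t - real n" "\<not> (AE x in mu. fst (\<Phi> s) x = 0)" using nz by blast
    then have st: "s \<le> t" by linarith
    have "nH (\<lambda>x. fst (\<Phi> t) x - X t x)^2 \<le> exp (- lam * (t - s)) * nH (\<lambda>x. fst (\<Phi> s) x - X s x)^2"
      by (rule trajectory_dichotomy[OF \<Phi> s(2) H(1,2) X st])
    also have "\<dots> \<le> exp (- lam * real n) * (B + CX)^2"
    proof (intro mult_mono power_mono)
      have "lam * real n \<le> lam * (t - s)" using lam_pos s by (intro mult_left_mono) auto
      then show "exp (- lam * (t - s)) \<le> exp (- lam * real n)" by simp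
      show "nH (\<lambda>x. fst (\<Phi> s) x - X s x) \<le> B + CX"
        using nH_triangle_diff[OF H(3) ftraj_memH[OF X]] B ftraj_bound[OF X] by (meson add_mono order_trans)
    qed auto
    finally show ?thesis .
  qed
  then have "nH (\<lambda>x. fst (\<Phi> t) x - X t x)^2 \<le> 0" by (rule exp_decay_zero[OF lam_pos, rotated]) simp
  then have "nH (\<lambda>x. fst (\<Phi> t) x - X t x) = 0" by simp
  then have "AE x in mu. fst (\<Phi> t) x - X t x = 0" by (intro nH_eq_0 memH_diff H(3) ftraj_memH[OF X])
  then have "AE x in mu. fst (\<Phi> t) x = X t x" by eventually_elim simp
  then have "(fst (\<Phi> t), shift t \<sigma>) \<in> M1 b w"
    using M1_iff[OF ftraj_shift[OF X, of t], of "fst (\<Phi> t)"] H(3) by simp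
  then show ?thesis using H(2)[of t] by (metis prod.collapse)
qed

lemma nonzero_attracted:
  assumes \<Phi>: "complete_traj b w \<Phi>" and nz: "\<not> (AE x in mu. fst (\<Phi> s) x = 0)"
    and \<sigma>: "\<sigma> \<in> Sig b w" "\<And>t. snd (\<Phi> t) = shift t \<sigma>" and X: "ftraj \<sigma> X"
  shows "((\<lambda>t. nH (\<lambda>x. fst (\<Phi> t) x - X t x)) \<longlongrightarrow> 0) at_top"
proof -
  define R where "R = nH (\<lambda>x. fst (\<Phi> s) x - X s x)^2"
  have "((\<lambda>t. sqrt (exp (- lam * (t - s)) * R)) \<longlongrightarrow> sqrt (0 * R)) at_top"
  proof (intro tendsto_intros)
    have "filterlim (\<lambda>t. lam * (t - s)) at_top at_top"
      by (intro filterlim_tendsto_pos_mult_at_top[OF tendsto_const lam_pos])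
         (use filterlim_tendsto_add_at_top[OF tendsto_const[of "- s"] filterlim_ident] in simp)
    then have "filterlim (\<lambda>t. - lam * (t - s)) at_bot at_top" by (simp add: filterlim_uminus_at_bot)
    then show "((\<lambda>t. exp (- lam * (t - s))) \<longlongrightarrow> 0) at_top" by (rule filterlim_compose[OF exp_at_bot])
  qed
  then have l: "((\<lambda>t. sqrt (exp (- lam * (t - s)) * R)) \<longlongrightarrow> 0) at_top" by simp
  show ?thesis
  proof (rule Lim_null_comparison[OF _ l])
    have "\<forall>\<^sub>F t in at_top. s \<le> t" by (rule eventually_ge_at_top)
    then show "\<forall>\<^sub>F t in at_top. norm (nH (\<lambda>x. fst (\<Phi> t) x - X t x)) \<le> sqrt (exp (- lam * (t - s)) * R)"
    proof eventually_elim
      case (elim t)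
      have "nH (\<lambda>x. fst (\<Phi> t) x - X t x)^2 \<le> exp (- lam * (t - s)) * R"
        unfolding R_def by (rule trajectory_dichotomy[OF \<Phi> nz \<sigma> X elim])
      then show ?case by (simp add: real_le_rsqrt)
    qed
  qed
qed

lemma complete_traj_ftraj:
  assumes X: "ftraj \<sigma> X" and m: "\<And>t. memH (v t)" and e: "\<And>t. AE x in mu. v t x = X t x"
  shows "complete_traj b w (\<lambda>t. (v t, shift t \<sigma>))"
  unfolding complete_traj_def
proof (intro allI)
  fix s
  have \<sigma>: "\<sigma> \<in> Sig b w" using X by (simp add: ftraj_def)
  have Xs: "sol (shift s \<sigma>) 0 (X (0 + s)) (\<lambda>t. X (t + s))" by (rule ftraj_sol[OF ftraj_shift[OF X]])
  have "sol (shift s \<sigma>) 0 (v (0 + s)) (\<lambda>t. v (t + s))" by (rule sol_cong[OF Xs m e])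
  moreover have "AE x in mu. 0 \<le> v t x" for t using e[of t] ftraj_pos[OF X, of t] by eventually_elim simp
  ultimately have "nonneg_sol (shift s \<sigma>) 0 (v (0 + s)) (\<lambda>t. v (t + s))" by (simp add: nonneg_sol_def ae01_mu)
  then show "\<exists>\<sigma>' u. \<sigma>' \<in> Sig b w \<and> nonneg_sol \<sigma>' 0 (u 0) u \<and> (\<forall>t\<ge>0. (v (t + s), shift (t + s) \<sigma>) = (u t, shift t \<sigma>'))"
    by (intro exI[of _ "shift s \<sigma>"] exI[of _ "\<lambda>t. v (t + s)"]) (simp add: Sig_shift[OF \<sigma>] shift_add)
qed

lemma zero_sol: assumes x: "memH x" "AE s in mu. x s = 0" shows "sol \<sigma> \<tau> x (\<lambda>_. x)"
proof -
  have "sol \<sigma> \<tau> (\<lambda>_. 0) (\<lambda>_ _. 0)"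
    unfolding sol_def
  proof (intro conjI allI impI)
    show "contH \<tau> (\<lambda>_ _. 0)" by (auto simp: contH_def intro: exI[of _ 1])
    show "abscontH T1 T2 (\<lambda>_ _. 0)" for T1 T2 by (rule abscontH_lipschitz[of 0]) auto
    have A: "isA (\<lambda>_. 0) (\<lambda>_. 0)" using isA_parabola[of 0] by simp
    then show "AE t in lborel. t > \<tau> \<longrightarrow> (\<exists>w. isA (\<lambda>_. 0) w)" by (intro AE_I2) blast
    show "\<exists>r. L2locH \<tau> r \<and>
        (AE t in lborel. t > \<tau> \<longrightarrow> ae01 (\<lambda>s. r t s \<in> (\<lambda>z. fst \<sigma> t * z + snd \<sigma> t * 0) ` H0 0)) \<and>
        (AE t in lborel. t > \<tau> \<longrightarrow> (\<exists>u' w. hasDerivH (\<lambda>_ _. 0) u' t \<and> isA (\<lambda>_. 0) w \<and> ae01 (\<lambda>s. u' s + w s = r t s)))"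
    proof (intro exI[of _ "\<lambda>_ _. 0"] conjI)
      show "L2locH \<tau> (\<lambda>_ _. 0)" by (rule L2locH_bounded[of _ 0]) simp_all
      have "(0::real) \<in> (\<lambda>z. fst \<sigma> t * z + snd \<sigma> t * 0) ` H0 0" for t
        by (rule image_eqI[of _ _ 0]) (simp_all add: H0_def)
      then show "AE t in lborel. t > \<tau> \<longrightarrow> ae01 (\<lambda>s. 0 \<in> (\<lambda>z. fst \<sigma> t * z + snd \<sigma> t * 0) ` H0 0)"
        by (simp add: ae01_mu)
      have "hasDerivH (\<lambda>_ _. 0) (\<lambda>_. 0) t" for t by (rule hasDerivH_const) simp
      then show "AE t in lborel. t > \<tau> \<longrightarrow> (\<exists>u' w. hasDerivH (\<lambda>_ _. 0) u' t \<and> isA (\<lambda>_. 0) w \<and> ae01 (\<lambda>s. u' s + w s = 0))"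
        using A by (intro AE_I2 impI exI[of _ "\<lambda>_. 0"] conjI) (auto simp: ae01_mu)
    qed
  qed simp
  from sol_cong[OF this, of "\<lambda>_. x"] show ?thesis using x by simp
qed

section \<open>Invariance, compactness and isolation of M1 and M2\<close>

lemma weakly_inv_M1: "weakly_inv b w (M1 b w)"
  unfolding weakly_inv_def
proof
  fix y assume y: "y \<in> M1 b w"
  obtain X where X: "ftraj (snd y) X" "memH (fst y)" "AE s in mu. fst y s = X 0 s" by (rule M1_E[OF y])
  \<comment> \<open>The prescribed point may differ from \<open>X 0\<close> on a null set, so the
    trajectory is altered at time 0 to pass through it exactly.\<close>
  define v where "v t = (if t = 0 then fst y else X t)" for t
  have v: "memH (v t)" "AE x in mu. v t x = X t x" for t using X ftraj_memH[OF X(1)] by (auto simp: v_def)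
  define \<Phi> where "\<Phi> t = (v t, shift t (snd y))" for t
  have "complete_traj b w \<Phi>" unfolding \<Phi>_def by (rule complete_traj_ftraj[OF X(1) v])
  moreover have "\<Phi> t \<in> M1 b w" for t
    unfolding \<Phi>_def using M1_iff[OF ftraj_shift[OF X(1), of t], of "v t"] v[of t] by simp
  moreover have "\<Phi> 0 = y" by (simp add: \<Phi>_def v_def shift_0)
  ultimately show "\<exists>\<Phi>. complete_traj b w \<Phi> \<and> (\<forall>t. \<Phi> t \<in> M1 b w) \<and> \<Phi> 0 = y" by blast
qed

lemma weakly_inv_M2: "weakly_inv b w (M2 b w)"
  unfolding weakly_inv_def
proof
  fix y assume y: "y \<in> M2 b w"
  have x: "memH (fst y)" "AE s in mu. fst y s = 0" and \<sigma>: "snd y \<in> Sig b w" using M2_zero[OF y] M2_Sig[OF y] by auto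
  have nn: "AE s in mu. 0 \<le> fst y s" using x(2) by eventually_elim simp
  define \<Phi> where "\<Phi> t = (fst y, shift t (snd y))" for t :: real
  have "complete_traj b w \<Phi>"
    unfolding complete_traj_def
  proof (intro allI)
    fix s
    show "\<exists>\<sigma>' u. \<sigma>' \<in> Sig b w \<and> nonneg_sol \<sigma>' 0 (u 0) u \<and> (\<forall>t\<ge>0. \<Phi> (t + s) = (u t, shift t \<sigma>'))"
      using zero_sol[OF x] nn
      by (intro exI[of _ "shift s (snd y)"] exI[of _ "\<lambda>_. fst y"])
         (simp add: Sig_shift[OF \<sigma>] shift_add \<Phi>_def nonneg_sol_def ae01_mu)
  qed
  moreover have "\<Phi> t \<in> M2 b w" for t using x Sig_shift[OF \<sigma>] by (simp add: \<Phi>_def M2_def ae01_mu)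
  moreover have "\<Phi> 0 = y" by (simp add: \<Phi>_def shift_0)
  ultimately show "\<exists>\<Phi>. complete_traj b w \<Phi> \<and> (\<forall>t. \<Phi> t \<in> M2 b w) \<and> \<Phi> 0 = y" by blast
qed

text \<open>M1 is, up to null sets, a graph over the compact hull. A subsequence is selected for the
  symbols, and \<open>coeffs_converge\<close> carries the first components along.\<close>

lemma compact_M1: "compactX (M1 b w)"
  unfolding compactX_def
proof (intro allI impI)
  fix f :: "nat \<Rightarrow> pt" assume f: "\<forall>n. f n \<in> M1 b w"
  have fS: "snd (f n) \<in> Sig b w" for n using f M1_Sig by blast
  obtain \<sigma> and h :: "nat \<Rightarrow> nat" where h: "\<sigma> \<in> Sig b w" "strict_mono h" "locunif (\<lambda>n. snd (f (h n))) \<sigma>"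
    by (rule Sig_compact[of "\<lambda>n. snd (f n)", OF fS])
  have "\<exists>c. coeffs (fst (snd (f (h n)))) (snd (snd (f (h n)))) c" for n using coeffs_exist[OF adm_Sig[OF fS]] by metis
  then obtain C where C: "\<And>n. coeffs (fst (snd (f (h n)))) (snd (snd (f (h n)))) (C n)" by metis
  obtain c where c: "coeffs (fst \<sigma>) (snd \<sigma>) c" using coeffs_exist[OF adm_Sig[OF h(1)]] by blast
  have X: "ftraj \<sigma> (sol_of c)" using h c by (auto simp: ftraj_def)
  have Xn: "ftraj (snd (f (h n))) (sol_of (C n))" for n using fS C by (auto simp: ftraj_def)
  have "(\<lambda>n. nH (\<lambda>x. sol_of (C n) 0 x - sol_of c 0 x)) \<longlonglongrightarrow> 0"
    by (rule coeffs_converge[OF fS h(1,3) C c])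
  moreover have "nH (\<lambda>x. sol_of (C n) 0 x - sol_of c 0 x) = nH (\<lambda>x. fst (f (h n)) x - sol_of c 0 x)" for n
  proof (rule nH_cong)
    have z: "memH (fst (f (h n)))" "AE x in mu. fst (f (h n)) x = sol_of (C n) 0 x"
      using M1_iff[OF Xn[of n], of "fst (f (h n))"] f by auto
    show "(\<lambda>x. sol_of (C n) 0 x - sol_of c 0 x) \<in> borel_measurable mu"
      by (intro memH_measurable memH_diff ftraj_memH[OF Xn] ftraj_memH[OF X])
    show "(\<lambda>x. fst (f (h n)) x - sol_of c 0 x) \<in> borel_measurable mu"
      by (intro memH_measurable memH_diff z ftraj_memH[OF X])
    show "AE x in mu. sol_of (C n) 0 x - sol_of c 0 x = fst (f (h n)) x - sol_of c 0 x"
      using z(2) by eventually_elim simp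
  qed
  moreover have "(\<lambda>n. rho (snd (f (h n))) \<sigma>) \<longlonglongrightarrow> 0"
    by (rule locunif_rho[OF Sig_cont[OF fS] Sig_cont[OF h(1)] h(3)])
  ultimately have "(\<lambda>n. nH (\<lambda>x. fst (f (h n)) x - sol_of c 0 x) + rho (snd (f (h n))) \<sigma>) \<longlonglongrightarrow> 0 + 0"
    by (intro tendsto_add) simp_all
  then have "(\<lambda>n. dX (f (h n)) (sol_of c 0, \<sigma>)) \<longlonglongrightarrow> 0" by (simp add: dX_def)
  moreover have "(sol_of c 0, \<sigma>) \<in> M1 b w" using ftraj_in_M1[OF X, of 0] by (simp add: shift_0)
  ultimately show "\<exists>l\<in>M1 b w. \<exists>h. strict_mono h \<and> (\<lambda>n. dX (f (h n)) l) \<longlonglongrightarrow> 0" using h(2) by blast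
qed

lemma compact_M2: "compactX (M2 b w)"
  unfolding compactX_def
proof (intro allI impI)
  fix f :: "nat \<Rightarrow> pt" assume f: "\<forall>n. f n \<in> M2 b w"
  have fS: "snd (f n) \<in> Sig b w" for n using f M2_Sig by blast
  obtain \<sigma> and h :: "nat \<Rightarrow> nat" where h: "\<sigma> \<in> Sig b w" "strict_mono h" "locunif (\<lambda>n. snd (f (h n))) \<sigma>"
    by (rule Sig_compact[of "\<lambda>n. snd (f n)", OF fS])
  have "nH (\<lambda>x. fst (f (h n)) x - 0) = 0" for n using M2_zero[of "f (h n)"] f by (intro nH_zero_AE) simp
  moreover have "(\<lambda>n. rho (snd (f (h n))) \<sigma>) \<longlonglongrightarrow> 0"
    by (rule locunif_rho[OF Sig_cont[OF fS] Sig_cont[OF h(1)] h(3)])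
  ultimately have "(\<lambda>n. dX (f (h n)) ((\<lambda>_. 0), \<sigma>)) \<longlonglongrightarrow> 0" by (simp add: dX_def)
  then show "\<exists>l\<in>M2 b w. \<exists>h. strict_mono h \<and> (\<lambda>n. dX (f (h n)) l) \<longlonglongrightarrow> 0" using h(2) zero_in_M2[OF h(1)] by blast
qed

lemma M1_Xp: "M1 b w \<subseteq> Xp b w"
proof
  fix y assume y: "y \<in> M1 b w"
  obtain X where X: "ftraj (snd y) X" "memH (fst y)" "AE s in mu. fst y s = X 0 s" by (rule M1_E[OF y])
  have "AE s in mu. 0 \<le> fst y s" using X(3) ftraj_pos[OF X(1), of 0] by eventually_elim simp
  then show "y \<in> Xp b w" using X M1_Sig[OF y] by (simp add: Xp_def ae01_mu)
qed

lemma M2_Xp: "M2 b w \<subseteq> Xp b w"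
proof
  fix y assume y: "y \<in> M2 b w"
  have z: "memH (fst y)" "AE s in mu. fst y s = 0" using M2_zero[OF y] by auto
  have "AE s in mu. 0 \<le> fst y s" using z(2) by eventually_elim simp
  then show "y \<in> Xp b w" using z M2_Sig[OF y] by (simp add: Xp_def ae01_mu)
qed

lemma in_own_nbhd:
  assumes M: "M \<subseteq> Xp b w" and e: "e > 0" shows "M \<subseteq> nbhd b w e M"
proof
  fix y assume y: "y \<in> M"
  have S: "z \<in> M \<Longrightarrow> snd z \<in> Sig b w" for z using M by (auto simp: Xp_def)
  have "distset y M \<le> dX y y" by (rule distset_le[OF S[OF y] y S])
  also have "\<dots> = 0" using rho_self[OF S[OF y]] by (simp add: dX_def)
  finally show "y \<in> nbhd b w e M" using y M e by (auto simp: nbhd_def)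
qed

lemma nbhd_M1: assumes "y \<in> nbhd b w e (M1 b w)" shows "m0 - e < nH (fst y)" "nH (fst y) < CX + e" "snd y \<in> Sig b w"
proof -
  have y: "memH (fst y)" "distset y (M1 b w) < e" and S: "snd y \<in> Sig b w" using assms by (auto simp: nbhd_def Xp_def)
  obtain z where z: "z \<in> M1 b w" "nH (\<lambda>s. fst y s - fst z s) < e"
    by (rule distset_less[OF y(2) M1_ne S M1_Sig])
  have mz: "memH (fst z)" using z(1) by (auto simp: M1_def)
  show "m0 - e < nH (fst y)"
    using nH_triangle_rev[OF mz y(1)] nH_minus_commute[of "fst z" "fst y"] M1_bounds(1)[OF z(1)] z(2) by linarith
  show "nH (fst y) < CX + e" using nH_triangle_rev[OF y(1) mz] M1_bounds(2)[OF z(1)] z(2) by linarith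
  show "snd y \<in> Sig b w" by (rule S)
qed

lemma nbhd_M2: assumes "y \<in> nbhd b w e (M2 b w)" shows "nH (fst y) < e" "snd y \<in> Sig b w"
proof -
  have y: "memH (fst y)" "distset y (M2 b w) < e" and S: "snd y \<in> Sig b w" using assms by (auto simp: nbhd_def Xp_def)
  obtain z where z: "z \<in> M2 b w" "nH (\<lambda>s. fst y s - fst z s) < e"
    by (rule distset_less[OF y(2) M2_ne S M2_Sig])
  have mz: "memH (fst z)" "nH (fst z) = 0" using M2_zero[OF z(1)] by (auto intro: nH_zero_AE)
  show "nH (fst y) < e" using nH_triangle_rev[OF y(1) mz(1)] mz z(2) by linarith
  show "snd y \<in> Sig b w" by (rule S)
qed

text \<open>Within distance m0/2 of M1 the norm stays above m0/2, so a trajectory that remains there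
  is bounded and never 0, which is the situation of \<open>bounded_nonzero_in_M1\<close>.\<close>

lemma isolated_M1: "isolated b w (M1 b w)"
  unfolding isolated_def
proof (intro conjI M1_Xp compact_M1 weakly_inv_M1 exI[of _ "m0 / 2"] allI impI)
  show "0 < m0 / 2" using m0_pos by simp
  then show "M1 b w \<subseteq> nbhd b w (m0 / 2) (M1 b w)" by (rule in_own_nbhd[OF M1_Xp])
  fix N assume N: "N \<subseteq> nbhd b w (m0 / 2) (M1 b w) \<and> weakly_inv b w N"
  show "N \<subseteq> M1 b w"
  proof
    fix y assume "y \<in> N"
    then obtain \<Phi> where \<Phi>: "complete_traj b w \<Phi>" "\<And>t. \<Phi> t \<in> N" "\<Phi> 0 = y" using N unfolding weakly_inv_def by blast
    have nb: "\<Phi> t \<in> nbhd b w (m0 / 2) (M1 b w)" for t using \<Phi>(2) N by blast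
    have "\<Phi> 0 \<in> M1 b w"
    proof (rule bounded_nonzero_in_M1[OF \<Phi>(1)])
      show "nH (fst (\<Phi> t)) \<le> CX + m0 / 2" for t using nbhd_M1(2)[OF nb] by (simp add: less_imp_le)
      have "\<not> (AE x in mu. fst (\<Phi> t) x = 0)" for t
        using nbhd_M1(1)[OF nb, of t] m0_pos nH_zero_AE[of "fst (\<Phi> t)"] by auto
      then show "\<exists>s'<s. \<not> (AE x in mu. fst (\<Phi> s') x = 0)" for s by (intro exI[of _ "s - 1"]) simp
    qed
    then show "y \<in> M1 b w" using \<Phi>(3) by simp
  qed
qed

text \<open>A nonzero state would be attracted by \<open>X\<close>, whose norm is at least
  \<open>m0\<close>, and would have to leave the m0/2-neighborhood of 0.\<close>

lemma isolated_M2: "isolated b w (M2 b w)"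
  unfolding isolated_def
proof (intro conjI M2_Xp compact_M2 weakly_inv_M2 exI[of _ "m0 / 2"] allI impI)
  show e: "0 < m0 / 2" using m0_pos by simp
  then show "M2 b w \<subseteq> nbhd b w (m0 / 2) (M2 b w)" by (rule in_own_nbhd[OF M2_Xp])
  fix N assume N: "N \<subseteq> nbhd b w (m0 / 2) (M2 b w) \<and> weakly_inv b w N"
  show "N \<subseteq> M2 b w"
  proof
    fix y assume "y \<in> N"
    then obtain \<Phi> where \<Phi>: "complete_traj b w \<Phi>" "\<And>t. \<Phi> t \<in> N" "\<Phi> 0 = y" using N unfolding weakly_inv_def by blast
    have nb: "\<Phi> t \<in> nbhd b w (m0 / 2) (M2 b w)" for t using \<Phi>(2) N by blast
    obtain \<sigma> where H: "\<sigma> \<in> Sig b w" "\<And>t. snd (\<Phi> t) = shift t \<sigma>" "\<And>t. memH (fst (\<Phi> t))" using complete_trajE[OF \<Phi>(1)] by metis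
    obtain X where X: "ftraj \<sigma> X" using ftraj_exists[OF H(1)] by blast
    have "AE x in mu. fst (\<Phi> 0) x = 0"
    proof (rule ccontr)
      assume nz: "\<not> (AE x in mu. fst (\<Phi> 0) x = 0)"
      have "((\<lambda>t. nH (\<lambda>x. fst (\<Phi> t) x - X t x)) \<longlongrightarrow> 0) at_top" by (rule nonzero_attracted[OF \<Phi>(1) nz H(1,2) X])
      then have "\<forall>\<^sub>F t in at_top. nH (\<lambda>x. fst (\<Phi> t) x - X t x) < m0 / 2" by (rule order_tendstoD) (rule e)
      then obtain t where t: "nH (\<lambda>x. fst (\<Phi> t) x - X t x) < m0 / 2" by (auto simp: eventually_at_top_linorder)
      have "nH (X t) \<le> nH (fst (\<Phi> t)) + nH (\<lambda>x. fst (\<Phi> t) x - X t x)"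
        using nH_triangle_rev[OF ftraj_memH[OF X] H(3), of t t] nH_minus_commute[of "X t" "fst (\<Phi> t)"] by simp
      then show False using ftraj_lower[OF X, of t] nbhd_M2(1)[OF nb, of t] t by linarith
    qed
    then show "y \<in> M2 b w" using \<Phi>(3) H(1) H(2)[of 0] H(3)[of 0] by (auto simp: M2_def ae01_mu shift_0)
  qed
qed

lemma disjoint_M1_M2: "disjoint_fam b w (M1 b w) (M2 b w)"
  unfolding disjoint_fam_def
proof (intro exI[of _ "m0 / 2"] conjI)
  show "0 < m0 / 2" using m0_pos by simp
  show "nbhd b w (m0 / 2) (M1 b w) \<inter> nbhd b w (m0 / 2) (M2 b w) = {}"
    using nbhd_M1(1)[of _ "m0 / 2"] nbhd_M2(1)[of _ "m0 / 2"] by fastforce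
qed

lemma gradient_like:
  assumes \<Phi>: "complete_traj b w \<Phi>" and bd: "bounded_traj \<Phi>"
  shows "(\<forall>t. \<Phi> t \<in> M1 b w) \<or> (\<forall>t. \<Phi> t \<in> M2 b w) \<or>
    (((\<lambda>t. distset (\<Phi> t) (M1 b w)) \<longlongrightarrow> 0) at_top \<and> ((\<lambda>t. distset (\<Phi> t) (M2 b w)) \<longlongrightarrow> 0) at_bot)"
proof -
  obtain \<sigma> where H: "\<sigma> \<in> Sig b w" "\<And>t. snd (\<Phi> t) = shift t \<sigma>" "\<And>t. memH (fst (\<Phi> t))" using complete_trajE[OF \<Phi>] by metis
  have S: "snd (\<Phi> t) \<in> Sig b w" for t using Sig_shift[OF H(1)] H(2) by simp
  obtain X where X: "ftraj \<sigma> X" using ftraj_exists[OF H(1)] by blast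
  obtain R where R: "\<And>t t'. dX (\<Phi> t) (\<Phi> t') \<le> R" using bd unfolding bounded_traj_def by blast
  have B: "nH (fst (\<Phi> t)) \<le> nH (fst (\<Phi> 0)) + R" for t
    using nH_triangle_rev[OF H(3) H(3), of t 0] dX_ge[OF S S, of t 0] R[of t 0] by linarith
  let ?Z = "\<lambda>t. AE x in mu. fst (\<Phi> t) x = 0"
  have inM2: "\<Phi> t \<in> M2 b w" if "?Z t" for t
    using that S[of t] H(3)[of t] by (cases "\<Phi> t") (simp add: M2_def ae01_mu)
  \<comment> \<open>The third case is the negation of the first two: some state is nonzero, yet all
    states before some time \<open>s1\<close> are 0.\<close>
  consider (zero) "\<forall>t. ?Z t" | (always) "\<forall>s. \<exists>s'<s. \<not> ?Z s'" | (conn) s0 s1 where "\<not> ?Z s0" "\<forall>s<s1. ?Z s"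
    by blast
  then show ?thesis
  proof cases
    case zero
    then show ?thesis using inM2 by blast
  next
    case always
    then show ?thesis using bounded_nonzero_in_M1[OF \<Phi> _ B] by blast
  next
    case conn
    have l: "((\<lambda>t. nH (\<lambda>x. fst (\<Phi> t) x - X t x)) \<longlongrightarrow> 0) at_top" by (rule nonzero_attracted[OF \<Phi> conn(1) H(1,2) X])
    have "((\<lambda>t. distset (\<Phi> t) (M1 b w)) \<longlongrightarrow> 0) at_top"
    proof (rule Lim_null_comparison[OF _ l])
      have "norm (distset (\<Phi> t) (M1 b w)) \<le> nH (\<lambda>x. fst (\<Phi> t) x - X t x)" for t
      proof -
        have "distset (\<Phi> t) (M1 b w) \<le> dX (\<Phi> t) (X t, shift t \<sigma>)"
          by (rule distset_le[OF S ftraj_in_M1[OF X] M1_Sig])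
        also have "\<dots> = nH (\<lambda>x. fst (\<Phi> t) x - X t x)" using H(2) rho_self[OF Sig_shift[OF H(1)]] by (simp add: dX_def)
        finally show ?thesis using distset_nonneg[OF S M1_ne M1_Sig, of t] by simp
      qed
      then show "\<forall>\<^sub>F t in at_top. norm (distset (\<Phi> t) (M1 b w)) \<le> nH (\<lambda>x. fst (\<Phi> t) x - X t x)" by simp
    qed
    moreover have "((\<lambda>t. distset (\<Phi> t) (M2 b w)) \<longlongrightarrow> 0) at_bot"
    \<comment> \<open>Before \<open>s1\<close> the trajectory lies in M2, so the distance is exactly
      0 there.\<close>
    proof (rule tendsto_eventually)
      have "\<forall>\<^sub>F t in at_bot. t < s1" by (rule eventually_gt_at_bot)
      then show "\<forall>\<^sub>F t in at_bot. distset (\<Phi> t) (M2 b w) = 0"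
      proof eventually_elim
        case (elim t)
        then have "\<Phi> t \<in> M2 b w" using conn(2) inM2 by blast
        then have "distset (\<Phi> t) (M2 b w) \<le> dX (\<Phi> t) (\<Phi> t)" by (rule distset_le[OF S _ M2_Sig])
        also have "\<dots> = 0" using rho_self[OF S] by (simp add: dX_def)
        finally show ?case using distset_nonneg[OF S M2_ne M2_Sig, of t] by simp
      qed
    qed
    ultimately show ?thesis by blast
  qed
qed

end

theorem theorem5:
  fixes b \<omega> :: "real \<Rightarrow> real" and b0 b1 \<omega>0 \<omega>1 :: real
  assumes "uniformly_continuous_on UNIV b" and "uniformly_continuous_on UNIV \<omega>"
    and "0 < b0" and "\<And>t. b0 \<le> b t" and "\<And>t. b t \<le> b1"
    and "0 \<le> \<omega>0" and "\<And>t. \<omega>0 \<le> \<omega> t" and "\<And>t. \<omega> t \<le> \<omega>1" and "\<omega>1 < pi^2"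
  shows "isolated b \<omega> (M1 b \<omega>) \<and> isolated b \<omega> (M2 b \<omega>) \<and>
         disjoint_fam b \<omega> (M1 b \<omega>) (M2 b \<omega>) \<and>
         (\<forall>\<Phi>. complete_traj b \<omega> \<Phi> \<and> bounded_traj \<Phi> \<longrightarrow>
            (\<forall>t. \<Phi> t \<in> M1 b \<omega>) \<or> (\<forall>t. \<Phi> t \<in> M2 b \<omega>) \<or>
            (((\<lambda>t. distset (\<Phi> t) (M1 b \<omega>)) \<longlongrightarrow> 0) at_top \<and>
             ((\<lambda>t. distset (\<Phi> t) (M2 b \<omega>)) \<longlongrightarrow> 0) at_bot))"
proof -
  interpret problem b \<omega> b0 b1 \<omega>1
  proof unfold_locales
    show "b0 \<le> b1" using assms(4)[of 0] assms(5)[of 0] by linarith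
    show "0 \<le> \<omega> t" for t using assms(6) assms(7)[of t] by linarith
    then show "0 \<le> \<omega>1" using assms(8)[of 0] order_trans by blast
  qed (use assms in auto)
  show ?thesis using isolated_M1 isolated_M2 disjoint_M1_M2 gradient_like by blast
qed

end
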